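(* Let $k$ be a field of characteristic zero, $S$ a DG $k$-algebra, $V$ a complex of $k$-vector spaces of finite total dimension, and $S\to\underline{\mathrm{End}}\,V$ a morphism of DG algebras. For any $S\backslash A\in\mathrm{DGA}_S$, the commutative DG algebra $(S\backslash A)_V$ represents the functor $$\mathrm{Rep}_V(S\backslash A):\ \mathrm{CDGA}_k\to\mathrm{Sets},\qquad C\mapsto\mathrm{Hom}_{\mathrm{DGA}_S}(A,\ \underline{\mathrm{End}}\,V\otimes C).$$
   Context: All DG objects have differentials of degree $-1$, the Koszul sign rule is used, and $\otimes=\otimes_k$. $\mathrm{DGA}_k$ is the category of unital associative $\mathbb Z$-graded DG $k$-algebras and $\mathrm{CDGA}_k$ its full subcategory of graded-commutative DG algebras. $\mathrm{DGA}_S$ is the category whose objects are DG algebra maps $S\to A$ (written $S\backslash A$, or just $A$) and whose morphisms are DG algebra maps under $S$. $\underline{\mathrm{End}}\,V$ is the DG algebra of graded endomorphisms of $(V,d_V)$ with differential $df=d_Vf-(-1)^i f d_V$ for $f$ of degree $i$; $\underline{\mathrm{End}}\,V\otimes C$ is an object of $\mathrm{DGA}_S$ via the given map $S\to\underline{\mathrm{End}}\,V$. Let $\underline{\mathrm{End}}\,V*_S A$ be the coproduct in $\mathrm{DGA}_S$. Define $\sqrt[V]{S\backslash A}:=(\underline{\mathrm{End}}\,V*_SA)^{\underline{\mathrm{End}}(V)}$, the graded centralizer of the image of $\underline{\mathrm{End}}\,V$ in $\underline{\mathrm{End}}\,V*_SA$, and let $(S\backslash A)_V$ be the abelianization of $\sqrt[V]{S\backslash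 A}$, i.e. its quotient by the two-sided ideal generated by all graded commutators.
   Formalization: The complex V is assumed nonzero; for V = 0 the claim fails, since then End V = 0 and (S\A)_V = 0, so Hom((S\A)_V, k) is empty while Rep_V(S\A)(k) is a one-point set. *)

theory Defs
  imports
    "HOL-Algebra.Ideal"
    "HOL-Algebra.QuotRing"
    "HOL-Algebra.Module"
    "HOL-Algebra.Algebraic_Closure_Type"
begin

section \<open>Complexes and DG algebras\<close>

text \<open>
  The ground field is a type \<open>'k\<close> of class \<open>field_char_0\<close>; \<open>ring_of_type_algebra\<close> is this field
  as a record. Complexes and DG algebras share one record type. As for modules in
  HOL-Algebra, the multiplicative fields of a complex carry no meaning. Gradings are internal:
  \<open>gr M i\<close> is the set of homogeneous elements of degree \<open>i\<close> (including zero), and the carrier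
  is the direct sum of these subspaces.
\<close>

abbreviation ground :: "'k::field_char_0 ring"
  where "ground \<equiv> ring_of_type_algebra"

record ('k, 'a) dg = "('k, 'a) module" +
  gr :: "int \<Rightarrow> 'a set"
  dif :: "'a \<Rightarrow> 'a"

definition ksign :: "int \<Rightarrow> 'k::field_char_0"
  where "ksign i = (if even i then 1 else - 1)"

definition is_decomp :: "('k, 'a, 'm) dg_scheme \<Rightarrow> 'a \<Rightarrow> (int \<Rightarrow> 'a) \<Rightarrow> bool"
  where "is_decomp M x c \<longleftrightarrow>
    (\<forall>i. c i \<in> gr M i) \<and> finite {i. c i \<noteq> \<zero>\<^bsub>M\<^esub>} \<and> x = (\<Oplus>\<^bsub>M\<^esub>i\<in>{i. c i \<noteq> \<zero>\<^bsub>M\<^esub>}. c i)"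

text \<open>The homogeneous component of degree \<open>i\<close> of \<open>x\<close>.\<close>

definition hcomp :: "('k, 'a, 'm) dg_scheme \<Rightarrow> int \<Rightarrow> 'a \<Rightarrow> 'a"
  where "hcomp M i x = (THE c. is_decomp M x c) i"

text \<open>
  Additive extension to all of \<open>M\<close> of a family of maps \<open>\<phi> i\<close> given on \<open>gr M i\<close>, with
  values in \<open>N\<close>.
\<close>

definition hext ::
  "('k, 'a, 'm) dg_scheme \<Rightarrow> ('b, 'n) ring_scheme \<Rightarrow> (int \<Rightarrow> 'a \<Rightarrow> 'b) \<Rightarrow> 'a \<Rightarrow> 'b"
  where "hext M N \<phi> x = (\<Oplus>\<^bsub>N\<^esub>i\<in>{i. hcomp M i x \<noteq> \<zero>\<^bsub>M\<^esub>}. \<phi> i (hcomp M i x))"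

locale dg_module = module ground M
  for M :: "('k::field_char_0, 'a, 'm) dg_scheme" (structure) +
  assumes gr_submodule: "submodule (gr M i) ground M"
    and gr_direct: "x \<in> carrier M \<Longrightarrow> \<exists>!c. is_decomp M x c"
    and dif_add: "\<lbrakk>x \<in> carrier M; y \<in> carrier M\<rbrakk> \<Longrightarrow> dif M (x \<oplus> y) = dif M x \<oplus> dif M y"
    and dif_smult: "x \<in> carrier M \<Longrightarrow> dif M (r \<odot> x) = r \<odot> dif M x"
    and dif_degree: "x \<in> gr M i \<Longrightarrow> dif M x \<in> gr M (i - 1)"
    and dif_dif: "x \<in> carrier M \<Longrightarrow> dif M (dif M x) = \<zero>"

locale dg_algebra = dg_module A + ring A
  for A :: "('k::field_char_0, 'a, 'm) dg_scheme" (structure) +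
  assumes smult_mult_l: "\<lbrakk>x \<in> carrier A; y \<in> carrier A\<rbrakk> \<Longrightarrow> (r \<odot> x) \<otimes> y = r \<odot> (x \<otimes> y)"
    and smult_mult_r: "\<lbrakk>x \<in> carrier A; y \<in> carrier A\<rbrakk> \<Longrightarrow> x \<otimes> (r \<odot> y) = r \<odot> (x \<otimes> y)"
    and one_degree: "\<one> \<in> gr A 0"
    and mult_degree: "\<lbrakk>x \<in> gr A i; y \<in> gr A j\<rbrakk> \<Longrightarrow> x \<otimes> y \<in> gr A (i + j)"
    and leibniz: "\<lbrakk>x \<in> gr A i; y \<in> carrier A\<rbrakk> \<Longrightarrow>
      dif A (x \<otimes> y) = (dif A x \<otimes> y) \<oplus> (ksign i \<odot> (x \<otimes> dif A y))"

locale cdg_algebra = dg_algebra A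
  for A :: "('k::field_char_0, 'a, 'm) dg_scheme" (structure) +
  assumes graded_comm: "\<lbrakk>x \<in> gr A i; y \<in> gr A j\<rbrakk> \<Longrightarrow> x \<otimes> y = ksign (i * j) \<odot> (y \<otimes> x)"

text \<open>
  Morphisms are extensional functions, so that equality of morphisms is equality in HOL.
\<close>

definition dga_hom ::
  "('k, 'a, 'm) dg_scheme \<Rightarrow> ('k, 'b, 'n) dg_scheme \<Rightarrow> ('a \<Rightarrow> 'b) set"
  where "dga_hom A B =
    {f \<in> ring_hom A B \<inter> extensional (carrier A).
      (\<forall>r. \<forall>x\<in>carrier A. f (r \<odot>\<^bsub>A\<^esub> x) = r \<odot>\<^bsub>B\<^esub> f x) \<and>
      (\<forall>i. \<forall>x\<in>gr A i. f x \<in> gr B i) \<and>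
      (\<forall>x\<in>carrier A. f (dif A x) = dif B (f x))}"

text \<open>Morphisms in \<open>DGA\<^sub>S\<close> between \<open>\<alpha> : S \<rightarrow> A\<close> and \<open>\<beta> : S \<rightarrow> B\<close>.\<close>

definition dga_under_hom ::
  "('k, 's, 'l) dg_scheme \<Rightarrow> ('k, 'a, 'm) dg_scheme \<Rightarrow> ('s \<Rightarrow> 'a) \<Rightarrow>
   ('k, 'b, 'n) dg_scheme \<Rightarrow> ('s \<Rightarrow> 'b) \<Rightarrow> ('a \<Rightarrow> 'b) set"
  where "dga_under_hom S A \<alpha> B \<beta> = {f \<in> dga_hom A B. \<forall>s\<in>carrier S. f (\<alpha> s) = \<beta> s}"

definition subspan :: "('k::field_char_0, 'a, 'm) dg_scheme \<Rightarrow> 'a set \<Rightarrow> 'a set"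
  where "subspan M T = \<Inter>{N. submodule N ground M \<and> T \<subseteq> N}"

definition finite_total_dim :: "('k::field_char_0, 'a, 'm) dg_scheme \<Rightarrow> bool"
  where "finite_total_dim M \<longleftrightarrow> (\<exists>B. finite B \<and> B \<subseteq> carrier M \<and> subspan M B = carrier M)"

text \<open>
  The quotient by a subspace \<open>I\<close>, with all operations induced on cosets; it is used only when
  these are well defined.
\<close>

definition dg_quot :: "('k, 'a, 'm) dg_scheme \<Rightarrow> 'a set \<Rightarrow> ('k, 'a set) dg"
  where "dg_quot A I =
    \<lparr>carrier = a_rcosets\<^bsub>A\<^esub> I, monoid.mult = rcoset_mult A I, one = I +>\<^bsub>A\<^esub> \<one>\<^bsub>A\<^esub>,
     ring.zero = I, add = set_add A,
     module.smult = (\<lambda>r Q. \<Union>x\<in>Q. I +>\<^bsub>A\<^esub> (r \<odot>\<^bsub>A\<^esub> x)),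
     gr = (\<lambda>i. (\<lambda>x. I +>\<^bsub>A\<^esub> x) ` gr A i),
     dif = (\<lambda>Q. \<Union>x\<in>Q. I +>\<^bsub>A\<^esub> dif A x)\<rparr>"

section \<open>The endomorphism DG algebra of a complex\<close>

definition lin_endo :: "('k, 'v, 'm) dg_scheme \<Rightarrow> ('v \<Rightarrow> 'v) set"
  where "lin_endo V =
    {f \<in> carrier V \<rightarrow>\<^sub>E carrier V.
      (\<forall>x\<in>carrier V. \<forall>y\<in>carrier V. f (x \<oplus>\<^bsub>V\<^esub> y) = f x \<oplus>\<^bsub>V\<^esub> f y) \<and>
      (\<forall>r. \<forall>x\<in>carrier V. f (r \<odot>\<^bsub>V\<^esub> x) = r \<odot>\<^bsub>V\<^esub> f x)}"

definition homog_endo :: "('k, 'v, 'm) dg_scheme \<Rightarrow> int \<Rightarrow> ('v \<Rightarrow> 'v) set"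
  where "homog_endo V i = {f \<in> lin_endo V. \<forall>j. \<forall>v\<in>gr V j. f v \<in> gr V (i + j)}"

text \<open>The graded algebra of finite sums of homogeneous endomorphisms, still without differential.\<close>

definition gEnd :: "('k, 'v, 'm) dg_scheme \<Rightarrow> ('k, 'v \<Rightarrow> 'v) dg"
  where "gEnd V =
    \<lparr>carrier = {f \<in> lin_endo V. \<exists>I c. finite I \<and> (\<forall>i\<in>I. c i \<in> homog_endo V i) \<and>
                 (\<forall>v\<in>carrier V. f v = (\<Oplus>\<^bsub>V\<^esub>i\<in>I. c i v))},
     monoid.mult = (\<lambda>f g. compose (carrier V) f g),
     one = (\<lambda>v\<in>carrier V. v),
     ring.zero = (\<lambda>v\<in>carrier V. \<zero>\<^bsub>V\<^esub>),
     add = (\<lambda>f g. \<lambda>v\<in>carrier V. f v \<oplus>\<^bsub>V\<^esub> g v),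
     module.smult = (\<lambda>r f. \<lambda>v\<in>carrier V. r \<odot>\<^bsub>V\<^esub> f v),
     gr = homog_endo V,
     dif = undefined\<rparr>"

definition End_dga :: "('k::field_char_0, 'v, 'm) dg_scheme \<Rightarrow> ('k, 'v \<Rightarrow> 'v) dg"
  where "End_dga V = (gEnd V)
    \<lparr>dif := hext (gEnd V) (gEnd V)
       (\<lambda>i f. \<lambda>v\<in>carrier V. dif V (f v) \<ominus>\<^bsub>V\<^esub> (ksign i \<odot>\<^bsub>V\<^esub> f (dif V v)))\<rparr>"

section \<open>Free vector spaces\<close>

definition free_vec :: "'x set \<Rightarrow> ('x \<Rightarrow> 'k::field_char_0) set"
  where "free_vec Q = {f. finite {x. f x \<noteq> 0} \<and> {x. f x \<noteq> 0} \<subseteq> Q}"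

definition bvec :: "'x \<Rightarrow> 'x \<Rightarrow> 'k::field_char_0"
  where "bvec x = (\<lambda>y. if y = x then 1 else 0)"

text \<open>Linear and bilinear extension of maps given on the basis \<open>bvec x\<close>.\<close>

definition lin_ext :: "('x \<Rightarrow> 'y \<Rightarrow> 'k::field_char_0) \<Rightarrow> ('x \<Rightarrow> 'k) \<Rightarrow> 'y \<Rightarrow> 'k"
  where "lin_ext \<phi> f = (\<lambda>y. \<Sum>x | f x \<noteq> 0. f x * \<phi> x y)"

definition bilin_ext ::
  "('x \<Rightarrow> 'y \<Rightarrow> 'z \<Rightarrow> 'k::field_char_0) \<Rightarrow> ('x \<Rightarrow> 'k) \<Rightarrow> ('y \<Rightarrow> 'k) \<Rightarrow> 'z \<Rightarrow> 'k"
  where "bilin_ext \<phi> f g = lin_ext (\<lambda>x. lin_ext (\<lambda>y. \<phi> x y) g) f"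

section \<open>The tensor product of DG algebras\<close>

text \<open>
  A pair \<open>((i, a), (j, b))\<close> stands for the tensor \<open>a \<otimes> b\<close> of homogeneous elements of degrees
  \<open>i\<close> and \<open>j\<close>. The vector space \<open>A \<otimes> B\<close>, i.e. the direct sum of all \<open>gr A i \<otimes> gr B j\<close>, is the
  quotient of the free vector space on these pairs by the span of the bilinearity relations. The
  Koszul signs are part of the operations on the free vector space.
\<close>

type_synonym ('a, 'b) tgen = "(int \<times> 'a) \<times> (int \<times> 'b)"

definition tensor_free ::
  "('k::field_char_0, 'a, 'm) dg_scheme \<Rightarrow> ('k, 'b, 'n) dg_scheme \<Rightarrow>
   ('k, ('a, 'b) tgen \<Rightarrow> 'k) dg"
  where "tensor_free A B =
    \<lparr>carrier = free_vec {((i, a), (j, b)) | i a j b. a \<in> gr A i \<and> b \<in> gr B j},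
     monoid.mult = bilin_ext (\<lambda>((i, a), (j, b)) ((i', a'), (j', b')) z.
        ksign (j * i') * bvec ((i + i', a \<otimes>\<^bsub>A\<^esub> a'), (j + j', b \<otimes>\<^bsub>B\<^esub> b')) z),
     one = bvec ((0, \<one>\<^bsub>A\<^esub>), (0, \<one>\<^bsub>B\<^esub>)),
     ring.zero = (\<lambda>z. 0),
     add = (\<lambda>f g z. f z + g z),
     module.smult = (\<lambda>r f z. r * f z),
     gr = (\<lambda>n. free_vec {((i, a), (j, b)) | i a j b. a \<in> gr A i \<and> b \<in> gr B j \<and> i + j = n}),
     dif = lin_ext (\<lambda>((i, a), (j, b)) z.
        bvec ((i - 1, dif A a), (j, b)) z + ksign i * bvec ((i, a), (j - 1, dif B b)) z)\<rparr>"

definition tensor_rels ::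
  "('k::field_char_0, 'a, 'm) dg_scheme \<Rightarrow> ('k, 'b, 'n) dg_scheme \<Rightarrow> (('a, 'b) tgen \<Rightarrow> 'k) set"
  where "tensor_rels A B =
    {(\<lambda>z. bvec ((i, a \<oplus>\<^bsub>A\<^esub> a'), (j, b)) z - bvec ((i, a), (j, b)) z - bvec ((i, a'), (j, b)) z)
      | i j a a' b. a \<in> gr A i \<and> a' \<in> gr A i \<and> b \<in> gr B j} \<union>
    {(\<lambda>z. bvec ((i, a), (j, b \<oplus>\<^bsub>B\<^esub> b')) z - bvec ((i, a), (j, b)) z - bvec ((i, a), (j, b')) z)
      | i j a b b'. a \<in> gr A i \<and> b \<in> gr B j \<and> b' \<in> gr B j} \<union>
    {(\<lambda>z. bvec ((i, r \<odot>\<^bsub>A\<^esub> a), (j, b)) z - r * bvec ((i, a), (j, b)) z)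
      | i j r a b. a \<in> gr A i \<and> b \<in> gr B j} \<union>
    {(\<lambda>z. bvec ((i, a), (j, r \<odot>\<^bsub>B\<^esub> b)) z - r * bvec ((i, a), (j, b)) z)
      | i j r a b. a \<in> gr A i \<and> b \<in> gr B j}"

definition tensor_ker ::
  "('k::field_char_0, 'a, 'm) dg_scheme \<Rightarrow> ('k, 'b, 'n) dg_scheme \<Rightarrow> (('a, 'b) tgen \<Rightarrow> 'k) set"
  where "tensor_ker A B = subspan (tensor_free A B) (tensor_rels A B)"

definition tensor_dga ::
  "('k::field_char_0, 'a, 'm) dg_scheme \<Rightarrow> ('k, 'b, 'n) dg_scheme \<Rightarrow>
   ('k, (('a, 'b) tgen \<Rightarrow> 'k) set) dg"
  where "tensor_dga A B = dg_quot (tensor_free A B) (tensor_ker A B)"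

definition tensor_elem ::
  "('k::field_char_0, 'a, 'm) dg_scheme \<Rightarrow> ('k, 'b, 'n) dg_scheme \<Rightarrow> 'a \<Rightarrow> 'b \<Rightarrow>
   (('a, 'b) tgen \<Rightarrow> 'k) set"
  where "tensor_elem A B a b =
    hext A (tensor_dga A B) (\<lambda>i x.
      hext B (tensor_dga A B) (\<lambda>j y.
        tensor_ker A B +>\<^bsub>tensor_free A B\<^esub> bvec ((i, x), (j, y))) b) a"

text \<open>The map \<open>id \<otimes> g : A \<otimes> B \<rightarrow> A \<otimes> B'\<close> induced by a morphism \<open>g : B \<rightarrow> B'\<close>.\<close>

definition tensor_map_right ::
  "('k::field_char_0, 'a, 'm) dg_scheme \<Rightarrow> ('k, 'b, 'n) dg_scheme \<Rightarrow> ('k, 'c, 'p) dg_scheme \<Rightarrow>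
   ('b \<Rightarrow> 'c) \<Rightarrow> (('a, 'b) tgen \<Rightarrow> 'k) set \<Rightarrow> (('a, 'c) tgen \<Rightarrow> 'k) set"
  where "tensor_map_right A B B' g = (\<lambda>Q\<in>carrier (tensor_dga A B).
    \<Union>f\<in>Q. tensor_ker A B' +>\<^bsub>tensor_free A B'\<^esub>
      lin_ext (\<lambda>((i, a), (j, b)). bvec ((i, a), (j, g b))) f)"

section \<open>The coproduct in \<open>DGA\<^sub>S\<close>\<close>

text \<open>
  The free graded algebra on a set \<open>Q\<close> of letters with degrees \<open>\<delta>\<close>: its basis consists of
  the words over \<open>Q\<close>. A map \<open>\<tau>\<close> on letters lowering the degree by one is extended to a
  derivation (the signed sum over all letters of a word); this squares to zero only in suitable
  quotients.
\<close>

definition word_deg :: "('x \<Rightarrow> int) \<Rightarrow> 'x list \<Rightarrow> int"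
  where "word_deg \<delta> w = sum_list (map \<delta> w)"

definition free_dga ::
  "'x set \<Rightarrow> ('x \<Rightarrow> int) \<Rightarrow> ('x \<Rightarrow> 'x) \<Rightarrow> ('k::field_char_0, 'x list \<Rightarrow> 'k) dg"
  where "free_dga Q \<delta> \<tau> =
    \<lparr>carrier = free_vec (lists Q),
     monoid.mult = bilin_ext (\<lambda>u v. bvec (u @ v)),
     one = bvec [],
     ring.zero = (\<lambda>w. 0),
     add = (\<lambda>f g w. f w + g w),
     module.smult = (\<lambda>r f w. r * f w),
     gr = (\<lambda>n. free_vec {w \<in> lists Q. word_deg \<delta> w = n}),
     dif = lin_ext (\<lambda>u w.
        \<Sum>n<length u. ksign (word_deg \<delta> (take n u)) * bvec (u[n := \<tau> (u ! n)]) w)\<rparr>"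

text \<open>The letters are the homogeneous elements of \<open>B\<close> and \<open>A\<close>, tagged with their degree.\<close>

type_synonym ('b, 'a) cgen = "(int \<times> 'b) + (int \<times> 'a)"

definition coprod_free ::
  "('k::field_char_0, 'b, 'n) dg_scheme \<Rightarrow> ('k, 'a, 'm) dg_scheme \<Rightarrow>
   ('k, ('b, 'a) cgen list \<Rightarrow> 'k) dg"
  where "coprod_free B A =
    free_dga ({Inl (i, b) | i b. b \<in> gr B i} \<union> {Inr (i, a) | i a. a \<in> gr A i})
      (case_sum fst fst)
      (map_sum (\<lambda>(i, b). (i - 1, dif B b)) (\<lambda>(i, a). (i - 1, dif A a)))"

text \<open>
  The relations making the inclusion \<open>j\<close> of letters from \<open>A\<close> a homomorphism of graded algebras.
\<close>

definition alg_rels ::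
  "('k::field_char_0, 'a, 'm) dg_scheme \<Rightarrow> (int \<times> 'a \<Rightarrow> 'x) \<Rightarrow> ('x list \<Rightarrow> 'k) set"
  where "alg_rels A j =
    {(\<lambda>w. bvec [j (i, a \<oplus>\<^bsub>A\<^esub> a')] w - bvec [j (i, a)] w - bvec [j (i, a')] w)
      | i a a'. a \<in> gr A i \<and> a' \<in> gr A i} \<union>
    {(\<lambda>w. bvec [j (i, r \<odot>\<^bsub>A\<^esub> a)] w - r * bvec [j (i, a)] w)
      | i r a. a \<in> gr A i} \<union>
    {(\<lambda>w. bvec [j (i + i', a \<otimes>\<^bsub>A\<^esub> a')] w - bvec [j (i, a), j (i', a')] w)
      | i i' a a'. a \<in> gr A i \<and> a' \<in> gr A i'} \<union>
    {(\<lambda>w. bvec [j (0, \<one>\<^bsub>A\<^esub>)] w - bvec [] w)}"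

definition coprod_ideal ::
  "('k::field_char_0, 's, 'l) dg_scheme \<Rightarrow>
   ('k, 'b, 'n) dg_scheme \<Rightarrow> ('s \<Rightarrow> 'b) \<Rightarrow> ('k, 'a, 'm) dg_scheme \<Rightarrow> ('s \<Rightarrow> 'a) \<Rightarrow>
   (('b, 'a) cgen list \<Rightarrow> 'k) set"
  where "coprod_ideal S B \<beta> A \<alpha> = genideal (coprod_free B A)
    (alg_rels B Inl \<union> alg_rels A Inr \<union>
     {(\<lambda>w. bvec [Inl (i, \<beta> s)] w - bvec [Inr (i, \<alpha> s)] w) | i s. s \<in> gr S i})"

definition coprod_dga ::
  "('k::field_char_0, 's, 'l) dg_scheme \<Rightarrow>
   ('k, 'b, 'n) dg_scheme \<Rightarrow> ('s \<Rightarrow> 'b) \<Rightarrow> ('k, 'a, 'm) dg_scheme \<Rightarrow> ('s \<Rightarrow> 'a) \<Rightarrow>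
   ('k, (('b, 'a) cgen list \<Rightarrow> 'k) set) dg"
  where "coprod_dga S B \<beta> A \<alpha> = dg_quot (coprod_free B A) (coprod_ideal S B \<beta> A \<alpha>)"

text \<open>The canonical map from the first factor to the coproduct.\<close>

definition coprod_inl ::
  "('k::field_char_0, 's, 'l) dg_scheme \<Rightarrow>
   ('k, 'b, 'n) dg_scheme \<Rightarrow> ('s \<Rightarrow> 'b) \<Rightarrow> ('k, 'a, 'm) dg_scheme \<Rightarrow> ('s \<Rightarrow> 'a) \<Rightarrow>
   'b \<Rightarrow> (('b, 'a) cgen list \<Rightarrow> 'k) set"
  where "coprod_inl S B \<beta> A \<alpha> = (\<lambda>b\<in>carrier B.
    hext B (coprod_dga S B \<beta> A \<alpha>)
      (\<lambda>i x. coprod_ideal S B \<beta> A \<alpha> +>\<^bsub>coprod_free B A\<^esub> bvec [Inl (i, x)]) b)"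

section \<open>The \<open>V\<close>-th root, its abelianization, and the representation functor\<close>

definition graded_centralizer_part ::
  "('k::field_char_0, 'a, 'm) dg_scheme \<Rightarrow> 'a set \<Rightarrow> int \<Rightarrow> 'a set"
  where "graded_centralizer_part P T i =
    {x \<in> gr P i. \<forall>j. \<forall>t\<in>T \<inter> gr P j. x \<otimes>\<^bsub>P\<^esub> t = ksign (i * j) \<odot>\<^bsub>P\<^esub> (t \<otimes>\<^bsub>P\<^esub> x)}"

definition graded_centralizer ::
  "('k::field_char_0, 'a) dg \<Rightarrow> 'a set \<Rightarrow> ('k, 'a) dg"
  where "graded_centralizer P T = P
    \<lparr>carrier := {x \<in> carrier P. \<forall>i. hcomp P i x \<in> graded_centralizer_part P T i},
     gr := graded_centralizer_part P T\<rparr>"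

definition graded_commutators :: "('k::field_char_0, 'a, 'm) dg_scheme \<Rightarrow> 'a set"
  where "graded_commutators R =
    {(x \<otimes>\<^bsub>R\<^esub> y) \<ominus>\<^bsub>R\<^esub> (ksign (i * j) \<odot>\<^bsub>R\<^esub> (y \<otimes>\<^bsub>R\<^esub> x)) | i j x y. x \<in> gr R i \<and> y \<in> gr R j}"

definition abelianization :: "('k::field_char_0, 'a, 'm) dg_scheme \<Rightarrow> ('k, 'a set) dg"
  where "abelianization R = dg_quot R (genideal R (graded_commutators R))"

definition dga_root ::
  "('k::field_char_0, 's, 'l) dg_scheme \<Rightarrow> ('k, 'v, 'n) dg_scheme \<Rightarrow> ('s \<Rightarrow> 'v \<Rightarrow> 'v) \<Rightarrow>
   ('k, 'a, 'm) dg_scheme \<Rightarrow> ('s \<Rightarrow> 'a) \<Rightarrow>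
   ('k, (('v \<Rightarrow> 'v, 'a) cgen list \<Rightarrow> 'k) set) dg"
  where "dga_root S V \<rho> A \<alpha> =
    graded_centralizer (coprod_dga S (End_dga V) \<rho> A \<alpha>)
      (coprod_inl S (End_dga V) \<rho> A \<alpha> ` carrier (End_dga V))"

definition rep_dga ::
  "('k::field_char_0, 's, 'l) dg_scheme \<Rightarrow> ('k, 'v, 'n) dg_scheme \<Rightarrow> ('s \<Rightarrow> 'v \<Rightarrow> 'v) \<Rightarrow>
   ('k, 'a, 'm) dg_scheme \<Rightarrow> ('s \<Rightarrow> 'a) \<Rightarrow>
   ('k, (('v \<Rightarrow> 'v, 'a) cgen list \<Rightarrow> 'k) set set) dg"
  where "rep_dga S V \<rho> A \<alpha> = abelianization (dga_root S V \<rho> A \<alpha>)"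

text \<open>The functor \<open>Rep\<^sub>V(S\A)\<close> on objects and on morphisms.\<close>

definition Rep_obj ::
  "('k::field_char_0, 's, 'l) dg_scheme \<Rightarrow> ('k, 'v, 'n) dg_scheme \<Rightarrow> ('s \<Rightarrow> 'v \<Rightarrow> 'v) \<Rightarrow>
   ('k, 'a, 'm) dg_scheme \<Rightarrow> ('s \<Rightarrow> 'a) \<Rightarrow> ('k, 'c, 'p) dg_scheme \<Rightarrow>
   ('a \<Rightarrow> (('v \<Rightarrow> 'v, 'c) tgen \<Rightarrow> 'k) set) set"
  where "Rep_obj S V \<rho> A \<alpha> C =
    dga_under_hom S A \<alpha> (tensor_dga (End_dga V) C) (\<lambda>s. tensor_elem (End_dga V) C (\<rho> s) \<one>\<^bsub>C\<^esub>)"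

definition Rep_mor ::
  "('k::field_char_0, 'v, 'n) dg_scheme \<Rightarrow> ('k, 'a, 'm) dg_scheme \<Rightarrow>
   ('k, 'c, 'p) dg_scheme \<Rightarrow> ('k, 'd, 'q) dg_scheme \<Rightarrow> ('c \<Rightarrow> 'd) \<Rightarrow>
   ('a \<Rightarrow> (('v \<Rightarrow> 'v, 'c) tgen \<Rightarrow> 'k) set) \<Rightarrow> 'a \<Rightarrow> (('v \<Rightarrow> 'v, 'd) tgen \<Rightarrow> 'k) set"
  where "Rep_mor V A C D g \<phi> = compose (carrier A) (tensor_map_right (End_dga V) C D g) \<phi>"

text \<open>
  An object \<open>R\<close> represents a set-valued functor \<open>(F, Fmor)\<close> on the category of commutative DG
  algebras (with underlying set in the type \<open>'c\<close>) if there is a natural isomorphism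
  \<open>\<Phi>\<close> from \<open>Hom(R, -)\<close> to it. The type \<open>'c\<close> plays the role of a universe and is arbitrary.
\<close>

definition represents ::
  "('k::field_char_0, 'r, 'm) dg_scheme \<Rightarrow> (('k, 'c) dg \<Rightarrow> 'f set) \<Rightarrow>
   (('k, 'c) dg \<Rightarrow> ('k, 'c) dg \<Rightarrow> ('c \<Rightarrow> 'c) \<Rightarrow> 'f \<Rightarrow> 'f) \<Rightarrow> bool"
  where "represents R F Fmor \<longleftrightarrow>
    cdg_algebra R \<and>
    (\<exists>\<Phi>.
      (\<forall>C. cdg_algebra C \<longrightarrow> bij_betw (\<Phi> C) (dga_hom R C) (F C)) \<and>
      (\<forall>C D. \<forall>g\<in>dga_hom C D. \<forall>f\<in>dga_hom R C. cdg_algebra C \<longrightarrow> cdg_algebra D \<longrightarrow>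
         \<Phi> D (compose (carrier R) g f) = Fmor C D g (\<Phi> C f)))"

end

theory Submission
  imports Defs
begin

text \<open>
  Write \<open>E\<close> for the endomorphism algebra of \<open>V\<close>, \<open>P\<close> for the coproduct of \<open>E\<close> and \<open>A\<close> under \<open>S\<close>,
  \<open>Z\<close> for the graded centralizer of \<open>E\<close> in \<open>P\<close> (the \<open>V\<close>-th root of \<open>A\<close>), and \<open>R\<close> for the
  abelianization of \<open>Z\<close>. For a commutative \<open>C\<close>, the universal property of the coproduct says that a
  morphism \<open>A \<rightarrow> E \<otimes> C\<close> under \<open>S\<close> is the same as a morphism \<open>P \<rightarrow> E \<otimes> C\<close> under \<open>E\<close>. The point is
  that \<open>E\<close> is a graded matrix algebra, so that multiplication gives an isomorphism
  \<open>\<mu> : E \<otimes> Z \<rightarrow> P\<close>, while the centralizer of \<open>E \<otimes> 1\<close> in \<open>E \<otimes> C\<close> is \<open>1 \<otimes> C\<close>. Hence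
  restriction to centralizers turns morphisms \<open>P \<rightarrow> E \<otimes> C\<close> under \<open>E\<close> into morphisms \<open>Z \<rightarrow> C\<close>, and these
  factor through \<open>R\<close> because \<open>C\<close> is commutative. In the other direction, \<open>f : R \<rightarrow> C\<close> corresponds to
  \<open>A \<rightarrow> P \<rightarrow> E \<otimes> Z \<rightarrow> E \<otimes> C\<close>, where the last two maps are the inverse of \<open>\<mu>\<close> and
  \<open>id \<otimes> (f \<circ> \<pi>)\<close> with \<open>\<pi> : Z \<rightarrow> R\<close> the projection. Naturality in \<open>C\<close> is functoriality of the
  tensor product.

  Both facts about matrix algebras come from one averaging operator. Let \<open>e a b\<close> be the matrix units
  for a homogeneous basis of \<open>V\<close> and \<open>q\<close> a fixed basis vector. For \<open>z\<close> homogeneous of degree \<open>n\<close>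
  in an algebra that receives a map from \<open>E\<close>, the sum of \<open>e c q \<cdot> z \<cdot> e q c\<close> over all \<open>c\<close>, with
  signs \<open>(-1)^(n (deg c - deg q))\<close>, is a graded centralizing element (\<open>average_central\<close>); this operator
  fixes the centralizer (\<open>average_fixes_central\<close>), and on \<open>E \<otimes> C\<close> it is a projection onto \<open>1 \<otimes> C\<close>
  (\<open>second_factor_centralizer\<close>). Up to sign, \<open>e a a \<cdot> x \<cdot> e b b\<close> is the product of \<open>e a b\<close> with the average
  of \<open>e q a \<cdot> x \<cdot> e b q\<close> (\<open>peirce_component\<close>). Summing over \<open>a\<close> and \<open>b\<close> shows that \<open>\<mu>\<close> is onto;
  the same formula, used inside the kernel of \<open>\<mu>\<close>, shows that \<open>\<mu>\<close> is injective
  (\<open>matrix_decomposition\<close>).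

  The remaining work is to see that the explicit constructions have their universal
  properties. The free objects from which tensor products and coproducts are obtained are both
  monoid algebras twisted by a sign cocycle, and the ideals that are divided out are shown to be
  stable under all operations by evaluating these operations on basis vectors. That the induced
  structure on a quotient is a DG algebra then needs to be proved only once (\<open>quot_dg_algebra\<close>).
\<close>

section \<open>Graded vector spaces\<close>

lemma ground_simps [simp]:
  "carrier ground = (UNIV :: 'k::field_char_0 set)"
  "a \<oplus>\<^bsub>ground\<^esub> b = (a + b :: 'k)" "a \<otimes>\<^bsub>ground\<^esub> b = (a * b :: 'k)"
  "\<zero>\<^bsub>ground\<^esub> = (0 :: 'k)" "\<one>\<^bsub>ground\<^esub> = (1 :: 'k)"
  by (simp_all add: ring_of_type_algebra_def)

lemma ksign_simps [simp]:
  "ksign 0 = 1" "ksign i * ksign i = 1" "ksign (i - 1) = - ksign i" "ksign (- i) = ksign i"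
  "ksign i * (ksign i * r) = r"
  by (auto simp: ksign_def)

lemma ksign_add: "ksign (i + j) = ksign i * ksign j" "ksign (i - j) = ksign i * ksign j"
  by (auto simp: ksign_def)

locale kmodule = module ground M
  for M :: "('k::field_char_0, 'a, 'm) dg_scheme" (structure)
begin

lemma kmodule: "kmodule M" ..

lemma ksmult_closed [simp, intro]: "x \<in> carrier M \<Longrightarrow> r \<odot> x \<in> carrier M"
  by (rule smult_closed) simp_all

lemma ksmult_add: "x \<in> carrier M \<Longrightarrow> (r + s) \<odot> x = r \<odot> x \<oplus> s \<odot> x"
  using smult_l_distr[of r s x] by simp

lemma ksmult_r_add: "\<lbrakk>x \<in> carrier M; y \<in> carrier M\<rbrakk> \<Longrightarrow> r \<odot> (x \<oplus> y) = r \<odot> x \<oplus> r \<odot> y"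
  by (rule smult_r_distr) simp_all

lemma ksmult_assoc: "x \<in> carrier M \<Longrightarrow> r \<odot> (s \<odot> x) = (r * s) \<odot> x"
  using smult_assoc1[of r s x] by simp

lemma ksmult_one [simp]: "x \<in> carrier M \<Longrightarrow> 1 \<odot> x = x"
  using smult_one[of x] by simp

lemma ksmult_zero [simp]: "x \<in> carrier M \<Longrightarrow> 0 \<odot> x = \<zero>" "r \<odot> \<zero> = \<zero>"
  using smult_l_null[of x] smult_r_null[of r] by simp_all

lemma kminus: "x \<in> carrier M \<Longrightarrow> \<ominus> x = (- 1) \<odot> x"
  by (rule M.minus_equality) (use ksmult_add[of x "-1" 1] in \<open>simp_all\<close>)

lemma kdiff: "\<lbrakk>x \<in> carrier M; y \<in> carrier M\<rbrakk> \<Longrightarrow> x \<ominus> y = x \<oplus> (- 1) \<odot> y"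
  by (simp add: a_minus_def kminus)

lemma kcancel:
  assumes "x \<in> carrier M"
  shows "x \<oplus> (- 1) \<odot> x = \<zero>" "(- 1) \<odot> x \<oplus> x = \<zero>"
  using assms ksmult_add[of x 1 "-1"] ksmult_add[of x "-1" 1] by simp_all

lemma kdiff_zero_iff: "\<lbrakk>x \<in> carrier M; y \<in> carrier M\<rbrakk> \<Longrightarrow> x \<ominus> y = \<zero> \<longleftrightarrow> x = y"
proof
  assume xy: "x \<in> carrier M" "y \<in> carrier M" and "x \<ominus> y = \<zero>"
  then have "x \<oplus> (- 1) \<odot> y \<oplus> y = \<zero> \<oplus> y" by (simp add: kdiff)
  then show "x = y" using xy by (simp add: M.a_assoc kcancel)
qed (simp add: kdiff kcancel)

lemma ksubmoduleI:
  assumes "H \<subseteq> carrier M" "\<zero> \<in> H" "\<And>a b. \<lbrakk>a \<in> H; b \<in> H\<rbrakk> \<Longrightarrow> a \<oplus> b \<in> H"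
    "\<And>r a. a \<in> H \<Longrightarrow> r \<odot> a \<in> H"
  shows "submodule H ground M"
  by (rule submoduleI) (use assms in \<open>auto simp: kminus subset_iff\<close>)

lemma ksubmoduleD:
  assumes "submodule H ground M"
  shows "H \<subseteq> carrier M" "x \<in> H \<Longrightarrow> x \<in> carrier M" "\<zero> \<in> H" "\<lbrakk>x \<in> H; y \<in> H\<rbrakk> \<Longrightarrow> x \<oplus> y \<in> H"
    "x \<in> H \<Longrightarrow> r \<odot> x \<in> H" "x \<in> H \<Longrightarrow> \<ominus> x \<in> H" "\<lbrakk>x \<in> H; y \<in> H\<rbrakk> \<Longrightarrow> x \<ominus> y \<in> H"
proof -
  note E = submoduleE[OF assms]
  show 1: "H \<subseteq> carrier M" "\<lbrakk>x \<in> H; y \<in> H\<rbrakk> \<Longrightarrow> x \<oplus> y \<in> H" "x \<in> H \<Longrightarrow> r \<odot> x \<in> H"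
    "x \<in> H \<Longrightarrow> \<ominus> x \<in> H" for x y r
    using E by simp_all
  then show "x \<in> H \<Longrightarrow> x \<in> carrier M" "\<lbrakk>x \<in> H; y \<in> H\<rbrakk> \<Longrightarrow> x \<ominus> y \<in> H"
    by (auto simp: a_minus_def)
  show "\<zero> \<in> H"
    using E(2) 1 ksmult_zero(1) by (metis ex_in_conv subsetD)
qed

lemma submodule_finsum:
  assumes "submodule H ground M" "\<And>i. i \<in> J \<Longrightarrow> f i \<in> H"
  shows "(\<Oplus>i\<in>J. f i) \<in> H"
proof (cases "finite J")
  case True
  then show ?thesis using assms(2)
    by (induction J) (use ksubmoduleD[OF assms(1)] in \<open>auto simp: M.finsum_insert Pi_def\<close>)
qed (simp add: M.finsum_infinite ksubmoduleD(3)[OF assms(1)])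

lemma subspan_submodule:
  assumes "T \<subseteq> carrier M"
  shows "submodule (subspan M T) ground M"
proof (rule ksubmoduleI)
  have c: "submodule (carrier M) ground M"
    by (rule carrier_is_submodule)
  show "subspan M T \<subseteq> carrier M"
    unfolding subspan_def using c assms by blast
qed (auto simp: subspan_def ksubmoduleD)

lemma subspan_least: "\<lbrakk>submodule N ground M; T \<subseteq> N\<rbrakk> \<Longrightarrow> subspan M T \<subseteq> N"
  by (auto simp: subspan_def)

lemma subspan_incl: "T \<subseteq> subspan M T"
  by (auto simp: subspan_def)

end

lemma kmoduleI:
  assumes "abelian_group M" "\<And>r x. x \<in> carrier M \<Longrightarrow> r \<odot>\<^bsub>M\<^esub> x \<in> carrier M"
    "\<And>r s x. x \<in> carrier M \<Longrightarrow> (r + s) \<odot>\<^bsub>M\<^esub> x = r \<odot>\<^bsub>M\<^esub> x \<oplus>\<^bsub>M\<^esub> s \<odot>\<^bsub>M\<^esub> x"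
    "\<And>r x y. \<lbrakk>x \<in> carrier M; y \<in> carrier M\<rbrakk> \<Longrightarrow> r \<odot>\<^bsub>M\<^esub> (x \<oplus>\<^bsub>M\<^esub> y) = r \<odot>\<^bsub>M\<^esub> x \<oplus>\<^bsub>M\<^esub> r \<odot>\<^bsub>M\<^esub> y"
    "\<And>r s x. x \<in> carrier M \<Longrightarrow> (r * s) \<odot>\<^bsub>M\<^esub> x = r \<odot>\<^bsub>M\<^esub> (s \<odot>\<^bsub>M\<^esub> x)"
    "\<And>x. x \<in> carrier M \<Longrightarrow> 1 \<odot>\<^bsub>M\<^esub> x = x"
  shows "kmodule M"
  unfolding kmodule_def by (rule moduleI) (use assms in \<open>auto intro: cring_from_type_algebra\<close>)

definition klin :: "('k::field_char_0, 'a, 'm) dg_scheme \<Rightarrow> ('k, 'b, 'n) dg_scheme \<Rightarrow> ('a \<Rightarrow> 'b) \<Rightarrow> bool"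
  where "klin M N f \<longleftrightarrow> f \<in> carrier M \<rightarrow> carrier N \<and>
    (\<forall>x\<in>carrier M. \<forall>y\<in>carrier M. f (x \<oplus>\<^bsub>M\<^esub> y) = f x \<oplus>\<^bsub>N\<^esub> f y) \<and>
    (\<forall>r. \<forall>x\<in>carrier M. f (r \<odot>\<^bsub>M\<^esub> x) = r \<odot>\<^bsub>N\<^esub> f x)"

lemma klinI:
  assumes "\<And>x. x \<in> carrier M \<Longrightarrow> f x \<in> carrier N"
    "\<And>x y. \<lbrakk>x \<in> carrier M; y \<in> carrier M\<rbrakk> \<Longrightarrow> f (x \<oplus>\<^bsub>M\<^esub> y) = f x \<oplus>\<^bsub>N\<^esub> f y"
    "\<And>r x. x \<in> carrier M \<Longrightarrow> f (r \<odot>\<^bsub>M\<^esub> x) = r \<odot>\<^bsub>N\<^esub> f x"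
  shows "klin M N f"
  using assms by (auto simp: klin_def)

lemma klinD:
  assumes "klin M N f"
  shows "x \<in> carrier M \<Longrightarrow> f x \<in> carrier N"
    "\<lbrakk>x \<in> carrier M; y \<in> carrier M\<rbrakk> \<Longrightarrow> f (x \<oplus>\<^bsub>M\<^esub> y) = f x \<oplus>\<^bsub>N\<^esub> f y"
    "x \<in> carrier M \<Longrightarrow> f (r \<odot>\<^bsub>M\<^esub> x) = r \<odot>\<^bsub>N\<^esub> f x"
  using assms by (auto simp: klin_def)

lemma klin_zero:
  assumes "klin M N f" "kmodule M" "kmodule N"
  shows "f \<zero>\<^bsub>M\<^esub> = \<zero>\<^bsub>N\<^esub>"
proof -
  interpret M: kmodule M by fact
  interpret N: kmodule N by fact
  have "f (0 \<odot>\<^bsub>M\<^esub> \<zero>\<^bsub>M\<^esub>) = 0 \<odot>\<^bsub>N\<^esub> f \<zero>\<^bsub>M\<^esub>"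
    using assms(1) by (intro klinD(3)) auto
  then show ?thesis
    using klinD(1)[OF assms(1)] by simp
qed

lemma klin_diff:
  assumes "klin M N f" "kmodule M" "kmodule N" "x \<in> carrier M" "y \<in> carrier M"
  shows "f (x \<ominus>\<^bsub>M\<^esub> y) = f x \<ominus>\<^bsub>N\<^esub> f y"
proof -
  interpret M: kmodule M by fact
  interpret N: kmodule N by fact
  show ?thesis
    using assms by (simp add: M.kdiff N.kdiff klinD[OF assms(1)])
qed

lemma klin_finsum:
  assumes "klin M N f" "kmodule M" "kmodule N" "\<And>i. i \<in> J \<Longrightarrow> c i \<in> carrier M"
  shows "f (\<Oplus>\<^bsub>M\<^esub>i\<in>J. c i) = (\<Oplus>\<^bsub>N\<^esub>i\<in>J. f (c i))"
proof -
  interpret M: kmodule M by fact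
  interpret N: kmodule N by fact
  show ?thesis
  proof (cases "finite J")
    case True
    then show ?thesis using assms(4)
      by (induction J)
        (auto simp: M.M.finsum_insert N.M.finsum_insert Pi_def klinD[OF assms(1)] klin_zero[OF assms(1-3)])
  qed (simp add: klin_zero[OF assms(1-3)])
qed

lemma klin_comp: "\<lbrakk>klin M N f; klin N L g\<rbrakk> \<Longrightarrow> klin M L (\<lambda>x. g (f x))"
  by (auto simp: klin_def Pi_def)

lemma klin_preimage_submodule:
  assumes "klin M N f" "kmodule M" "kmodule N" "submodule H ground N"
  shows "submodule {x \<in> carrier M. f x \<in> H} ground M"
proof -
  interpret M: kmodule M by fact
  interpret N: kmodule N by fact
  show ?thesis
    using N.ksubmoduleD[OF assms(4)] klin_zero[OF assms(1-3)]
    by (intro M.ksubmoduleI) (auto simp: klinD[OF assms(1)])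
qed

lemma klin_plus:
  assumes "klin M N f" "klin M N g" "kmodule N"
  shows "klin M N (\<lambda>x. f x \<oplus>\<^bsub>N\<^esub> g x)"
proof -
  interpret N: kmodule N by fact
  show ?thesis
    by (rule klinI) (simp_all add: klinD[OF assms(1)] klinD[OF assms(2)] N.ksmult_r_add N.M.a_ac)
qed

lemma klin_scale:
  assumes "klin M N f" "kmodule N"
  shows "klin M N (\<lambda>x. r \<odot>\<^bsub>N\<^esub> f x)"
proof -
  interpret N: kmodule N by fact
  show ?thesis
    by (rule klinI) (simp_all add: klinD[OF assms(1)] N.ksmult_r_add N.ksmult_assoc mult.commute)
qed

lemma klin_minus:
  assumes "klin M N f" "klin M N g" "kmodule N"
  shows "klin M N (\<lambda>x. f x \<ominus>\<^bsub>N\<^esub> g x)"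
proof -
  interpret N: kmodule N by fact
  have "klin M N (\<lambda>x. f x \<oplus>\<^bsub>N\<^esub> (- 1) \<odot>\<^bsub>N\<^esub> g x)"
    by (intro klin_plus klin_scale assms)
  then show ?thesis
    using klinD[OF assms(1)] klinD[OF assms(2)] by (auto simp: klin_def N.kdiff Pi_def)
qed

lemma klin_restrict:
  assumes "kmodule M" "klin M N f"
  shows "klin M N (restrict f (carrier M))"
proof -
  interpret M: kmodule M by fact
  show ?thesis
    by (rule klinI) (simp_all add: klinD[OF assms(2)])
qed

lemma klin_finsum_fun:
  assumes "\<And>c. c \<in> J \<Longrightarrow> klin M N (f c)" "kmodule M" "kmodule N"
  shows "klin M N (\<lambda>x. \<Oplus>\<^bsub>N\<^esub>c\<in>J. f c x)"
proof -
  interpret N: kmodule N by fact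
  have z: "klin M N (\<lambda>x. \<zero>\<^bsub>N\<^esub>)" by (rule klinI) auto
  show ?thesis
  proof (cases "finite J")
    case True
    then show ?thesis using assms(1)
    proof (induction J)
      case empty
      then show ?case using z by simp
    next
      case (insert c J)
      have "klin M N (\<lambda>x. f c x \<oplus>\<^bsub>N\<^esub> (\<Oplus>\<^bsub>N\<^esub>c\<in>J. f c x))"
        by (rule klin_plus[OF _ _ assms(3)]) (use insert in auto)
      moreover have "(\<Oplus>\<^bsub>N\<^esub>c\<in>insert c J. f c x) = f c x \<oplus>\<^bsub>N\<^esub> (\<Oplus>\<^bsub>N\<^esub>c\<in>J. f c x)" if "x \<in> carrier M" for x
        using insert that klinD(1)[OF insert.prems] by (subst N.M.finsum_insert) auto
      ultimately show ?case
        using insert.prems assms(2) by (auto simp: klin_def kmodule.ksmult_closed Pi_def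
          module_def abelian_group_def kmodule_def abelian_monoid.a_closed)
    qed
  qed (use z in \<open>simp add: N.M.finsum_infinite\<close>)
qed

lemma (in kmodule) finsum_single:
  assumes "finite J" "a \<in> J" "f a \<in> carrier M" "\<And>c. \<lbrakk>c \<in> J; c \<noteq> a\<rbrakk> \<Longrightarrow> f c = \<zero>"
  shows "(\<Oplus>c\<in>J. f c) = f a"
proof -
  have "f c \<in> carrier M" if "c \<in> J" for c
    using assms that by (cases "c = a") auto
  then have "(\<Oplus>c\<in>{a}. f c) = (\<Oplus>c\<in>J. f c)"
    using assms by (intro M.add.finprod_mono_neutral_cong_left) auto
  then show ?thesis using assms(3) by (simp add: M.finsum_insert)
qed

text \<open>
  That the homogeneous elements generate is proved by induction from this form; the existence of a
  decomposition as a function with finite support, which \<open>is_decomp\<close> asks for, is then a general fact.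
\<close>

inductive_set hsums :: "('k, 'a, 'm) dg_scheme \<Rightarrow> 'a set" for M
  where zero: "\<zero>\<^bsub>M\<^esub> \<in> hsums M"
  | add: "\<lbrakk>x \<in> gr M i; y \<in> hsums M\<rbrakk> \<Longrightarrow> x \<oplus>\<^bsub>M\<^esub> y \<in> hsums M"

text \<open>
  The differential is left out because decompositions into homogeneous components are used for
  quotients and endomorphism algebras before a differential is available on them.
\<close>

locale gr_module = kmodule M
  for M :: "('k::field_char_0, 'a, 'm) dg_scheme" (structure) +
  assumes gr_submodule: "submodule (gr M i) ground M"
    and gr_direct: "x \<in> carrier M \<Longrightarrow> \<exists>!c. is_decomp M x c"
begin

lemma gr_module: "gr_module M" ..

lemma gr_closed: "x \<in> gr M i \<Longrightarrow> x \<in> carrier M"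
  and gr_zero [simp]: "\<zero> \<in> gr M i"
  and gr_add: "\<lbrakk>x \<in> gr M i; y \<in> gr M i\<rbrakk> \<Longrightarrow> x \<oplus> y \<in> gr M i"
  and gr_smult: "x \<in> gr M i \<Longrightarrow> r \<odot> x \<in> gr M i"
  and gr_diff: "\<lbrakk>x \<in> gr M i; y \<in> gr M i\<rbrakk> \<Longrightarrow> x \<ominus> y \<in> gr M i"
  by (rule ksubmoduleD[OF gr_submodule]; assumption?)+

lemma hcomp_decomp:
  assumes "x \<in> carrier M"
  shows "is_decomp M x (\<lambda>i. hcomp M i x)"
  unfolding hcomp_def using theI'[OF gr_direct[OF assms]] by simp

lemma hcomp_gr: "x \<in> carrier M \<Longrightarrow> hcomp M i x \<in> gr M i"
  and hcomp_finite: "x \<in> carrier M \<Longrightarrow> finite {i. hcomp M i x \<noteq> \<zero>}"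
  using hcomp_decomp by (auto simp: is_decomp_def)

lemma hcomp_closed [simp]: "x \<in> carrier M \<Longrightarrow> hcomp M i x \<in> carrier M"
  using hcomp_gr gr_closed by blast

lemma hcomp_sum:
  assumes "x \<in> carrier M" "finite J" "{i. hcomp M i x \<noteq> \<zero>} \<subseteq> J"
  shows "(\<Oplus>i\<in>J. hcomp M i x) = x"
proof -
  have "x = (\<Oplus>i\<in>{i. hcomp M i x \<noteq> \<zero>}. hcomp M i x)"
    using hcomp_decomp[OF assms(1)] by (simp add: is_decomp_def)
  also have "\<dots> = (\<Oplus>i\<in>J. hcomp M i x)"
    using assms by (intro M.add.finprod_mono_neutral_cong_left) auto
  finally show ?thesis ..
qed

lemma hcomp_eqI:
  assumes "finite J" "\<And>i. i \<in> J \<Longrightarrow> c i \<in> gr M i"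
  shows "hcomp M i (\<Oplus>i\<in>J. c i) = (if i \<in> J then c i else \<zero>)"
proof -
  let ?x = "\<Oplus>i\<in>J. c i" and ?c = "\<lambda>i. if i \<in> J then c i else \<zero>"
  have cl: "\<And>i. i \<in> J \<Longrightarrow> c i \<in> carrier M"
    using assms gr_closed by blast
  have x: "?x \<in> carrier M"
    by (rule M.finsum_closed) (use cl in auto)
  have fin: "finite {i. ?c i \<noteq> \<zero>}"
    by (rule finite_subset[OF _ assms(1)]) auto
  have "(\<Oplus>i\<in>{i. ?c i \<noteq> \<zero>}. ?c i) = ?x"
    using assms(1) cl by (intro M.add.finprod_mono_neutral_cong_left) (auto split: if_splits)
  then have "is_decomp M ?x ?c"
    using assms fin by (simp add: is_decomp_def)
  then have "(\<lambda>i. hcomp M i ?x) = ?c"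
    using gr_direct[OF x] hcomp_decomp[OF x] by blast
  then show ?thesis by (rule fun_cong)
qed

lemma hcomp_homog:
  assumes "x \<in> gr M i"
  shows "hcomp M j x = (if j = i then x else \<zero>)"
  using hcomp_eqI[of "{i}" "\<lambda>_. x" j] assms gr_closed[OF assms] by (simp add: M.finsum_insert)

lemma hcomp_klin: "klin M M (hcomp M i)"
proof (rule klinI)
  fix x y r assume xy: "x \<in> carrier M" "y \<in> carrier M"
  define J where "J = insert i ({i. hcomp M i x \<noteq> \<zero>} \<union> {i. hcomp M i y \<noteq> \<zero>})"
  have J: "finite J" "{i. hcomp M i x \<noteq> \<zero>} \<subseteq> J" "{i. hcomp M i y \<noteq> \<zero>} \<subseteq> J" "i \<in> J"
    using xy hcomp_finite by (auto simp: J_def)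
  have "x \<oplus> y = (\<Oplus>i\<in>J. hcomp M i x \<oplus> hcomp M i y)"
    using xy J by (simp add: M.finsum_addf hcomp_sum Pi_def)
  then show "hcomp M i (x \<oplus> y) = hcomp M i x \<oplus> hcomp M i y"
    using hcomp_eqI[of J "\<lambda>i. hcomp M i x \<oplus> hcomp M i y" i] J xy by (simp add: gr_add hcomp_gr)
  have "r \<odot> x = (\<Oplus>i\<in>J. r \<odot> hcomp M i x)"
    using xy J finsum_smult_ldistr[of J r "\<lambda>i. hcomp M i x"] by (simp add: hcomp_sum Pi_def)
  then show "hcomp M i (r \<odot> x) = r \<odot> hcomp M i x"
    using hcomp_eqI[of J "\<lambda>i. r \<odot> hcomp M i x" i] J xy by (simp add: gr_smult hcomp_gr)
qed simp

lemma gr_induct [consumes 1, case_names zero add]: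
  assumes "x \<in> carrier M" "P \<zero>"
    and "\<And>i x y. \<lbrakk>x \<in> gr M i; y \<in> carrier M; P y\<rbrakk> \<Longrightarrow> P (x \<oplus> y)"
  shows "P x"
proof -
  have "P (\<Oplus>i\<in>J. hcomp M i x)" if "finite J" for J
    using that
  proof (induction J)
    case (insert i J)
    then show ?case
      using assms(1) by (simp add: M.finsum_insert Pi_def)
        (rule assms(3)[OF hcomp_gr[OF assms(1)]], auto intro: M.finsum_closed)
  qed (simp add: assms(2))
  then show ?thesis
    using hcomp_sum[OF assms(1)] hcomp_finite[OF assms(1)] by (metis order_refl)
qed

lemma klin_gr_eq:
  assumes "klin M N f" "klin M N g" "kmodule N" "\<And>i x. x \<in> gr M i \<Longrightarrow> f x = g x" "x \<in> carrier M"
  shows "f x = g x"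
  using assms(5)
proof (induction x rule: gr_induct)
  case zero
  show ?case using klin_zero assms(1-3) kmodule by metis
next
  case (add i x y)
  then show ?case
    using assms(4) gr_closed by (simp add: klinD[OF assms(1)] klinD[OF assms(2)])
qed

lemma submodule_contains_gr:
  assumes "submodule H ground M" "\<And>i. gr M i \<subseteq> H"
  shows "carrier M \<subseteq> H"
proof
  fix x assume "x \<in> carrier M"
  then show "x \<in> H"
    by (induction x rule: gr_induct) (use assms(2) in \<open>auto intro: ksubmoduleD(3,4)[OF assms(1)]\<close>)
qed

end

text \<open>
  The condition on a family of maps on homogeneous elements under which its extension \<open>hext\<close> is linear.
\<close>

definition hlin :: "('k::field_char_0, 'a, 'm) dg_scheme \<Rightarrow> ('k, 'b, 'n) dg_scheme \<Rightarrow> (int \<Rightarrow> 'a \<Rightarrow> 'b) \<Rightarrow> bool"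
  where "hlin M N \<phi> \<longleftrightarrow> (\<forall>i. \<forall>x\<in>gr M i. \<phi> i x \<in> carrier N \<and>
    (\<forall>y\<in>gr M i. \<phi> i (x \<oplus>\<^bsub>M\<^esub> y) = \<phi> i x \<oplus>\<^bsub>N\<^esub> \<phi> i y) \<and> (\<forall>r. \<phi> i (r \<odot>\<^bsub>M\<^esub> x) = r \<odot>\<^bsub>N\<^esub> \<phi> i x))"

context gr_module
begin

context
  fixes N :: "('k, 'b, 'n) dg_scheme" and \<phi> :: "int \<Rightarrow> 'a \<Rightarrow> 'b"
  assumes N: "kmodule N" and \<phi>: "hlin M N \<phi>"
begin

interpretation N: kmodule N by (rule N)

lemma hlin_zero: "\<phi> i \<zero> = \<zero>\<^bsub>N\<^esub>"
proof -
  have "\<phi> i (0 \<odot> \<zero>) = 0 \<odot>\<^bsub>N\<^esub> \<phi> i \<zero>" "\<phi> i \<zero> \<in> carrier N"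
    using \<phi> gr_zero unfolding hlin_def by blast+
  then show ?thesis by simp
qed

lemma hext_sum:
  assumes "x \<in> carrier M" "finite J" "{i. hcomp M i x \<noteq> \<zero>} \<subseteq> J"
  shows "hext M N \<phi> x = (\<Oplus>\<^bsub>N\<^esub>i\<in>J. \<phi> i (hcomp M i x))"
  unfolding hext_def using assms \<phi> hcomp_gr
  by (intro N.M.add.finprod_mono_neutral_cong_left) (auto simp: hlin_zero hlin_def)

lemma hext_homog:
  assumes "x \<in> gr M i"
  shows "hext M N \<phi> x = \<phi> i x"
proof -
  have "hext M N \<phi> x = (\<Oplus>\<^bsub>N\<^esub>j\<in>{i}. \<phi> j (hcomp M j x))"
    using assms gr_closed by (intro hext_sum) (auto simp: hcomp_homog)
  also have "\<dots> = \<phi> i x"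
    using assms \<phi> by (subst N.M.finsum_insert) (auto simp: hcomp_homog hlin_def)
  finally show ?thesis .
qed

lemma hext_klin: "klin M N (hext M N \<phi>)"
proof (rule klinI)
  have \<phi>c: "\<And>i x. x \<in> carrier M \<Longrightarrow> \<phi> i (hcomp M i x) \<in> carrier N"
    using \<phi> hcomp_gr by (auto simp: hlin_def)
  note lin = klinD[OF hcomp_klin]
  fix x y r assume xy: "x \<in> carrier M" "y \<in> carrier M"
  define J where "J = {i. hcomp M i x \<noteq> \<zero>} \<union> {i. hcomp M i y \<noteq> \<zero>}"
  have J: "finite J"
    using xy hcomp_finite by (auto simp: J_def)
  have "hext M N \<phi> (x \<oplus> y) = (\<Oplus>\<^bsub>N\<^esub>i\<in>J. \<phi> i (hcomp M i (x \<oplus> y)))"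
    using xy J by (intro hext_sum) (auto simp: J_def lin)
  also have "\<dots> = (\<Oplus>\<^bsub>N\<^esub>i\<in>J. \<phi> i (hcomp M i x) \<oplus>\<^bsub>N\<^esub> \<phi> i (hcomp M i y))"
    using xy \<phi> \<phi>c hcomp_gr by (intro N.M.finsum_cong') (auto simp: lin hlin_def)
  also have "\<dots> = (\<Oplus>\<^bsub>N\<^esub>i\<in>J. \<phi> i (hcomp M i x)) \<oplus>\<^bsub>N\<^esub> (\<Oplus>\<^bsub>N\<^esub>i\<in>J. \<phi> i (hcomp M i y))"
    using xy \<phi>c by (intro N.M.finsum_addf) auto
  also have "\<dots> = hext M N \<phi> x \<oplus>\<^bsub>N\<^esub> hext M N \<phi> y"
    using xy J hext_sum[of x J] hext_sum[of y J] by (simp add: J_def)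
  finally show "hext M N \<phi> (x \<oplus> y) = hext M N \<phi> x \<oplus>\<^bsub>N\<^esub> hext M N \<phi> y" .
  have "hext M N \<phi> (r \<odot> x) = (\<Oplus>\<^bsub>N\<^esub>i\<in>J. \<phi> i (hcomp M i (r \<odot> x)))"
    using xy J by (intro hext_sum) (auto simp: J_def lin)
  also have "\<dots> = (\<Oplus>\<^bsub>N\<^esub>i\<in>J. r \<odot>\<^bsub>N\<^esub> \<phi> i (hcomp M i x))"
    using xy \<phi> \<phi>c hcomp_gr by (intro N.M.finsum_cong') (auto simp: lin hlin_def)
  also have "\<dots> = r \<odot>\<^bsub>N\<^esub> (\<Oplus>\<^bsub>N\<^esub>i\<in>J. \<phi> i (hcomp M i x))"
    using xy \<phi>c J by (intro N.finsum_smult_ldistr[symmetric]) auto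
  also have "\<dots> = r \<odot>\<^bsub>N\<^esub> hext M N \<phi> x"
    using xy J hext_sum[of x J] by (simp add: J_def)
  finally show "hext M N \<phi> (r \<odot> x) = r \<odot>\<^bsub>N\<^esub> hext M N \<phi> x" .
next
  fix x assume "x \<in> carrier M"
  then show "hext M N \<phi> x \<in> carrier N"
    unfolding hext_def using \<phi> hcomp_gr by (intro N.M.finsum_closed) (auto simp: hlin_def)
qed

end

end

text \<open>
  Existence of decompositions follows from generation by collecting terms of equal degree, and
  uniqueness follows from independence applied to the difference of two decompositions. Sums range
  over arbitrary finite index sets, because the support of a sum of decompositions is not determined by
  the supports.
\<close>

lemma gr_moduleI:
  fixes M :: "('k::field_char_0, 'a, 'm) dg_scheme" (structure)
  assumes "kmodule M" and sub: "\<And>i. submodule (gr M i) ground M" and gen: "carrier M \<subseteq> hsums M"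
    and indep: "\<And>J c. \<lbrakk>finite J; \<And>i. c i \<in> gr M i; (\<Oplus>i\<in>J. c i) = \<zero>\<rbrakk> \<Longrightarrow> \<forall>i\<in>J. c i = \<zero>"
  shows "gr_module M"
proof -
  interpret kmodule M by fact
  note D = ksubmoduleD[OF sub]
  show ?thesis
  proof (intro gr_module.intro gr_module_axioms.intro)
    fix x assume "x \<in> carrier M"
    then have "x \<in> hsums M" using gen by blast
    then have "\<exists>c J. (\<forall>i. c i \<in> gr M i) \<and> finite J \<and> (\<forall>i. i \<notin> J \<longrightarrow> c i = \<zero>) \<and> x = (\<Oplus>i\<in>J. c i)"
    proof (induction rule: hsums.induct)
      case zero
      show ?case by (rule exI[of _ "\<lambda>_. \<zero>"], rule exI[of _ "{}"]) (simp add: D)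
    next
      case (add x i y)
      then obtain c J where c: "\<forall>i. c i \<in> gr M i" "finite J" "\<forall>i. i \<notin> J \<longrightarrow> c i = \<zero>" "y = (\<Oplus>i\<in>J. c i)"
        by blast
      have cl: "\<And>i. c i \<in> carrier M" "x \<in> carrier M"
        using c add D by blast+
      have "y = (\<Oplus>j\<in>insert i J. c j)"
        using c cl by (cases "i \<in> J") (auto simp: insert_absorb M.finsum_insert Pi_def)
      also have "\<dots> = c i \<oplus> (\<Oplus>j\<in>J - {i}. c j)"
        using c cl by (subst insert_Diff_single[symmetric], subst M.finsum_insert) auto
      finally have y: "y = c i \<oplus> (\<Oplus>j\<in>J - {i}. c j)" .
      let ?c = "c(i := x \<oplus> c i)"
      have "(\<Oplus>j\<in>insert i (J - {i}). ?c j) = (x \<oplus> c i) \<oplus> (\<Oplus>j\<in>J - {i}. ?c j)"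
        using c cl by (subst M.finsum_insert) auto
      also have "(\<Oplus>j\<in>J - {i}. ?c j) = (\<Oplus>j\<in>J - {i}. c j)"
        using cl by (intro M.finsum_cong') auto
      finally have "x \<oplus> y = (\<Oplus>j\<in>insert i (J - {i}). ?c j)"
        using y cl by (simp add: M.a_assoc Pi_def)
      moreover have "\<forall>j. ?c j \<in> gr M j" "\<forall>j. j \<notin> insert i (J - {i}) \<longrightarrow> ?c j = \<zero>"
        using c add.hyps D by auto
      ultimately show ?case
        using c(2) by (intro exI[of _ ?c] exI[of _ "insert i (J - {i})"]) auto
    qed
    then obtain c J where c: "\<And>i. c i \<in> gr M i" "finite J" "\<And>i. i \<notin> J \<Longrightarrow> c i = \<zero>" "x = (\<Oplus>i\<in>J. c i)"
      by blast
    have cl: "\<And>i. c i \<in> carrier M"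
      using c D by blast
    have sup: "{i. c i \<noteq> \<zero>} \<subseteq> J" using c(3) by blast
    have "(\<Oplus>i\<in>{i. c i \<noteq> \<zero>}. c i) = (\<Oplus>i\<in>J. c i)"
      using c(2) sup cl by (intro M.add.finprod_mono_neutral_cong_left) auto
    then have dec: "is_decomp M x c"
      using c finite_subset[OF sup c(2)] by (simp add: is_decomp_def)
    show "\<exists>!c. is_decomp M x c"
    proof (rule ex1I[of _ c], rule dec)
      fix c' assume c': "is_decomp M x c'"
      then have g': "\<And>i. c' i \<in> gr M i"
        by (simp add: is_decomp_def)
      then have cl': "\<And>i. c' i \<in> carrier M"
        by (rule D(2))
      let ?J = "J \<union> {i. c' i \<noteq> \<zero>}"
      have fin: "finite ?J" using c' c(2) by (simp add: is_decomp_def)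
      have "x = (\<Oplus>i\<in>{i. c' i \<noteq> \<zero>}. c' i)" using c' by (simp add: is_decomp_def)
      also have "\<dots> = (\<Oplus>i\<in>?J. c' i)"
        using cl' fin by (intro M.add.finprod_mono_neutral_cong_left) auto
      finally have x': "x = (\<Oplus>i\<in>?J. c' i)" .
      have x: "x = (\<Oplus>i\<in>?J. c i)"
        unfolding c(4) using cl c(3) fin by (intro M.add.finprod_mono_neutral_cong_left) auto
      have "(\<Oplus>i\<in>?J. c' i \<oplus> (- 1) \<odot> c i) = (\<Oplus>i\<in>?J. c' i) \<oplus> (\<Oplus>i\<in>?J. (- 1) \<odot> c i)"
        using cl cl' by (intro M.finsum_addf) auto
      also have "(\<Oplus>i\<in>?J. (- 1) \<odot> c i) = (- 1) \<odot> (\<Oplus>i\<in>?J. c i)"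
        using cl fin by (intro finsum_smult_ldistr[symmetric]) auto
      also have "(\<Oplus>i\<in>?J. c' i) \<oplus> (- 1) \<odot> (\<Oplus>i\<in>?J. c i) = \<zero>"
        using x x' \<open>x \<in> carrier M\<close> kcancel by metis
      finally have z: "(\<Oplus>i\<in>?J. c' i \<oplus> (- 1) \<odot> c i) = \<zero>" .
      have "\<forall>i\<in>?J. c' i \<oplus> (- 1) \<odot> c i = \<zero>"
        by (rule indep[OF fin _ z]) (use c(1) g' in \<open>simp add: D(4,5)\<close>)
      then have "\<forall>i\<in>?J. c' i \<ominus> c i = \<zero>"
        using cl cl' by (simp add: kdiff)
      then have eq: "\<And>i. i \<in> ?J \<Longrightarrow> c' i = c i"
        using kdiff_zero_iff[OF cl' cl] by blast
      have "c' i = c i" for i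
      proof (cases "i \<in> ?J")
        case False
        then have "i \<notin> J" "c' i = \<zero>" by blast+
        then show ?thesis using c(3) by metis
      qed (rule eq)
      then show "c' = c" by (rule ext)
    qed
  qed (rule kmodule sub)+
qed

section \<open>Graded algebras and their quotients\<close>

sublocale dg_module \<subseteq> kmodule M ..

sublocale dg_module \<subseteq> gr_module M
  by (intro gr_module.intro gr_module_axioms.intro kmodule gr_submodule gr_direct)

lemma (in dg_module) dif_closed [simp]: "x \<in> carrier M \<Longrightarrow> dif M x \<in> carrier M"
proof -
  have z: "dif M \<zero> = \<zero>"
    using dif_smult[of \<zero> 0] dif_degree[of \<zero> 0] gr_closed by simp
  show "dif M x \<in> carrier M" if "x \<in> carrier M"
    using that
  proof (induction x rule: gr_induct)
    case (add i x y)
    then show ?case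
      using gr_closed[OF add(1)] gr_closed[OF dif_degree[OF add(1)]] by (simp add: dif_add)
  qed (simp add: z)
qed

lemma (in dg_module) dif_klin: "klin M M (dif M)"
  by (rule klinI) (simp_all add: dif_add dif_smult)

locale gr_algebra = gr_module A + ring A
  for A :: "('k::field_char_0, 'a, 'm) dg_scheme" (structure) +
  assumes smult_mult_l: "\<lbrakk>x \<in> carrier A; y \<in> carrier A\<rbrakk> \<Longrightarrow> (r \<odot> x) \<otimes> y = r \<odot> (x \<otimes> y)"
    and smult_mult_r: "\<lbrakk>x \<in> carrier A; y \<in> carrier A\<rbrakk> \<Longrightarrow> x \<otimes> (r \<odot> y) = r \<odot> (x \<otimes> y)"
    and one_degree: "\<one> \<in> gr A 0"
    and mult_degree: "\<lbrakk>x \<in> gr A i; y \<in> gr A j\<rbrakk> \<Longrightarrow> x \<otimes> y \<in> gr A (i + j)"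
begin

lemma mult_klin_l: "a \<in> carrier A \<Longrightarrow> klin A A (\<lambda>x. a \<otimes> x)"
  by (rule klinI) (simp_all add: r_distr smult_mult_r)

lemma mult_klin_r: "a \<in> carrier A \<Longrightarrow> klin A A (\<lambda>x. x \<otimes> a)"
  by (rule klinI) (simp_all add: l_distr smult_mult_l)

end

text \<open>
  A graded algebra with a linear map of degree \<open>-1\<close>. This is what the free objects carry before relations
  are imposed: their \<open>dif\<close> becomes a square-zero derivation only in the quotient.
\<close>

locale predg_algebra = gr_algebra A
  for A :: "('k::field_char_0, 'a, 'm) dg_scheme" (structure) +
  assumes dif_klin: "klin A A (dif A)"
    and dif_degree: "x \<in> gr A i \<Longrightarrow> dif A x \<in> gr A (i - 1)"
begin

lemma predg_algebra: "predg_algebra A" ..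

end

sublocale dg_algebra \<subseteq> predg_algebra A
  by (intro predg_algebra.intro gr_algebra.intro gr_algebra_axioms.intro predg_algebra_axioms.intro)
    (fact gr_module ring_axioms smult_mult_l smult_mult_r one_degree mult_degree dif_klin dif_degree)+

text \<open>
  Both conditions are additive in each argument, so homogeneous elements suffice.
\<close>

lemma dg_algebraI:
  fixes A :: "('k::field_char_0, 'a, 'm) dg_scheme" (structure)
  assumes "predg_algebra A"
    and dd: "\<And>i x. x \<in> gr A i \<Longrightarrow> dif A (dif A x) = \<zero>"
    and lb: "\<And>i j x y. \<lbrakk>x \<in> gr A i; y \<in> gr A j\<rbrakk> \<Longrightarrow>
      dif A (x \<otimes> y) = (dif A x \<otimes> y) \<oplus> (ksign i \<odot> (x \<otimes> dif A y))"
  shows "dg_algebra A"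
proof -
  interpret predg_algebra A by fact
  note d = klinD[OF dif_klin]
  show ?thesis
  proof (intro dg_algebra.intro dg_module.intro dg_module_axioms.intro dg_algebra_axioms.intro)
    fix x i y
    show "dif A (x \<otimes> y) = (dif A x \<otimes> y) \<oplus> (ksign i \<odot> (x \<otimes> dif A y))" if x: "x \<in> gr A i" and y: "y \<in> carrier A"
      using y
    proof (induction y rule: gr_induct)
      case zero
      show ?case using gr_closed[OF x] d(1) klin_zero[OF dif_klin kmodule kmodule] by simp
    next
      case (add j u v)
      have c: "x \<in> carrier A" "u \<in> carrier A"
        using x add gr_closed by blast+
      show ?case
        using add c lb[OF x add(1)] by (simp add: r_distr d ksmult_r_add a_ac)
    qed
  next
    fix x assume "x \<in> carrier A"
    then show "dif A (dif A x) = \<zero>"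
    proof (induction x rule: gr_induct)
      case zero
      show ?case using klin_zero[OF dif_klin kmodule kmodule] by simp
    next
      case (add j u v)
      then show ?case using gr_closed[OF add(1)] dd[OF add(1)] by (simp add: d)
    qed
  qed (simp_all add: d dif_degree one_degree mult_degree smult_mult_l smult_mult_r gr_submodule gr_direct
      module_axioms ring_axioms)
qed

text \<open>
  Multiplicativity is an equality of bilinear maps, and compatibility with the differentials is an
  equality of linear maps; both are determined by homogeneous elements.
\<close>

lemma dga_homI:
  assumes "predg_algebra A" "predg_algebra B" and f: "klin A B f" and e: "f \<in> extensional (carrier A)"
    and o: "f \<one>\<^bsub>A\<^esub> = \<one>\<^bsub>B\<^esub>"
    and m: "\<And>i j x y. \<lbrakk>x \<in> gr A i; y \<in> gr A j\<rbrakk> \<Longrightarrow> f (x \<otimes>\<^bsub>A\<^esub> y) = f x \<otimes>\<^bsub>B\<^esub> f y"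
    and g: "\<And>i x. x \<in> gr A i \<Longrightarrow> f x \<in> gr B i"
    and d: "\<And>i x. x \<in> gr A i \<Longrightarrow> f (dif A x) = dif B (f x)"
  shows "f \<in> dga_hom A B"
proof -
  interpret A: predg_algebra A by fact
  interpret B: predg_algebra B by fact
  have 1: "f (x \<otimes>\<^bsub>A\<^esub> y) = f x \<otimes>\<^bsub>B\<^esub> f y" if x: "x \<in> gr A i" and y: "y \<in> carrier A" for i x y
  proof -
    have c: "x \<in> carrier A" "f x \<in> carrier B"
      using A.gr_closed[OF x] klinD(1)[OF f] by blast+
    show ?thesis
      by (rule A.klin_gr_eq[OF klin_comp[OF A.mult_klin_l[OF c(1)] f] klin_comp[OF f B.mult_klin_l[OF c(2)]]
            B.kmodule m[OF x] y])
  qed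
  have 2: "f (x \<otimes>\<^bsub>A\<^esub> y) = f x \<otimes>\<^bsub>B\<^esub> f y" if x: "x \<in> carrier A" and y: "y \<in> carrier A" for x y
    by (rule A.klin_gr_eq[OF klin_comp[OF A.mult_klin_r[OF y] f]
          klin_comp[OF f B.mult_klin_r[OF klinD(1)[OF f y]]] B.kmodule 1[OF _ y] x])
  have 3: "f (dif A x) = dif B (f x)" if "x \<in> carrier A" for x
    by (rule A.klin_gr_eq[OF klin_comp[OF A.dif_klin f] klin_comp[OF f B.dif_klin] B.kmodule d that])
  have "f \<in> ring_hom A B"
    by (rule ring_hom_memI) (simp_all add: klinD[OF f] 2 o)
  then show ?thesis
    using e g 3 klinD(3)[OF f] by (auto simp: dga_hom_def)
qed

lemma dga_homD:
  assumes "f \<in> dga_hom A B"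
  shows "klin A B f" "f \<in> extensional (carrier A)" "f \<one>\<^bsub>A\<^esub> = \<one>\<^bsub>B\<^esub>"
    "\<lbrakk>x \<in> carrier A; y \<in> carrier A\<rbrakk> \<Longrightarrow> f (x \<otimes>\<^bsub>A\<^esub> y) = f x \<otimes>\<^bsub>B\<^esub> f y"
    "x \<in> gr A i \<Longrightarrow> f x \<in> gr B i" "x \<in> carrier A \<Longrightarrow> f (dif A x) = dif B (f x)"
    "x \<in> carrier A \<Longrightarrow> f x \<in> carrier B"
proof -
  have "f \<in> ring_hom A B" using assms by (simp add: dga_hom_def)
  note r = this ring_hom_closed[OF this] ring_hom_mult[OF this] ring_hom_add[OF this] ring_hom_one[OF this]
  show "klin A B f"
    using assms r by (intro klinI) (auto simp: dga_hom_def)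
qed (use assms in \<open>auto simp: dga_hom_def ring_hom_closed ring_hom_mult ring_hom_one\<close>)

lemma dga_hom_comp:
  assumes "predg_algebra A" "predg_algebra B" "predg_algebra C" "f \<in> dga_hom A B" "g \<in> dga_hom B C"
  shows "compose (carrier A) g f \<in> dga_hom A C"
proof -
  interpret A: predg_algebra A by fact
  note f = dga_homD[OF assms(4)] and g = dga_homD[OF assms(5)]
  have d: "x \<in> gr A i \<Longrightarrow> dif A x \<in> carrier A" for x i
    using A.gr_closed by (rule klinD(1)[OF A.dif_klin])
  show ?thesis
    by (rule dga_homI[OF assms(1,3)])
      (use f g A.gr_closed d in \<open>auto simp: compose_def klin_def A.mult_degree\<close>)
qed

subsection \<open>Cosets\<close>

context kmodule
begin

context
  fixes I assumes I: "submodule I ground M"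
begin

lemma submodule_abelian_subgroup: "abelian_subgroup I M"
  using I M.a_comm_group unfolding submodule_def by (intro abelian_subgroupI2) auto

interpretation I: abelian_subgroup I M by (rule submodule_abelian_subgroup)

lemma coset_eq_iff:
  assumes "x \<in> carrier M" "y \<in> carrier M"
  shows "I +> x = I +> y \<longleftrightarrow> x \<ominus> y \<in> I"
proof -
  have "x \<in> I +> y \<longleftrightarrow> x \<ominus> y \<in> I"
    using I.a_rcos_module[of y x] assms by (simp add: M.minus_eq)
  moreover have "x \<in> I +> y \<longleftrightarrow> I +> x = I +> y"
    using I.a_repr_independence' I.a_repr_independenceD I.a_rcos_self assms by metis
  ultimately show ?thesis by simp
qed

lemma coset_zero_iff: "x \<in> carrier M \<Longrightarrow> I +> x = I \<longleftrightarrow> x \<in> I"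
  using I.a_rcos_self I.a_rcos_const by auto

lemma coset_carrier: "x \<in> carrier M \<Longrightarrow> z \<in> I +> x \<Longrightarrow> z \<in> carrier M \<and> z \<ominus> x \<in> I"
  using I.a_rcos_module[of x z] I.a_elemrcos_carrier[of x z] by (simp add: M.minus_eq)

text \<open>
  Several operations on the quotient, and the induced maps of tensor products, are defined as unions
  over a coset. If the family is constant on the coset, then the union is its value at any representative.
\<close>

lemma coset_UN:
  assumes "x \<in> carrier M" "\<And>y. \<lbrakk>y \<in> carrier M; y \<ominus> x \<in> I\<rbrakk> \<Longrightarrow> F y = F x"
  shows "(\<Union>y\<in>I +> x. F y) = F x"
proof -
  have "F y = F x" if "y \<in> I +> x" for y
    using coset_carrier[OF assms(1) that] by (intro assms(2)) auto
  then show ?thesis using I.a_rcos_self[OF assms(1)] by blast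
qed

lemma quot_carrier: "carrier (dg_quot M I) = (\<lambda>x. I +> x) ` carrier M"
  by (auto simp: dg_quot_def A_RCOSETS_defs a_r_coset_def)

lemma quot_coset_closed [simp]: "x \<in> carrier M \<Longrightarrow> I +> x \<in> carrier (dg_quot M I)"
  by (simp add: quot_carrier)

lemma quot_add:
  "\<lbrakk>x \<in> carrier M; y \<in> carrier M\<rbrakk> \<Longrightarrow> (I +> x) \<oplus>\<^bsub>dg_quot M I\<^esub> (I +> y) = I +> (x \<oplus> y)"
  by (simp add: dg_quot_def I.a_rcos_sum)

lemma quot_zero: "\<zero>\<^bsub>dg_quot M I\<^esub> = I" "\<zero>\<^bsub>dg_quot M I\<^esub> = I +> \<zero>"
  using coset_zero_iff[of \<zero>] ksubmoduleD(3)[OF I] by (simp_all add: dg_quot_def)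

lemma quot_smult:
  assumes "x \<in> carrier M"
  shows "r \<odot>\<^bsub>dg_quot M I\<^esub> (I +> x) = I +> (r \<odot> x)"
proof -
  have "(\<Union>y\<in>I +> x. I +> (r \<odot> y)) = I +> (r \<odot> x)"
  proof (rule coset_UN[OF assms])
    fix y assume y: "y \<in> carrier M" "y \<ominus> x \<in> I"
    have "r \<odot> (y \<ominus> x) \<in> I" by (rule ksubmoduleD(5)[OF I y(2)])
    then show "I +> (r \<odot> y) = I +> (r \<odot> x)"
      using y assms by (simp add: coset_eq_iff kdiff ksmult_r_add ksmult_assoc)
  qed
  then show ?thesis by (simp add: dg_quot_def)
qed

lemma quot_kmodule: "kmodule (dg_quot M I)"
proof (rule kmoduleI)
  show "abelian_group (dg_quot M I)"
  proof (rule abelian_groupI)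
    fix U assume "U \<in> carrier (dg_quot M I)"
    then obtain x where x: "x \<in> carrier M" "U = I +> x" by (auto simp: quot_carrier)
    then have "(I +> ((- 1) \<odot> x)) \<oplus>\<^bsub>dg_quot M I\<^esub> U = \<zero>\<^bsub>dg_quot M I\<^esub>"
      by (simp add: quot_add kcancel quot_zero(2))
    then show "\<exists>W\<in>carrier (dg_quot M I). W \<oplus>\<^bsub>dg_quot M I\<^esub> U = \<zero>\<^bsub>dg_quot M I\<^esub>"
      using x by (intro bexI) auto
  qed (auto simp: quot_carrier quot_zero(2) quot_add M.a_ac)
qed (auto simp: quot_carrier quot_smult quot_add ksmult_add ksmult_r_add ksmult_assoc)

lemma quot_klin: "klin M (dg_quot M I) (\<lambda>x. I +> x)"
  by (rule klinI) (simp_all add: quot_add quot_smult)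

lemma klin_quot:
  assumes "klin M N h" "kmodule N" "\<And>x. x \<in> I \<Longrightarrow> h x = \<zero>\<^bsub>N\<^esub>"
  obtains f where "klin (dg_quot M I) N f" "\<And>x. x \<in> carrier M \<Longrightarrow> f (I +> x) = h x"
    "f \<in> extensional (carrier (dg_quot M I))"
proof -
  interpret N: kmodule N by fact
  note h = klinD[OF assms(1)]
  have wd: "h x = h y" if "x \<in> carrier M" "y \<in> carrier M" "I +> x = I +> y" for x y
  proof -
    have "h (x \<ominus> y) = \<zero>\<^bsub>N\<^esub>" using that assms(3) by (simp add: coset_eq_iff)
    then have "h x \<ominus>\<^bsub>N\<^esub> h y = \<zero>\<^bsub>N\<^esub>"
      using klin_diff[OF assms(1) kmodule assms(2)] that by simp
    then show ?thesis using that h N.kdiff_zero_iff by simp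
  qed
  define f where "f = (\<lambda>Q\<in>carrier (dg_quot M I). h (SOME x. x \<in> carrier M \<and> Q = I +> x))"
  have f: "f (I +> x) = h x" if "x \<in> carrier M" for x
  proof -
    let ?y = "SOME y. y \<in> carrier M \<and> I +> x = I +> y"
    have "?y \<in> carrier M \<and> I +> x = I +> ?y"
      by (rule someI[of _ x]) (simp add: that)
    then have "h x = h ?y" by (intro wd that) auto
    then show ?thesis using that by (simp add: f_def)
  qed
  have lin: "klin (dg_quot M I) N f"
    by (rule klinI) (auto simp: quot_carrier f quot_add quot_smult h)
  have "f \<in> extensional (carrier (dg_quot M I))"
    unfolding f_def by (rule restrict_extensional)
  with lin f show thesis by (rule that)
qed

end

end

text \<open>
  A graded subspace is one that contains the homogeneous components of its elements; the
  components of a coset are then the cosets of the components.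
\<close>

lemma (in gr_module) quot_gr_module:
  assumes I: "submodule I ground M" and homog: "\<And>x i. x \<in> I \<Longrightarrow> hcomp M i x \<in> I"
  shows "gr_module (dg_quot M I)"
proof (rule gr_moduleI)
  note q = quot_add[OF I] quot_smult[OF I] quot_zero(2)[OF I]
  let ?N = "dg_quot M I"
  interpret N: kmodule ?N by (rule quot_kmodule[OF I])
  show "kmodule ?N" by (rule N.kmodule)
  have gr: "gr ?N i = (\<lambda>x. I +> x) ` gr M i" for i by (simp add: dg_quot_def)
  show "submodule (gr ?N i) ground ?N" for i
  proof (rule N.ksubmoduleI)
    show "gr ?N i \<subseteq> carrier ?N"
      using gr_closed quot_carrier[OF I] by (auto simp: gr)
    show "\<zero>\<^bsub>?N\<^esub> \<in> gr ?N i" by (auto simp: gr q)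
    show "U \<oplus>\<^bsub>?N\<^esub> W \<in> gr ?N i" if "U \<in> gr ?N i" "W \<in> gr ?N i" for U W
    proof -
      obtain x y where "x \<in> gr M i" "U = I +> x" "y \<in> gr M i" "W = I +> y"
        using \<open>U \<in> gr ?N i\<close> \<open>W \<in> gr ?N i\<close> by (auto simp: gr)
      then show ?thesis
        using gr_closed gr_add by (auto simp: gr q)
    qed
    show "r \<odot>\<^bsub>?N\<^esub> U \<in> gr ?N i" if U: "U \<in> gr ?N i" for r U
    proof -
      obtain x where x: "x \<in> gr M i" "U = I +> x"
        using U by (auto simp: gr)
      then show ?thesis
        using gr_closed[OF x(1)] gr_smult[OF x(1)] by (auto simp: gr q)
    qed
  qed
  have "I +> x \<in> hsums ?N" if "x \<in> carrier M" for x
    using that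
  proof (induction x rule: gr_induct)
    case zero
    show ?case using hsums.zero[of ?N] by (simp add: q)
  next
    case (add i x y)
    then have "(I +> x) \<oplus>\<^bsub>?N\<^esub> (I +> y) \<in> hsums ?N"
      by (intro hsums.add[of _ _ i]) (auto simp: gr)
    then show ?case using add gr_closed[OF add(1)] by (simp add: q)
  qed
  then show "carrier ?N \<subseteq> hsums ?N" by (auto simp: quot_carrier[OF I])
  fix J c assume J: "finite J" and c: "\<And>i. c i \<in> gr ?N i" and z: "(\<Oplus>\<^bsub>?N\<^esub>i\<in>J. c i) = \<zero>\<^bsub>?N\<^esub>"
  have "\<forall>i. \<exists>x. x \<in> gr M i \<and> c i = I +> x" using c by (auto simp: gr)
  then obtain b where b: "\<And>i. b i \<in> gr M i" "\<And>i. c i = I +> b i" by metis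
  have bc: "\<And>i. b i \<in> carrier M" using b(1) gr_closed by blast
  have "I +> (\<Oplus>i\<in>J. b i) = (\<Oplus>\<^bsub>?N\<^esub>i\<in>J. c i)"
    using klin_finsum[OF quot_klin[OF I] kmodule N.kmodule, of J b] bc b(2) by simp
  then have "(\<Oplus>i\<in>J. b i) \<in> I"
    using z bc coset_zero_iff[OF I, of "\<Oplus>i\<in>J. b i"] quot_zero(1)[OF I] by (simp add: Pi_def)
  then have "hcomp M i (\<Oplus>i\<in>J. b i) \<in> I" for i by (rule homog)
  then have "b i \<in> I" if "i \<in> J" for i
    using hcomp_eqI[OF J, of b i] b(1) that by metis
  then show "\<forall>i\<in>J. c i = \<zero>\<^bsub>?N\<^esub>"
    using b(2) bc coset_zero_iff[OF I] quot_zero(1)[OF I] by simp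
qed

text \<open>
  The Leibniz rule and \<open>d\<^sup>2 = 0\<close> are required only modulo \<open>I\<close>. On the free algebra on letters \<open>dif\<close> does
  not square to zero, and on the free vector space for the tensor product it is not even a derivation,
  because \<open>a \<otimes> (b + b')\<close> and \<open>a \<otimes> b + a \<otimes> b'\<close> are still different there.
\<close>

locale dg_ideal = predg_algebra A
  for A :: "('k::field_char_0, 'a, 'm) dg_scheme" (structure) and I +
  assumes sub: "submodule I ground A"
    and ideal_l: "\<lbrakk>a \<in> carrier A; x \<in> I\<rbrakk> \<Longrightarrow> a \<otimes> x \<in> I"
    and ideal_r: "\<lbrakk>a \<in> carrier A; x \<in> I\<rbrakk> \<Longrightarrow> x \<otimes> a \<in> I"
    and homog: "x \<in> I \<Longrightarrow> hcomp A i x \<in> I"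
    and dif_I: "x \<in> I \<Longrightarrow> dif A x \<in> I"
    and dif_dif_I: "x \<in> gr A i \<Longrightarrow> dif A (dif A x) \<in> I"
    and leibniz_I: "\<lbrakk>x \<in> gr A i; y \<in> gr A j\<rbrakk> \<Longrightarrow>
      dif A (x \<otimes> y) \<ominus> ((dif A x \<otimes> y) \<oplus> (ksign i \<odot> (x \<otimes> dif A y))) \<in> I"
begin

abbreviation Q where "Q \<equiv> dg_quot A I"

lemma ideal: "ideal I A"
  using sub ideal_l ideal_r unfolding submodule_def by (intro idealI) (auto simp: ring_axioms)

lemma quot_mult: "\<lbrakk>x \<in> carrier A; y \<in> carrier A\<rbrakk> \<Longrightarrow> (I +> x) \<otimes>\<^bsub>Q\<^esub> (I +> y) = I +> (x \<otimes> y)"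
  by (simp add: dg_quot_def ideal.rcoset_mult_add[OF ideal])

lemma quot_one: "\<one>\<^bsub>Q\<^esub> = I +> \<one>"
  by (simp add: dg_quot_def)

lemma quot_gr: "gr Q i = (\<lambda>x. I +> x) ` gr A i"
  by (simp add: dg_quot_def)

lemmas q = quot_add[OF sub] quot_smult[OF sub] quot_zero(2)[OF sub] quot_mult quot_one

lemma dif_closed: "x \<in> carrier A \<Longrightarrow> dif A x \<in> carrier A"
  by (rule klinD(1)[OF dif_klin])

lemma quot_dif:
  assumes "x \<in> carrier A"
  shows "dif Q (I +> x) = I +> dif A x"
proof -
  have "(\<Union>y\<in>I +> x. I +> dif A y) = I +> dif A x"
  proof (rule coset_UN[OF sub assms])
    fix y assume y: "y \<in> carrier A" "y \<ominus> x \<in> I"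
    then have "dif A (y \<ominus> x) \<in> I" by (intro dif_I)
    then show "I +> dif A y = I +> dif A x"
      using y assms dif_closed klin_diff[OF dif_klin kmodule kmodule] by (simp add: coset_eq_iff[OF sub])
  qed
  then show ?thesis by (simp add: dg_quot_def)
qed

lemma quot_ring: "ring Q"
proof (rule ringI)
  show "abelian_group Q"
    using quot_kmodule[OF sub] by (simp add: kmodule_def module_def)
  show "monoid Q"
    by (rule monoidI) (auto simp: quot_carrier[OF sub] q m_assoc)
qed (auto simp: quot_carrier[OF sub] q l_distr r_distr)

lemma quot_dg_algebra: "dg_algebra Q"
proof (rule dg_algebraI)
  show "predg_algebra Q"
  proof (intro predg_algebra.intro gr_algebra.intro gr_algebra_axioms.intro predg_algebra_axioms.intro
      quot_gr_module[OF sub homog] quot_ring)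
    show "klin Q Q (dif Q)"
      by (rule klinI) (auto simp: quot_carrier[OF sub] q quot_dif dif_closed klinD[OF dif_klin])
  qed (use gr_closed in \<open>auto simp: quot_carrier[OF sub] quot_gr q quot_dif smult_mult_l smult_mult_r
        one_degree mult_degree dif_degree\<close>)
next
  fix U i assume "U \<in> gr Q i"
  then obtain x where x: "x \<in> gr A i" "U = I +> x" by (auto simp: quot_gr)
  then show "dif Q (dif Q U) = \<zero>\<^bsub>Q\<^esub>"
    using gr_closed[OF x(1)] dif_dif_I[OF x(1)] coset_zero_iff[OF sub] quot_zero(1)[OF sub]
    by (simp add: quot_dif dif_closed)
  fix W j assume "W \<in> gr Q j"
  then obtain y where y: "y \<in> gr A j" "W = I +> y" by (auto simp: quot_gr)
  have c: "x \<in> carrier A" "y \<in> carrier A" using x y gr_closed by blast+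
  have "I +> dif A (x \<otimes> y) = I +> ((dif A x \<otimes> y) \<oplus> (ksign i \<odot> (x \<otimes> dif A y)))"
    using leibniz_I[OF x(1) y(1)] c by (simp add: coset_eq_iff[OF sub] dif_closed)
  then show "dif Q (U \<otimes>\<^bsub>Q\<^esub> W) = (dif Q U \<otimes>\<^bsub>Q\<^esub> W) \<oplus>\<^bsub>Q\<^esub> (ksign i \<odot>\<^bsub>Q\<^esub> (U \<otimes>\<^bsub>Q\<^esub> dif Q W))"
    using c by (simp add: x y q quot_dif dif_closed)
qed

lemma quot_hom: "(\<lambda>x\<in>carrier A. I +> x) \<in> dga_hom A Q"
proof -
  interpret Q: dg_algebra Q by (rule quot_dg_algebra)
  show ?thesis
    by (rule dga_homI[OF predg_algebra Q.predg_algebra])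
      (use gr_closed in \<open>auto simp: klin_def q dif_closed quot_dif quot_gr quot_coset_closed[OF sub]\<close>)
qed

text \<open>
  The universal property of the quotient. As \<open>A\<close> is a DG algebra only modulo \<open>I\<close>, this covers maps
  that are given on free generators and respect the relations.
\<close>

lemma dga_hom_quot:
  assumes h: "h \<in> dga_hom A P" and "predg_algebra P" and ker: "\<And>x. x \<in> I \<Longrightarrow> h x = \<zero>\<^bsub>P\<^esub>"
  obtains f where "f \<in> dga_hom Q P" "\<And>x. x \<in> carrier A \<Longrightarrow> f (I +> x) = h x"
proof -
  interpret P: predg_algebra P by fact
  interpret Q: dg_algebra Q by (rule quot_dg_algebra)
  note H = dga_homD[OF h]
  obtain f where f: "klin Q P f" "\<And>x. x \<in> carrier A \<Longrightarrow> f (I +> x) = h x" "f \<in> extensional (carrier Q)"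
    using klin_quot[OF sub H(1) P.kmodule ker] by blast
  have "f \<in> dga_hom Q P"
    by (rule dga_homI[OF Q.predg_algebra P.predg_algebra f(1) f(3)])
      (use gr_closed H in \<open>auto simp: quot_gr q f(2) quot_dif dif_closed\<close>)
  then show thesis using f(2) that by blast
qed

end

text \<open>
  For generated ideals, stability is checked on generators: the elements of the ideal whose
  homogeneous components, and the differentials of these, are in the ideal form an ideal themselves.
\<close>

lemma (in predg_algebra) dg_ideal_genideal:
  assumes G: "\<And>g. g \<in> G \<Longrightarrow> \<exists>i. g \<in> gr A i"
    and dG: "\<And>g. g \<in> G \<Longrightarrow> dif A g \<in> genideal A G"
    and lb: "\<And>i j x y. \<lbrakk>x \<in> gr A i; y \<in> gr A j\<rbrakk> \<Longrightarrow>
      dif A (x \<otimes> y) = (dif A x \<otimes> y) \<oplus> (ksign i \<odot> (x \<otimes> dif A y))"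
    and dd: "\<And>i x. x \<in> gr A i \<Longrightarrow> dif A (dif A x) \<in> genideal A G"
  shows "dg_ideal A (genideal A G)"
proof -
  let ?I = "genideal A G"
  have Gc: "G \<subseteq> carrier A" using G gr_closed by blast
  interpret I: ideal ?I A by (rule genideal_ideal[OF Gc])
  note d = klinD[OF dif_klin] and h = klinD[OF hcomp_klin]
  have sm: "r \<odot> x \<in> ?I" if "x \<in> ?I" for r x
    using I.I_l_closed[OF that, of "r \<odot> \<one>"] I.a_Hcarr[OF that] smult_mult_l[of \<one> x r] by simp
  have sub: "submodule ?I ground A"
    by (rule ksubmoduleI) (use sm in \<open>auto simp: I.a_Hcarr\<close>)
  define J where "J = {x \<in> ?I. \<forall>i. hcomp A i x \<in> ?I \<and> dif A (hcomp A i x) \<in> ?I}"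
  have sJ: "submodule J ground A"
  proof (rule ksubmoduleI)
    show "J \<subseteq> carrier A" by (auto simp: J_def I.a_Hcarr)
    show "\<zero> \<in> J"
      by (simp add: J_def klin_zero[OF hcomp_klin kmodule kmodule] klin_zero[OF dif_klin kmodule kmodule])
    fix x y r assume x: "x \<in> J" and y: "y \<in> J"
    then have c: "x \<in> carrier A" "y \<in> carrier A" by (auto simp: J_def I.a_Hcarr)
    then show "x \<oplus> y \<in> J" using x y by (simp add: J_def h d)
    show "r \<odot> x \<in> J" using x c by (simp add: J_def h d sm)
  qed
  note J = ksubmoduleD[OF sJ]
  have hl: "hcomp A i (a \<otimes> x) = a \<otimes> hcomp A (i - j) x" if a: "a \<in> gr A j" and x: "x \<in> carrier A" for a x i j
  proof (rule klin_gr_eq[OF klin_comp[OF mult_klin_l[OF gr_closed[OF a]] hcomp_klin]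
        klin_comp[OF hcomp_klin mult_klin_l[OF gr_closed[OF a]]] kmodule _ x])
    fix k y assume y: "y \<in> gr A k"
    show "hcomp A i (a \<otimes> y) = a \<otimes> hcomp A (i - j) y"
      using hcomp_homog[OF mult_degree[OF a y]] hcomp_homog[OF y] gr_closed[OF a] by auto
  qed
  have hr: "hcomp A i (x \<otimes> a) = hcomp A (i - j) x \<otimes> a" if a: "a \<in> gr A j" and x: "x \<in> carrier A" for a x i j
  proof (rule klin_gr_eq[OF klin_comp[OF mult_klin_r[OF gr_closed[OF a]] hcomp_klin]
        klin_comp[OF hcomp_klin mult_klin_r[OF gr_closed[OF a]]] kmodule _ x])
    fix k y assume y: "y \<in> gr A k"
    show "hcomp A i (y \<otimes> a) = hcomp A (i - j) y \<otimes> a"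
      using hcomp_homog[OF mult_degree[OF y a]] hcomp_homog[OF y] gr_closed[OF a] by auto
  qed
  have J1: "a \<otimes> x \<in> J \<and> x \<otimes> a \<in> J" if "a \<in> gr A j" "x \<in> J" for a x j
  proof -
    have c: "a \<in> carrier A" "x \<in> carrier A" using that gr_closed J by blast+
    have g: "hcomp A k x \<in> gr A k" "hcomp A k x \<in> ?I" "dif A (hcomp A k x) \<in> ?I" for k
      using hcomp_gr[OF c(2)] that by (auto simp: J_def)
    have "dif A (a \<otimes> hcomp A k x) \<in> ?I" "dif A (hcomp A k x \<otimes> a) \<in> ?I" for k
      using lb[OF that(1) g(1)[of k]] lb[OF g(1)[of k] that(1)] c g(2,3)[of k]
      by (simp_all add: I.I_l_closed I.I_r_closed sm d)
    then show ?thesis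
      using that c g by (simp add: J_def hl hr I.I_l_closed I.I_r_closed)
  qed
  have J2: "a \<otimes> x \<in> J \<and> x \<otimes> a \<in> J" if "x \<in> J" "a \<in> carrier A" for a x
    using that(2)
  proof (induction a rule: gr_induct)
    case (add i a b)
    then show ?case using J1[OF add(1) that(1)] gr_closed[OF add(1)] J(2)[OF that(1)]
      by (simp add: l_distr r_distr J(4))
  qed (use that J in simp)
  have "ideal J A"
    using sJ J2 unfolding submodule_def by (intro idealI) (auto simp: ring_axioms)
  moreover have "G \<subseteq> J"
  proof
    fix g assume g: "g \<in> G"
    then obtain i where "g \<in> gr A i" using G by blast
    then show "g \<in> J"
      using dG[OF g] genideal_self[OF Gc] g klin_zero[OF dif_klin kmodule kmodule]
      by (auto simp: J_def hcomp_homog)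
  qed
  ultimately have IJ: "?I \<subseteq> J" by (intro genideal_minimal)
  have dI: "dif A x \<in> ?I" if "x \<in> ?I" for x
  proof -
    have x: "x \<in> carrier A" "\<And>i. dif A (hcomp A i x) \<in> ?I"
      using that IJ I.a_Hcarr by (auto simp: J_def)
    let ?S = "{i. hcomp A i x \<noteq> \<zero>}"
    have "dif A x = dif A (\<Oplus>i\<in>?S. hcomp A i x)"
      using hcomp_sum[OF x(1) hcomp_finite] x(1) by simp
    also have "\<dots> = (\<Oplus>i\<in>?S. dif A (hcomp A i x))"
      by (rule klin_finsum[OF dif_klin kmodule kmodule]) (simp add: x)
    finally show ?thesis
      using submodule_finsum[OF sub, of ?S "\<lambda>i. dif A (hcomp A i x)"] x by simp
  qed
  show ?thesis
  proof (intro dg_ideal.intro dg_ideal_axioms.intro predg_algebra sub)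
    show "x \<in> ?I \<Longrightarrow> hcomp A i x \<in> ?I" for x i using IJ by (auto simp: J_def)
    fix x y i j assume xy: "x \<in> gr A i" "y \<in> gr A j"
    have c: "x \<in> carrier A" "y \<in> carrier A" using xy gr_closed by blast+
    show "dif A (x \<otimes> y) \<ominus> ((dif A x \<otimes> y) \<oplus> (ksign i \<odot> (x \<otimes> dif A y))) \<in> ?I"
      using lb[OF xy] c by (simp add: kdiff kcancel d)
  qed (use dI dd I.I_l_closed I.I_r_closed in auto)
qed

subsection \<open>Abelianization\<close>

lemma (in dg_algebra) dif_one: "dif A \<one> = \<zero>"
proof -
  have "dif A (\<one> \<otimes> \<one>) = (dif A \<one> \<otimes> \<one>) \<oplus> (ksign 0 \<odot> (\<one> \<otimes> dif A \<one>))"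
    by (rule leibniz[OF one_degree]) simp
  then have e: "dif A \<one> = dif A \<one> \<oplus> dif A \<one>" by simp
  have "dif A \<one> \<ominus> dif A \<one> = (dif A \<one> \<oplus> dif A \<one>) \<ominus> dif A \<one>"
    using e by simp
  then show ?thesis by (simp add: kdiff kcancel a_assoc)
qed

text \<open>
  The ideal is stable under \<open>d\<close> because \<open>d [x, y] = [dx, y] + (-1)^i [x, dy]\<close> for \<open>x\<close> of degree \<open>i\<close>, where
  the brackets are graded commutators.
\<close>

lemma (in dg_algebra) dg_ideal_commutators: "dg_ideal A (genideal A (graded_commutators A))"
proof (rule dg_ideal_genideal)
  let ?G = "graded_commutators A"
  have deg: "(x \<otimes> y) \<ominus> (ksign (i * j) \<odot> (y \<otimes> x)) \<in> gr A (i + j)" if "x \<in> gr A i" "y \<in> gr A j" for x y i j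
    using mult_degree[OF that] mult_degree[OF that(2,1)] by (simp add: gr_diff gr_smult add.commute)
  show G: "\<exists>i. g \<in> gr A i" if "g \<in> ?G" for g
    using that deg unfolding graded_commutators_def by blast
  then have Gc: "?G \<subseteq> carrier A" using gr_closed by blast
  interpret I: ideal "genideal A ?G" A by (rule genideal_ideal[OF Gc])
  fix g assume "g \<in> ?G"
  then obtain i j x y where g: "x \<in> gr A i" "y \<in> gr A j" "g = (x \<otimes> y) \<ominus> (ksign (i * j) \<odot> (y \<otimes> x))"
    by (auto simp: graded_commutators_def)
  have c [simp]: "x \<in> carrier A" "y \<in> carrier A" using g gr_closed by blast+
  let ?a = "(dif A x \<otimes> y) \<ominus> (ksign ((i - 1) * j) \<odot> (y \<otimes> dif A x))"
  let ?b = "(x \<otimes> dif A y) \<ominus> (ksign (i * (j - 1)) \<odot> (dif A y \<otimes> x))"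
  have "?a \<in> ?G" "?b \<in> ?G"
    using g dif_degree unfolding graded_commutators_def by blast+
  then have ab: "?a \<in> genideal A ?G" "?b \<in> genideal A ?G"
    using genideal_self[OF Gc] by blast+
  have s: "ksign ((i - 1) * j) = (ksign (i * j) * ksign j :: 'k)"
    "ksign (i * (j - 1)) = (ksign (i * j) * ksign i :: 'k)"
    "ksign (j * (i - 1)) = (ksign (i * j) * ksign j :: 'k)"
    "ksign ((j - 1) * i) = (ksign (i * j) * ksign i :: 'k)"
    by (simp_all add: algebra_simps ksign_add)
  have "dif A g = ((dif A x \<otimes> y) \<oplus> (ksign i \<odot> (x \<otimes> dif A y))) \<ominus>
      (ksign (i * j) \<odot> ((dif A y \<otimes> x) \<oplus> (ksign j \<odot> (y \<otimes> dif A x))))"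
    using g(1,2) by (simp add: g(3) kdiff dif_add dif_smult leibniz)
  also have "\<dots> = ?a \<oplus> ksign i \<odot> ?b"
    by (simp add: kdiff s ksmult_r_add ksmult_assoc a_ac mult_ac)
  also have "\<dots> = ?a \<oplus> (ksign i \<odot> \<one>) \<otimes> ?b"
    by (simp add: smult_mult_l)
  finally show "dif A g \<in> genideal A ?G"
    using ab by (simp add: I.I_l_closed)
next
  show "dif A (dif A x) \<in> genideal A (graded_commutators A)" if "x \<in> gr A i" for x i
  proof -
    have "graded_commutators A \<subseteq> carrier A"
      using gr_closed by (auto simp: graded_commutators_def)
    then interpret I: ideal "genideal A (graded_commutators A)" A by (rule genideal_ideal)
    show ?thesis using dif_dif gr_closed[OF that] by simp
  qed
qed (use gr_closed in \<open>auto simp: leibniz\<close>)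

lemma (in dg_algebra) abelianization_cdg_algebra: "cdg_algebra (abelianization A)"
proof -
  interpret dg_ideal A "genideal A (graded_commutators A)" by (rule dg_ideal_commutators)
  have Gc: "graded_commutators A \<subseteq> carrier A"
    using gr_closed by (auto simp: graded_commutators_def)
  show ?thesis
    unfolding abelianization_def
  proof (intro cdg_algebra.intro cdg_algebra_axioms.intro quot_dg_algebra)
    fix U W i j assume "U \<in> gr Q i" "W \<in> gr Q j"
    then obtain x y where xy: "x \<in> gr A i" "y \<in> gr A j"
      "U = genideal A (graded_commutators A) +> x" "W = genideal A (graded_commutators A) +> y"
      by (auto simp: quot_gr)
    have c: "x \<in> carrier A" "y \<in> carrier A" using xy gr_closed by blast+
    have "(x \<otimes> y) \<ominus> (ksign (i * j) \<odot> (y \<otimes> x)) \<in> graded_commutators A"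
      using xy unfolding graded_commutators_def by blast
    then have "(x \<otimes> y) \<ominus> (ksign (i * j) \<odot> (y \<otimes> x)) \<in> genideal A (graded_commutators A)"
      using genideal_self[OF Gc] by blast
    then show "U \<otimes>\<^bsub>Q\<^esub> W = ksign (i * j) \<odot>\<^bsub>Q\<^esub> (W \<otimes>\<^bsub>Q\<^esub> U)"
      using c by (simp add: xy(3,4) q coset_eq_iff[OF sub])
  qed
qed

text \<open>
  The kernel of a morphism to a commutative algebra is an ideal that contains all graded commutators.
\<close>

lemma (in dg_algebra) dga_hom_abelianization:
  assumes "h \<in> dga_hom A C" "cdg_algebra C"
  obtains f where "f \<in> dga_hom (abelianization A) C"
    "\<And>x. x \<in> carrier A \<Longrightarrow> f (genideal A (graded_commutators A) +> x) = h x"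
proof -
  interpret C: cdg_algebra C by fact
  interpret dg_ideal A "genideal A (graded_commutators A)" by (rule dg_ideal_commutators)
  note h = dga_homD[OF assms(1)]
  have K: "submodule {x \<in> carrier A. h x \<in> {\<zero>\<^bsub>C\<^esub>}} ground A"
    by (rule klin_preimage_submodule[OF h(1) kmodule C.kmodule]) (rule C.ksubmoduleI; simp)
  have "ideal {x \<in> carrier A. h x \<in> {\<zero>\<^bsub>C\<^esub>}} A"
    using K h(4,7) unfolding submodule_def by (intro idealI) (auto simp: ring_axioms)
  moreover have "graded_commutators A \<subseteq> {x \<in> carrier A. h x \<in> {\<zero>\<^bsub>C\<^esub>}}"
  proof
    fix g assume "g \<in> graded_commutators A"
    then obtain i j x y where g: "x \<in> gr A i" "y \<in> gr A j" "g = (x \<otimes> y) \<ominus> (ksign (i * j) \<odot> (y \<otimes> x))"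
      by (auto simp: graded_commutators_def)
    have c: "x \<in> carrier A" "y \<in> carrier A" using g gr_closed by blast+
    have "h g = (h x \<otimes>\<^bsub>C\<^esub> h y) \<ominus>\<^bsub>C\<^esub> (ksign (i * j) \<odot>\<^bsub>C\<^esub> (h y \<otimes>\<^bsub>C\<^esub> h x))"
      using c by (simp add: g(3) klin_diff[OF h(1) kmodule C.kmodule] h(4) klinD(3)[OF h(1)])
    also have "\<dots> = \<zero>\<^bsub>C\<^esub>"
      using C.graded_comm[OF h(5)[OF g(1)] h(5)[OF g(2)]] h(7) c by (simp add: C.kdiff C.kcancel)
    finally show "g \<in> {x \<in> carrier A. h x \<in> {\<zero>\<^bsub>C\<^esub>}}"
      using c by (simp add: g(3))
  qed
  ultimately have "genideal A (graded_commutators A) \<subseteq> {x \<in> carrier A. h x \<in> {\<zero>\<^bsub>C\<^esub>}}"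
    by (rule genideal_minimal)
  then obtain f where "f \<in> dga_hom Q C" "\<And>x. x \<in> carrier A \<Longrightarrow> f (genideal A (graded_commutators A) +> x) = h x"
    using dga_hom_quot[OF assms(1) C.predg_algebra] by blast
  then show thesis by (intro that) (simp_all add: abelianization_def)
qed

section \<open>Twisted monoid algebras\<close>

lemma free_vecI: "\<lbrakk>finite {x. f x \<noteq> 0}; \<And>x. f x \<noteq> 0 \<Longrightarrow> x \<in> Q\<rbrakk> \<Longrightarrow> f \<in> free_vec Q"
  by (auto simp: free_vec_def)

lemma free_vecD: "f \<in> free_vec Q \<Longrightarrow> finite {x. f x \<noteq> 0}" "\<lbrakk>f \<in> free_vec Q; f x \<noteq> 0\<rbrakk> \<Longrightarrow> x \<in> Q"
  by (auto simp: free_vec_def)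

lemma free_vec_mono: "Q \<subseteq> Q' \<Longrightarrow> free_vec Q \<subseteq> free_vec Q'"
  by (auto simp: free_vec_def)

lemma bvec_free [simp]: "x \<in> Q \<Longrightarrow> bvec x \<in> free_vec Q"
  by (auto simp: free_vec_def bvec_def intro: finite_subset[of _ "{x}"] split: if_splits)

lemma free_vec_add: "\<lbrakk>f \<in> free_vec Q; g \<in> free_vec Q\<rbrakk> \<Longrightarrow> (\<lambda>z. f z + g z) \<in> free_vec Q"
proof (rule free_vecI)
  assume f: "f \<in> free_vec Q" and g: "g \<in> free_vec Q"
  show "finite {x. f x + g x \<noteq> 0}"
    by (rule finite_subset[of _ "{x. f x \<noteq> 0} \<union> {x. g x \<noteq> 0}"]) (use free_vecD(1) f g in auto)
  show "x \<in> Q" if "f x + g x \<noteq> 0" for x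
    using that free_vecD(2)[OF f, of x] free_vecD(2)[OF g, of x] by (cases "f x = 0") auto
qed

lemma free_vec_smult: "f \<in> free_vec Q \<Longrightarrow> (\<lambda>z. r * f z) \<in> free_vec Q"
  by (rule free_vecI) (auto dest: free_vecD intro: finite_subset[of _ "{x. f x \<noteq> 0}"])

lemma free_vec_zero: "(\<lambda>z. 0) \<in> free_vec Q"
  by (simp add: free_vec_def)

lemma free_vec_induct [consumes 1, case_names zero add]:
  assumes "f \<in> free_vec Q" "P (\<lambda>z. 0)"
    and step: "\<And>r x f. \<lbrakk>x \<in> Q; f \<in> free_vec Q; P f\<rbrakk> \<Longrightarrow> P (\<lambda>z. r * bvec x z + f z)"
  shows "P f"
proof -
  have "P f" if "finite S" "{x. f x \<noteq> 0} = S" "f \<in> free_vec Q" for S f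
    using that
  proof (induction S arbitrary: f)
    case empty
    then have "f = (\<lambda>z. 0)" by auto
    then show ?case using assms(2) by simp
  next
    case (insert x S)
    let ?g = "f(x := 0)"
    have S: "{z. ?g z \<noteq> 0} = S" using insert.hyps insert.prems(1) by auto
    have g: "?g \<in> free_vec Q"
      using insert.prems(2) insert.hyps(1) S by (intro free_vecI) (auto dest: free_vecD split: if_splits)
    have "x \<in> Q" using insert.prems free_vecD(2)[of f Q x] by blast
    then have "P (\<lambda>z. f x * bvec x z + ?g z)"
      using insert.IH[OF S g] g by (intro step)
    moreover have "(\<lambda>z. f x * bvec x z + ?g z) = f" by (auto simp: bvec_def)
    ultimately show ?case by simp
  qed
  then show ?thesis using assms(1) free_vecD(1) by blast
qed

lemma lin_ext_sum:
  assumes "finite S" "{x. f x \<noteq> 0} \<subseteq> S"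
  shows "lin_ext \<phi> f y = (\<Sum>x\<in>S. f x * \<phi> x y)"
  unfolding lin_ext_def using assms by (intro sum.mono_neutral_left) auto

lemma lin_ext_bvec [simp]: "lin_ext \<phi> (bvec x) = \<phi> x"
  by (rule ext) (subst lin_ext_sum[of "{x}"]; simp add: bvec_def)

lemma lin_ext_zero [simp]: "lin_ext \<phi> (\<lambda>z. 0) = (\<lambda>y. 0)"
  by (simp add: lin_ext_def)

lemma lin_ext_add:
  assumes "f \<in> free_vec Q" "g \<in> free_vec Q"
  shows "lin_ext \<phi> (\<lambda>z. f z + g z) = (\<lambda>y. lin_ext \<phi> f y + lin_ext \<phi> g y)"
proof
  fix y
  let ?S = "{x. f x \<noteq> 0} \<union> {x. g x \<noteq> 0}"
  have "finite ?S" using assms free_vecD by blast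
  then show "lin_ext \<phi> (\<lambda>z. f z + g z) y = lin_ext \<phi> f y + lin_ext \<phi> g y"
    by (subst (1 2 3) lin_ext_sum[of ?S]) (auto simp: sum.distrib distrib_right)
qed

lemma lin_ext_smult:
  assumes "f \<in> free_vec Q"
  shows "lin_ext \<phi> (\<lambda>z. r * f z) = (\<lambda>y. r * lin_ext \<phi> f y)"
proof
  fix y
  show "lin_ext \<phi> (\<lambda>z. r * f z) y = r * lin_ext \<phi> f y"
    using free_vecD(1)[OF assms] by (subst (1 2) lin_ext_sum[of "{x. f x \<noteq> 0}"])
      (auto simp: sum_distrib_left mult.assoc)
qed

lemma lin_ext_free:
  assumes "f \<in> free_vec Q" "\<And>x. x \<in> Q \<Longrightarrow> \<phi> x \<in> free_vec Q'"
  shows "lin_ext \<phi> f \<in> free_vec Q'"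
  using assms(1)
proof (induction f rule: free_vec_induct)
  case (add r x f)
  then show ?case
    using assms(2) lin_ext_add[of "\<lambda>z. r * bvec x z" Q f \<phi>] lin_ext_smult[of "bvec x" Q \<phi> r]
    by (simp add: free_vec_smult free_vec_add)
qed (simp add: free_vec_zero)

text \<open>
  The monoid algebra of \<open>(Q, m, e)\<close> twisted by \<open>\<sigma>\<close>: basis vectors multiply by
  \<open>x \<cdot> y = \<sigma> x y (m x y)\<close>. The free vector space behind the tensor product is of this form, with the
  Koszul sign as \<open>\<sigma>\<close>, and so is the free algebra on a set of letters, with words as monoid and \<open>\<sigma> = 1\<close>.
\<close>

definition twisted_alg ::
  "'x set \<Rightarrow> ('x \<Rightarrow> int) \<Rightarrow> ('x \<Rightarrow> 'x \<Rightarrow> 'k::field_char_0) \<Rightarrow> ('x \<Rightarrow> 'x \<Rightarrow> 'x) \<Rightarrow> 'x \<Rightarrow>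
   ('x \<Rightarrow> 'x \<Rightarrow> 'k) \<Rightarrow> ('k, 'x \<Rightarrow> 'k) dg"
  where "twisted_alg Q \<delta> \<sigma> m e D =
    \<lparr>carrier = free_vec Q,
     monoid.mult = bilin_ext (\<lambda>x y z. \<sigma> x y * bvec (m x y) z),
     one = bvec e,
     ring.zero = (\<lambda>z. 0),
     add = (\<lambda>f g z. f z + g z),
     module.smult = (\<lambda>r f z. r * f z),
     gr = (\<lambda>n. free_vec {x \<in> Q. \<delta> x = n}),
     dif = lin_ext D\<rparr>"

text \<open>
  The cocycle identity is associativity of the twisted product. On \<open>D\<close>, which extends linearly to the
  differential, there is only a condition on degrees.
\<close>

locale twisted_monoid =
  fixes Q :: "'x set" and \<delta> :: "'x \<Rightarrow> int" and \<sigma> :: "'x \<Rightarrow> 'x \<Rightarrow> 'k::field_char_0"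
    and m :: "'x \<Rightarrow> 'x \<Rightarrow> 'x" and e :: 'x and D :: "'x \<Rightarrow> 'x \<Rightarrow> 'k"
  assumes m_closed: "\<lbrakk>x \<in> Q; y \<in> Q\<rbrakk> \<Longrightarrow> m x y \<in> Q" and e_closed: "e \<in> Q"
    and m_assoc: "\<lbrakk>x \<in> Q; y \<in> Q; z \<in> Q\<rbrakk> \<Longrightarrow> m (m x y) z = m x (m y z)"
    and \<sigma>_cocycle: "\<lbrakk>x \<in> Q; y \<in> Q; z \<in> Q\<rbrakk> \<Longrightarrow> \<sigma> x y * \<sigma> (m x y) z = \<sigma> y z * \<sigma> x (m y z)"
    and m_e: "x \<in> Q \<Longrightarrow> m e x = x" "x \<in> Q \<Longrightarrow> m x e = x"
    and \<sigma>_e: "x \<in> Q \<Longrightarrow> \<sigma> e x = 1" "x \<in> Q \<Longrightarrow> \<sigma> x e = 1"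
    and \<delta>_m: "\<lbrakk>x \<in> Q; y \<in> Q\<rbrakk> \<Longrightarrow> \<delta> (m x y) = \<delta> x + \<delta> y" and \<delta>_e: "\<delta> e = 0"
    and D_degree: "x \<in> Q \<Longrightarrow> D x \<in> free_vec {y \<in> Q. \<delta> y = \<delta> x - 1}"
begin

abbreviation T where "T \<equiv> twisted_alg Q \<delta> \<sigma> m e D"

lemma T_simps:
  "carrier T = free_vec Q" "\<one>\<^bsub>T\<^esub> = bvec e" "\<zero>\<^bsub>T\<^esub> = (\<lambda>z. 0)" "f \<oplus>\<^bsub>T\<^esub> g = (\<lambda>z. f z + g z)"
  "r \<odot>\<^bsub>T\<^esub> f = (\<lambda>z. r * f z)" "gr T n = free_vec {x \<in> Q. \<delta> x = n}" "dif T = lin_ext D"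
  "f \<otimes>\<^bsub>T\<^esub> g = lin_ext (\<lambda>x. lin_ext (\<lambda>y z. \<sigma> x y * bvec (m x y) z) g) f"
  by (simp_all add: twisted_alg_def bilin_ext_def)

lemma T_kmodule: "kmodule T"
proof (rule kmoduleI)
  show "abelian_group T"
  proof (rule abelian_groupI)
    fix f assume "f \<in> carrier T"
    then show "\<exists>g\<in>carrier T. g \<oplus>\<^bsub>T\<^esub> f = \<zero>\<^bsub>T\<^esub>"
      using free_vec_smult[of f Q "-1"] by (intro bexI[of _ "\<lambda>z. - 1 * f z"]) (auto simp: T_simps)
  qed (auto simp: T_simps free_vec_add free_vec_zero add_ac)
qed (auto simp: T_simps free_vec_smult distrib_left distrib_right mult.assoc)

interpretation T: kmodule T by (rule T_kmodule)

lemma bvec_closed [simp]: "x \<in> Q \<Longrightarrow> bvec x \<in> carrier T"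
  by (simp add: T_simps)

lemma free_vec_subset_submodule:
  assumes "submodule H ground T" "\<And>x. x \<in> Q' \<Longrightarrow> bvec x \<in> H" "f \<in> free_vec Q'"
  shows "f \<in> H"
  using assms(3)
proof (induction f rule: free_vec_induct)
  case zero
  show ?case using T.ksubmoduleD(3)[OF assms(1)] by (simp add: T_simps)
next
  case (add r x f)
  have "r \<odot>\<^bsub>T\<^esub> bvec x \<oplus>\<^bsub>T\<^esub> f \<in> H"
    using T.ksubmoduleD[OF assms(1)] assms(2) add by simp
  then show ?case by (simp add: T_simps)
qed

text \<open>
  Identities in \<open>T\<close> are checked on basis vectors. The version with a submodule \<open>H\<close> instead of equality also
  yields identities modulo an ideal; the version with a subset \<open>Q'\<close> applies to the basis of one degree.
\<close>

lemma klin_bvec_mem: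
  assumes "klin T N F" "kmodule N" "submodule H ground N" "Q' \<subseteq> Q" "\<And>x. x \<in> Q' \<Longrightarrow> F (bvec x) \<in> H"
    "f \<in> free_vec Q'"
  shows "F f \<in> H"
proof -
  have "f \<in> {x \<in> carrier T. F x \<in> H}"
    by (rule free_vec_subset_submodule[OF klin_preimage_submodule[OF assms(1) T_kmodule assms(2,3)] _ assms(6)])
      (use assms(4,5) in auto)
  then show ?thesis by simp
qed

lemma klin_bvec_eq:
  assumes "klin T N F" "klin T N G" "kmodule N" "\<And>x. x \<in> Q \<Longrightarrow> F (bvec x) = G (bvec x)" "f \<in> carrier T"
  shows "F f = G f"
proof -
  interpret N: kmodule N by fact
  have "submodule {\<zero>\<^bsub>N\<^esub>} ground N" by (rule N.ksubmoduleI) auto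
  then have "F f \<ominus>\<^bsub>N\<^esub> G f \<in> {\<zero>\<^bsub>N\<^esub>}"
    by (rule klin_bvec_mem[OF klin_minus[OF assms(1-3)] assms(3) _ subset_refl])
      (use assms klinD(1)[OF assms(2)] in \<open>auto simp: N.kdiff_zero_iff T_simps\<close>)
  then show ?thesis
    using klinD(1)[OF assms(1,5)] klinD(1)[OF assms(2,5)] by (simp add: N.kdiff_zero_iff)
qed

lemma lin_ext_klin: "\<lbrakk>\<And>x. x \<in> Q \<Longrightarrow> \<phi> x \<in> free_vec Q\<rbrakk> \<Longrightarrow> klin T T (lin_ext \<phi>)"
  by (rule klinI) (auto simp: T_simps lin_ext_free lin_ext_add lin_ext_smult)

lemma mult_bvec:
  assumes "x \<in> Q" "y \<in> Q"
  shows "bvec x \<otimes>\<^bsub>T\<^esub> bvec y = \<sigma> x y \<odot>\<^bsub>T\<^esub> bvec (m x y)"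
  by (simp add: T_simps)

lemma term_free: "\<lbrakk>x \<in> Q; g \<in> free_vec Q\<rbrakk> \<Longrightarrow> lin_ext (\<lambda>y z. \<sigma> x y * bvec (m x y) z) g \<in> free_vec Q"
  by (rule lin_ext_free, assumption) (simp add: free_vec_smult m_closed)

lemma mult_lin_l:
  assumes "g \<in> carrier T"
  shows "klin T T (\<lambda>f. f \<otimes>\<^bsub>T\<^esub> g)"
  using lin_ext_klin[of "\<lambda>x. lin_ext (\<lambda>y z. \<sigma> x y * bvec (m x y) z) g"] term_free assms
  by (simp add: T_simps)

lemma mult_lin_r:
  assumes "f \<in> carrier T"
  shows "klin T T (\<lambda>g. f \<otimes>\<^bsub>T\<^esub> g)"
proof (rule klinI)
  show c: "f \<otimes>\<^bsub>T\<^esub> g \<in> carrier T" if "g \<in> carrier T" for g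
    using klinD(1)[OF mult_lin_l[OF that] assms] .
  note add = lin_ext_add[of _ Q] and sm = lin_ext_smult[of _ Q]
  fix g h r assume g: "g \<in> carrier T" and h: "h \<in> carrier T"
  show "f \<otimes>\<^bsub>T\<^esub> (g \<oplus>\<^bsub>T\<^esub> h) = f \<otimes>\<^bsub>T\<^esub> g \<oplus>\<^bsub>T\<^esub> f \<otimes>\<^bsub>T\<^esub> h"
  proof (rule klin_bvec_eq[OF mult_lin_l klin_plus[OF mult_lin_l mult_lin_l T_kmodule] T_kmodule _ assms])
    show "bvec x \<otimes>\<^bsub>T\<^esub> (g \<oplus>\<^bsub>T\<^esub> h) = bvec x \<otimes>\<^bsub>T\<^esub> g \<oplus>\<^bsub>T\<^esub> bvec x \<otimes>\<^bsub>T\<^esub> h" if "x \<in> Q" for x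
      using g h by (simp add: T_simps add)
  qed (use g h in auto)
  show "f \<otimes>\<^bsub>T\<^esub> (r \<odot>\<^bsub>T\<^esub> g) = r \<odot>\<^bsub>T\<^esub> (f \<otimes>\<^bsub>T\<^esub> g)"
  proof (rule klin_bvec_eq[OF mult_lin_l klin_scale[OF mult_lin_l T_kmodule] T_kmodule _ assms])
    show "bvec x \<otimes>\<^bsub>T\<^esub> (r \<odot>\<^bsub>T\<^esub> g) = r \<odot>\<^bsub>T\<^esub> (bvec x \<otimes>\<^bsub>T\<^esub> g)" if "x \<in> Q" for x
      using g by (simp add: T_simps sm)
  qed (use g in auto)
qed

lemma mult_closed: "\<lbrakk>f \<in> carrier T; g \<in> carrier T\<rbrakk> \<Longrightarrow> f \<otimes>\<^bsub>T\<^esub> g \<in> carrier T"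
  by (rule klinD(1)[OF mult_lin_l])

text \<open>
  Associativity on basis vectors is extended linearly in one argument at a time.
\<close>

lemma mult_assoc:
  assumes f: "f \<in> carrier T" and g: "g \<in> carrier T" and h: "h \<in> carrier T"
  shows "(f \<otimes>\<^bsub>T\<^esub> g) \<otimes>\<^bsub>T\<^esub> h = f \<otimes>\<^bsub>T\<^esub> (g \<otimes>\<^bsub>T\<^esub> h)"
proof -
  note l = mult_lin_l and r = mult_lin_r and c = bvec_closed
  have 1: "(bvec x \<otimes>\<^bsub>T\<^esub> bvec y) \<otimes>\<^bsub>T\<^esub> bvec z = bvec x \<otimes>\<^bsub>T\<^esub> (bvec y \<otimes>\<^bsub>T\<^esub> bvec z)"
    if "x \<in> Q" "y \<in> Q" "z \<in> Q" for x y z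
    using that klinD(3)[OF l[of "bvec z"], of "bvec (m x y)" "\<sigma> x y"]
      klinD(3)[OF r[of "bvec x"], of "bvec (m y z)" "\<sigma> y z"]
    by (simp add: mult_bvec m_closed T.ksmult_assoc m_assoc \<sigma>_cocycle)
  have 2: "(bvec x \<otimes>\<^bsub>T\<^esub> bvec y) \<otimes>\<^bsub>T\<^esub> h = bvec x \<otimes>\<^bsub>T\<^esub> (bvec y \<otimes>\<^bsub>T\<^esub> h)" if xy: "x \<in> Q" "y \<in> Q" for x y
    by (rule klin_bvec_eq[OF r[OF mult_closed[OF c c]] klin_comp[OF r[OF c] r[OF c]] T_kmodule 1 h])
      (simp_all add: xy)
  have 3: "(bvec x \<otimes>\<^bsub>T\<^esub> g) \<otimes>\<^bsub>T\<^esub> h = bvec x \<otimes>\<^bsub>T\<^esub> (g \<otimes>\<^bsub>T\<^esub> h)" if x: "x \<in> Q" for x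
    by (rule klin_bvec_eq[OF klin_comp[OF r[OF c] l[OF h]] klin_comp[OF l[OF h] r[OF c]] T_kmodule 2 g])
      (simp_all add: x)
  show ?thesis
    by (rule klin_bvec_eq[OF klin_comp[OF l[OF g] l[OF h]] l[OF mult_closed[OF g h]] T_kmodule 3 f])
qed

lemma id_klin: "klin T T (\<lambda>x. x)"
  by (rule klinI) auto

lemma mult_e:
  assumes f: "f \<in> carrier T"
  shows "bvec e \<otimes>\<^bsub>T\<^esub> f = f" "f \<otimes>\<^bsub>T\<^esub> bvec e = f"
proof -
  have "\<And>x. x \<in> Q \<Longrightarrow> bvec e \<otimes>\<^bsub>T\<^esub> bvec x = bvec x" "\<And>x. x \<in> Q \<Longrightarrow> bvec x \<otimes>\<^bsub>T\<^esub> bvec e = bvec x"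
    by (simp_all add: mult_bvec e_closed m_e \<sigma>_e)
  then show "bvec e \<otimes>\<^bsub>T\<^esub> f = f" "f \<otimes>\<^bsub>T\<^esub> bvec e = f"
    using klin_bvec_eq[OF mult_lin_r id_klin T_kmodule _ f] klin_bvec_eq[OF mult_lin_l id_klin T_kmodule _ f]
      e_closed by simp_all
qed

lemma T_ring: "ring T"
proof (rule ringI)
  show "abelian_group T" using T_kmodule by (simp add: kmodule_def module_def)
  have "\<one>\<^bsub>T\<^esub> = bvec e" by (simp add: T_simps)
  then show "monoid T"
    by (intro monoidI) (auto simp: mult_closed e_closed mult_assoc mult_e)
qed (simp_all add: klinD(2)[OF mult_lin_l] klinD(2)[OF mult_lin_r])

lemma T_gr_module: "gr_module T"
proof (rule gr_moduleI[OF T_kmodule])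
  show "submodule (gr T i) ground T" for i
    by (rule T.ksubmoduleI)
      (use free_vec_mono[of "{x \<in> Q. \<delta> x = i}" Q] in
        \<open>auto simp: T_simps free_vec_add free_vec_smult free_vec_zero\<close>)
  have "f \<in> hsums T" if "f \<in> free_vec Q" for f
    using that
  proof (induction f rule: free_vec_induct)
    case zero
    show ?case using hsums.zero[of T] by (simp add: T_simps)
  next
    case (add r x f)
    then have "(\<lambda>z. r * bvec x z) \<oplus>\<^bsub>T\<^esub> f \<in> hsums T"
      by (intro hsums.add[of _ _ "\<delta> x"]) (simp_all add: T_simps free_vec_smult)
    then show ?case by (simp add: T_simps)
  qed
  then show "carrier T \<subseteq> hsums T" by (auto simp: T_simps)
  fix J c assume J: "finite J" and c: "\<And>i. c i \<in> gr T i" and z: "(\<Oplus>\<^bsub>T\<^esub>i\<in>J. c i) = \<zero>\<^bsub>T\<^esub>"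
  have cc: "c i \<in> carrier T" for i
    using c[of i] free_vec_mono[of "{x \<in> Q. \<delta> x = i}" Q] by (auto simp: T_simps)
  have pt: "(\<Oplus>\<^bsub>T\<^esub>i\<in>J'. c i) x = (\<Sum>i\<in>J'. c i x)" if "finite J'" for J' x
    using that by induction (auto simp: T.M.finsum_insert cc Pi_def T_simps(3,4))
  show "\<forall>i\<in>J. c i = \<zero>\<^bsub>T\<^esub>"
  proof
    fix i assume i: "i \<in> J"
    have "c i x = 0" for x
    proof (rule ccontr)
      assume n: "c i x \<noteq> 0"
      then have d: "\<delta> x = i" using c[of i] by (auto simp: T_simps free_vec_def)
      have "c j x = 0" if "j \<noteq> i" for j
        using c[of j] that d by (auto simp: T_simps free_vec_def)
      then have "(\<Sum>j\<in>J. c j x) = c i x"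
        using J i by (subst sum.mono_neutral_right[of J "{i}"]) auto
      then show False using pt[OF J, of x] z n by (simp add: T_simps)
    qed
    then show "c i = \<zero>\<^bsub>T\<^esub>" by (auto simp: T_simps)
  qed
qed

lemma bvec_gr: "x \<in> Q \<Longrightarrow> bvec x \<in> gr T (\<delta> x)"
  by (simp add: T_simps)

lemma dif_bvec: "dif T (bvec x) = D x"
  by (simp add: T_simps)

lemma T_dif_klin: "klin T T (dif T)"
  using lin_ext_klin[of D] D_degree free_vec_mono[of "{y \<in> Q. _ y}" Q] by (force simp: T_simps(7))

lemma T_predg_algebra: "predg_algebra T"
proof (intro predg_algebra.intro gr_algebra.intro gr_algebra_axioms.intro predg_algebra_axioms.intro
    T_gr_module T_ring T_dif_klin)
  interpret TG: gr_module T by (rule T_gr_module)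
  note sub = TG.gr_submodule
  fix f g i j
  show "r \<odot>\<^bsub>T\<^esub> f \<otimes>\<^bsub>T\<^esub> g = r \<odot>\<^bsub>T\<^esub> (f \<otimes>\<^bsub>T\<^esub> g)" "f \<otimes>\<^bsub>T\<^esub> (r \<odot>\<^bsub>T\<^esub> g) = r \<odot>\<^bsub>T\<^esub> (f \<otimes>\<^bsub>T\<^esub> g)"
    if "f \<in> carrier T" "g \<in> carrier T" for r
    using that klinD(3)[OF mult_lin_l] klinD(3)[OF mult_lin_r] by simp_all
  show "\<one>\<^bsub>T\<^esub> \<in> gr T 0" using e_closed by (simp add: T_simps \<delta>_e)
  show "dif T f \<in> gr T (i - 1)" if "f \<in> gr T i"
    by (rule klin_bvec_mem[OF T_dif_klin T_kmodule sub, where Q' = "{x \<in> Q. \<delta> x = i}"])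
      (use that D_degree in \<open>auto simp: T_simps\<close>)
  assume f: "f \<in> gr T i" and g: "g \<in> gr T j"
  have gc: "g \<in> carrier T" using g by (rule TG.gr_closed)
  have 1: "bvec x \<otimes>\<^bsub>T\<^esub> g \<in> gr T (i + j)" if x: "x \<in> {x \<in> Q. \<delta> x = i}" for x
  proof (rule klin_bvec_mem[where Q' = "{x \<in> Q. \<delta> x = j}" and f = g, OF mult_lin_r T_kmodule sub])
    show "bvec x \<in> carrier T" using x by simp
  qed (use x g in \<open>auto simp: mult_bvec T_simps m_closed \<delta>_m free_vec_smult\<close>)
  show "f \<otimes>\<^bsub>T\<^esub> g \<in> gr T (i + j)"
    by (rule klin_bvec_mem[where Q' = "{x \<in> Q. \<delta> x = i}" and f = f, OF mult_lin_l[OF gc] T_kmodule sub _ 1])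
      (use f in \<open>auto simp: T_simps(6)\<close>)
qed

sublocale T: predg_algebra T by (rule T_predg_algebra)

lemma dif_dif_mem:
  assumes "submodule I ground T" "\<And>x. x \<in> Q \<Longrightarrow> dif T (D x) \<in> I" "f \<in> carrier T"
  shows "dif T (dif T f) \<in> I"
  by (rule klin_bvec_mem[OF klin_comp[OF T_dif_klin T_dif_klin] T_kmodule assms(1) subset_refl])
    (use assms in \<open>auto simp: dif_bvec T_simps(1)\<close>)

text \<open>
  The defect of the Leibniz rule is linear in \<open>f\<close> only for a fixed sign, that is, on a fixed degree; hence
  \<open>f\<close> runs through the basis vectors of degree \<open>i\<close>.
\<close>

lemma leibniz_mem:
  assumes I: "submodule I ground T"
    and b: "\<And>x y. \<lbrakk>x \<in> Q; y \<in> Q\<rbrakk> \<Longrightarrow> dif T (bvec x \<otimes>\<^bsub>T\<^esub> bvec y) \<ominus>\<^bsub>T\<^esub>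
      ((D x \<otimes>\<^bsub>T\<^esub> bvec y) \<oplus>\<^bsub>T\<^esub> (ksign (\<delta> x) \<odot>\<^bsub>T\<^esub> (bvec x \<otimes>\<^bsub>T\<^esub> D y))) \<in> I"
    and f: "f \<in> gr T i" and g: "g \<in> carrier T"
  shows "dif T (f \<otimes>\<^bsub>T\<^esub> g) \<ominus>\<^bsub>T\<^esub> ((dif T f \<otimes>\<^bsub>T\<^esub> g) \<oplus>\<^bsub>T\<^esub> (ksign i \<odot>\<^bsub>T\<^esub> (f \<otimes>\<^bsub>T\<^esub> dif T g))) \<in> I"
proof -
  have dc: "dif T f \<in> carrier T" if "f \<in> carrier T" for f
    using T_dif_klin that by (rule klinD(1))
  have 1: "dif T (bvec x \<otimes>\<^bsub>T\<^esub> g) \<ominus>\<^bsub>T\<^esub> ((dif T (bvec x) \<otimes>\<^bsub>T\<^esub> g) \<oplus>\<^bsub>T\<^esub> (ksign i \<odot>\<^bsub>T\<^esub> (bvec x \<otimes>\<^bsub>T\<^esub> dif T g))) \<in> I"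
    if x: "x \<in> {x \<in> Q. \<delta> x = i}" for x
  proof -
    have xc: "bvec x \<in> carrier T" "dif T (bvec x) \<in> carrier T"
      using x dc[of "bvec x"] by simp_all
    have "klin T T (\<lambda>g. dif T (bvec x \<otimes>\<^bsub>T\<^esub> g) \<ominus>\<^bsub>T\<^esub>
        ((dif T (bvec x) \<otimes>\<^bsub>T\<^esub> g) \<oplus>\<^bsub>T\<^esub> (ksign i \<odot>\<^bsub>T\<^esub> (bvec x \<otimes>\<^bsub>T\<^esub> dif T g))))"
      by (rule klin_minus[OF klin_comp[OF mult_lin_r[OF xc(1)] T_dif_klin]
            klin_plus[OF mult_lin_r[OF xc(2)] klin_scale[OF klin_comp[OF T_dif_klin mult_lin_r[OF xc(1)]]]]])
        (rule T_kmodule)+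
    then show ?thesis
      by (rule klin_bvec_mem[OF _ T_kmodule I subset_refl])
        (use b x g in \<open>auto simp: dif_bvec T_simps(1)\<close>)
  qed
  have "klin T T (\<lambda>f. dif T (f \<otimes>\<^bsub>T\<^esub> g) \<ominus>\<^bsub>T\<^esub>
        ((dif T f \<otimes>\<^bsub>T\<^esub> g) \<oplus>\<^bsub>T\<^esub> (ksign i \<odot>\<^bsub>T\<^esub> (f \<otimes>\<^bsub>T\<^esub> dif T g))))"
    by (rule klin_minus[OF klin_comp[OF mult_lin_l[OF g] T_dif_klin]
          klin_plus[OF klin_comp[OF T_dif_klin mult_lin_l[OF g]] klin_scale[OF mult_lin_l[OF dc[OF g]]]]])
      (rule T_kmodule)+
  then show ?thesis
    by (rule klin_bvec_mem[where Q' = "{x \<in> Q. \<delta> x = i}" and f = f, OF _ T_kmodule I])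
      (use f 1 in \<open>auto simp: T_simps(6)\<close>)
qed

text \<open>
  Linear extension of a map on basis vectors with values in an arbitrary module, unlike \<open>lin_ext\<close>, whose
  values are functions. It is extensional so that it can be a morphism.
\<close>

definition fext :: "('k, 'b, 'n) dg_scheme \<Rightarrow> ('x \<Rightarrow> 'b) \<Rightarrow> ('x \<Rightarrow> 'k) \<Rightarrow> 'b"
  where "fext N \<phi> = (\<lambda>f\<in>carrier T. \<Oplus>\<^bsub>N\<^esub>x\<in>{x. f x \<noteq> 0}. f x \<odot>\<^bsub>N\<^esub> \<phi> x)"

context
  fixes N :: "('k, 'b, 'n) dg_scheme" and \<phi> :: "'x \<Rightarrow> 'b"
  assumes N: "kmodule N" and \<phi>: "\<And>x. x \<in> Q \<Longrightarrow> \<phi> x \<in> carrier N"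
begin

interpretation N: kmodule N by (rule N)

lemma fext_sum:
  assumes "f \<in> carrier T" "finite S" "{x. f x \<noteq> 0} \<subseteq> S" "S \<subseteq> Q"
  shows "fext N \<phi> f = (\<Oplus>\<^bsub>N\<^esub>x\<in>S. f x \<odot>\<^bsub>N\<^esub> \<phi> x)"
  unfolding fext_def restrict_apply'[OF assms(1)] using assms \<phi>
  by (intro N.M.add.finprod_mono_neutral_cong_left) auto

lemma fext_bvec: "x \<in> Q \<Longrightarrow> fext N \<phi> (bvec x) = \<phi> x"
proof -
  assume x: "x \<in> Q"
  have "fext N \<phi> (bvec x) = (\<Oplus>\<^bsub>N\<^esub>y\<in>{x}. bvec x y \<odot>\<^bsub>N\<^esub> \<phi> y)"
    by (rule fext_sum[OF bvec_closed[OF x]]) (use x in \<open>auto simp: bvec_def\<close>)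
  then show ?thesis using \<phi>[OF x] by (simp add: bvec_def N.M.finsum_insert)
qed

lemma fext_klin: "klin T N (fext N \<phi>)"
proof (rule klinI)
  fix f g r assume f: "f \<in> carrier T" and g: "g \<in> carrier T"
  define S where "S = {x. f x \<noteq> 0} \<union> {x. g x \<noteq> 0}"
  have S: "finite S" "S \<subseteq> Q"
    using f g by (auto simp: S_def T_simps free_vec_def)
  note sum = fext_sum[OF _ S(1) _ S(2)]
  have c: "\<And>r x. x \<in> S \<Longrightarrow> r \<odot>\<^bsub>N\<^esub> \<phi> x \<in> carrier N" using S \<phi> by blast
  have fg: "f \<oplus>\<^bsub>T\<^esub> g \<in> carrier T" "r \<odot>\<^bsub>T\<^esub> f \<in> carrier T"
    using f g by simp_all
  have "fext N \<phi> (f \<oplus>\<^bsub>T\<^esub> g) = (\<Oplus>\<^bsub>N\<^esub>x\<in>S. (f \<oplus>\<^bsub>T\<^esub> g) x \<odot>\<^bsub>N\<^esub> \<phi> x)"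
    by (rule sum[OF fg(1)]) (auto simp: S_def T_simps)
  also have "\<dots> = (\<Oplus>\<^bsub>N\<^esub>x\<in>S. f x \<odot>\<^bsub>N\<^esub> \<phi> x \<oplus>\<^bsub>N\<^esub> g x \<odot>\<^bsub>N\<^esub> \<phi> x)"
    using S \<phi> by (intro N.M.finsum_cong') (auto simp: T_simps N.ksmult_add subset_iff)
  also have "\<dots> = fext N \<phi> f \<oplus>\<^bsub>N\<^esub> fext N \<phi> g"
    using sum[OF f] sum[OF g] c by (simp add: S_def N.M.finsum_addf Pi_def)
  finally show "fext N \<phi> (f \<oplus>\<^bsub>T\<^esub> g) = fext N \<phi> f \<oplus>\<^bsub>N\<^esub> fext N \<phi> g" .
  have "fext N \<phi> (r \<odot>\<^bsub>T\<^esub> f) = (\<Oplus>\<^bsub>N\<^esub>x\<in>S. (r \<odot>\<^bsub>T\<^esub> f) x \<odot>\<^bsub>N\<^esub> \<phi> x)"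
    by (rule sum[OF fg(2)]) (auto simp: S_def T_simps)
  also have "\<dots> = (\<Oplus>\<^bsub>N\<^esub>x\<in>S. r \<odot>\<^bsub>N\<^esub> (f x \<odot>\<^bsub>N\<^esub> \<phi> x))"
    using S \<phi> by (intro N.M.finsum_cong') (auto simp: T_simps N.ksmult_assoc subset_iff)
  also have "\<dots> = r \<odot>\<^bsub>N\<^esub> fext N \<phi> f"
    using sum[OF f] c S N.finsum_smult_ldistr[of S r "\<lambda>x. f x \<odot>\<^bsub>N\<^esub> \<phi> x"] by (simp add: S_def Pi_def)
  finally show "fext N \<phi> (r \<odot>\<^bsub>T\<^esub> f) = r \<odot>\<^bsub>N\<^esub> fext N \<phi> f" .
next
  fix f assume "f \<in> carrier T"
  then show "fext N \<phi> f \<in> carrier N"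
    unfolding fext_def using \<phi> by (simp add: T_simps) (intro N.M.finsum_closed, auto simp: free_vec_def)
qed

end

lemma fext_dga_hom:
  assumes "predg_algebra P" and \<phi>: "\<And>x. x \<in> Q \<Longrightarrow> \<phi> x \<in> gr P (\<delta> x)" and one: "\<phi> e = \<one>\<^bsub>P\<^esub>"
    and mul: "\<And>x y. \<lbrakk>x \<in> Q; y \<in> Q\<rbrakk> \<Longrightarrow> \<phi> x \<otimes>\<^bsub>P\<^esub> \<phi> y = \<sigma> x y \<odot>\<^bsub>P\<^esub> \<phi> (m x y)"
    and dif: "\<And>x. x \<in> Q \<Longrightarrow> fext P \<phi> (D x) = dif P (\<phi> x)"
  shows "fext P \<phi> \<in> dga_hom T P"
proof -
  interpret P: predg_algebra P by fact
  have c: "\<And>x. x \<in> Q \<Longrightarrow> \<phi> x \<in> carrier P" using \<phi> P.gr_closed by blast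
  have lin: "klin T P (fext P \<phi>)" by (rule fext_klin[OF P.kmodule]) (rule c)
  have bv: "\<And>x. x \<in> Q \<Longrightarrow> fext P \<phi> (bvec x) = \<phi> x" by (rule fext_bvec[OF P.kmodule c])
  have 1: "fext P \<phi> (bvec x \<otimes>\<^bsub>T\<^esub> g) = fext P \<phi> (bvec x) \<otimes>\<^bsub>P\<^esub> fext P \<phi> g"
    if x: "x \<in> Q" and g: "g \<in> carrier T" for x g
  proof (rule klin_bvec_eq[OF klin_comp[OF mult_lin_r[OF bvec_closed[OF x]] lin]
        klin_comp[OF lin P.mult_klin_l] P.kmodule _ g])
    show "fext P \<phi> (bvec x) \<in> carrier P" using bv x c by simp
    show "fext P \<phi> (bvec x \<otimes>\<^bsub>T\<^esub> bvec y) = fext P \<phi> (bvec x) \<otimes>\<^bsub>P\<^esub> fext P \<phi> (bvec y)" if "y \<in> Q" for y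
      using x that by (simp add: mult_bvec klinD(3)[OF lin] m_closed bv mul)
  qed
  have 2: "fext P \<phi> (f \<otimes>\<^bsub>T\<^esub> g) = fext P \<phi> f \<otimes>\<^bsub>P\<^esub> fext P \<phi> g"
    if f: "f \<in> carrier T" and g: "g \<in> carrier T" for f g
    by (rule klin_bvec_eq[OF klin_comp[OF mult_lin_l[OF g] lin]
        klin_comp[OF lin P.mult_klin_r[OF klinD(1)[OF lin g]]] P.kmodule 1[OF _ g] f])
  show ?thesis
  proof (rule dga_homI[OF T_predg_algebra assms(1) lin])
    show "fext P \<phi> \<in> extensional (carrier T)" unfolding fext_def by (rule restrict_extensional)
    show "fext P \<phi> \<one>\<^bsub>T\<^esub> = \<one>\<^bsub>P\<^esub>" by (simp add: T_simps(2) bv e_closed one)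
    show "fext P \<phi> f \<in> gr P i" if "f \<in> gr T i" for f i
      by (rule klin_bvec_mem[OF lin P.kmodule P.gr_submodule, where Q' = "{x \<in> Q. \<delta> x = i}"])
        (use that \<phi> in \<open>auto simp: T_simps(6) bv\<close>)
    show "fext P \<phi> (dif T f) = dif P (fext P \<phi> f)" if "f \<in> gr T i" for f i
      by (rule klin_bvec_eq[OF klin_comp[OF T_dif_klin lin] klin_comp[OF lin P.dif_klin] P.kmodule _
            T.gr_closed[OF that]]) (unfold dif_bvec, simp add: dif bv)
  qed (use 2 T.gr_closed in blast)
qed

end

section \<open>The tensor product\<close>

definition tensor_basis :: "('k::field_char_0, 'a, 'm) dg_scheme \<Rightarrow> ('k, 'b, 'n) dg_scheme \<Rightarrow> ('a, 'b) tgen set"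
  where "tensor_basis A B = {((i, a), (j, b)) | i a j b. a \<in> gr A i \<and> b \<in> gr B j}"

definition tensor_deg :: "('a, 'b) tgen \<Rightarrow> int"
  where "tensor_deg = (\<lambda>((i, a), (j, b)). i + j)"

definition tensor_sign :: "('a, 'b) tgen \<Rightarrow> ('a, 'b) tgen \<Rightarrow> 'k::field_char_0"
  where "tensor_sign = (\<lambda>((i, a), (j, b)) ((i', a'), (j', b')). ksign (j * i'))"

definition tensor_mul ::
  "('k::field_char_0, 'a, 'm) dg_scheme \<Rightarrow> ('k, 'b, 'n) dg_scheme \<Rightarrow> ('a, 'b) tgen \<Rightarrow> ('a, 'b) tgen \<Rightarrow> ('a, 'b) tgen"
  where "tensor_mul A B = (\<lambda>((i, a), (j, b)) ((i', a'), (j', b')).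
    ((i + i', a \<otimes>\<^bsub>A\<^esub> a'), (j + j', b \<otimes>\<^bsub>B\<^esub> b')))"

definition tensor_deriv ::
  "('k::field_char_0, 'a, 'm) dg_scheme \<Rightarrow> ('k, 'b, 'n) dg_scheme \<Rightarrow> ('a, 'b) tgen \<Rightarrow> ('a, 'b) tgen \<Rightarrow> 'k"
  where "tensor_deriv A B = (\<lambda>((i, a), (j, b)) z.
    bvec ((i - 1, dif A a), (j, b)) z + ksign i * bvec ((i, a), (j - 1, dif B b)) z)"

lemma tensor_free_twisted:
  "tensor_free A B = twisted_alg (tensor_basis A B) tensor_deg tensor_sign (tensor_mul A B)
    ((0, \<one>\<^bsub>A\<^esub>), (0, \<one>\<^bsub>B\<^esub>)) (tensor_deriv A B)"
proof -
  have 1: "(\<lambda>((i, a), (j, b)) ((i', a'), (j', b')) z.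
        ksign (j * i') * bvec ((i + i', a \<otimes>\<^bsub>A\<^esub> a'), (j + j', b \<otimes>\<^bsub>B\<^esub> b')) z) =
      (\<lambda>x y z. tensor_sign x y * bvec (tensor_mul A B x y) z)"
    by (auto simp: fun_eq_iff tensor_sign_def tensor_mul_def)
  have 2: "{((i, a), (j, b)) | i a j b. a \<in> gr A i \<and> b \<in> gr B j \<and> i + j = n} =
      {x \<in> tensor_basis A B. tensor_deg x = n}" for n
    by (auto simp: tensor_basis_def tensor_deg_def)
  show ?thesis
    unfolding tensor_free_def twisted_alg_def 1 2 by (simp add: tensor_basis_def tensor_deriv_def)
qed

text \<open>
  The degrees are arguments of \<open>f\<close> because a homogeneous element does not determine its degree (zero
  has every degree).
\<close>

definition gr_bilinear :: "('k::field_char_0, 'a, 'm) dg_scheme \<Rightarrow> ('k, 'b, 'n) dg_scheme \<Rightarrow> ('k, 'c, 'p) dg_scheme \<Rightarrow>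
    (int \<Rightarrow> 'a \<Rightarrow> int \<Rightarrow> 'b \<Rightarrow> 'c) \<Rightarrow> bool"
  where "gr_bilinear A B N f \<longleftrightarrow> (\<forall>i j. \<forall>a\<in>gr A i. \<forall>b\<in>gr B j. f i a j b \<in> carrier N \<and>
    (\<forall>a'\<in>gr A i. f i (a \<oplus>\<^bsub>A\<^esub> a') j b = f i a j b \<oplus>\<^bsub>N\<^esub> f i a' j b) \<and>
    (\<forall>b'\<in>gr B j. f i a j (b \<oplus>\<^bsub>B\<^esub> b') = f i a j b \<oplus>\<^bsub>N\<^esub> f i a j b') \<and>
    (\<forall>r. f i (r \<odot>\<^bsub>A\<^esub> a) j b = r \<odot>\<^bsub>N\<^esub> f i a j b) \<and> (\<forall>r. f i a j (r \<odot>\<^bsub>B\<^esub> b) = r \<odot>\<^bsub>N\<^esub> f i a j b))"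

lemma gr_bilinearD:
  assumes "gr_bilinear A B N f" "a \<in> gr A i" "b \<in> gr B j"
  shows "f i a j b \<in> carrier N"
    "a' \<in> gr A i \<Longrightarrow> f i (a \<oplus>\<^bsub>A\<^esub> a') j b = f i a j b \<oplus>\<^bsub>N\<^esub> f i a' j b"
    "b' \<in> gr B j \<Longrightarrow> f i a j (b \<oplus>\<^bsub>B\<^esub> b') = f i a j b \<oplus>\<^bsub>N\<^esub> f i a j b'"
    "f i (r \<odot>\<^bsub>A\<^esub> a) j b = r \<odot>\<^bsub>N\<^esub> f i a j b" "f i a j (r \<odot>\<^bsub>B\<^esub> b) = r \<odot>\<^bsub>N\<^esub> f i a j b"
  using assms unfolding gr_bilinear_def by blast+

lemma gr_bilinear_plus:
  assumes "gr_bilinear A B N f" "gr_bilinear A B N g" "kmodule N"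
  shows "gr_bilinear A B N (\<lambda>i a j b. f i a j b \<oplus>\<^bsub>N\<^esub> g i a j b)"
proof -
  interpret N: kmodule N by fact
  note f = gr_bilinearD[OF assms(1)] and g = gr_bilinearD[OF assms(2)]
  show ?thesis
    unfolding gr_bilinear_def by (intro allI ballI conjI) (simp_all add: f g N.ksmult_r_add N.M.a_ac)
qed

text \<open>
  The coefficient \<open>s\<close> may depend on the degrees. It carries the Koszul signs and, with values \<open>0\<close> and \<open>1\<close>,
  the projection to one total degree.
\<close>

lemma gr_bilinear_map:
  assumes f: "gr_bilinear A' B' N f" and N: "kmodule N" and A: "gr_module A" and B: "gr_module B"
    and u: "klin A A' u" "\<And>i a. a \<in> gr A i \<Longrightarrow> u a \<in> gr A' (i + k)"
    and w: "klin B B' w" "\<And>j b. b \<in> gr B j \<Longrightarrow> w b \<in> gr B' (j + l)"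
  shows "gr_bilinear A B N (\<lambda>i a j b. s i j \<odot>\<^bsub>N\<^esub> f (i + k) (u a) (j + l) (w b))"
proof -
  interpret N: kmodule N by fact
  interpret A: gr_module A by fact
  interpret B: gr_module B by fact
  show ?thesis
    unfolding gr_bilinear_def
  proof (intro allI ballI)
    fix i j a b assume ab: "a \<in> gr A i" "b \<in> gr B j"
    note f = gr_bilinearD[OF f u(2)[OF ab(1)] w(2)[OF ab(2)]]
    have "\<forall>a'\<in>gr A i. u (a \<oplus>\<^bsub>A\<^esub> a') = u a \<oplus>\<^bsub>A'\<^esub> u a'" "\<forall>b'\<in>gr B j. w (b \<oplus>\<^bsub>B\<^esub> b') = w b \<oplus>\<^bsub>B'\<^esub> w b'"
      "u (r \<odot>\<^bsub>A\<^esub> a) = r \<odot>\<^bsub>A'\<^esub> u a" "w (r \<odot>\<^bsub>B\<^esub> b) = r \<odot>\<^bsub>B'\<^esub> w b" for r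
      by (simp_all add: klinD[OF u(1)] klinD[OF w(1)] A.gr_closed[OF ab(1)] A.gr_closed[of _ i]
          B.gr_closed[OF ab(2)] B.gr_closed[of _ j])
    moreover have "\<forall>a'\<in>gr A i. f (i + k) (u a') (j + l) (w b) \<in> carrier N"
      "\<forall>b'\<in>gr B j. f (i + k) (u a) (j + l) (w b') \<in> carrier N"
      using gr_bilinearD(1)[OF assms(1)] u(2) w(2) ab by blast+
    ultimately show "s i j \<odot>\<^bsub>N\<^esub> f (i + k) (u a) (j + l) (w b) \<in> carrier N \<and>
        (\<forall>a'\<in>gr A i. s i j \<odot>\<^bsub>N\<^esub> f (i + k) (u (a \<oplus>\<^bsub>A\<^esub> a')) (j + l) (w b) =
          s i j \<odot>\<^bsub>N\<^esub> f (i + k) (u a) (j + l) (w b) \<oplus>\<^bsub>N\<^esub> s i j \<odot>\<^bsub>N\<^esub> f (i + k) (u a') (j + l) (w b)) \<and>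
        (\<forall>b'\<in>gr B j. s i j \<odot>\<^bsub>N\<^esub> f (i + k) (u a) (j + l) (w (b \<oplus>\<^bsub>B\<^esub> b')) =
          s i j \<odot>\<^bsub>N\<^esub> f (i + k) (u a) (j + l) (w b) \<oplus>\<^bsub>N\<^esub> s i j \<odot>\<^bsub>N\<^esub> f (i + k) (u a) (j + l) (w b')) \<and>
        (\<forall>r. s i j \<odot>\<^bsub>N\<^esub> f (i + k) (u (r \<odot>\<^bsub>A\<^esub> a)) (j + l) (w b) =
          r \<odot>\<^bsub>N\<^esub> (s i j \<odot>\<^bsub>N\<^esub> f (i + k) (u a) (j + l) (w b))) \<and>
        (\<forall>r. s i j \<odot>\<^bsub>N\<^esub> f (i + k) (u a) (j + l) (w (r \<odot>\<^bsub>B\<^esub> b)) =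
          r \<odot>\<^bsub>N\<^esub> (s i j \<odot>\<^bsub>N\<^esub> f (i + k) (u a) (j + l) (w b)))"
      using f u(2) w(2) by (simp add: N.ksmult_r_add N.ksmult_assoc mult.commute)
  qed
qed

locale dga_tensor = A: dg_algebra A + B: dg_algebra B
  for A :: "('k::field_char_0, 'a, 'm) dg_scheme" and B :: "('k, 'b, 'n) dg_scheme"
begin

abbreviation "F \<equiv> tensor_free A B"
abbreviation "K \<equiv> tensor_ker A B"
abbreviation "W \<equiv> tensor_dga A B"

sublocale tw: twisted_monoid "tensor_basis A B" tensor_deg tensor_sign "tensor_mul A B"
  "((0, \<one>\<^bsub>A\<^esub>), (0, \<one>\<^bsub>B\<^esub>))" "tensor_deriv A B"
  rewrites "twisted_alg (tensor_basis A B) tensor_deg tensor_sign (tensor_mul A B)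
    ((0, \<one>\<^bsub>A\<^esub>), (0, \<one>\<^bsub>B\<^esub>)) (tensor_deriv A B) \<equiv> F"
proof -
  show "twisted_monoid (tensor_basis A B) tensor_deg tensor_sign (tensor_mul A B)
    ((0, \<one>\<^bsub>A\<^esub>), (0, \<one>\<^bsub>B\<^esub>)) (tensor_deriv A B)"
  proof
    fix x y z assume x: "x \<in> tensor_basis A B"
    then obtain i a j b where x': "x = ((i, a), (j, b))" "a \<in> gr A i" "b \<in> gr B j"
      by (auto simp: tensor_basis_def)
    have c: "a \<in> carrier A" "b \<in> carrier B" using x' A.gr_closed B.gr_closed by blast+
    show "tensor_mul A B ((0, \<one>\<^bsub>A\<^esub>), (0, \<one>\<^bsub>B\<^esub>)) x = x" "tensor_mul A B x ((0, \<one>\<^bsub>A\<^esub>), (0, \<one>\<^bsub>B\<^esub>)) = x"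
      "tensor_sign ((0, \<one>\<^bsub>A\<^esub>), (0, \<one>\<^bsub>B\<^esub>)) x = (1 :: 'k)"
      "tensor_sign x ((0, \<one>\<^bsub>A\<^esub>), (0, \<one>\<^bsub>B\<^esub>)) = (1 :: 'k)"
      using c by (simp_all add: x'(1) tensor_mul_def tensor_sign_def)
    have "((i - 1, dif A a), (j, b)) \<in> tensor_basis A B" "((i, a), (j - 1, dif B b)) \<in> tensor_basis A B"
      using x' A.dif_degree B.dif_degree by (auto simp: tensor_basis_def)
    then show "tensor_deriv A B x \<in> free_vec {y \<in> tensor_basis A B.
        tensor_deg y = tensor_deg x - 1}"
      by (auto simp: x'(1) tensor_deriv_def tensor_deg_def intro!: free_vec_add free_vec_smult bvec_free)
    assume y: "y \<in> tensor_basis A B"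
    then obtain i' a' j' b' where y': "y = ((i', a'), (j', b'))" "a' \<in> gr A i'" "b' \<in> gr B j'"
      by (auto simp: tensor_basis_def)
    show "tensor_mul A B x y \<in> tensor_basis A B"
      using x' y' A.mult_degree B.mult_degree by (auto simp: tensor_mul_def tensor_basis_def)
    show "tensor_deg (tensor_mul A B x y) = tensor_deg x + tensor_deg y"
      by (simp add: x' y' tensor_mul_def tensor_deg_def)
    assume z: "z \<in> tensor_basis A B"
    then obtain i'' a'' j'' b'' where z': "z = ((i'', a''), (j'', b''))" "a'' \<in> gr A i''" "b'' \<in> gr B j''"
      by (auto simp: tensor_basis_def)
    have c': "a' \<in> carrier A" "b' \<in> carrier B" "a'' \<in> carrier A" "b'' \<in> carrier B"
      using y' z' A.gr_closed B.gr_closed by blast+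
    show "tensor_mul A B (tensor_mul A B x y) z = tensor_mul A B x (tensor_mul A B y z)"
      using c c' by (simp add: x' y' z' tensor_mul_def A.m_assoc B.m_assoc)
    show "(tensor_sign x y :: 'k) * tensor_sign (tensor_mul A B x y) z =
        tensor_sign y z * tensor_sign x (tensor_mul A B y z)"
      by (simp add: x' y' z' tensor_mul_def tensor_sign_def distrib_left distrib_right ksign_add mult_ac)
  qed (simp_all add: tensor_basis_def tensor_deg_def A.one_degree B.one_degree)
  show "twisted_alg (tensor_basis A B) tensor_deg tensor_sign (tensor_mul A B)
    ((0, \<one>\<^bsub>A\<^esub>), (0, \<one>\<^bsub>B\<^esub>)) (tensor_deriv A B) \<equiv> F"
    by (simp add: tensor_free_twisted)
qed

text \<open>
  The class of \<open>a \<otimes> b\<close> in the tensor product.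
\<close>

definition t :: "int \<Rightarrow> 'a \<Rightarrow> int \<Rightarrow> 'b \<Rightarrow> (('a, 'b) tgen \<Rightarrow> 'k) set"
  where "t i a j b = K +>\<^bsub>F\<^esub> bvec ((i, a), (j, b))"

lemma basisI: "\<lbrakk>a \<in> gr A i; b \<in> gr B j\<rbrakk> \<Longrightarrow> ((i, a), (j, b)) \<in> tensor_basis A B"
  by (auto simp: tensor_basis_def)

lemma bv_closed: "\<lbrakk>a \<in> gr A i; b \<in> gr B j\<rbrakk> \<Longrightarrow> bvec ((i, a), (j, b)) \<in> carrier F"
  by (simp add: basisI)

lemma F_simps: "f \<oplus>\<^bsub>F\<^esub> g = (\<lambda>z. f z + g z)" "r \<odot>\<^bsub>F\<^esub> f = (\<lambda>z. r * f z)"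
  by (simp_all add: tensor_free_def)

lemma rels_closed: "tensor_rels A B \<subseteq> carrier F"
proof
  fix x assume "x \<in> tensor_rels A B"
  note m = bv_closed A.gr_add B.gr_add A.gr_smult B.gr_smult
  from \<open>x \<in> tensor_rels A B\<close> consider
      i j a a' b where "a \<in> gr A i" "a' \<in> gr A i" "b \<in> gr B j"
        "x = (bvec ((i, a \<oplus>\<^bsub>A\<^esub> a'), (j, b)) \<oplus>\<^bsub>F\<^esub> (- 1) \<odot>\<^bsub>F\<^esub> bvec ((i, a), (j, b))) \<oplus>\<^bsub>F\<^esub> (- 1) \<odot>\<^bsub>F\<^esub> bvec ((i, a'), (j, b))"
    | i j a b b' where "a \<in> gr A i" "b \<in> gr B j" "b' \<in> gr B j"
        "x = (bvec ((i, a), (j, b \<oplus>\<^bsub>B\<^esub> b')) \<oplus>\<^bsub>F\<^esub> (- 1) \<odot>\<^bsub>F\<^esub> bvec ((i, a), (j, b))) \<oplus>\<^bsub>F\<^esub> (- 1) \<odot>\<^bsub>F\<^esub> bvec ((i, a), (j, b'))"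
    | i j a b r where "a \<in> gr A i" "b \<in> gr B j"
        "x = bvec ((i, r \<odot>\<^bsub>A\<^esub> a), (j, b)) \<oplus>\<^bsub>F\<^esub> (- r) \<odot>\<^bsub>F\<^esub> bvec ((i, a), (j, b))"
    | i j a b r where "a \<in> gr A i" "b \<in> gr B j"
        "x = bvec ((i, a), (j, r \<odot>\<^bsub>B\<^esub> b)) \<oplus>\<^bsub>F\<^esub> (- r) \<odot>\<^bsub>F\<^esub> bvec ((i, a), (j, b))"
    unfolding tensor_rels_def F_simps by (auto simp: algebra_simps)
  then show "x \<in> carrier F"
    by cases (simp_all add: m)
qed

lemma K_sub: "submodule K ground F"
  unfolding tensor_ker_def by (rule tw.T.subspan_submodule[OF rels_closed])

text \<open>
  A linear map that is bilinear on generators kills all relations. All stability properties of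
  \<open>K\<close> are instances: to see that an operation preserves \<open>K\<close>, follow it by the projection to the quotient and
  check that the composite is bilinear on generators.
\<close>

lemma K_zero:
  assumes g: "klin F N g" and N: "kmodule N" and b: "gr_bilinear A B N (\<lambda>i a j b. g (bvec ((i, a), (j, b))))"
    and x: "x \<in> K"
  shows "g x = \<zero>\<^bsub>N\<^esub>"
proof -
  interpret N: kmodule N by fact
  have H: "submodule {x \<in> carrier F. g x \<in> {\<zero>\<^bsub>N\<^esub>}} ground F"
    by (rule klin_preimage_submodule[OF g tw.T_kmodule N]) (rule N.ksubmoduleI; simp)
  note l = klinD[OF g] and m = bv_closed A.gr_add B.gr_add A.gr_smult B.gr_smult
  note B = gr_bilinearD[OF b]
  have cc: "\<And>a i b j. \<lbrakk>a \<in> gr A i; b \<in> gr B j\<rbrakk> \<Longrightarrow> g (bvec ((i, a), (j, b))) \<in> carrier N"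
    by (rule B(1))
  have "tensor_rels A B \<subseteq> {x \<in> carrier F. g x \<in> {\<zero>\<^bsub>N\<^esub>}}"
  proof
    fix x assume xr: "x \<in> tensor_rels A B"
    then consider
      i j a a' b where "a \<in> gr A i" "a' \<in> gr A i" "b \<in> gr B j"
        "x = bvec ((i, a \<oplus>\<^bsub>A\<^esub> a'), (j, b)) \<oplus>\<^bsub>F\<^esub> (- 1) \<odot>\<^bsub>F\<^esub> (bvec ((i, a), (j, b)) \<oplus>\<^bsub>F\<^esub> bvec ((i, a'), (j, b)))"
    | i j a b b' where "a \<in> gr A i" "b \<in> gr B j" "b' \<in> gr B j"
        "x = bvec ((i, a), (j, b \<oplus>\<^bsub>B\<^esub> b')) \<oplus>\<^bsub>F\<^esub> (- 1) \<odot>\<^bsub>F\<^esub> (bvec ((i, a), (j, b)) \<oplus>\<^bsub>F\<^esub> bvec ((i, a), (j, b')))"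
    | i j a b r where "a \<in> gr A i" "b \<in> gr B j"
        "x = bvec ((i, r \<odot>\<^bsub>A\<^esub> a), (j, b)) \<oplus>\<^bsub>F\<^esub> (- 1) \<odot>\<^bsub>F\<^esub> (r \<odot>\<^bsub>F\<^esub> bvec ((i, a), (j, b)))"
    | i j a b r where "a \<in> gr A i" "b \<in> gr B j"
        "x = bvec ((i, a), (j, r \<odot>\<^bsub>B\<^esub> b)) \<oplus>\<^bsub>F\<^esub> (- 1) \<odot>\<^bsub>F\<^esub> (r \<odot>\<^bsub>F\<^esub> bvec ((i, a), (j, b)))"
      unfolding tensor_rels_def F_simps by (auto simp: algebra_simps)
    then have "g x = \<zero>\<^bsub>N\<^esub>"
      by cases (simp_all add: m l B cc N.kcancel del: F_simps)
    then show "x \<in> {x \<in> carrier F. g x \<in> {\<zero>\<^bsub>N\<^esub>}}"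
      using xr rels_closed by auto
  qed
  then have "K \<subseteq> {x \<in> carrier F. g x \<in> {\<zero>\<^bsub>N\<^esub>}}"
    unfolding tensor_ker_def by (rule tw.T.subspan_least[OF H])
  then show ?thesis using x by auto
qed

lemma W_kmodule: "kmodule W"
  unfolding tensor_dga_def by (rule tw.T.quot_kmodule[OF K_sub])

lemma proj_klin: "klin F W (\<lambda>x. K +>\<^bsub>F\<^esub> x)"
  unfolding tensor_dga_def by (rule tw.T.quot_klin[OF K_sub])

lemma proj_zero_iff: "x \<in> carrier F \<Longrightarrow> K +>\<^bsub>F\<^esub> x = \<zero>\<^bsub>W\<^esub> \<longleftrightarrow> x \<in> K"
  unfolding tensor_dga_def using tw.T.coset_zero_iff[OF K_sub] tw.T.quot_zero(1)[OF K_sub] by simp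

interpretation W: kmodule W by (rule W_kmodule)

lemma t_bilinear: "gr_bilinear A B W t"
proof -
  note m = bv_closed A.gr_add B.gr_add A.gr_smult B.gr_smult
  note p = klinD[OF proj_klin]
  have r: "tensor_rels A B \<subseteq> K" unfolding tensor_ker_def by (rule tw.T.subspan_incl)
  have eq: "K +>\<^bsub>F\<^esub> x = K +>\<^bsub>F\<^esub> y" if "x \<in> carrier F" "y \<in> carrier F" "x \<oplus>\<^bsub>F\<^esub> (- 1) \<odot>\<^bsub>F\<^esub> y \<in> tensor_rels A B" for x y
    using that r by (subst tw.T.coset_eq_iff[OF K_sub]) (auto simp: tw.T.kdiff)
  show ?thesis
    unfolding gr_bilinear_def t_def
  proof (intro allI ballI conjI)
    fix i j a b assume ab: "a \<in> gr A i" "b \<in> gr B j"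
    show "K +>\<^bsub>F\<^esub> bvec ((i, a), (j, b)) \<in> carrier W" by (rule p(1)[OF bv_closed[OF ab]])
    show "K +>\<^bsub>F\<^esub> bvec ((i, a \<oplus>\<^bsub>A\<^esub> a'), (j, b)) = (K +>\<^bsub>F\<^esub> bvec ((i, a), (j, b))) \<oplus>\<^bsub>W\<^esub> (K +>\<^bsub>F\<^esub> bvec ((i, a'), (j, b)))"
      if a': "a' \<in> gr A i" for a'
      unfolding p(2)[OF bv_closed[OF ab] bv_closed[OF a' ab(2)], symmetric]
    proof (rule eq)
      show "bvec ((i, a \<oplus>\<^bsub>A\<^esub> a'), (j, b)) \<oplus>\<^bsub>F\<^esub> (- 1) \<odot>\<^bsub>F\<^esub> (bvec ((i, a), (j, b)) \<oplus>\<^bsub>F\<^esub> bvec ((i, a'), (j, b))) \<in> tensor_rels A B"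
        unfolding tensor_rels_def F_simps
        by (rule UnI1, rule UnI1, rule UnI1, rule CollectI) (use ab a' in \<open>force simp: algebra_simps\<close>)
    qed (use ab a' in \<open>simp_all add: m\<close>)
    show "K +>\<^bsub>F\<^esub> bvec ((i, a), (j, b \<oplus>\<^bsub>B\<^esub> b')) = (K +>\<^bsub>F\<^esub> bvec ((i, a), (j, b))) \<oplus>\<^bsub>W\<^esub> (K +>\<^bsub>F\<^esub> bvec ((i, a), (j, b')))"
      if b': "b' \<in> gr B j" for b'
      unfolding p(2)[OF bv_closed[OF ab] bv_closed[OF ab(1) b'], symmetric]
    proof (rule eq)
      show "bvec ((i, a), (j, b \<oplus>\<^bsub>B\<^esub> b')) \<oplus>\<^bsub>F\<^esub> (- 1) \<odot>\<^bsub>F\<^esub> (bvec ((i, a), (j, b)) \<oplus>\<^bsub>F\<^esub> bvec ((i, a), (j, b'))) \<in> tensor_rels A B"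
        unfolding tensor_rels_def F_simps
        by (rule UnI1, rule UnI1, rule UnI2, rule CollectI) (use ab b' in \<open>force simp: algebra_simps\<close>)
    qed (use ab b' in \<open>simp_all add: m\<close>)
    fix r
    show "K +>\<^bsub>F\<^esub> bvec ((i, r \<odot>\<^bsub>A\<^esub> a), (j, b)) = r \<odot>\<^bsub>W\<^esub> (K +>\<^bsub>F\<^esub> bvec ((i, a), (j, b)))"
      unfolding p(3)[OF bv_closed[OF ab], symmetric]
    proof (rule eq)
      show "bvec ((i, r \<odot>\<^bsub>A\<^esub> a), (j, b)) \<oplus>\<^bsub>F\<^esub> (- 1) \<odot>\<^bsub>F\<^esub> (r \<odot>\<^bsub>F\<^esub> bvec ((i, a), (j, b))) \<in> tensor_rels A B"
        unfolding tensor_rels_def F_simps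
        by (rule UnI1, rule UnI2, rule CollectI) (use ab in force)
    qed (use ab in \<open>simp_all add: m\<close>)
    show "K +>\<^bsub>F\<^esub> bvec ((i, a), (j, r \<odot>\<^bsub>B\<^esub> b)) = r \<odot>\<^bsub>W\<^esub> (K +>\<^bsub>F\<^esub> bvec ((i, a), (j, b)))"
      unfolding p(3)[OF bv_closed[OF ab], symmetric]
    proof (rule eq)
      show "bvec ((i, a), (j, r \<odot>\<^bsub>B\<^esub> b)) \<oplus>\<^bsub>F\<^esub> (- 1) \<odot>\<^bsub>F\<^esub> (r \<odot>\<^bsub>F\<^esub> bvec ((i, a), (j, b))) \<in> tensor_rels A B"
        unfolding tensor_rels_def F_simps
        by (rule UnI2, rule CollectI) (use ab in force)
    qed (use ab in \<open>simp_all add: m\<close>)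
  qed
qed

end

context dga_tensor
begin

interpretation W: kmodule W by (rule W_kmodule)

lemma t_eq: "K +>\<^bsub>F\<^esub> bvec ((i, a), (j, b)) = t i a j b"
  by (simp add: t_def)

lemma t_closed: "\<lbrakk>a \<in> gr A i; b \<in> gr B j\<rbrakk> \<Longrightarrow> t i a j b \<in> carrier W"
  using gr_bilinearD(1)[OF t_bilinear] .

lemma t_zero:
  assumes "b \<in> gr B j" shows "t i \<zero>\<^bsub>A\<^esub> j b = \<zero>\<^bsub>W\<^esub>"
  using gr_bilinearD(4)[OF t_bilinear A.gr_zero assms, of i 0] t_closed[OF A.gr_zero assms, of i] by simp

lemma t_zero':
  assumes "a \<in> gr A i" shows "t i a j \<zero>\<^bsub>B\<^esub> = \<zero>\<^bsub>W\<^esub>"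
  using gr_bilinearD(5)[OF t_bilinear assms B.gr_zero, of j 0] t_closed[OF assms B.gr_zero, of j] by simp

lemma id_klin: "klin A A (\<lambda>x. x)" "klin B B (\<lambda>x. x)"
  by (auto simp: klin_def)

lemmas t_map = gr_bilinear_map[OF t_bilinear W_kmodule A.gr_module B.gr_module]

lemma t_deg_bilinear: "gr_bilinear A B W (\<lambda>i a j b. s i j \<odot>\<^bsub>W\<^esub> t i a j b)"
  using t_map[where k = 0 and l = 0 and s = s, OF id_klin(1) _ id_klin(2)] by simp

lemma proj_mult_bvec:
  assumes "a \<in> gr A i" "b \<in> gr B j" "a' \<in> gr A i'" "b' \<in> gr B j'"
  shows "K +>\<^bsub>F\<^esub> (bvec ((i, a), (j, b)) \<otimes>\<^bsub>F\<^esub> bvec ((i', a'), (j', b'))) =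
    ksign (j * i') \<odot>\<^bsub>W\<^esub> t (i + i') (a \<otimes>\<^bsub>A\<^esub> a') (j + j') (b \<otimes>\<^bsub>B\<^esub> b')"
proof -
  have c: "bvec ((i + i', a \<otimes>\<^bsub>A\<^esub> a'), (j + j', b \<otimes>\<^bsub>B\<^esub> b')) \<in> carrier F"
    using assms by (intro bv_closed A.mult_degree B.mult_degree)
  show ?thesis
    using tw.mult_bvec[OF basisI[OF assms(1,2)] basisI[OF assms(3,4)]] klinD(3)[OF proj_klin c]
    by (simp add: tensor_sign_def tensor_mul_def t_def)
qed

lemma K_ideal_bvec:
  assumes "a0 \<in> gr A i0" "b0 \<in> gr B j0" "x \<in> K"
  shows "bvec ((i0, a0), (j0, b0)) \<otimes>\<^bsub>F\<^esub> x \<in> K" "x \<otimes>\<^bsub>F\<^esub> bvec ((i0, a0), (j0, b0)) \<in> K"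
proof -
  let ?q = "bvec ((i0, a0), (j0, b0))"
  have q: "?q \<in> carrier F" by (rule bv_closed[OF assms(1,2)])
  have c: "a0 \<in> carrier A" "b0 \<in> carrier B" using assms A.gr_closed B.gr_closed by blast+
  have x: "x \<in> carrier F" using assms(3) tw.T.ksubmoduleD(2)[OF K_sub] by blast
  have "gr_bilinear A B W (\<lambda>i a j b. ksign (j0 * i) \<odot>\<^bsub>W\<^esub> t (i + i0) (a0 \<otimes>\<^bsub>A\<^esub> a) (j + j0) (b0 \<otimes>\<^bsub>B\<^esub> b))"
    by (rule t_map[OF A.mult_klin_l[OF c(1)] _ B.mult_klin_l[OF c(2)]])
      (use A.mult_degree[OF assms(1)] B.mult_degree[OF assms(2)] in \<open>auto simp: add.commute\<close>)
  then have "gr_bilinear A B W (\<lambda>i a j b. K +>\<^bsub>F\<^esub> (?q \<otimes>\<^bsub>F\<^esub> bvec ((i, a), (j, b))))"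
    using proj_mult_bvec[OF assms(1,2)] by (simp add: gr_bilinear_def add.commute A.gr_add A.gr_smult B.gr_add B.gr_smult)
  from K_zero[OF klin_comp[OF tw.mult_lin_r[OF q] proj_klin] W_kmodule this assms(3)]
  show "?q \<otimes>\<^bsub>F\<^esub> x \<in> K" using proj_zero_iff q x by (simp add: tw.mult_closed)
  have "gr_bilinear A B W (\<lambda>i a j b. ksign (j * i0) \<odot>\<^bsub>W\<^esub> t (i + i0) (a \<otimes>\<^bsub>A\<^esub> a0) (j + j0) (b \<otimes>\<^bsub>B\<^esub> b0))"
    by (rule t_map[OF A.mult_klin_r[OF c(1)] _ B.mult_klin_r[OF c(2)]])
      (use A.mult_degree[OF _ assms(1)] B.mult_degree[OF _ assms(2)] in auto)
  then have "gr_bilinear A B W (\<lambda>i a j b. K +>\<^bsub>F\<^esub> (bvec ((i, a), (j, b)) \<otimes>\<^bsub>F\<^esub> ?q))"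
    using proj_mult_bvec[OF _ _ assms(1,2)] by (simp add: gr_bilinear_def A.gr_add A.gr_smult B.gr_add B.gr_smult)
  from K_zero[OF klin_comp[OF tw.mult_lin_l[OF q] proj_klin] W_kmodule this assms(3)]
  show "x \<otimes>\<^bsub>F\<^esub> ?q \<in> K" using proj_zero_iff q x by (simp add: tw.mult_closed)
qed

lemma deriv_closed: "x \<in> tensor_basis A B \<Longrightarrow> tensor_deriv A B x \<in> carrier F"
  using klinD(1)[OF tw.T_dif_klin, of "bvec x"] by (simp add: tw.dif_bvec)

lemma deriv_eq: "tensor_deriv A B ((i, a), (j, b)) =
    bvec ((i - 1, dif A a), (j, b)) \<oplus>\<^bsub>F\<^esub> ksign i \<odot>\<^bsub>F\<^esub> bvec ((i, a), (j - 1, dif B b))"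
  by (simp add: F_simps tensor_deriv_def)

lemma proj_deriv:
  assumes "a \<in> gr A i" "b \<in> gr B j"
  shows "K +>\<^bsub>F\<^esub> tensor_deriv A B ((i, a), (j, b)) =
    t (i - 1) (dif A a) j b \<oplus>\<^bsub>W\<^esub> ksign i \<odot>\<^bsub>W\<^esub> t i a (j - 1) (dif B b)"
proof -
  have c: "bvec ((i - 1, dif A a), (j, b)) \<in> carrier F" "bvec ((i, a), (j - 1, dif B b)) \<in> carrier F"
    using assms by (simp_all add: bv_closed A.dif_degree B.dif_degree)
  show ?thesis
    using c by (simp add: deriv_eq klinD[OF proj_klin] t_def del: F_simps)
qed

text \<open>
  The two mixed terms \<open>da \<otimes> db\<close> cancel since their signs are \<open>(-1)^(i-1)\<close> and \<open>(-1)^i\<close>. The terms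
  \<open>dda \<otimes> b\<close> and \<open>a \<otimes> ddb\<close> are tensors with a zero factor, which vanish in the quotient.
\<close>

lemma dif_dif_basis:
  assumes "a \<in> gr A i" "b \<in> gr B j"
  shows "dif F (tensor_deriv A B ((i, a), (j, b))) \<in> K"
proof -
  let ?x = "tensor_deriv A B ((i, a), (j, b))"
  have d: "dif A a \<in> gr A (i - 1)" "dif B b \<in> gr B (j - 1)" "dif B (dif B b) \<in> gr B (j - 1 - 1)"
    "dif A (dif A a) \<in> gr A (i - 1 - 1)"
    using assms A.dif_degree B.dif_degree by blast+
  have c: "bvec ((i - 1, dif A a), (j, b)) \<in> carrier F" "bvec ((i, a), (j - 1, dif B b)) \<in> carrier F"
    using assms d by (simp_all add: bv_closed)
  have c': "tensor_deriv A B ((i - 1, dif A a), (j, b)) \<in> carrier F"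
    "tensor_deriv A B ((i, a), (j - 1, dif B b)) \<in> carrier F"
    using assms d by (simp_all add: deriv_closed basisI)
  have dd: "dif A (dif A a) = \<zero>\<^bsub>A\<^esub>" "dif B (dif B b) = \<zero>\<^bsub>B\<^esub>"
    using assms A.gr_closed B.gr_closed A.dif_dif B.dif_dif by blast+
  have "dif F ?x = tensor_deriv A B ((i - 1, dif A a), (j, b)) \<oplus>\<^bsub>F\<^esub>
      ksign i \<odot>\<^bsub>F\<^esub> tensor_deriv A B ((i, a), (j - 1, dif B b))"
    using c by (simp add: deriv_eq[of i a j b] klinD[OF tw.T_dif_klin] tw.dif_bvec del: F_simps)
  then have "K +>\<^bsub>F\<^esub> dif F ?x = (K +>\<^bsub>F\<^esub> tensor_deriv A B ((i - 1, dif A a), (j, b))) \<oplus>\<^bsub>W\<^esub>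
      ksign i \<odot>\<^bsub>W\<^esub> (K +>\<^bsub>F\<^esub> tensor_deriv A B ((i, a), (j - 1, dif B b)))"
    using c' by (simp add: klinD[OF proj_klin] del: F_simps)
  also have "\<dots> = \<zero>\<^bsub>W\<^esub>"
    using assms d t_closed[OF d(1,2)]
    by (simp add: proj_deriv dd t_zero t_zero' W.ksmult_assoc W.kcancel W.M.a_ac W.ksmult_r_add flip: W.ksmult_add)
  finally have "K +>\<^bsub>F\<^esub> dif F ?x = \<zero>\<^bsub>W\<^esub>" .
  moreover have "dif F ?x \<in> carrier F"
    by (rule klinD(1)[OF tw.T_dif_klin deriv_closed[OF basisI[OF assms]]])
  ultimately show ?thesis using proj_zero_iff by blast
qed

text \<open>
  Both sides expand to the four tensors in which \<open>d\<close> is applied to one of the factors \<open>a\<close>, \<open>a'\<close>, \<open>b\<close>, \<open>b'\<close>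
  of \<open>aa' \<otimes> bb'\<close>. Splitting \<open>d (aa')\<close> and \<open>d (bb')\<close> uses bilinearity, so this is a computation in the quotient.
\<close>

lemma leibniz_basis:
  assumes x: "a \<in> gr A i" "b \<in> gr B j" and y: "a' \<in> gr A i'" "b' \<in> gr B j'"
  defines "x0 \<equiv> ((i, a), (j, b))" and "y0 \<equiv> ((i', a'), (j', b'))"
  shows "dif F (bvec x0 \<otimes>\<^bsub>F\<^esub> bvec y0) \<ominus>\<^bsub>F\<^esub> (tensor_deriv A B x0 \<otimes>\<^bsub>F\<^esub> bvec y0 \<oplus>\<^bsub>F\<^esub>
    ksign (i + j) \<odot>\<^bsub>F\<^esub> (bvec x0 \<otimes>\<^bsub>F\<^esub> tensor_deriv A B y0)) \<in> K"
proof -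
  have d: "dif A a \<in> gr A (i - 1)" "dif B b \<in> gr B (j - 1)" "dif A a' \<in> gr A (i' - 1)" "dif B b' \<in> gr B (j' - 1)"
    using x y A.dif_degree B.dif_degree by blast+
  have ac: "a \<in> carrier A" "b \<in> carrier B" "a' \<in> carrier A" "b' \<in> carrier B"
    using x y A.gr_closed B.gr_closed by blast+
  have mXY: "a \<otimes>\<^bsub>A\<^esub> a' \<in> gr A (i + i')" "b \<otimes>\<^bsub>B\<^esub> b' \<in> gr B (j + j')"
    using x y by (simp_all add: A.mult_degree B.mult_degree)
  have cX: "bvec x0 \<in> carrier F" "bvec y0 \<in> carrier F" "tensor_deriv A B x0 \<in> carrier F" "tensor_deriv A B y0 \<in> carrier F"
    using x y by (simp_all add: x0_def y0_def bv_closed deriv_closed basisI)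
  have g: "dif A a \<otimes>\<^bsub>A\<^esub> a' \<in> gr A (i + i' - 1)" "a \<otimes>\<^bsub>A\<^esub> dif A a' \<in> gr A (i + i' - 1)"
    "dif B b \<otimes>\<^bsub>B\<^esub> b' \<in> gr B (j + j' - 1)" "b \<otimes>\<^bsub>B\<^esub> dif B b' \<in> gr B (j + j' - 1)"
    using A.mult_degree[OF d(1) y(1)] A.mult_degree[OF x(1) d(3)] B.mult_degree[OF d(2) y(2)] B.mult_degree[OF x(2) d(4)]
    by (simp_all add: algebra_simps)
  note lin = klinD[OF proj_klin] and ml = klinD[OF tw.mult_lin_l] and mr = klinD[OF tw.mult_lin_r]
    and dl = klinD[OF tw.T_dif_klin] and T = gr_bilinearD[OF t_bilinear]
  define p q r s where "p = t (i + i' - 1) (dif A a \<otimes>\<^bsub>A\<^esub> a') (j + j') (b \<otimes>\<^bsub>B\<^esub> b')"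
    and "q = t (i + i' - 1) (a \<otimes>\<^bsub>A\<^esub> dif A a') (j + j') (b \<otimes>\<^bsub>B\<^esub> b')"
    and "r = t (i + i') (a \<otimes>\<^bsub>A\<^esub> a') (j + j' - 1) (dif B b \<otimes>\<^bsub>B\<^esub> b')"
    and "s = t (i + i') (a \<otimes>\<^bsub>A\<^esub> a') (j + j' - 1) (b \<otimes>\<^bsub>B\<^esub> dif B b')"
  have pc: "p \<in> carrier W" "q \<in> carrier W" "r \<in> carrier W" "s \<in> carrier W"
    using g mXY by (simp_all add: p_def q_def r_def s_def t_closed)
  have "bvec x0 \<otimes>\<^bsub>F\<^esub> bvec y0 = ksign (j * i') \<odot>\<^bsub>F\<^esub> bvec ((i + i', a \<otimes>\<^bsub>A\<^esub> a'), (j + j', b \<otimes>\<^bsub>B\<^esub> b'))"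
    using tw.mult_bvec[OF basisI[OF x] basisI[OF y]] by (simp add: x0_def y0_def tensor_sign_def tensor_mul_def)
  then have "K +>\<^bsub>F\<^esub> dif F (bvec x0 \<otimes>\<^bsub>F\<^esub> bvec y0) = ksign (j * i') \<odot>\<^bsub>W\<^esub>
      (K +>\<^bsub>F\<^esub> tensor_deriv A B ((i + i', a \<otimes>\<^bsub>A\<^esub> a'), (j + j', b \<otimes>\<^bsub>B\<^esub> b')))"
    using bv_closed[OF mXY] deriv_closed[OF basisI[OF mXY]]
    by (simp add: dl tw.dif_bvec lin del: F_simps)
  also have "\<dots> = ksign (j * i') \<odot>\<^bsub>W\<^esub> (p \<oplus>\<^bsub>W\<^esub> ksign i \<odot>\<^bsub>W\<^esub> q \<oplus>\<^bsub>W\<^esub> ksign (i + i') \<odot>\<^bsub>W\<^esub> (r \<oplus>\<^bsub>W\<^esub> ksign j \<odot>\<^bsub>W\<^esub> s))"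
    using mXY g by (simp add: proj_deriv A.leibniz[OF x(1) ac(3)] B.leibniz[OF x(2) ac(4)] T A.gr_smult B.gr_smult
        p_def q_def r_def s_def)
  finally have L: "K +>\<^bsub>F\<^esub> dif F (bvec x0 \<otimes>\<^bsub>F\<^esub> bvec y0) =
    ksign (j * i') \<odot>\<^bsub>W\<^esub> (p \<oplus>\<^bsub>W\<^esub> ksign i \<odot>\<^bsub>W\<^esub> q \<oplus>\<^bsub>W\<^esub> ksign (i + i') \<odot>\<^bsub>W\<^esub> (r \<oplus>\<^bsub>W\<^esub> ksign j \<odot>\<^bsub>W\<^esub> s))" .
  have e: "i - 1 + i' = i + i' - 1" "j - 1 + j' = j + j' - 1" "i + (i' - 1) = i + i' - 1" "j + (j' - 1) = j + j' - 1"
    by simp_all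
  have c: "bvec ((i - 1, dif A a), (j, b)) \<in> carrier F" "bvec ((i, a), (j - 1, dif B b)) \<in> carrier F"
    "bvec ((i' - 1, dif A a'), (j', b')) \<in> carrier F" "bvec ((i', a'), (j' - 1, dif B b')) \<in> carrier F"
    using x y d by (simp_all add: bv_closed)
  have R1: "K +>\<^bsub>F\<^esub> (tensor_deriv A B x0 \<otimes>\<^bsub>F\<^esub> bvec y0) = ksign (j * i') \<odot>\<^bsub>W\<^esub> p \<oplus>\<^bsub>W\<^esub> (ksign i * ksign ((j - 1) * i')) \<odot>\<^bsub>W\<^esub> r"
    using c cX x y d t_closed mXY g unfolding x0_def deriv_eq
    by (simp add: ml lin tw.mult_closed y0_def proj_mult_bvec e W.ksmult_assoc p_def r_def del: F_simps)
  have R2: "K +>\<^bsub>F\<^esub> (bvec x0 \<otimes>\<^bsub>F\<^esub> tensor_deriv A B y0) = ksign (j * (i' - 1)) \<odot>\<^bsub>W\<^esub> q \<oplus>\<^bsub>W\<^esub> (ksign i' * ksign (j * i')) \<odot>\<^bsub>W\<^esub> s"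
    using c cX x y d t_closed mXY g unfolding y0_def deriv_eq
    by (simp add: mr lin tw.mult_closed x0_def proj_mult_bvec e W.ksmult_assoc q_def s_def del: F_simps)
  have sg: "ksign ((j - 1) * i') = (ksign (j * i') * ksign i' :: 'k)" "ksign (j * (i' - 1)) = (ksign (j * i') * ksign j :: 'k)"
    by (simp_all add: algebra_simps ksign_add)
  have "K +>\<^bsub>F\<^esub> (tensor_deriv A B x0 \<otimes>\<^bsub>F\<^esub> bvec y0 \<oplus>\<^bsub>F\<^esub> ksign (i + j) \<odot>\<^bsub>F\<^esub> (bvec x0 \<otimes>\<^bsub>F\<^esub> tensor_deriv A B y0)) =
    (ksign (j * i') \<odot>\<^bsub>W\<^esub> p \<oplus>\<^bsub>W\<^esub> (ksign i * ksign ((j - 1) * i')) \<odot>\<^bsub>W\<^esub> r) \<oplus>\<^bsub>W\<^esub>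
    ksign (i + j) \<odot>\<^bsub>W\<^esub> (ksign (j * (i' - 1)) \<odot>\<^bsub>W\<^esub> q \<oplus>\<^bsub>W\<^esub> (ksign i' * ksign (j * i')) \<odot>\<^bsub>W\<^esub> s)"
    using cX by (simp add: lin tw.mult_closed R1 R2 del: F_simps)
  also have "\<dots> = K +>\<^bsub>F\<^esub> dif F (bvec x0 \<otimes>\<^bsub>F\<^esub> bvec y0)"
    unfolding L sg using pc by (simp add: W.ksmult_r_add W.ksmult_assoc W.M.a_ac ksign_add mult_ac)
  finally show ?thesis
    using cX klinD(1)[OF tw.T_dif_klin]
    by (subst tw.T.coset_eq_iff[OF K_sub, symmetric]) (auto simp: tw.mult_closed)
qed

lemma dg_ideal: "dg_ideal F K"
proof (intro dg_ideal.intro dg_ideal_axioms.intro tw.T_predg_algebra K_sub)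
  note cl = tw.T.ksubmoduleD(2)[OF K_sub]
  fix x assume x: "x \<in> K"
  show "f \<otimes>\<^bsub>F\<^esub> x \<in> K" if "f \<in> carrier F" for f
    by (rule tw.klin_bvec_mem[OF tw.mult_lin_l[OF cl[OF x]] tw.T_kmodule K_sub subset_refl])
      (use x that K_ideal_bvec in \<open>auto simp: tw.T_simps(1) tensor_basis_def\<close>)
  show "x \<otimes>\<^bsub>F\<^esub> f \<in> K" if "f \<in> carrier F" for f
    by (rule tw.klin_bvec_mem[OF tw.mult_lin_r[OF cl[OF x]] tw.T_kmodule K_sub subset_refl])
      (use x that K_ideal_bvec in \<open>auto simp: tw.T_simps(1) tensor_basis_def\<close>)
  show "hcomp F n x \<in> K" for n
  proof -
    have e: "K +>\<^bsub>F\<^esub> hcomp F n (bvec ((i, a), (j, b))) = (if n = i + j then 1 else 0) \<odot>\<^bsub>W\<^esub> t i a j b"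
      if "a \<in> gr A i" "b \<in> gr B j" for i a j b
      using tw.T.hcomp_homog[OF tw.bvec_gr[OF basisI[OF that]], of n] t_closed[OF that] proj_zero_iff[of "\<zero>\<^bsub>F\<^esub>"]
        tw.T.ksubmoduleD(3)[OF K_sub]
      by (auto simp: tensor_deg_def t_def)
    have "gr_bilinear A B W (\<lambda>i a j b. K +>\<^bsub>F\<^esub> hcomp F n (bvec ((i, a), (j, b))))"
      using t_deg_bilinear[of "\<lambda>i j. if n = i + j then 1 else 0"]
      by (simp add: gr_bilinear_def e A.gr_add A.gr_smult B.gr_add B.gr_smult)
    from K_zero[OF klin_comp[OF tw.T.hcomp_klin proj_klin] W_kmodule this x]
    show ?thesis using proj_zero_iff cl[OF x] by simp
  qed
  show "dif F x \<in> K"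
  proof -
    have 1: "gr_bilinear A B W (\<lambda>i a j b. 1 \<odot>\<^bsub>W\<^esub> t (i + - 1) (dif A a) (j + 0) b)"
      by (rule t_map[OF A.dif_klin _ id_klin(2)]) (use A.dif_degree in auto)
    have 2: "gr_bilinear A B W (\<lambda>i a j b. ksign i \<odot>\<^bsub>W\<^esub> t (i + 0) a (j + - 1) (dif B b))"
      by (rule t_map[OF id_klin(1) _ B.dif_klin]) (use B.dif_degree in auto)
    have "gr_bilinear A B W (\<lambda>i a j b. K +>\<^bsub>F\<^esub> dif F (bvec ((i, a), (j, b))))"
      using gr_bilinear_plus[OF 1 2 W_kmodule]
      by (simp add: gr_bilinear_def tw.dif_bvec proj_deriv A.gr_add A.gr_smult B.gr_add B.gr_smult
          t_closed[OF A.dif_degree])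
    from K_zero[OF klin_comp[OF tw.T_dif_klin proj_klin] W_kmodule this x]
    show ?thesis using proj_zero_iff klinD(1)[OF tw.T_dif_klin cl[OF x]] by simp
  qed
next
  show "dif F (dif F f) \<in> K" if "f \<in> gr F i" for f i
    by (rule tw.dif_dif_mem[OF K_sub _ tw.T.gr_closed[OF that]])
      (auto simp: tensor_basis_def dif_dif_basis)
  show "dif F (f \<otimes>\<^bsub>F\<^esub> g) \<ominus>\<^bsub>F\<^esub> (dif F f \<otimes>\<^bsub>F\<^esub> g \<oplus>\<^bsub>F\<^esub> ksign i \<odot>\<^bsub>F\<^esub> (f \<otimes>\<^bsub>F\<^esub> dif F g)) \<in> K"
    if "f \<in> gr F i" "g \<in> gr F j" for f g i j
    by (rule tw.leibniz_mem[OF K_sub _ that(1) tw.T.gr_closed[OF that(2)]])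
      (auto simp: tensor_basis_def tensor_deg_def leibniz_basis)
qed

end

context dga_tensor
begin

sublocale dg_ideal F K by (rule dg_ideal)

lemma W_dg_algebra: "dg_algebra W"
  using quot_dg_algebra by (simp add: tensor_dga_def)

end

sublocale dga_tensor \<subseteq> W: dg_algebra W by (rule W_dg_algebra)

context dga_tensor
begin

lemma W_gr: "gr W n = (\<lambda>x. K +>\<^bsub>F\<^esub> x) ` gr F n"
  by (simp add: tensor_dga_def quot_gr)

lemma W_carrier: "carrier W = (\<lambda>x. K +>\<^bsub>F\<^esub> x) ` carrier F"
  by (simp add: tensor_dga_def tw.T.quot_carrier[OF K_sub])

lemma t_gr: "\<lbrakk>a \<in> gr A i; b \<in> gr B j\<rbrakk> \<Longrightarrow> t i a j b \<in> gr W (i + j)"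
  using tw.bvec_gr[OF basisI] by (auto simp: W_gr t_def tensor_deg_def)

lemma W_one: "\<one>\<^bsub>W\<^esub> = t 0 \<one>\<^bsub>A\<^esub> 0 \<one>\<^bsub>B\<^esub>"
  using quot_one tw.T_simps(2) by (simp add: tensor_dga_def t_def)

lemma t_mult:
  assumes "a \<in> gr A i" "b \<in> gr B j" "a' \<in> gr A i'" "b' \<in> gr B j'"
  shows "t i a j b \<otimes>\<^bsub>W\<^esub> t i' a' j' b' = ksign (j * i') \<odot>\<^bsub>W\<^esub> t (i + i') (a \<otimes>\<^bsub>A\<^esub> a') (j + j') (b \<otimes>\<^bsub>B\<^esub> b')"
  using quot_mult[OF bv_closed[OF assms(1,2)] bv_closed[OF assms(3,4)]] proj_mult_bvec[OF assms]
  by (simp add: t_def tensor_dga_def)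

lemma t_dif:
  assumes "a \<in> gr A i" "b \<in> gr B j"
  shows "dif W (t i a j b) = t (i - 1) (dif A a) j b \<oplus>\<^bsub>W\<^esub> ksign i \<odot>\<^bsub>W\<^esub> t i a (j - 1) (dif B b)"
  using quot_dif[OF bv_closed[OF assms]] proj_deriv[OF assms]
  by (simp add: t_def tensor_dga_def tw.dif_bvec)

text \<open>
  A homogeneous element of degree \<open>n\<close> is a sum of pure tensors of total degree \<open>n\<close>.
\<close>

lemma W_gr_mem:
  assumes g: "klin W N g" and N: "kmodule N" and H: "submodule H ground N" and x: "x \<in> gr W n"
    and t: "\<And>i a j b. \<lbrakk>a \<in> gr A i; b \<in> gr B j; i + j = n\<rbrakk> \<Longrightarrow> g (t i a j b) \<in> H"
  shows "g x \<in> H"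
proof -
  obtain f where f: "f \<in> free_vec {q \<in> tensor_basis A B. tensor_deg q = n}" "x = K +>\<^bsub>F\<^esub> f"
    using x by (auto simp: W_gr tw.T_simps(6))
  show ?thesis
    unfolding f(2)
    by (rule tw.klin_bvec_mem[OF klin_comp[OF proj_klin g] N H _ _ f(1)])
      (auto simp: tensor_basis_def tensor_deg_def t_eq t)
qed

lemma W_gr_klin_eq:
  assumes g: "klin W N g" and h: "klin W N h" and N: "kmodule N" and x: "x \<in> gr W n"
    and t: "\<And>i a j b. \<lbrakk>a \<in> gr A i; b \<in> gr B j; i + j = n\<rbrakk> \<Longrightarrow> g (t i a j b) = h (t i a j b)"
  shows "g x = h x"
proof -
  interpret N: kmodule N by fact
  have "g x \<ominus>\<^bsub>N\<^esub> h x \<in> {\<zero>\<^bsub>N\<^esub>}"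
  proof (rule W_gr_mem[OF klin_minus[OF g h N] N _ x])
    show "submodule {\<zero>\<^bsub>N\<^esub>} ground N" by (rule N.ksubmoduleI) auto
    show "g (t i a j b) \<ominus>\<^bsub>N\<^esub> h (t i a j b) \<in> {\<zero>\<^bsub>N\<^esub>}" if "a \<in> gr A i" "b \<in> gr B j" "i + j = n" for i a j b
      using t[OF that] klinD(1)[OF h t_closed[OF that(1,2)]] by (simp add: N.kdiff_zero_iff)
  qed
  then show ?thesis
    using klinD(1)[OF g W.gr_closed[OF x]] klinD(1)[OF h W.gr_closed[OF x]] by (simp add: N.kdiff_zero_iff)
qed

lemma W_klin_eq:
  assumes g: "klin W N g" and h: "klin W N h" and N: "kmodule N" and x: "x \<in> carrier W"
    and t: "\<And>i a j b. \<lbrakk>a \<in> gr A i; b \<in> gr B j\<rbrakk> \<Longrightarrow> g (t i a j b) = h (t i a j b)"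
  shows "g x = h x"
  by (rule W.klin_gr_eq[OF g h N _ x]) (rule W_gr_klin_eq[OF g h N _ t])

lemma lift_lin:
  assumes N: "kmodule N" and f: "gr_bilinear A B N f"
  obtains h where "klin W N h" "\<And>i a j b. \<lbrakk>a \<in> gr A i; b \<in> gr B j\<rbrakk> \<Longrightarrow> h (t i a j b) = f i a j b"
proof -
  let ?\<phi> = "\<lambda>((i, a), (j, b)). f i a j b"
  have \<phi>: "\<And>x. x \<in> tensor_basis A B \<Longrightarrow> ?\<phi> x \<in> carrier N"
    using gr_bilinearD(1)[OF f] by (auto simp: tensor_basis_def)
  have lin: "klin F N (tw.fext N ?\<phi>)" by (rule tw.fext_klin[OF N \<phi>])
  have bv: "tw.fext N ?\<phi> (bvec ((i, a), (j, b))) = f i a j b" if "a \<in> gr A i" "b \<in> gr B j" for i a j b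
    using tw.fext_bvec[OF N \<phi> basisI[OF that]] by simp
  have bil: "gr_bilinear A B N (\<lambda>i a j b. tw.fext N ?\<phi> (bvec ((i, a), (j, b))))"
    using f by (simp add: gr_bilinear_def bv A.gr_add A.gr_smult B.gr_add B.gr_smult)
  obtain h where "klin (dg_quot F K) N h" "\<And>x. x \<in> carrier F \<Longrightarrow> h (K +>\<^bsub>F\<^esub> x) = tw.fext N ?\<phi> x"
    using tw.T.klin_quot[OF K_sub lin N K_zero[OF lin N bil]] by blast
  then show thesis
    by (intro that[of h]) (simp_all add: tensor_dga_def t_def bv_closed bv)
qed

text \<open>
  Morphisms whose images commute in the graded sense induce a morphism on the tensor product: moving
  \<open>v b\<close> past \<open>u a'\<close> produces exactly the Koszul sign in the product of two pure tensors.
\<close>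

lemma lift_dga:
  assumes P: "predg_algebra P" and u: "u \<in> dga_hom A P" and v: "v \<in> dga_hom B P"
    and comm: "\<And>i a j b. \<lbrakk>a \<in> gr A i; b \<in> gr B j\<rbrakk> \<Longrightarrow> v b \<otimes>\<^bsub>P\<^esub> u a = ksign (i * j) \<odot>\<^bsub>P\<^esub> (u a \<otimes>\<^bsub>P\<^esub> v b)"
    and lb: "\<And>i x y. \<lbrakk>x \<in> gr P i; y \<in> carrier P\<rbrakk> \<Longrightarrow>
      dif P (x \<otimes>\<^bsub>P\<^esub> y) = (dif P x \<otimes>\<^bsub>P\<^esub> y) \<oplus>\<^bsub>P\<^esub> (ksign i \<odot>\<^bsub>P\<^esub> (x \<otimes>\<^bsub>P\<^esub> dif P y))"
  obtains h where "h \<in> dga_hom W P" "\<And>i a j b. \<lbrakk>a \<in> gr A i; b \<in> gr B j\<rbrakk> \<Longrightarrow> h (t i a j b) = u a \<otimes>\<^bsub>P\<^esub> v b"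
proof -
  interpret P: predg_algebra P by fact
  note U = dga_homD[OF u] and V = dga_homD[OF v]
  have uc: "\<And>a i. a \<in> gr A i \<Longrightarrow> u a \<in> carrier P" and vc: "\<And>b j. b \<in> gr B j \<Longrightarrow> v b \<in> carrier P"
    using U(7) V(7) A.gr_closed B.gr_closed by blast+
  have bil: "gr_bilinear A B P (\<lambda>i a j b. u a \<otimes>\<^bsub>P\<^esub> v b)"
    unfolding gr_bilinear_def
    by (intro allI ballI conjI)
      (simp_all add: uc vc klinD[OF U(1)] klinD[OF V(1)] A.gr_closed[of _ i for i] B.gr_closed[of _ j for j]
        P.l_distr P.r_distr P.smult_mult_l P.smult_mult_r)
  obtain h where h: "klin W P h" and ht: "\<And>i a j b. \<lbrakk>a \<in> gr A i; b \<in> gr B j\<rbrakk> \<Longrightarrow> h (t i a j b) = u a \<otimes>\<^bsub>P\<^esub> v b"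
    using lift_lin[OF P.kmodule bil] by blast
  let ?h = "restrict h (carrier W)"
  have rl: "klin W P ?h" by (rule klin_restrict[OF W_kmodule h])
  have rt: "?h (t i a j b) = u a \<otimes>\<^bsub>P\<^esub> v b" if "a \<in> gr A i" "b \<in> gr B j" for i a j b
    using ht[OF that] t_closed[OF that] by simp
  note lin = klinD[OF rl]
  have "?h \<in> dga_hom W P"
  proof (rule dga_homI[OF W.predg_algebra P rl])
    show "?h \<one>\<^bsub>W\<^esub> = \<one>\<^bsub>P\<^esub>"
      using rt[OF A.one_degree B.one_degree] by (simp add: W_one U V)
    show "?h x \<in> gr P n" if x: "x \<in> gr W n" for x n
      by (rule W_gr_mem[OF rl P.kmodule P.gr_submodule x]) (use rt P.mult_degree U(5) V(5) in force)
    have tt: "?h (t i a j b \<otimes>\<^bsub>W\<^esub> t i' a' j' b') = ?h (t i a j b) \<otimes>\<^bsub>P\<^esub> ?h (t i' a' j' b')"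
      if m: "a \<in> gr A i" "b \<in> gr B j" "a' \<in> gr A i'" "b' \<in> gr B j'" for i a j b i' a' j' b'
    proof -
      have c: "a \<in> carrier A" "b \<in> carrier B" "a' \<in> carrier A" "b' \<in> carrier B"
        using m A.gr_closed B.gr_closed by blast+
      note pc = uc[OF m(1)] vc[OF m(2)] uc[OF m(3)] vc[OF m(4)]
      have "u a \<otimes>\<^bsub>P\<^esub> v b \<otimes>\<^bsub>P\<^esub> (u a' \<otimes>\<^bsub>P\<^esub> v b') = u a \<otimes>\<^bsub>P\<^esub> (v b \<otimes>\<^bsub>P\<^esub> u a') \<otimes>\<^bsub>P\<^esub> v b'"
        using pc by (simp add: P.m_assoc)
      also have "\<dots> = ksign (j * i') \<odot>\<^bsub>P\<^esub> (u (a \<otimes>\<^bsub>A\<^esub> a') \<otimes>\<^bsub>P\<^esub> v (b \<otimes>\<^bsub>B\<^esub> b'))"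
        using pc c by (simp add: comm[OF m(3,2)] P.smult_mult_l P.smult_mult_r P.m_assoc U V mult.commute)
      finally show ?thesis
        using m by (simp add: rt t_mult lin t_closed A.mult_degree B.mult_degree del: restrict_apply)
    qed
    have 1: "?h (t i a j b \<otimes>\<^bsub>W\<^esub> y) = ?h (t i a j b) \<otimes>\<^bsub>P\<^esub> ?h y" if ab: "a \<in> gr A i" "b \<in> gr B j" and y: "y \<in> carrier W" for i a j b y
      by (rule W_klin_eq[OF klin_comp[OF W.mult_klin_l[OF t_closed[OF ab]] rl]
            klin_comp[OF rl P.mult_klin_l[OF lin(1)[OF t_closed[OF ab]]]] P.kmodule y])
        (rule tt[OF ab])
    show "?h (x \<otimes>\<^bsub>W\<^esub> y) = ?h x \<otimes>\<^bsub>P\<^esub> ?h y" if "x \<in> gr W i" "y \<in> gr W j" for x y i j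
      by (rule W_klin_eq[OF klin_comp[OF W.mult_klin_r[OF W.gr_closed[OF that(2)]] rl]
            klin_comp[OF rl P.mult_klin_r[OF lin(1)[OF W.gr_closed[OF that(2)]]]] P.kmodule W.gr_closed[OF that(1)]])
        (rule 1[OF _ _ W.gr_closed[OF that(2)]])
    show "?h (dif W x) = dif P (?h x)" if x: "x \<in> gr W i" for x i
    proof (rule W_klin_eq[OF klin_comp[OF W.dif_klin rl] klin_comp[OF rl P.dif_klin] P.kmodule W.gr_closed[OF x]])
      fix i a j b assume ab: "a \<in> gr A i" "b \<in> gr B j"
      have d: "dif A a \<in> gr A (i - 1)" "dif B b \<in> gr B (j - 1)"
        using ab A.dif_degree B.dif_degree by blast+
      have "dif P (u a \<otimes>\<^bsub>P\<^esub> v b) = u (dif A a) \<otimes>\<^bsub>P\<^esub> v b \<oplus>\<^bsub>P\<^esub> ksign i \<odot>\<^bsub>P\<^esub> (u a \<otimes>\<^bsub>P\<^esub> v (dif B b))"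
        using lb[OF U(5)[OF ab(1)] vc[OF ab(2)]] A.gr_closed[OF ab(1)] B.gr_closed[OF ab(2)] by (simp add: U(6) V(6))
      then show "?h (dif W (t i a j b)) = dif P (?h (t i a j b))"
        using ab d by (simp add: t_dif lin t_closed rt del: restrict_apply)
    qed
  qed simp
  then show thesis using rt that by blast
qed

text \<open>
  The maps \<open>a \<mapsto> a \<otimes> 1\<close> and \<open>b \<mapsto> 1 \<otimes> b\<close>. The first is written with \<open>tensor_elem\<close>, because composed with
  \<open>S \<rightarrow> E\<close> it is the structure map over \<open>S\<close> in the definition of the representation functor.
\<close>

definition il where "il = (\<lambda>a\<in>carrier A. tensor_elem A B a \<one>\<^bsub>B\<^esub>)"
definition ir where "ir = (\<lambda>b\<in>carrier B. hext B W (\<lambda>j y. t 0 \<one>\<^bsub>A\<^esub> j y) b)"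

lemma hlin_t_left: "b \<in> gr B j \<Longrightarrow> hlin A W (\<lambda>i a. t i a j b)"
  using gr_bilinearD[OF t_bilinear] by (simp add: hlin_def)

lemma hlin_t_right: "a \<in> gr A i \<Longrightarrow> hlin B W (\<lambda>j b. t i a j b)"
  using gr_bilinearD[OF t_bilinear] by (simp add: hlin_def)

lemma tensor_elem_one:
  assumes "a \<in> carrier A"
  shows "tensor_elem A B a \<one>\<^bsub>B\<^esub> = hext A W (\<lambda>i x. t i x 0 \<one>\<^bsub>B\<^esub>) a"
  unfolding tensor_elem_def hext_def[of A W] t_eq
  by (rule W.finsum_cong')
    (use assms A.hcomp_gr B.hext_homog[OF W_kmodule hlin_t_right B.one_degree] t_closed[OF _ B.one_degree] in auto)

lemma il_klin: "klin A W il"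
proof -
  have "klin A W (restrict (hext A W (\<lambda>i x. t i x 0 \<one>\<^bsub>B\<^esub>)) (carrier A))"
    by (rule klin_restrict[OF A.kmodule A.hext_klin[OF W_kmodule hlin_t_left[OF B.one_degree]]])
  also have "restrict (hext A W (\<lambda>i x. t i x 0 \<one>\<^bsub>B\<^esub>)) (carrier A) = il"
    unfolding il_def by (rule restrict_ext) (simp add: tensor_elem_one)
  finally show ?thesis .
qed

lemma ir_klin: "klin B W ir"
  unfolding ir_def by (rule klin_restrict[OF B.kmodule B.hext_klin[OF W_kmodule hlin_t_right[OF A.one_degree]]])

lemma il_gr: "a \<in> gr A i \<Longrightarrow> il a = t i a 0 \<one>\<^bsub>B\<^esub>"
  using A.hext_homog[OF W_kmodule hlin_t_left[OF B.one_degree], of a i] A.gr_closed by (simp add: il_def tensor_elem_one)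

lemma ir_gr: "b \<in> gr B j \<Longrightarrow> ir b = t 0 \<one>\<^bsub>A\<^esub> j b"
  using B.hext_homog[OF W_kmodule hlin_t_right[OF A.one_degree], of b j] B.gr_closed by (simp add: ir_def)

lemma il_hom: "il \<in> dga_hom A W"
proof (rule dga_homI[OF A.predg_algebra W.predg_algebra il_klin])
  show "il \<in> extensional (carrier A)" by (simp add: il_def)
  show "il \<one>\<^bsub>A\<^esub> = \<one>\<^bsub>W\<^esub>" by (simp add: il_gr[OF A.one_degree] W_one)
  fix i j x y assume x: "x \<in> gr A i"
  show "il x \<in> gr W i" using t_gr[OF x B.one_degree] by (simp add: il_gr[OF x])
  show "il (dif A x) = dif W (il x)"
    using t_closed[OF A.dif_degree[OF x] B.one_degree]
    by (simp add: il_gr[OF x] il_gr[OF A.dif_degree[OF x]] t_dif[OF x B.one_degree] B.dif_one t_zero'[OF x])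
  assume y: "y \<in> gr A j"
  show "il (x \<otimes>\<^bsub>A\<^esub> y) = il x \<otimes>\<^bsub>W\<^esub> il y"
    using t_closed[OF A.mult_degree[OF x y] B.one_degree]
    by (simp add: il_gr[OF x] il_gr[OF y] il_gr[OF A.mult_degree[OF x y]] t_mult[OF x B.one_degree y B.one_degree])
qed

lemma ir_hom: "ir \<in> dga_hom B W"
proof (rule dga_homI[OF B.predg_algebra W.predg_algebra ir_klin])
  show "ir \<in> extensional (carrier B)" by (simp add: ir_def)
  show "ir \<one>\<^bsub>B\<^esub> = \<one>\<^bsub>W\<^esub>" by (simp add: ir_gr[OF B.one_degree] W_one)
  fix i j x y assume x: "x \<in> gr B i"
  show "ir x \<in> gr W i" using t_gr[OF A.one_degree x] by (simp add: ir_gr[OF x])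
  show "ir (dif B x) = dif W (ir x)"
    using t_closed[OF A.one_degree B.dif_degree[OF x]]
    by (simp add: ir_gr[OF x] ir_gr[OF B.dif_degree[OF x]] t_dif[OF A.one_degree x] A.dif_one t_zero[OF x])
  assume y: "y \<in> gr B j"
  show "ir (x \<otimes>\<^bsub>B\<^esub> y) = ir x \<otimes>\<^bsub>W\<^esub> ir y"
    using t_closed[OF A.one_degree B.mult_degree[OF x y]]
    by (simp add: ir_gr[OF x] ir_gr[OF y] ir_gr[OF B.mult_degree[OF x y]] t_mult[OF A.one_degree x A.one_degree y])
qed

lemma il_ir_mult:
  assumes "a \<in> gr A i" "b \<in> gr B j"
  shows "il a \<otimes>\<^bsub>W\<^esub> ir b = t i a j b" "ir b \<otimes>\<^bsub>W\<^esub> il a = ksign (i * j) \<odot>\<^bsub>W\<^esub> t i a j b"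
  using t_mult[OF assms(1) B.one_degree A.one_degree assms(2)] t_mult[OF A.one_degree assms(2) assms(1) B.one_degree]
    assms A.gr_closed[OF assms(1)] B.gr_closed[OF assms(2)]
  by (simp_all add: il_gr[OF assms(1)] ir_gr[OF assms(2)] t_closed mult.commute)

end

text \<open>
  The explicit formula for \<open>id \<otimes> g\<close> agrees with the morphism induced by \<open>a \<mapsto> a \<otimes> 1\<close> and
  \<open>b \<mapsto> 1 \<otimes> g b\<close>, since both are linear and have the same values on pure tensors.
\<close>

lemma tensor_map_right:
  fixes A :: "('k::field_char_0, 'a, 'm) dg_scheme" and B :: "('k, 'b, 'n) dg_scheme" and B' :: "('k, 'c, 'p) dg_scheme"
  assumes "dg_algebra A" "dg_algebra B" "dg_algebra B'" and g: "g \<in> dga_hom B B'"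
  shows "tensor_map_right A B B' g \<in> dga_hom (tensor_dga A B) (tensor_dga A B')"
    "\<And>i a j b. \<lbrakk>a \<in> gr A i; b \<in> gr B j\<rbrakk> \<Longrightarrow>
      tensor_map_right A B B' g (dga_tensor.t A B i a j b) = dga_tensor.t A B' i a j (g b)"
proof -
  interpret T: dga_tensor A B by (intro dga_tensor.intro assms)
  interpret T': dga_tensor A B' by (intro dga_tensor.intro assms)
  note G = dga_homD[OF g]
  have c: "compose (carrier B) T'.ir g \<in> dga_hom B T'.W"
    by (rule dga_hom_comp[OF T.B.predg_algebra T'.B.predg_algebra T'.W.predg_algebra g T'.ir_hom])
  have ce: "compose (carrier B) T'.ir g b = T'.ir (g b)" if "b \<in> gr B j" for b j
    using T.B.gr_closed[OF that] by (simp add: compose_def)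
  have comm: "compose (carrier B) T'.ir g b \<otimes>\<^bsub>T'.W\<^esub> T'.il a =
      ksign (i * j) \<odot>\<^bsub>T'.W\<^esub> (T'.il a \<otimes>\<^bsub>T'.W\<^esub> compose (carrier B) T'.ir g b)"
    if ab: "a \<in> gr A i" "b \<in> gr B j" for i a j b
    using T'.il_ir_mult[OF ab(1) G(5)[OF ab(2)]] by (simp add: ce[OF ab(2)])
  obtain h where h: "h \<in> dga_hom T.W T'.W"
    and ht: "\<And>i a j b. \<lbrakk>a \<in> gr A i; b \<in> gr B j\<rbrakk> \<Longrightarrow> h (T.t i a j b) = T'.il a \<otimes>\<^bsub>T'.W\<^esub> compose (carrier B) T'.ir g b"
    using T.lift_dga[OF T'.W.predg_algebra T'.il_hom c comm T'.W.leibniz] by blast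
  have ht': "h (T.t i a j b) = T'.t i a j (g b)" if "a \<in> gr A i" "b \<in> gr B j" for i a j b
    using ht[OF that] T'.il_ir_mult(1)[OF that(1) G(5)[OF that(2)]] by (simp add: ce[OF that(2)])
  note hl = dga_homD(1)[OF h]
  let ?L = "lin_ext (\<lambda>((i, a), (j, b)). bvec ((i, a), (j, g b))) :: _ \<Rightarrow> _ \<Rightarrow> 'k"
  have Lb: "?L (bvec ((i, a), (j, b))) = bvec ((i, a), (j, g b))" for i a j b by simp
  have Lk: "klin T.F T'.F ?L"
  proof (rule klinI)
    fix x y r assume x: "x \<in> carrier T.F" and y: "y \<in> carrier T.F"
    note xy = x[unfolded T.tw.T_simps(1)] y[unfolded T.tw.T_simps(1)]
    show "?L (x \<oplus>\<^bsub>T.F\<^esub> y) = ?L x \<oplus>\<^bsub>T'.F\<^esub> ?L y" "?L (r \<odot>\<^bsub>T.F\<^esub> x) = r \<odot>\<^bsub>T'.F\<^esub> ?L x"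
      using lin_ext_add[OF xy] lin_ext_smult[OF xy(1)] by (simp_all add: T.F_simps T'.F_simps)
  next
    fix x assume x: "x \<in> carrier T.F"
    show "?L x \<in> carrier T'.F"
      unfolding T'.tw.T_simps(1)
      by (rule lin_ext_free[OF x[unfolded T.tw.T_simps(1)]])
        (auto simp: tensor_basis_def G(5) intro!: bvec_free)
  qed
  have eq: "T'.K +>\<^bsub>T'.F\<^esub> ?L f = h (T.K +>\<^bsub>T.F\<^esub> f)" if f: "f \<in> carrier T.F" for f
    by (rule T.tw.klin_bvec_eq[OF klin_comp[OF Lk T'.proj_klin] klin_comp[OF T.proj_klin hl] T'.W_kmodule _ f])
      (auto simp: tensor_basis_def T.t_eq T'.t_eq ht')
  have "tensor_map_right A B B' g q = h q" if q: "q \<in> carrier T.W" for q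
  proof -
    obtain f where f: "f \<in> carrier T.F" "q = T.K +>\<^bsub>T.F\<^esub> f" using q T.W_carrier by auto
    have "(\<Union>f\<in>q. T'.K +>\<^bsub>T'.F\<^esub> ?L f) = T'.K +>\<^bsub>T'.F\<^esub> ?L f"
      unfolding f(2)
    proof (rule T.tw.T.coset_UN[OF T.K_sub f(1)])
      fix y assume y: "y \<in> carrier T.F" "y \<ominus>\<^bsub>T.F\<^esub> f \<in> T.K"
      then have "T.K +>\<^bsub>T.F\<^esub> y = T.K +>\<^bsub>T.F\<^esub> f" using f(1) by (simp add: T.tw.T.coset_eq_iff[OF T.K_sub])
      then show "T'.K +>\<^bsub>T'.F\<^esub> ?L y = T'.K +>\<^bsub>T'.F\<^esub> ?L f" by (simp only: eq[OF y(1)] eq[OF f(1)])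
    qed
    then show ?thesis using q f eq by (simp add: tensor_map_right_def)
  qed
  moreover have "tensor_map_right A B B' g \<in> extensional (carrier T.W)"
    unfolding tensor_map_right_def by (rule restrict_extensional)
  ultimately have "tensor_map_right A B B' g = h"
    using dga_homD(2)[OF h] by (intro extensionalityI) auto
  then show "tensor_map_right A B B' g \<in> dga_hom (tensor_dga A B) (tensor_dga A B')"
    "\<And>i a j b. \<lbrakk>a \<in> gr A i; b \<in> gr B j\<rbrakk> \<Longrightarrow> tensor_map_right A B B' g (T.t i a j b) = T'.t i a j (g b)"
    using h ht' by simp_all
qed

section \<open>The coproduct\<close>

definition word_deriv :: "('x \<Rightarrow> int) \<Rightarrow> ('x \<Rightarrow> 'x) \<Rightarrow> 'x list \<Rightarrow> 'x list \<Rightarrow> 'k::field_char_0"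
  where "word_deriv \<delta> \<tau> u w = (\<Sum>n<length u. ksign (word_deg \<delta> (take n u)) * bvec (u[n := \<tau> (u ! n)]) w)"

lemma free_dga_twisted:
  "free_dga Q \<delta> \<tau> = twisted_alg (lists Q) (word_deg \<delta>) (\<lambda>_ _. 1) (@) [] (word_deriv \<delta> \<tau>)"
  by (simp add: free_dga_def twisted_alg_def word_deriv_def[abs_def])

locale free_words =
  fixes Q :: "'x set" and \<delta> :: "'x \<Rightarrow> int" and \<tau> :: "'x \<Rightarrow> 'x" and ty :: "'k::field_char_0 itself"
  assumes \<tau>: "x \<in> Q \<Longrightarrow> \<tau> x \<in> Q" "x \<in> Q \<Longrightarrow> \<delta> (\<tau> x) = \<delta> x - 1"
begin

abbreviation T :: "('k, 'x list \<Rightarrow> 'k) dg" where "T \<equiv> free_dga Q \<delta> \<tau>"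
abbreviation D :: "'x list \<Rightarrow> 'x list \<Rightarrow> 'k" where "D \<equiv> word_deriv \<delta> \<tau>"

lemma word_deg_simps: "word_deg \<delta> [] = 0" "word_deg \<delta> (x # u) = \<delta> x + word_deg \<delta> u"
  "word_deg \<delta> (u @ v) = word_deg \<delta> u + word_deg \<delta> v"
  by (simp_all add: word_deg_def)

lemma D_degree: "u \<in> lists Q \<Longrightarrow> D u \<in> free_vec {y \<in> lists Q. word_deg \<delta> y = word_deg \<delta> u - 1}"
proof -
  assume u: "u \<in> lists Q"
  have 1: "bvec (u[n := \<tau> (u ! n)]) \<in> free_vec {y \<in> lists Q. word_deg \<delta> y = word_deg \<delta> u - 1}" if "n < length u" for n
  proof (rule bvec_free)
    have n: "u ! n \<in> Q" using u that by (auto simp: in_lists_conv_set)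
    have "word_deg \<delta> (u[n := x]) = word_deg \<delta> u - \<delta> (u ! n) + \<delta> x" for x
      using that by (induction u arbitrary: n) (auto simp: word_deg_simps split: nat.split)
    moreover have "u[n := \<tau> (u ! n)] \<in> lists Q"
      using u n \<tau>(1) set_update_subset_insert[of u n] by (fastforce simp: in_lists_conv_set)
    ultimately show "u[n := \<tau> (u ! n)] \<in> {y \<in> lists Q. word_deg \<delta> y = word_deg \<delta> u - 1}"
      using \<tau>(2)[OF n] by simp
  qed
  have "(\<lambda>w. \<Sum>n<m. ksign (word_deg \<delta> (take n u)) * bvec (u[n := \<tau> (u ! n)]) w) \<in>
      free_vec {y \<in> lists Q. word_deg \<delta> y = word_deg \<delta> u - 1}" if "m \<le> length u" for m
    using that
  proof (induction m)
    case (Suc m)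
    then show ?case
      using free_vec_add[OF Suc.IH free_vec_smult[OF 1]] by simp
  qed (simp add: free_vec_zero)
  from this[of "length u"] show ?thesis by (simp add: word_deriv_def[abs_def])
qed

sublocale tw: twisted_monoid "lists Q" "word_deg \<delta>" "\<lambda>_ _. 1" "(@)" "[]" D
  rewrites "twisted_alg (lists Q) (word_deg \<delta>) (\<lambda>_ _. 1) (@) [] D \<equiv> T"
proof -
  show "twisted_monoid (lists Q) (word_deg \<delta>) (\<lambda>_ _. 1) (@) [] D"
    by unfold_locales (use D_degree in \<open>auto simp: word_deg_simps\<close>)
  show "twisted_alg (lists Q) (word_deg \<delta>) (\<lambda>_ _. 1) (@) [] D \<equiv> T"
    by (simp add: free_dga_twisted)
qed

lemma T_simps': "f \<oplus>\<^bsub>T\<^esub> g = (\<lambda>w. f w + g w)" "r \<odot>\<^bsub>T\<^esub> f = (\<lambda>w. r * f w)" "carrier T = free_vec (lists Q)"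
  "\<one>\<^bsub>T\<^esub> = bvec []"
  by (simp_all add: free_dga_def)

lemma bvec_append: "\<lbrakk>u \<in> lists Q; v \<in> lists Q\<rbrakk> \<Longrightarrow> bvec u \<otimes>\<^bsub>T\<^esub> bvec v = bvec (u @ v)"
  using tw.mult_bvec[of u v] by (simp add: T_simps')

lemma D_short:
  "D [] = (\<lambda>w. 0)" "D [x] = bvec [\<tau> x]"
  "D [x, y] = (\<lambda>w. bvec [\<tau> x, y] w + ksign (\<delta> x) * bvec [x, \<tau> y] w)"
  by (auto simp: fun_eq_iff word_deriv_def word_deg_simps lessThan_Suc)

text \<open>
  Left multiplication by a letter in coordinates. It turns the sum that defines \<open>D\<close> into the
  recursion \<open>D_Cons\<close>, on which all inductions over words are based.
\<close>

definition shift :: "'x \<Rightarrow> ('x list \<Rightarrow> 'k) \<Rightarrow> 'x list \<Rightarrow> 'k"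
  where "shift x f w = (case w of [] \<Rightarrow> 0 | y # w' \<Rightarrow> if y = x then f w' else 0)"

lemma shift_bvec: "shift x (bvec u) = bvec (x # u)"
  by (auto simp: shift_def bvec_def fun_eq_iff split: list.split)

lemma mult_letter:
  assumes "x \<in> Q" "f \<in> carrier T"
  shows "bvec [x] \<otimes>\<^bsub>T\<^esub> f = shift x f"
proof -
  have "f \<in> free_vec (lists Q)" using assms(2) by (simp add: T_simps')
  then show ?thesis
  proof (induction f rule: free_vec_induct)
    case zero
    have "bvec [x] \<otimes>\<^bsub>T\<^esub> \<zero>\<^bsub>T\<^esub> = \<zero>\<^bsub>T\<^esub>" using assms(1) by simp
    then show ?case by (simp add: free_dga_def shift_def fun_eq_iff split: list.split)
  next
    case (add r u f)
    have c: "bvec [x] \<in> carrier T" "r \<odot>\<^bsub>T\<^esub> bvec u \<in> carrier T" "f \<in> carrier T" "bvec u \<in> carrier T"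
      using add assms by (simp_all add: T_simps' free_vec_smult)
    have "bvec [x] \<otimes>\<^bsub>T\<^esub> (r \<odot>\<^bsub>T\<^esub> bvec u \<oplus>\<^bsub>T\<^esub> f) = r \<odot>\<^bsub>T\<^esub> shift x (bvec u) \<oplus>\<^bsub>T\<^esub> shift x f"
      using c add assms by (simp add: tw.T.r_distr tw.T.smult_mult_r bvec_append shift_bvec del: T_simps')
    then show ?case by (auto simp: T_simps' shift_def fun_eq_iff split: list.split)
  qed
qed

lemma D_closed [simp]: "u \<in> lists Q \<Longrightarrow> D u \<in> carrier T"
  using klinD(1)[OF tw.T_dif_klin, of "bvec u"] by (simp add: tw.dif_bvec)

lemma D_Cons:
  assumes "x \<in> Q" "u \<in> lists Q"
  shows "D (x # u) = bvec [\<tau> x] \<otimes>\<^bsub>T\<^esub> bvec u \<oplus>\<^bsub>T\<^esub> ksign (\<delta> x) \<odot>\<^bsub>T\<^esub> (bvec [x] \<otimes>\<^bsub>T\<^esub> D u)"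
proof
  fix w
  have "D (x # u) w = bvec (\<tau> x # u) w +
      (\<Sum>n<length u. ksign (\<delta> x + word_deg \<delta> (take n u)) * bvec (x # u[n := \<tau> (u ! n)]) w)"
    by (simp add: word_deriv_def sum.lessThan_Suc_shift word_deg_simps del: sum.lessThan_Suc)
  also have "\<dots> = bvec (\<tau> x # u) w + ksign (\<delta> x) * shift x (D u) w"
    unfolding shift_bvec[symmetric]
    by (simp add: ksign_add shift_def word_deriv_def sum_distrib_left mult.assoc split: list.split)
  finally show "D (x # u) w = (bvec [\<tau> x] \<otimes>\<^bsub>T\<^esub> bvec u \<oplus>\<^bsub>T\<^esub> ksign (\<delta> x) \<odot>\<^bsub>T\<^esub> (bvec [x] \<otimes>\<^bsub>T\<^esub> D u)) w"
    using assms \<tau>(1) by (simp add: mult_letter[OF assms(1) D_closed[OF assms(2)]] bvec_append T_simps')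
qed

lemma D_append:
  assumes "u \<in> lists Q" "v \<in> lists Q"
  shows "D (u @ v) = D u \<otimes>\<^bsub>T\<^esub> bvec v \<oplus>\<^bsub>T\<^esub> ksign (word_deg \<delta> u) \<odot>\<^bsub>T\<^esub> (bvec u \<otimes>\<^bsub>T\<^esub> D v)"
  using assms(1)
proof (induction u)
  case Nil
  have "D [] = \<zero>\<^bsub>T\<^esub>" by (simp add: D_short free_dga_def)
  then show ?case using assms(2) tw.mult_e[of "D v"] by (simp add: word_deg_simps del: T_simps')
next
  case (Cons x u)
  have c [simp]: "bvec [\<tau> x] \<in> carrier T" "bvec [x] \<in> carrier T" "bvec u \<in> carrier T" "bvec v \<in> carrier T"
    "D u \<in> carrier T" "D v \<in> carrier T"
    using Cons assms \<tau>(1) by simp_all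
  have u: "u \<in> lists Q" "x \<in> Q" using Cons by auto
  have 1: "bvec (u @ v) = bvec u \<otimes>\<^bsub>T\<^esub> bvec v" "bvec (x # u) = bvec [x] \<otimes>\<^bsub>T\<^esub> bvec u"
    using bvec_append[of u v] bvec_append[of "[x]" u] u assms by simp_all
  have "D ((x # u) @ v) = bvec [\<tau> x] \<otimes>\<^bsub>T\<^esub> (bvec u \<otimes>\<^bsub>T\<^esub> bvec v) \<oplus>\<^bsub>T\<^esub> ksign (\<delta> x) \<odot>\<^bsub>T\<^esub>
      (bvec [x] \<otimes>\<^bsub>T\<^esub> (D u \<otimes>\<^bsub>T\<^esub> bvec v \<oplus>\<^bsub>T\<^esub> ksign (word_deg \<delta> u) \<odot>\<^bsub>T\<^esub> (bvec u \<otimes>\<^bsub>T\<^esub> D v)))"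
    using D_Cons[of x "u @ v"] Cons.IH u assms by (simp add: 1)
  also have "\<dots> = D (x # u) \<otimes>\<^bsub>T\<^esub> bvec v \<oplus>\<^bsub>T\<^esub> ksign (word_deg \<delta> (x # u)) \<odot>\<^bsub>T\<^esub> (bvec (x # u) \<otimes>\<^bsub>T\<^esub> D v)"
    by (simp add: D_Cons[OF u(2,1)] 1(2) tw.T.l_distr tw.T.r_distr tw.T.smult_mult_l tw.T.smult_mult_r
        tw.T.ksmult_r_add tw.T.ksmult_assoc word_deg_simps ksign_add tw.T.M.a_assoc tw.T.m_assoc del: T_simps')
  finally show ?case .
qed

lemma T_leibniz:
  assumes "f \<in> gr T i" "g \<in> carrier T"
  shows "dif T (f \<otimes>\<^bsub>T\<^esub> g) = (dif T f \<otimes>\<^bsub>T\<^esub> g) \<oplus>\<^bsub>T\<^esub> (ksign i \<odot>\<^bsub>T\<^esub> (f \<otimes>\<^bsub>T\<^esub> dif T g))"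
proof -
  have d: "dif T f \<in> carrier T" "dif T g \<in> carrier T" "f \<in> carrier T" "dif T (f \<otimes>\<^bsub>T\<^esub> g) \<in> carrier T"
    using klinD(1)[OF tw.T_dif_klin] tw.T.gr_closed[OF assms(1)] assms(2) by (simp_all add: tw.mult_closed)
  have "dif T (f \<otimes>\<^bsub>T\<^esub> g) \<ominus>\<^bsub>T\<^esub> ((dif T f \<otimes>\<^bsub>T\<^esub> g) \<oplus>\<^bsub>T\<^esub> (ksign i \<odot>\<^bsub>T\<^esub> (f \<otimes>\<^bsub>T\<^esub> dif T g))) \<in> {\<zero>\<^bsub>T\<^esub>}"
  proof (rule tw.leibniz_mem[OF _ _ assms])
    show "submodule {\<zero>\<^bsub>T\<^esub>} ground T" by (rule tw.T.ksubmoduleI) auto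
    fix x y assume xy: "x \<in> lists Q" "y \<in> lists Q"
    then show "dif T (bvec x \<otimes>\<^bsub>T\<^esub> bvec y) \<ominus>\<^bsub>T\<^esub> (D x \<otimes>\<^bsub>T\<^esub> bvec y \<oplus>\<^bsub>T\<^esub>
        ksign (word_deg \<delta> x) \<odot>\<^bsub>T\<^esub> (bvec x \<otimes>\<^bsub>T\<^esub> D y)) \<in> {\<zero>\<^bsub>T\<^esub>}"
      using D_append[OF xy] by (simp add: bvec_append tw.dif_bvec tw.T.kdiff_zero_iff tw.mult_closed del: T_simps')
  qed
  then show ?thesis
    using d assms by (simp add: tw.T.kdiff_zero_iff tw.mult_closed)
qed

text \<open>
  The square of an odd derivation is again a derivation, as the mixed terms cancel; so it is enough that
  it sends letters into \<open>I\<close>.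
\<close>

lemma dif_dif_word:
  assumes I: "ideal I T" "submodule I ground T" and letter: "\<And>x. x \<in> Q \<Longrightarrow> bvec [\<tau> (\<tau> x)] \<in> I" and u: "u \<in> lists Q"
  shows "dif T (D u) \<in> I"
  using u
proof (induction u)
  case Nil
  have "D [] = \<zero>\<^bsub>T\<^esub>" by (simp add: D_short free_dga_def)
  then show ?case
    using klin_zero[OF tw.T_dif_klin tw.T_kmodule tw.T_kmodule] tw.T.ksubmoduleD(3)[OF I(2)] by simp
next
  case (Cons x u)
  interpret I: ideal I T by fact
  have u: "u \<in> lists Q" "x \<in> Q" using Cons by auto
  have c [simp]: "bvec [\<tau> x] \<in> carrier T" "bvec [\<tau> (\<tau> x)] \<in> carrier T" "bvec [x] \<in> carrier T" "bvec u \<in> carrier T"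
    "D u \<in> carrier T" "dif T (D u) \<in> carrier T"
    using Cons \<tau>(1) klinD(1)[OF tw.T_dif_klin] by simp_all
  have g: "bvec [\<tau> x] \<in> gr T (\<delta> x - 1)" "bvec [x] \<in> gr T (\<delta> x)"
    using tw.bvec_gr[of "[\<tau> x]"] tw.bvec_gr[of "[x]"] u \<tau> by (simp_all add: word_deg_simps)
  have "dif T (D (x # u)) = (bvec [\<tau> (\<tau> x)] \<otimes>\<^bsub>T\<^esub> bvec u \<oplus>\<^bsub>T\<^esub> ksign (\<delta> x - 1) \<odot>\<^bsub>T\<^esub> (bvec [\<tau> x] \<otimes>\<^bsub>T\<^esub> D u)) \<oplus>\<^bsub>T\<^esub>
      ksign (\<delta> x) \<odot>\<^bsub>T\<^esub> (bvec [\<tau> x] \<otimes>\<^bsub>T\<^esub> D u \<oplus>\<^bsub>T\<^esub> ksign (\<delta> x) \<odot>\<^bsub>T\<^esub> (bvec [x] \<otimes>\<^bsub>T\<^esub> dif T (D u)))"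
    by (simp add: D_Cons[OF u(2,1)] klinD[OF tw.T_dif_klin] T_leibniz[OF g(1)] T_leibniz[OF g(2)] tw.dif_bvec D_short
        del: T_simps')
  also have "\<dots> = bvec [\<tau> (\<tau> x)] \<otimes>\<^bsub>T\<^esub> bvec u \<oplus>\<^bsub>T\<^esub> bvec [x] \<otimes>\<^bsub>T\<^esub> dif T (D u)"
  proof -
    have 1: "ksign (\<delta> x - 1) \<odot>\<^bsub>T\<^esub> z \<oplus>\<^bsub>T\<^esub> ksign (\<delta> x) \<odot>\<^bsub>T\<^esub> z = \<zero>\<^bsub>T\<^esub>" if "z \<in> carrier T" for z
      using that tw.T.ksmult_add[OF that, of "- ksign (\<delta> x)" "ksign (\<delta> x)"] by (simp del: T_simps')
    have 2: "p \<oplus>\<^bsub>T\<^esub> q \<oplus>\<^bsub>T\<^esub> (r \<oplus>\<^bsub>T\<^esub> s) = p \<oplus>\<^bsub>T\<^esub> (q \<oplus>\<^bsub>T\<^esub> r) \<oplus>\<^bsub>T\<^esub> s"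
      if "p \<in> carrier T" "q \<in> carrier T" "r \<in> carrier T" "s \<in> carrier T" for p q r s
      using that by (simp add: tw.T.M.a_assoc del: T_simps')
    show ?thesis
      by (simp add: tw.T.ksmult_r_add tw.T.ksmult_assoc 1 2 del: T_simps' ksign_simps(3))
  qed
  finally show ?case
    using letter[OF u(2)] Cons.IH u I.I_l_closed I.I_r_closed I.a_closed by simp
qed

definition word_eval :: "('k, 'b, 'n) dg_scheme \<Rightarrow> ('x \<Rightarrow> 'b) \<Rightarrow> 'x list \<Rightarrow> 'b"
  where "word_eval P \<psi> u = foldr (\<lambda>x r. \<psi> x \<otimes>\<^bsub>P\<^esub> r) u \<one>\<^bsub>P\<^esub>"

lemma word_eval_simps [simp]: "word_eval P \<psi> [] = \<one>\<^bsub>P\<^esub>" "word_eval P \<psi> (x # u) = \<psi> x \<otimes>\<^bsub>P\<^esub> word_eval P \<psi> u"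
  by (simp_all add: word_eval_def)

text \<open>
  The free algebra maps to \<open>P\<close> by any assignment on letters that respects degrees. Compatibility
  with the differentials has to be required on letters only, as both composites satisfy the Leibniz rule.
\<close>

lemma eval_dga_hom:
  assumes P: "dg_algebra P" and \<psi>: "\<And>x. x \<in> Q \<Longrightarrow> \<psi> x \<in> gr P (\<delta> x)"
    and d: "\<And>x. x \<in> Q \<Longrightarrow> \<psi> (\<tau> x) = dif P (\<psi> x)"
  shows "tw.fext P (word_eval P \<psi>) \<in> dga_hom T P"
    "\<And>u. u \<in> lists Q \<Longrightarrow> tw.fext P (word_eval P \<psi>) (bvec u) = word_eval P \<psi> u"
proof -
  interpret P: dg_algebra P by fact
  have g: "word_eval P \<psi> u \<in> gr P (word_deg \<delta> u)" if "u \<in> lists Q" for u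
    using that by (induction u) (simp_all add: P.one_degree word_deg_simps \<psi> P.mult_degree)
  then have c: "\<And>u. u \<in> lists Q \<Longrightarrow> word_eval P \<psi> u \<in> carrier P" using P.gr_closed by blast
  have \<psi>c: "\<And>x. x \<in> Q \<Longrightarrow> \<psi> x \<in> carrier P" using \<psi> P.gr_closed by blast
  have lin: "klin T P (tw.fext P (word_eval P \<psi>))" by (rule tw.fext_klin[OF P.kmodule c])
  show bv: "tw.fext P (word_eval P \<psi>) (bvec u) = word_eval P \<psi> u" if "u \<in> lists Q" for u
    by (rule tw.fext_bvec[OF P.kmodule c that])
  have app: "word_eval P \<psi> (u @ v) = word_eval P \<psi> u \<otimes>\<^bsub>P\<^esub> word_eval P \<psi> v" if "u \<in> lists Q" "v \<in> lists Q" for u v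
    using that by (induction u) (simp_all add: c \<psi>c P.m_assoc)
  have letter: "tw.fext P (word_eval P \<psi>) (bvec [x] \<otimes>\<^bsub>T\<^esub> f) = \<psi> x \<otimes>\<^bsub>P\<^esub> tw.fext P (word_eval P \<psi>) f"
    if "x \<in> Q" "f \<in> carrier T" for x f
  proof (rule tw.klin_bvec_eq[OF klin_comp[OF tw.mult_lin_r lin] klin_comp[OF lin P.mult_klin_l[OF \<psi>c[OF that(1)]]] P.kmodule _ that(2)])
    show "bvec [x] \<in> carrier T" using that by simp
    show "tw.fext P (word_eval P \<psi>) (bvec [x] \<otimes>\<^bsub>T\<^esub> bvec u) = \<psi> x \<otimes>\<^bsub>P\<^esub> tw.fext P (word_eval P \<psi>) (bvec u)"
      if "u \<in> lists Q" for u
      using that \<open>x \<in> Q\<close> bv[of "x # u"] bv[of u] by (simp add: bvec_append)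
  qed
  show "tw.fext P (word_eval P \<psi>) \<in> dga_hom T P"
  proof (rule tw.fext_dga_hom[OF P.predg_algebra])
    fix u assume "u \<in> lists Q"
    then show "tw.fext P (word_eval P \<psi>) (D u) = dif P (word_eval P \<psi> u)"
    proof (induction u)
      case Nil
      have "D [] = \<zero>\<^bsub>T\<^esub>" by (simp add: D_short free_dga_def)
      then show ?case using klin_zero[OF lin tw.T_kmodule P.kmodule] by (simp add: P.dif_one)
    next
      case (Cons x u)
      have u: "u \<in> lists Q" "x \<in> Q" using Cons by auto
      have k: "bvec [\<tau> x] \<otimes>\<^bsub>T\<^esub> bvec u \<in> carrier T" "bvec [x] \<otimes>\<^bsub>T\<^esub> D u \<in> carrier T" "bvec u \<in> carrier T" "D u \<in> carrier T"
        using u \<tau>(1) by (simp_all add: tw.mult_closed)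
      show ?case
        using k u Cons.IH \<tau>(1) P.leibniz[OF \<psi>[OF u(2)] c[OF u(1)]]
        by (simp add: D_Cons klinD[OF lin] letter bv d del: T_simps')
    qed
  qed (use g app c in \<open>auto simp: word_deg_simps\<close>)
qed

end

text \<open>
  The letters coming from one of the two factors of the coproduct, so that statements about relations need
  to be proved only once for both.
\<close>

locale letter_inclusion = free_words Q \<delta> \<tau> "TYPE('k)" + A: dg_algebra A
  for Q :: "'x set" and \<delta> \<tau> and A :: "('k::field_char_0, 'a, 'm) dg_scheme" and j :: "int \<times> 'a \<Rightarrow> 'x" +
  assumes j: "a \<in> gr A i \<Longrightarrow> j (i, a) \<in> Q" "a \<in> gr A i \<Longrightarrow> \<delta> (j (i, a)) = i"
    "a \<in> gr A i \<Longrightarrow> \<tau> (j (i, a)) = j (i - 1, dif A a)"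
begin

lemma jc: "a \<in> gr A i \<Longrightarrow> bvec [j (i, a)] \<in> carrier T"
  "\<lbrakk>a \<in> gr A i; b \<in> gr A k\<rbrakk> \<Longrightarrow> bvec [j (i, a), j (k, b)] \<in> carrier T"
  by (simp_all add: j)

lemma nil_closed: "bvec [] \<in> carrier T"
  by simp

lemma alg_rels_cases:
  assumes "g \<in> alg_rels A j"
  obtains
    (add) i a b where "a \<in> gr A i" "b \<in> gr A i"
      "g = bvec [j (i, a \<oplus>\<^bsub>A\<^esub> b)] \<oplus>\<^bsub>T\<^esub> (- 1) \<odot>\<^bsub>T\<^esub> (bvec [j (i, a)] \<oplus>\<^bsub>T\<^esub> bvec [j (i, b)])"
  | (smult) i r a where "a \<in> gr A i" "g = bvec [j (i, r \<odot>\<^bsub>A\<^esub> a)] \<oplus>\<^bsub>T\<^esub> (- 1) \<odot>\<^bsub>T\<^esub> (r \<odot>\<^bsub>T\<^esub> bvec [j (i, a)])"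
  | (mult) i k a b where "a \<in> gr A i" "b \<in> gr A k"
      "g = bvec [j (i + k, a \<otimes>\<^bsub>A\<^esub> b)] \<oplus>\<^bsub>T\<^esub> (- 1) \<odot>\<^bsub>T\<^esub> bvec [j (i, a), j (k, b)]"
  | (one) "g = bvec [j (0, \<one>\<^bsub>A\<^esub>)] \<oplus>\<^bsub>T\<^esub> (- 1) \<odot>\<^bsub>T\<^esub> bvec []"
  using assms unfolding alg_rels_def T_simps' by (auto simp: algebra_simps)

lemma alg_rels_gr:
  assumes "g \<in> alg_rels A j"
  shows "\<exists>n. g \<in> gr T n"
proof -
  have l: "bvec [j (i, a)] \<in> gr T i" if "a \<in> gr A i" for i a
    using tw.bvec_gr[of "[j (i, a)]"] that by (simp add: j word_deg_simps)
  have w: "bvec [j (i, a), j (k, b)] \<in> gr T (i + k)" if "a \<in> gr A i" "b \<in> gr A k" for i k a b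
    using tw.bvec_gr[of "[j (i, a), j (k, b)]"] that by (simp add: j word_deg_simps)
  have e: "bvec [] \<in> gr T 0"
    using tw.bvec_gr[of "[]"] by (simp add: word_deg_simps)
  note c = tw.T.gr_add tw.T.gr_smult
  show ?thesis
    using assms
  proof (cases g rule: alg_rels_cases)
    case (add i a b)
    then have "g \<in> gr T i" by (simp add: c l A.gr_add del: T_simps')
    then show ?thesis ..
  next
    case (smult i r a)
    then have "g \<in> gr T i" by (simp add: c l A.gr_smult del: T_simps')
    then show ?thesis ..
  next
    case (mult i k a b)
    then have "g \<in> gr T (i + k)" by (simp add: c l w A.mult_degree del: T_simps')
    then show ?thesis ..
  next
    case one
    then have "g \<in> gr T 0" by (simp add: c l e A.one_degree del: T_simps')
    then show ?thesis ..
  qed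
qed

context
  fixes I assumes I: "submodule I ground T" and rels: "alg_rels A j \<subseteq> I"
begin

definition letter where "letter i a = I +>\<^bsub>T\<^esub> bvec [j (i, a)]"

abbreviation "N \<equiv> dg_quot T I"

interpretation N: kmodule N by (rule tw.T.quot_kmodule[OF I])

lemma proj: "klin T N (\<lambda>x. I +>\<^bsub>T\<^esub> x)" by (rule tw.T.quot_klin[OF I])

lemma letter_closed: "a \<in> gr A i \<Longrightarrow> letter i a \<in> carrier N"
  unfolding letter_def by (rule klinD(1)[OF proj jc(1)])

lemma proj_eqI:
  assumes "x \<in> carrier T" "y \<in> carrier T" "x \<oplus>\<^bsub>T\<^esub> (- 1) \<odot>\<^bsub>T\<^esub> y \<in> I"
  shows "I +>\<^bsub>T\<^esub> x = I +>\<^bsub>T\<^esub> y"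
  using assms by (simp add: tw.T.coset_eq_iff[OF I] tw.T.kdiff del: T_simps')

lemma letter_hlin: "hlin A N letter"
  unfolding hlin_def
proof (intro allI ballI conjI letter_closed)
  fix i a b r assume a: "a \<in> gr A i"
  show "letter i (a \<oplus>\<^bsub>A\<^esub> b) = letter i a \<oplus>\<^bsub>N\<^esub> letter i b" if b: "b \<in> gr A i"
    unfolding letter_def klinD(2)[OF proj jc(1)[OF a] jc(1)[OF b], symmetric]
  proof (rule proj_eqI)
    show "bvec [j (i, a \<oplus>\<^bsub>A\<^esub> b)] \<oplus>\<^bsub>T\<^esub> - 1 \<odot>\<^bsub>T\<^esub> (bvec [j (i, a)] \<oplus>\<^bsub>T\<^esub> bvec [j (i, b)]) \<in> I"
      by (rule subsetD[OF rels], unfold alg_rels_def T_simps', rule UnI1, rule UnI1, rule UnI1, rule CollectI)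
        (use a b in \<open>force simp: algebra_simps\<close>)
  qed (use a b in \<open>simp_all add: jc A.gr_add del: T_simps'\<close>)
  show "letter i (r \<odot>\<^bsub>A\<^esub> a) = r \<odot>\<^bsub>N\<^esub> letter i a"
    unfolding letter_def klinD(3)[OF proj jc(1)[OF a], symmetric]
  proof (rule proj_eqI)
    show "bvec [j (i, r \<odot>\<^bsub>A\<^esub> a)] \<oplus>\<^bsub>T\<^esub> - 1 \<odot>\<^bsub>T\<^esub> (r \<odot>\<^bsub>T\<^esub> bvec [j (i, a)]) \<in> I"
      by (rule subsetD[OF rels], unfold alg_rels_def T_simps', rule UnI1, rule UnI1, rule UnI2, rule CollectI)
        (use a in force)
  qed (use a in \<open>simp_all add: jc A.gr_smult del: T_simps'\<close>)
qed

lemma letter_mult: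
  assumes "a \<in> gr A i" "b \<in> gr A k"
  shows "letter (i + k) (a \<otimes>\<^bsub>A\<^esub> b) = I +>\<^bsub>T\<^esub> bvec [j (i, a), j (k, b)]"
  unfolding letter_def
proof (rule proj_eqI)
  show "bvec [j (i + k, a \<otimes>\<^bsub>A\<^esub> b)] \<oplus>\<^bsub>T\<^esub> (- 1) \<odot>\<^bsub>T\<^esub> bvec [j (i, a), j (k, b)] \<in> I"
    by (rule subsetD[OF rels], unfold alg_rels_def T_simps', rule UnI1, rule UnI2, rule CollectI)
      (use assms in force)
qed (use assms in \<open>simp_all add: jc A.mult_degree del: T_simps'\<close>)

lemma letter_one: "letter 0 \<one>\<^bsub>A\<^esub> = I +>\<^bsub>T\<^esub> bvec []"
  unfolding letter_def
proof (rule proj_eqI)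
  show "bvec [j (0, \<one>\<^bsub>A\<^esub>)] \<oplus>\<^bsub>T\<^esub> (- 1) \<odot>\<^bsub>T\<^esub> bvec [] \<in> I"
    by (rule subsetD[OF rels], unfold alg_rels_def T_simps', rule UnI2) simp
qed (simp_all add: jc A.one_degree del: T_simps')

lemma letter_zero: "bvec [j (i, \<zero>\<^bsub>A\<^esub>)] \<in> I"
proof -
  have "letter i \<zero>\<^bsub>A\<^esub> = \<zero>\<^bsub>N\<^esub>" by (rule A.hlin_zero[OF N.kmodule letter_hlin])
  then show ?thesis
    using tw.T.coset_zero_iff[OF I jc(1)[OF A.gr_zero]] tw.T.quot_zero(1)[OF I] by (simp add: letter_def)
qed

lemma dif_letter: "a \<in> gr A i \<Longrightarrow> dif T (bvec [j (i, a)]) = bvec [j (i - 1, dif A a)]"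
  by (simp add: tw.dif_bvec D_short j)

text \<open>
  The differential of a linear relation is a linear relation. For the relation \<open>[ab] - [a][b]\<close>, expand
  \<open>d (ab)\<close> by the Leibniz rule in \<open>A\<close> and \<open>d ([a][b])\<close> by the one for words; the terms match by the linear relations
  and the multiplicative relations for \<open>da, b\<close> and for \<open>a, db\<close>. The relation \<open>[1] - 1\<close> has differential
  \<open>[d 1] = [0]\<close>.
\<close>

lemma alg_rels_dif:
  assumes "g \<in> alg_rels A j"
  shows "dif T g \<in> I"
proof -
  have g: "g \<in> carrier T" using alg_rels_gr[OF assms] tw.T.gr_closed by blast
  note d = klinD[OF tw.T_dif_klin] and p = klinD[OF proj]
  have l: "\<And>i a. I +>\<^bsub>T\<^esub> bvec [j (i, a)] = letter i a" by (simp add: letter_def)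
  have ladd: "\<And>i a b. \<lbrakk>a \<in> gr A i; b \<in> gr A i\<rbrakk> \<Longrightarrow> letter i (a \<oplus>\<^bsub>A\<^esub> b) = letter i a \<oplus>\<^bsub>N\<^esub> letter i b"
    and lsm: "\<And>i a r. a \<in> gr A i \<Longrightarrow> letter i (r \<odot>\<^bsub>A\<^esub> a) = r \<odot>\<^bsub>N\<^esub> letter i a"
    using letter_hlin by (simp_all add: hlin_def)
  note gs = jc A.gr_add A.gr_smult A.dif_degree A.mult_degree
  have "I +>\<^bsub>T\<^esub> dif T g = \<zero>\<^bsub>N\<^esub>"
    using assms
  proof (cases g rule: alg_rels_cases)
    case (add i a b)
    have c: "a \<in> carrier A" "b \<in> carrier A" using add A.gr_closed by blast+
    show ?thesis
      using add(1,2) c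
      by (simp add: add(3) d gs dif_letter p l A.dif_add ladd letter_closed N.kcancel del: T_simps')
  next
    case (smult i r a)
    have c: "a \<in> carrier A" using smult A.gr_closed by blast
    show ?thesis
      using smult(1) c
      by (simp add: smult(2) d gs dif_letter p l A.dif_smult lsm letter_closed N.kcancel del: T_simps')
  next
    case (mult i k a b)
    have c: "a \<in> carrier A" "b \<in> carrier A" using mult A.gr_closed by blast+
    have da: "dif A a \<in> gr A (i - 1)" "dif A b \<in> gr A (k - 1)" using mult A.dif_degree by blast+
    have m: "dif A a \<otimes>\<^bsub>A\<^esub> b \<in> gr A (i + k - 1)" "a \<otimes>\<^bsub>A\<^esub> dif A b \<in> gr A (i + k - 1)"
      using A.mult_degree[OF da(1) mult(2)] A.mult_degree[OF mult(1) da(2)] by (simp_all add: algebra_simps)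
    have lm: "letter (i + k - 1) (dif A a \<otimes>\<^bsub>A\<^esub> b) = I +>\<^bsub>T\<^esub> bvec [j (i - 1, dif A a), j (k, b)]"
      "letter (i + k - 1) (a \<otimes>\<^bsub>A\<^esub> dif A b) = I +>\<^bsub>T\<^esub> bvec [j (i, a), j (k - 1, dif A b)]"
      using letter_mult[OF da(1) mult(2)] letter_mult[OF mult(1) da(2)] by (simp_all add: algebra_simps)
    have dw: "dif T (bvec [j (i, a), j (k, b)]) = bvec [j (i - 1, dif A a), j (k, b)] \<oplus>\<^bsub>T\<^esub>
        ksign i \<odot>\<^bsub>T\<^esub> bvec [j (i, a), j (k - 1, dif A b)]"
      using mult by (simp add: tw.dif_bvec D_short j T_simps')
    have "I +>\<^bsub>T\<^esub> dif T g = letter (i + k - 1) (dif A (a \<otimes>\<^bsub>A\<^esub> b)) \<oplus>\<^bsub>N\<^esub> (- 1) \<odot>\<^bsub>N\<^esub>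
        ((I +>\<^bsub>T\<^esub> bvec [j (i - 1, dif A a), j (k, b)]) \<oplus>\<^bsub>N\<^esub> ksign i \<odot>\<^bsub>N\<^esub> (I +>\<^bsub>T\<^esub> bvec [j (i, a), j (k - 1, dif A b)]))"
      using mult(1,2) da by (simp add: mult(3) d gs dif_letter dw p l del: T_simps')
    also have "\<dots> = \<zero>\<^bsub>N\<^esub>"
      using m letter_closed[OF m(1)] letter_closed[OF m(2)]
      by (simp add: A.leibniz[OF mult(1) c(2)] ladd lsm A.gr_smult lm[symmetric] N.kcancel)
    finally show ?thesis .
  next
    case one
    have "dif T (bvec []) = \<zero>\<^bsub>T\<^esub>" by (simp add: tw.dif_bvec D_short free_dga_def)
    then have "dif T g = bvec [j (- 1, \<zero>\<^bsub>A\<^esub>)]"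
      using jc(1)[OF A.gr_zero, of "- 1"] jc(1)[OF A.one_degree] nil_closed
      by (simp add: one d dif_letter[OF A.one_degree] A.dif_one del: T_simps')
    then show ?thesis
      using letter_zero[of "- 1"] tw.T.coset_zero_iff[OF I jc(1)[OF A.gr_zero]] tw.T.quot_zero(1)[OF I] by simp
  qed
  then show ?thesis
    using tw.T.coset_zero_iff[OF I d(1)[OF g]] tw.T.quot_zero(1)[OF I] by simp
qed

definition incl where "incl = (\<lambda>a\<in>carrier A. hext A N letter a)"

lemma incl_gr: "a \<in> gr A i \<Longrightarrow> incl a = I +>\<^bsub>T\<^esub> bvec [j (i, a)]"
  using A.hext_homog[OF N.kmodule letter_hlin, of a i] A.gr_closed by (simp add: incl_def letter_def)

lemma incl_hom:
  assumes "dg_ideal T I"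
  shows "incl \<in> dga_hom A N"
proof -
  interpret dg_ideal T I by fact
  interpret Q: dg_algebra N by (rule quot_dg_algebra)
  note q = quot_mult quot_one quot_dif quot_gr
  show ?thesis
  proof (rule dga_homI[OF A.predg_algebra Q.predg_algebra])
    show "klin A N incl"
      unfolding incl_def by (rule klin_restrict[OF A.kmodule A.hext_klin[OF N.kmodule letter_hlin]])
    show "incl \<in> extensional (carrier A)" by (simp add: incl_def)
    show "incl \<one>\<^bsub>A\<^esub> = \<one>\<^bsub>N\<^esub>"
      using letter_one by (simp add: incl_gr[OF A.one_degree] quot_one letter_def T_simps'(4))
    fix i k a b assume a: "a \<in> gr A i"
    show "incl a \<in> gr N i"
      using tw.bvec_gr[of "[j (i, a)]"] a by (simp add: incl_gr[OF a] quot_gr j word_deg_simps)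
    show "incl (dif A a) = dif N (incl a)"
      using jc(1)[OF a] by (simp add: incl_gr[OF a] incl_gr[OF A.dif_degree[OF a]] quot_dif dif_letter[OF a] del: T_simps')
    assume b: "b \<in> gr A k"
    show "incl (a \<otimes>\<^bsub>A\<^esub> b) = incl a \<otimes>\<^bsub>N\<^esub> incl b"
      using letter_mult[OF a b] quot_mult[OF jc(1)[OF a] jc(1)[OF b]] a b
      by (simp add: incl_gr[OF a] incl_gr[OF b] incl_gr[OF A.mult_degree[OF a b]] letter_def bvec_append j)
  qed
qed

end

lemma eval_kills_alg_rels:
  assumes P: "dg_algebra P" and u: "u \<in> dga_hom A P" and h: "h \<in> dga_hom T P"
    and hl: "\<And>i a. a \<in> gr A i \<Longrightarrow> h (bvec [j (i, a)]) = u a" and g: "g \<in> alg_rels A j"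
  shows "h g = \<zero>\<^bsub>P\<^esub>"
proof -
  interpret P: dg_algebra P by fact
  note H = dga_homD[OF h] and U = dga_homD[OF u]
  note k = klinD[OF H(1)] and ul = klinD[OF U(1)] and gs = jc A.gr_add A.gr_smult A.mult_degree
  show ?thesis
    using g
  proof (cases g rule: alg_rels_cases)
    case (add i a b)
    have c: "a \<in> carrier A" "b \<in> carrier A" using add A.gr_closed by blast+
    show ?thesis using add(1,2) c by (simp add: add(3) k gs hl ul P.kcancel del: T_simps')
  next
    case (smult i r a)
    have c: "a \<in> carrier A" using smult A.gr_closed by blast
    show ?thesis using smult(1) c by (simp add: smult(2) k gs hl ul P.kcancel del: T_simps')
  next
    case (mult i k' a b)
    have c: "a \<in> carrier A" "b \<in> carrier A" using mult A.gr_closed by blast+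
    have "h (bvec [j (i, a), j (k', b)]) = u a \<otimes>\<^bsub>P\<^esub> u b"
      using H(4)[OF jc(1)[OF mult(1)] jc(1)[OF mult(2)]] mult(1,2) by (simp add: bvec_append j hl)
    then show ?thesis using mult(1,2) c by (simp add: mult(3) k gs hl ul U(4) P.kcancel del: T_simps')
  next
    case one
    have "h (bvec []) = \<one>\<^bsub>P\<^esub>" using H(3) by (simp add: T_simps')
    then show ?thesis
      using jc(1)[OF A.one_degree] nil_closed by (simp add: one k hl A.one_degree U(3) P.kcancel del: T_simps')
  qed
qed

end

definition coprod_letters ::
  "('k::field_char_0, 'b, 'n) dg_scheme \<Rightarrow> ('k, 'a, 'm) dg_scheme \<Rightarrow> ('b, 'a) cgen set"
  where "coprod_letters B A = {Inl (i, b) | i b. b \<in> gr B i} \<union> {Inr (i, a) | i a. a \<in> gr A i}"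

definition letter_deriv ::
  "('k::field_char_0, 'b, 'n) dg_scheme \<Rightarrow> ('k, 'a, 'm) dg_scheme \<Rightarrow> ('b, 'a) cgen \<Rightarrow> ('b, 'a) cgen"
  where "letter_deriv B A = map_sum (\<lambda>(i, b). (i - 1, dif B b)) (\<lambda>(i, a). (i - 1, dif A a))"

locale dga_coprod = S: dg_algebra S + B: dg_algebra B + A: dg_algebra A
  for S :: "('k::field_char_0, 's, 'l) dg_scheme" and B :: "('k, 'b, 'n) dg_scheme"
    and A :: "('k, 'a, 'm) dg_scheme" +
  fixes \<beta> :: "'s \<Rightarrow> 'b" and \<alpha> :: "'s \<Rightarrow> 'a"
  assumes \<beta>: "\<beta> \<in> dga_hom S B" and \<alpha>: "\<alpha> \<in> dga_hom S A"
begin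

abbreviation "L \<equiv> coprod_letters B A"
abbreviation "I \<equiv> coprod_ideal S B \<beta> A \<alpha>"
abbreviation "P \<equiv> coprod_dga S B \<beta> A \<alpha>"

sublocale fw: free_words L "case_sum fst fst" "letter_deriv B A" "TYPE('k)"
  by unfold_locales (use B.dif_degree A.dif_degree in \<open>auto simp: coprod_letters_def letter_deriv_def\<close>)

sublocale l: letter_inclusion L "case_sum fst fst" "letter_deriv B A" B Inl
  by unfold_locales (auto simp: coprod_letters_def letter_deriv_def)

sublocale r: letter_inclusion L "case_sum fst fst" "letter_deriv B A" A Inr
  by unfold_locales (auto simp: coprod_letters_def letter_deriv_def)

definition "base_rels = {(\<lambda>w. bvec [Inl (i, \<beta> s)] w - bvec [Inr (i, \<alpha> s)] w :: 'k) | i s. s \<in> gr S i}"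

abbreviation "G \<equiv> alg_rels B Inl \<union> alg_rels A Inr \<union> base_rels"

lemma coprod_free_eq: "coprod_free B A = fw.T"
  by (simp add: coprod_free_def coprod_letters_def letter_deriv_def)

lemma I_eq: "I = genideal fw.T G"
  by (simp add: coprod_ideal_def coprod_free_eq base_rels_def)

lemma P_eq: "P = dg_quot fw.T I"
  by (simp add: coprod_dga_def coprod_free_eq)

lemma base_gr:
  assumes "s \<in> gr S i"
  shows "\<beta> s \<in> gr B i" "\<alpha> s \<in> gr A i" "\<beta> (dif S s) = dif B (\<beta> s)" "\<alpha> (dif S s) = dif A (\<alpha> s)"
  using dga_homD(5,6)[OF \<beta>] dga_homD(5,6)[OF \<alpha>] assms S.gr_closed[OF assms] by blast+

lemma base_rels_cases:
  assumes "g \<in> base_rels"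
  obtains i s where "s \<in> gr S i" "g = bvec [Inl (i, \<beta> s)] \<oplus>\<^bsub>fw.T\<^esub> (- 1) \<odot>\<^bsub>fw.T\<^esub> bvec [Inr (i, \<alpha> s)]"
  using assms unfolding base_rels_def fw.T_simps' by auto

lemma base_relsI:
  "s \<in> gr S i \<Longrightarrow> bvec [Inl (i, \<beta> s)] \<oplus>\<^bsub>fw.T\<^esub> (- 1) \<odot>\<^bsub>fw.T\<^esub> bvec [Inr (i, \<alpha> s)] \<in> base_rels"
  unfolding base_rels_def fw.T_simps' by auto

lemma letter_gr: "b \<in> gr B i \<Longrightarrow> bvec [Inl (i, b)] \<in> gr fw.T i" "a \<in> gr A i \<Longrightarrow> bvec [Inr (i, a)] \<in> gr fw.T i"
  using fw.tw.bvec_gr[of "[Inl (i, b)]"] fw.tw.bvec_gr[of "[Inr (i, a)]"]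
  by (simp_all add: l.j r.j fw.word_deg_simps)

lemma G_gr:
  assumes "g \<in> G"
  shows "\<exists>n. g \<in> gr fw.T n"
proof -
  have "\<exists>n. g \<in> gr fw.T n" if g: "g \<in> base_rels"
  proof -
    obtain i s where s: "s \<in> gr S i" "g = bvec [Inl (i, \<beta> s)] \<oplus>\<^bsub>fw.T\<^esub> (- 1) \<odot>\<^bsub>fw.T\<^esub> bvec [Inr (i, \<alpha> s)]"
      by (rule base_rels_cases[OF g])
    have "g \<in> gr fw.T i"
      unfolding s(2) by (intro fw.tw.T.gr_add fw.tw.T.gr_smult letter_gr base_gr s(1))
    then show ?thesis ..
  qed
  then show ?thesis
    using assms l.alg_rels_gr r.alg_rels_gr by blast
qed

lemma G_closed: "G \<subseteq> carrier fw.T"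
  using G_gr fw.tw.T.gr_closed by blast

lemma I_ideal: "ideal I fw.T"
  unfolding I_eq by (rule fw.tw.T.genideal_ideal[OF G_closed])

lemma G_I: "G \<subseteq> I"
  unfolding I_eq by (rule fw.tw.T.genideal_self[OF G_closed])

lemma I_sub: "submodule I ground fw.T"
proof -
  interpret I: ideal I fw.T by (rule I_ideal)
  have "r \<odot>\<^bsub>fw.T\<^esub> x \<in> I" if "x \<in> I" for r x
    using I.I_l_closed[OF that, of "r \<odot>\<^bsub>fw.T\<^esub> \<one>\<^bsub>fw.T\<^esub>"] I.a_Hcarr[OF that]
      fw.tw.T.smult_mult_l[of "\<one>\<^bsub>fw.T\<^esub>" x r] by (simp del: fw.T_simps')
  then show ?thesis
    by (intro fw.tw.T.ksubmoduleI) (auto simp: I.a_Hcarr simp del: fw.T_simps')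
qed

lemma I_rels: "alg_rels B Inl \<subseteq> I" "alg_rels A Inr \<subseteq> I" "base_rels \<subseteq> I"
  using G_I by blast+

lemma I_dg_ideal: "dg_ideal fw.T I"
  unfolding I_eq
proof (rule fw.tw.T.dg_ideal_genideal[OF G_gr])
  fix g assume "g \<in> G"
  moreover have "dif fw.T g \<in> I" if g: "g \<in> base_rels"
  proof -
    obtain i s where s: "s \<in> gr S i" "g = bvec [Inl (i, \<beta> s)] \<oplus>\<^bsub>fw.T\<^esub> (- 1) \<odot>\<^bsub>fw.T\<^esub> bvec [Inr (i, \<alpha> s)]"
      by (rule base_rels_cases[OF g])
    note b = base_gr[OF s(1)]
    have "dif fw.T g = bvec [Inl (i - 1, \<beta> (dif S s))] \<oplus>\<^bsub>fw.T\<^esub> (- 1) \<odot>\<^bsub>fw.T\<^esub> bvec [Inr (i - 1, \<alpha> (dif S s))]"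
      using b by (simp add: s(2) klinD[OF fw.tw.T_dif_klin] l.jc r.jc l.dif_letter[OF I_sub I_rels(1)]
        r.dif_letter[OF I_sub I_rels(2)] del: fw.T_simps')
    then show ?thesis
      using base_relsI[OF S.dif_degree[OF s(1)]] I_rels(3) by auto
  qed
  ultimately show "dif fw.T g \<in> genideal fw.T G"
    using l.alg_rels_dif[OF I_sub I_rels(1)] r.alg_rels_dif[OF I_sub I_rels(2)] by (auto simp: I_eq)
next
  show "dif fw.T (f \<otimes>\<^bsub>fw.T\<^esub> g) = (dif fw.T f \<otimes>\<^bsub>fw.T\<^esub> g) \<oplus>\<^bsub>fw.T\<^esub> (ksign i \<odot>\<^bsub>fw.T\<^esub> (f \<otimes>\<^bsub>fw.T\<^esub> dif fw.T g))"
    if "f \<in> gr fw.T i" "g \<in> gr fw.T j" for f g i j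
    by (rule fw.T_leibniz[OF that(1) fw.tw.T.gr_closed[OF that(2)]])
  \<comment> \<open>Applying the letter map twice gives a letter for the zero element, which is a relation.\<close>
  have letter: "bvec [letter_deriv B A (letter_deriv B A x)] \<in> I" if "x \<in> L" for x
    using that l.letter_zero[OF I_sub I_rels(1)] r.letter_zero[OF I_sub I_rels(2)] B.dif_dif A.dif_dif
      B.gr_closed A.gr_closed
    by (auto simp: coprod_letters_def letter_deriv_def)
  show "dif fw.T (dif fw.T f) \<in> genideal fw.T G" if "f \<in> gr fw.T i" for f i
    unfolding I_eq[symmetric]
    by (rule fw.tw.dif_dif_mem[OF I_sub _ fw.tw.T.gr_closed[OF that]])
      (rule fw.dif_dif_word[OF I_ideal I_sub letter])
qed

sublocale I: dg_ideal fw.T I by (rule I_dg_ideal)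

lemma P_dg_algebra: "dg_algebra P"
  unfolding P_eq by (rule I.quot_dg_algebra)

sublocale P: dg_algebra P by (rule P_dg_algebra)

abbreviation "inl \<equiv> coprod_inl S B \<beta> A \<alpha>"
definition "inr = r.incl I"

lemma inl_eq: "inl = l.incl I"
  by (simp add: coprod_inl_def l.incl_def[OF I_sub I_rels(1)] l.letter_def[OF I_sub I_rels(1), abs_def]
      P_eq coprod_free_eq)

lemma inl_hom: "inl \<in> dga_hom B P"
  unfolding inl_eq P_eq by (rule l.incl_hom[OF I_sub I_rels(1) I_dg_ideal])

lemma inr_hom: "inr \<in> dga_hom A P"
  unfolding inr_def P_eq by (rule r.incl_hom[OF I_sub I_rels(2) I_dg_ideal])

lemma inl_gr: "b \<in> gr B i \<Longrightarrow> inl b = I +>\<^bsub>fw.T\<^esub> bvec [Inl (i, b)]"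
  unfolding inl_eq by (rule l.incl_gr[OF I_sub I_rels(1)])

lemma inr_gr: "a \<in> gr A i \<Longrightarrow> inr a = I +>\<^bsub>fw.T\<^esub> bvec [Inr (i, a)]"
  unfolding inr_def by (rule r.incl_gr[OF I_sub I_rels(2)])

lemma inl_\<beta>:
  assumes "s \<in> carrier S"
  shows "inl (\<beta> s) = inr (\<alpha> s)"
proof (rule S.klin_gr_eq[OF klin_comp[OF dga_homD(1)[OF \<beta>] dga_homD(1)[OF inl_hom]]
      klin_comp[OF dga_homD(1)[OF \<alpha>] dga_homD(1)[OF inr_hom]] P.kmodule _ assms])
  fix i s assume s: "s \<in> gr S i"
  have c: "bvec [Inl (i, \<beta> s)] \<in> carrier fw.T" "bvec [Inr (i, \<alpha> s)] \<in> carrier fw.T"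
    using base_gr[OF s] l.jc r.jc by blast+
  show "inl (\<beta> s) = inr (\<alpha> s)"
    using base_relsI[OF s] I_rels(3) base_gr(1,2)[OF s] c
    by (auto simp: inl_gr inr_gr fw.tw.T.coset_eq_iff[OF I_sub] fw.tw.T.kdiff simp del: fw.T_simps')
qed

text \<open>
  The coproduct is generated by the images of the two factors.
\<close>

lemma P_hom_eq:
  assumes "f \<in> dga_hom P N" "g \<in> dga_hom P N" "predg_algebra N"
    and l: "\<And>i b. b \<in> gr B i \<Longrightarrow> f (inl b) = g (inl b)" and r: "\<And>i a. a \<in> gr A i \<Longrightarrow> f (inr a) = g (inr a)"
    and x: "x \<in> carrier P"
  shows "f x = g x"
proof -
  interpret N: predg_algebra N by fact
  note f = dga_homD[OF assms(1)] and g = dga_homD[OF assms(2)]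
  have w: "f (I +>\<^bsub>fw.T\<^esub> bvec u) = g (I +>\<^bsub>fw.T\<^esub> bvec u)" if "u \<in> lists L" for u
    using that
  proof (induction u)
    case Nil
    then show ?case using I.quot_one f(3) g(3) by (simp add: fw.T_simps' P_eq)
  next
    case (Cons y u)
    have c: "bvec [y] \<in> carrier fw.T" "bvec u \<in> carrier fw.T" using Cons by simp_all
    have "f (I +>\<^bsub>fw.T\<^esub> bvec [y]) = g (I +>\<^bsub>fw.T\<^esub> bvec [y])"
      using Cons.hyps(1) l r inl_gr inr_gr by (auto simp: coprod_letters_def)
    moreover have "I +>\<^bsub>fw.T\<^esub> bvec (y # u) = (I +>\<^bsub>fw.T\<^esub> bvec [y]) \<otimes>\<^bsub>P\<^esub> (I +>\<^bsub>fw.T\<^esub> bvec u)"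
      using I.quot_mult[OF c] Cons fw.bvec_append[of "[y]" u] by (simp add: P_eq)
    moreover have "I +>\<^bsub>fw.T\<^esub> bvec [y] \<in> carrier P" "I +>\<^bsub>fw.T\<^esub> bvec u \<in> carrier P"
      using c fw.tw.T.quot_coset_closed[OF I_sub] by (simp_all add: P_eq del: fw.T_simps')
    ultimately show ?case using Cons f(4) g(4) by simp
  qed
  obtain z where z: "z \<in> carrier fw.T" "x = I +>\<^bsub>fw.T\<^esub> z"
    using x fw.tw.T.quot_carrier[OF I_sub] by (auto simp: P_eq)
  have p: "klin fw.T P (\<lambda>x. I +>\<^bsub>fw.T\<^esub> x)" unfolding P_eq by (rule fw.tw.T.quot_klin[OF I_sub])
  show ?thesis
    unfolding z(2) by (rule fw.tw.klin_bvec_eq[OF klin_comp[OF p f(1)] klin_comp[OF p g(1)] N.kmodule w z(1)])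
qed

text \<open>
  The existence part of the universal property of the coproduct under \<open>S\<close>: the evaluation of words in
  \<open>N\<close> that is given by \<open>u\<close> and \<open>v\<close> on letters kills the relations of both factors, as \<open>u\<close> and \<open>v\<close> are morphisms,
  and the relations identifying the images of \<open>S\<close>, as \<open>u\<close> and \<open>v\<close> agree there.
\<close>

lemma P_lift:
  assumes N: "dg_algebra N" and u: "u \<in> dga_hom B N" and v: "v \<in> dga_hom A N"
    and s: "\<And>s. s \<in> carrier S \<Longrightarrow> u (\<beta> s) = v (\<alpha> s)"
  obtains h where "h \<in> dga_hom P N" "\<And>b. b \<in> carrier B \<Longrightarrow> h (inl b) = u b" "\<And>a. a \<in> carrier A \<Longrightarrow> h (inr a) = v a"
proof -
  interpret N: dg_algebra N by fact
  note U = dga_homD[OF u] and V = dga_homD[OF v]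
  let ?\<psi> = "case_sum (\<lambda>(i, b). u b) (\<lambda>(i, a). v a)"
  let ?h = "fw.tw.fext N (fw.word_eval N ?\<psi>)"
  have 1: "?\<psi> x \<in> gr N (case_sum fst fst x)" "?\<psi> (letter_deriv B A x) = dif N (?\<psi> x)" if "x \<in> L" for x
    using that U(5,6) V(5,6) B.gr_closed A.gr_closed by (auto simp: coprod_letters_def letter_deriv_def)
  have h1: "?h \<in> dga_hom fw.T N" by (rule fw.eval_dga_hom(1)[OF N]; rule 1)
  have h2: "?h (bvec u) = fw.word_eval N ?\<psi> u" if "u \<in> lists L" for u
    by (rule fw.eval_dga_hom(2)[OF N _ _ that]; rule 1)
  note h = h1 h2
  note H = dga_homD[OF h1]
  have hl: "?h (bvec [Inl (i, b)]) = u b" if "b \<in> gr B i" for i b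
    using h(2)[of "[Inl (i, b)]"] l.j(1)[OF that] U(7)[OF B.gr_closed[OF that]] by simp
  have hr: "?h (bvec [Inr (i, a)]) = v a" if "a \<in> gr A i" for i a
    using h(2)[of "[Inr (i, a)]"] r.j(1)[OF that] V(7)[OF A.gr_closed[OF that]] by simp
  have K: "submodule {x \<in> carrier fw.T. ?h x \<in> {\<zero>\<^bsub>N\<^esub>}} ground fw.T"
    by (rule klin_preimage_submodule[OF H(1) fw.tw.T_kmodule N.kmodule]) (rule N.ksubmoduleI; simp)
  have "ideal {x \<in> carrier fw.T. ?h x \<in> {\<zero>\<^bsub>N\<^esub>}} fw.T"
    using K H(4,7) fw.tw.mult_closed unfolding submodule_def
    by (intro idealI) (auto simp: fw.tw.T_ring simp del: fw.T_simps')
  moreover have "G \<subseteq> {x \<in> carrier fw.T. ?h x \<in> {\<zero>\<^bsub>N\<^esub>}}"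
  proof
    fix g assume g: "g \<in> G"
    have "?h g = \<zero>\<^bsub>N\<^esub>" if gb: "g \<in> base_rels"
    proof -
      obtain i s where s': "s \<in> gr S i" "g = bvec [Inl (i, \<beta> s)] \<oplus>\<^bsub>fw.T\<^esub> (- 1) \<odot>\<^bsub>fw.T\<^esub> bvec [Inr (i, \<alpha> s)]"
        by (rule base_rels_cases[OF gb])
      note b = base_gr[OF s'(1)]
      have "u (\<beta> s) = v (\<alpha> s)" "v (\<alpha> s) \<in> carrier N"
        using s[OF S.gr_closed[OF s'(1)]] V(7)[OF A.gr_closed[OF b(2)]] by auto
      then show ?thesis
        using b by (simp add: s'(2) klinD[OF H(1)] l.jc r.jc hl hr N.kcancel del: fw.T_simps')
    qed
    then have "?h g = \<zero>\<^bsub>N\<^esub>"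
      using g l.eval_kills_alg_rels[OF N u h(1) hl] r.eval_kills_alg_rels[OF N v h(1) hr] by blast
    then show "g \<in> {x \<in> carrier fw.T. ?h x \<in> {\<zero>\<^bsub>N\<^esub>}}" using g G_closed by auto
  qed
  ultimately have "I \<subseteq> {x \<in> carrier fw.T. ?h x \<in> {\<zero>\<^bsub>N\<^esub>}}"
    unfolding I_eq by (rule fw.tw.T.genideal_minimal)
  then obtain f where f: "f \<in> dga_hom P N" "\<And>x. x \<in> carrier fw.T \<Longrightarrow> f (I +>\<^bsub>fw.T\<^esub> x) = ?h x"
    using I.dga_hom_quot[OF h(1) N.predg_algebra] unfolding P_eq by blast
  have "f (inl b) = u b" if "b \<in> carrier B" for b
    by (rule B.klin_gr_eq[OF klin_comp[OF dga_homD(1)[OF inl_hom] dga_homD(1)[OF f(1)]] U(1) N.kmodule _ that])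
      (simp add: inl_gr f(2) l.jc hl del: fw.T_simps')
  moreover have "f (inr a) = v a" if "a \<in> carrier A" for a
    by (rule A.klin_gr_eq[OF klin_comp[OF dga_homD(1)[OF inr_hom] dga_homD(1)[OF f(1)]] V(1) N.kmodule _ that])
      (simp add: inr_gr f(2) r.jc hr del: fw.T_simps')
  ultimately show thesis using f(1) that by blast
qed

end

section \<open>Graded centralizers\<close>

lemma dga_hom_hcomp:
  assumes f: "f \<in> dga_hom M N" and "gr_module M" "gr_module N" "x \<in> carrier M"
  shows "f (hcomp M i x) = hcomp N i (f x)"
proof -
  interpret M: gr_module M by fact
  interpret N: gr_module N by fact
  note F = dga_homD[OF f]
  show ?thesis
  proof (rule M.klin_gr_eq[OF klin_comp[OF M.hcomp_klin F(1)] klin_comp[OF F(1) N.hcomp_klin] N.kmodule _ assms(4)])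
    fix k x assume x: "x \<in> gr M k"
    show "f (hcomp M i x) = hcomp N i (f x)"
      using M.hcomp_homog[OF x, of i] N.hcomp_homog[OF F(5)[OF x], of i] klin_zero[OF F(1) M.kmodule N.kmodule]
      by simp
  qed
qed

text \<open>
  Stability of \<open>T\<close> under the differential makes the centralizer a DG subalgebra.
\<close>

locale centralizer = dg_algebra P for P :: "('k::field_char_0, 'a) dg" (structure) +
  fixes T
  assumes T: "T \<subseteq> carrier P" and dT: "t \<in> T \<Longrightarrow> dif P t \<in> T"
begin

abbreviation "Z \<equiv> graded_centralizer P T"

lemma Z_gr: "x \<in> gr Z i \<longleftrightarrow> x \<in> gr P i \<and> (\<forall>j. \<forall>t\<in>T \<inter> gr P j. x \<otimes> t = ksign (i * j) \<odot> (t \<otimes> x))"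
  by (simp add: graded_centralizer_def graded_centralizer_part_def)

lemma Z_simps: "x \<oplus>\<^bsub>Z\<^esub> y = x \<oplus> y" "x \<otimes>\<^bsub>Z\<^esub> y = x \<otimes> y" "r \<odot>\<^bsub>Z\<^esub> x = r \<odot> x" "\<zero>\<^bsub>Z\<^esub> = \<zero>" "\<one>\<^bsub>Z\<^esub> = \<one>" "dif Z = dif P"
  by (simp_all add: graded_centralizer_def)

lemma Z_carrier: "x \<in> carrier Z \<longleftrightarrow> x \<in> carrier P \<and> (\<forall>i. hcomp P i x \<in> gr Z i)"
  by (simp add: graded_centralizer_def)

lemma Z_gr_submodule: "submodule (gr Z i) ground P"
proof (rule ksubmoduleI)
  have tc: "t \<in> T \<Longrightarrow> t \<in> carrier P" for t using T by blast
  show "gr Z i \<subseteq> carrier P" using Z_gr gr_closed by blast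
  show "\<zero> \<in> gr Z i" using tc by (auto simp: Z_gr)
  fix x y r assume x: "x \<in> gr Z i" and y: "y \<in> gr Z i"
  then have c: "x \<in> carrier P" "y \<in> carrier P" using Z_gr gr_closed by blast+
  show "x \<oplus> y \<in> gr Z i"
    using x y c tc by (auto simp: Z_gr gr_add l_distr r_distr ksmult_r_add)
  show "r \<odot> x \<in> gr Z i"
    using x c tc by (auto simp: Z_gr gr_smult smult_mult_l smult_mult_r ksmult_assoc mult.commute)
qed

lemma Z_gr_P: "x \<in> gr Z i \<Longrightarrow> x \<in> gr P i" "x \<in> gr Z i \<Longrightarrow> x \<in> carrier P"
  using Z_gr gr_closed by blast+

lemma Z_submodule: "submodule (carrier Z) ground P"
proof (rule ksubmoduleI)
  note D = ksubmoduleD[OF Z_gr_submodule]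
  show "carrier Z \<subseteq> carrier P" by (auto simp: Z_carrier)
  show "\<zero> \<in> carrier Z" by (simp add: Z_carrier klin_zero[OF hcomp_klin kmodule kmodule] D)
qed (simp_all add: Z_carrier klinD[OF hcomp_klin] ksubmoduleD[OF Z_gr_submodule])

lemma Z_gr_carrier: "x \<in> gr Z i \<Longrightarrow> x \<in> carrier Z"
  using hcomp_homog[OF Z_gr_P(1)] Z_gr_P ksubmoduleD(3)[OF Z_gr_submodule] by (simp add: Z_carrier)

lemma Z_gr_mult: "\<lbrakk>x \<in> gr Z i; y \<in> gr Z j\<rbrakk> \<Longrightarrow> x \<otimes> y \<in> gr Z (i + j)"
proof -
  assume x: "x \<in> gr Z i" and y: "y \<in> gr Z j"
  note c = Z_gr_P(2)[OF x] Z_gr_P(2)[OF y]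
  have "x \<otimes> y \<otimes> t = ksign ((i + j) * k) \<odot> (t \<otimes> (x \<otimes> y))" if t: "t \<in> T" "t \<in> gr P k" for t k
  proof -
    have tc: "t \<in> carrier P" using t T by blast
    have e: "x \<otimes> t = ksign (i * k) \<odot> (t \<otimes> x)" "y \<otimes> t = ksign (j * k) \<odot> (t \<otimes> y)"
      using x y t by (auto simp: Z_gr)
    have s: "ksign ((i + j) * k) = (ksign (j * k) * ksign (i * k) :: 'k)"
      by (simp add: distrib_right ksign_add)
    have "x \<otimes> y \<otimes> t = ksign (j * k) \<odot> (x \<otimes> t \<otimes> y)"
      using c tc by (simp add: m_assoc e(2) smult_mult_r)
    then show ?thesis
      using c tc by (simp add: e(1) s smult_mult_l ksmult_assoc m_assoc)
  qed
  then show ?thesis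
    using mult_degree[OF Z_gr_P(1)[OF x] Z_gr_P(1)[OF y]] by (simp add: Z_gr)
qed

text \<open>
  Differentiate \<open>x t = (-1)^(i k) t x\<close> by the Leibniz rule; the terms with \<open>dt\<close> cancel because \<open>dt\<close> lies in
  \<open>T\<close> and is therefore also centralized by \<open>x\<close>.
\<close>

lemma Z_gr_dif:
  assumes x: "x \<in> gr Z i"
  shows "dif P x \<in> gr Z (i - 1)"
proof -
  note c = Z_gr_P[OF x]
  have "dif P x \<otimes> t = ksign ((i - 1) * k) \<odot> (t \<otimes> dif P x)" if t: "t \<in> T" "t \<in> gr P k" for t k
  proof -
    have tc: "t \<in> carrier P" "dif P t \<in> carrier P" using t T by auto
    have e: "x \<otimes> t = ksign (i * k) \<odot> (t \<otimes> x)" "x \<otimes> dif P t = ksign (i * (k - 1)) \<odot> (dif P t \<otimes> x)"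
      using x t dT dif_degree[OF t(2)] by (auto simp: Z_gr)
    have s: "ksign (i * (k - 1)) = (ksign (i * k) * ksign i :: 'k)" "ksign ((i - 1) * k) = (ksign (i * k) * ksign k :: 'k)"
      by (simp_all add: algebra_simps ksign_add)
    have k: "ksign i * (r * ksign i) = r" for r :: 'k
      by (simp add: ksign_def)
    let ?p = "dif P x \<otimes> t" and ?q = "dif P t \<otimes> x" and ?r = "t \<otimes> dif P x"
    have "dif P (x \<otimes> t) = ?p \<oplus> ksign (i * k) \<odot> ?q"
      using c tc by (simp add: leibniz[OF c(1)] e(2)[unfolded s] ksmult_assoc k)
    moreover have "dif P (x \<otimes> t) = ksign (i * k) \<odot> ?q \<oplus> (ksign (i * k) * ksign k) \<odot> ?r"
      using c tc by (simp add: e(1) dif_smult leibniz[OF t(2)] ksmult_r_add ksmult_assoc)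
    ultimately have "?p \<oplus> ksign (i * k) \<odot> ?q = (ksign (i * k) * ksign k) \<odot> ?r \<oplus> ksign (i * k) \<odot> ?q"
      using c tc by (simp add: a_comm)
    then show ?thesis using c tc by (simp add: s)
  qed
  then show ?thesis using dif_degree[OF c(1)] by (simp add: Z_gr)
qed

lemma Z_kmodule: "kmodule Z"
proof -
  note D = ksubmoduleD[OF Z_submodule]
  show ?thesis
  proof (rule kmoduleI)
    show "abelian_group Z"
    proof (rule abelian_groupI)
      fix x assume x: "x \<in> carrier Z"
      show "\<exists>y\<in>carrier Z. y \<oplus>\<^bsub>Z\<^esub> x = \<zero>\<^bsub>Z\<^esub>"
        by (rule bexI[of _ "(- 1) \<odot> x"]) (use x D in \<open>simp_all add: Z_simps kcancel\<close>)
    qed (use D in \<open>auto simp: Z_simps a_ac\<close>)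
  qed (use D in \<open>auto simp: Z_simps ksmult_add ksmult_r_add ksmult_assoc\<close>)
qed

lemma Z_incl: "klin Z P (\<lambda>x. x)"
  using ksubmoduleD(2)[OF Z_submodule] by (intro klinI) (simp_all add: Z_simps)

lemma Z_gr_module: "gr_module Z"
proof (rule gr_moduleI[OF Z_kmodule])
  interpret Z: kmodule Z by (rule Z_kmodule)
  show "submodule (gr Z i) ground Z" for i
    by (rule Z.ksubmoduleI) (use ksubmoduleD[OF Z_gr_submodule] Z_gr_carrier in \<open>auto simp: Z_simps\<close>)
  show "carrier Z \<subseteq> hsums Z"
  proof
    fix x assume x: "x \<in> carrier Z"
    then have c: "x \<in> carrier P" "\<And>i. hcomp P i x \<in> gr Z i" by (auto simp: Z_carrier)
    have "(\<Oplus>i\<in>J. hcomp P i x) \<in> hsums Z" if "finite J" for J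
      using that
    proof (induction J)
      case empty
      show ?case using hsums.zero[of Z] by (simp add: Z_simps)
    next
      case (insert i J)
      then show ?case using hsums.add[OF c(2)] c(1) by (simp add: M.finsum_insert Pi_def Z_simps)
    qed
    from this[OF hcomp_finite[OF c(1)]] show "x \<in> hsums Z" by (simp add: hcomp_sum[OF c(1) hcomp_finite[OF c(1)]])
  qed
  fix J c assume J: "finite J" and c: "\<And>i. c i \<in> gr Z i" and z: "(\<Oplus>\<^bsub>Z\<^esub>i\<in>J. c i) = \<zero>\<^bsub>Z\<^esub>"
  have "(\<Oplus>\<^bsub>Z\<^esub>i\<in>J. c i) = (\<Oplus>i\<in>J. c i)"
    using klin_finsum[OF Z_incl Z_kmodule kmodule, of J c] Z_gr_carrier[OF c] by simp
  then have 1: "hcomp P i (\<Oplus>i\<in>J. c i) = \<zero>" for i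
    using z klin_zero[OF hcomp_klin kmodule kmodule] by (simp add: Z_simps)
  have g: "\<And>i. c i \<in> gr P i" by (rule Z_gr_P(1)[OF c])
  show "\<forall>i\<in>J. c i = \<zero>\<^bsub>Z\<^esub>"
  proof
    fix i assume "i \<in> J"
    then have "hcomp P i (\<Oplus>i\<in>J. c i) = c i" using hcomp_eqI[OF J g, of i] by simp
    then show "c i = \<zero>\<^bsub>Z\<^esub>" using 1 by (simp add: Z_simps)
  qed
qed

lemma Z_dg_algebra: "dg_algebra Z"
proof -
  interpret Z: gr_module Z by (rule Z_gr_module)
  note D = ksubmoduleD(2)[OF Z_submodule]
  have m1: "x \<otimes> y \<in> carrier Z" if x: "x \<in> gr Z i" and y: "y \<in> carrier Z" for x y i
    using y
  proof (induction y rule: Z.gr_induct)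
    case zero
    show ?case using Z_gr_P(2)[OF x] ksubmoduleD(3)[OF Z_submodule] by (simp add: Z_simps)
  next
    case (add j u v)
    then show ?case
      using Z_gr_P(2)[OF x] Z_gr_P(2)[OF add(1)] D[OF add(2)] Z_gr_carrier[OF Z_gr_mult[OF x add(1)]]
      by (simp add: Z_simps r_distr ksubmoduleD(4)[OF Z_submodule])
  qed
  have m: "x \<otimes> y \<in> carrier Z" if x: "x \<in> carrier Z" and y: "y \<in> carrier Z" for x y
    using x
  proof (induction x rule: Z.gr_induct)
    case zero
    show ?case using D[OF y] ksubmoduleD(3)[OF Z_submodule] by (simp add: Z_simps)
  next
    case (add j u v)
    then show ?case
      using D[OF y] Z_gr_P(2)[OF add(1)] D[OF add(2)] m1[OF add(1) y]
      by (simp add: Z_simps l_distr ksubmoduleD(4)[OF Z_submodule])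
  qed
  have o: "\<one> \<in> gr Z 0" using T one_degree by (auto simp: Z_gr)
  have d: "dif P x \<in> carrier Z" if x: "x \<in> carrier Z" for x
    using x
  proof (induction x rule: Z.gr_induct)
    case zero
    show ?case using klin_zero[OF dif_klin kmodule kmodule] ksubmoduleD(3)[OF Z_submodule] by (simp add: Z_simps)
  next
    case (add j u v)
    then show ?case
      using Z_gr_P(2)[OF add(1)] D[OF add(2)] Z_gr_carrier[OF Z_gr_dif[OF add(1)]]
      by (simp add: Z_simps dif_add ksubmoduleD(4)[OF Z_submodule])
  qed
  have "ring Z"
  proof (rule ringI)
    show "abelian_group Z" using Z_kmodule by (simp add: kmodule_def module_def)
    show "monoid Z"
      by (rule monoidI) (use m D Z_gr_carrier[OF o] in \<open>auto simp: Z_simps m_assoc\<close>)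
  qed (use D in \<open>auto simp: Z_simps l_distr r_distr\<close>)
  then have "predg_algebra Z"
    using Z_gr_module o
    by (intro predg_algebra.intro gr_algebra.intro gr_algebra_axioms.intro predg_algebra_axioms.intro klinI)
      (auto simp: Z_simps D smult_mult_l smult_mult_r Z_gr_mult Z_gr_dif d dif_add dif_smult)
  then show ?thesis
    by (rule dg_algebraI) (use Z_gr_P in \<open>simp_all add: Z_simps dif_dif leibniz\<close>)
qed

end

section \<open>The endomorphism algebra\<close>

lemma lin_endoI:
  assumes "klin V V f" "f \<in> extensional (carrier V)"
  shows "f \<in> lin_endo V"
  using assms by (auto simp: lin_endo_def klin_def PiE_def)

lemma lin_endoD:
  assumes "f \<in> lin_endo V"
  shows "klin V V f" "f \<in> extensional (carrier V)"
  using assms by (auto simp: lin_endo_def klin_def PiE_def)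

lemma homog_endo_lin: "f \<in> homog_endo V i \<Longrightarrow> f \<in> lin_endo V"
  by (simp add: homog_endo_def)

context dg_module
begin

text \<open>
  The differential of \<open>End_dga\<close> is defined by extension from the homogeneous components in \<open>gEnd\<close>. Both \<open>gEnd\<close>
  and \<open>End_dga\<close> are this algebra for different \<open>d\<close>, and everything but the differential is proved for all \<open>d\<close> at once.
\<close>

definition gEnd' :: "(('a \<Rightarrow> 'a) \<Rightarrow> 'a \<Rightarrow> 'a) \<Rightarrow> ('k, 'a \<Rightarrow> 'a) dg"
  where "gEnd' d = (gEnd M)\<lparr>dif := d\<rparr>"

lemma gEnd_simps:
  "f \<oplus>\<^bsub>gEnd' d\<^esub> g = (\<lambda>v\<in>carrier M. f v \<oplus> g v)" "r \<odot>\<^bsub>gEnd' d\<^esub> f = (\<lambda>v\<in>carrier M. r \<odot> f v)"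
  "f \<otimes>\<^bsub>gEnd' d\<^esub> g = compose (carrier M) f g" "\<zero>\<^bsub>gEnd' d\<^esub> = (\<lambda>v\<in>carrier M. \<zero>)"
  "\<one>\<^bsub>gEnd' d\<^esub> = (\<lambda>v\<in>carrier M. v)" "gr (gEnd' d) = homog_endo M" "dif (gEnd' d) = d"
  by (simp_all add: gEnd'_def gEnd_def)

lemma gEnd_carrier: "f \<in> carrier (gEnd' d) \<longleftrightarrow> f \<in> lin_endo M \<and>
    (\<exists>J c. finite J \<and> (\<forall>i\<in>J. c i \<in> homog_endo M i) \<and> (\<forall>v\<in>carrier M. f v = (\<Oplus>i\<in>J. c i v)))"
  by (simp add: gEnd'_def gEnd_def)

lemma endo_app: "\<lbrakk>f \<in> lin_endo M; v \<in> carrier M\<rbrakk> \<Longrightarrow> f v \<in> carrier M"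
  by (rule klinD(1)[OF lin_endoD(1)])

lemma endo_restrict: "klin M M f \<Longrightarrow> (\<lambda>v\<in>carrier M. f v) \<in> lin_endo M"
  by (rule lin_endoI[OF klin_restrict[OF kmodule]]) simp_all

lemma homog_endoI:
  assumes "klin M M f" "\<And>j v. v \<in> gr M j \<Longrightarrow> f v \<in> gr M (i + j)"
  shows "(\<lambda>v\<in>carrier M. f v) \<in> homog_endo M i"
  using endo_restrict[OF assms(1)] assms(2) gr_closed by (auto simp: homog_endo_def)

lemma homog_endoD:
  assumes "f \<in> homog_endo M i"
  shows "klin M M f" "v \<in> gr M j \<Longrightarrow> f v \<in> gr M (i + j)" "v \<in> carrier M \<Longrightarrow> f v \<in> carrier M"
    "f \<in> extensional (carrier M)"
  using assms lin_endoD[of f M] endo_app[of f] by (auto simp: homog_endo_def)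

lemma klin_const_zero: "klin M M (\<lambda>v. \<zero>)"
  by (rule klinI) auto

lemma homog_endo_zero: "(\<lambda>v\<in>carrier M. \<zero>) \<in> homog_endo M i"
  by (rule homog_endoI[OF klin_const_zero]) simp

lemma homog_endo_add:
  "\<lbrakk>f \<in> homog_endo M i; g \<in> homog_endo M i\<rbrakk> \<Longrightarrow> (\<lambda>v\<in>carrier M. f v \<oplus> g v) \<in> homog_endo M i"
  by (rule homog_endoI[OF klin_plus[OF _ _ kmodule]]) (simp_all add: homog_endoD gr_add)

lemma homog_endo_smult: "f \<in> homog_endo M i \<Longrightarrow> (\<lambda>v\<in>carrier M. r \<odot> f v) \<in> homog_endo M i"
  by (rule homog_endoI[OF klin_scale[OF _ kmodule]]) (simp_all add: homog_endoD gr_smult)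

lemma homog_endo_compose:
  assumes f: "f \<in> homog_endo M i" and g: "g \<in> homog_endo M j"
  shows "compose (carrier M) f g \<in> homog_endo M (i + j)"
  unfolding compose_def
proof (rule homog_endoI[OF klin_comp[OF homog_endoD(1)[OF g] homog_endoD(1)[OF f]]])
  fix k v assume "v \<in> gr M k"
  then show "f (g v) \<in> gr M (i + j + k)"
    using homog_endoD(2)[OF f homog_endoD(2)[OF g, of v k]] by (simp add: add.assoc)
qed

lemma homog_endo_id: "(\<lambda>v\<in>carrier M. v) \<in> homog_endo M 0"
  by (rule homog_endoI) (auto intro: klinI)

lemma homog_endo_carrier:
  assumes "f \<in> homog_endo M i"
  shows "f \<in> carrier (gEnd' d)"
proof -
  have "f v = (\<Oplus>i\<in>{i}. f v)" if "v \<in> carrier M" for v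
    using homog_endoD(3)[OF assms that] by (simp add: M.finsum_insert)
  then show ?thesis
    unfolding gEnd_carrier using assms homog_endo_lin[OF assms]
    by (intro conjI exI[of _ "{i}"] exI[of _ "\<lambda>_. f"]) auto
qed

lemma gEnd_add_closed:
  assumes f: "f \<in> carrier (gEnd' d)" and g: "g \<in> carrier (gEnd' d)"
  shows "(\<lambda>v\<in>carrier M. f v \<oplus> g v) \<in> carrier (gEnd' d)"
proof -
  obtain J c where c: "finite J" "\<And>i. i \<in> J \<Longrightarrow> c i \<in> homog_endo M i" "\<And>v. v \<in> carrier M \<Longrightarrow> f v = (\<Oplus>i\<in>J. c i v)"
    using f unfolding gEnd_carrier by blast
  obtain J' c' where c': "finite J'" "\<And>i. i \<in> J' \<Longrightarrow> c' i \<in> homog_endo M i" "\<And>v. v \<in> carrier M \<Longrightarrow> g v = (\<Oplus>i\<in>J'. c' i v)"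
    using g unfolding gEnd_carrier by blast
  let ?z = "\<lambda>v\<in>carrier M. \<zero>"
  define b where "b i = (if i \<in> J then c i else ?z)" for i
  define b' where "b' i = (if i \<in> J' then c' i else ?z)" for i
  have h: "b i \<in> homog_endo M i" "b' i \<in> homog_endo M i" for i
    using c(2) c'(2) homog_endo_zero by (auto simp: b_def b'_def)
  have "f v \<oplus> g v = (\<Oplus>i\<in>J \<union> J'. b i v \<oplus> b' i v)" if v: "v \<in> carrier M" for v
  proof -
    have "(\<Oplus>i\<in>J. c i v) = (\<Oplus>i\<in>J \<union> J'. b i v)"
      using c(1) c'(1) v homog_endoD(3)[OF h(1)]
      by (intro M.add.finprod_mono_neutral_cong_left) (auto simp: b_def)
    moreover have "(\<Oplus>i\<in>J'. c' i v) = (\<Oplus>i\<in>J \<union> J'. b' i v)"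
      using c(1) c'(1) v homog_endoD(3)[OF h(2)]
      by (intro M.add.finprod_mono_neutral_cong_left) (auto simp: b'_def)
    ultimately show ?thesis
      using v homog_endoD(3)[OF h(1)] homog_endoD(3)[OF h(2)] by (simp add: c(3) c'(3) M.finsum_addf)
  qed
  moreover have "(\<lambda>v\<in>carrier M. f v \<oplus> g v) \<in> lin_endo M"
    using f g by (intro endo_restrict klin_plus[OF _ _ kmodule]) (simp_all add: gEnd_carrier lin_endoD)
  ultimately show ?thesis
    unfolding gEnd_carrier using c(1) c'(1) homog_endo_add[OF h]
    by (intro conjI exI[of _ "J \<union> J'"] exI[of _ "\<lambda>i. \<lambda>v\<in>carrier M. b i v \<oplus> b' i v"]) auto
qed

lemma gEnd_smult_closed:
  assumes f: "f \<in> carrier (gEnd' d)"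
  shows "(\<lambda>v\<in>carrier M. r \<odot> f v) \<in> carrier (gEnd' d)"
proof -
  obtain J c where c: "finite J" "\<And>i. i \<in> J \<Longrightarrow> c i \<in> homog_endo M i" "\<And>v. v \<in> carrier M \<Longrightarrow> f v = (\<Oplus>i\<in>J. c i v)"
    using f unfolding gEnd_carrier by blast
  have "r \<odot> f v = (\<Oplus>i\<in>J. r \<odot> c i v)" if v: "v \<in> carrier M" for v
    unfolding c(3)[OF v]
    by (rule finsum_smult_ldistr[OF c(1)]) (use homog_endoD(3)[OF c(2) v] in auto)
  then have "\<forall>v\<in>carrier M. (\<lambda>v\<in>carrier M. r \<odot> f v) v = (\<Oplus>i\<in>J. (\<lambda>v\<in>carrier M. r \<odot> c i v) v)"
    by simp
  moreover have "(\<lambda>v\<in>carrier M. r \<odot> f v) \<in> lin_endo M"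
    using f by (intro endo_restrict klin_scale[OF _ kmodule]) (simp_all add: gEnd_carrier lin_endoD)
  ultimately show ?thesis
    unfolding gEnd_carrier using c(1) homog_endo_smult[OF c(2)]
    by (intro conjI exI[of _ J] exI[of _ "\<lambda>i. \<lambda>v\<in>carrier M. r \<odot> c i v"]) auto
qed

lemma gEndD:
  assumes "f \<in> carrier (gEnd' d)"
  shows "klin M M f" "f \<in> extensional (carrier M)" "v \<in> carrier M \<Longrightarrow> f v \<in> carrier M"
proof -
  have f: "f \<in> lin_endo M" using assms unfolding gEnd_carrier by blast
  show "klin M M f" "f \<in> extensional (carrier M)" by (rule lin_endoD[OF f])+
  show "v \<in> carrier M \<Longrightarrow> f v \<in> carrier M" by (rule endo_app[OF f])
qed

lemma gEnd_ext:
  assumes "f \<in> carrier (gEnd' d)" "g \<in> carrier (gEnd' d)" "\<And>v. v \<in> carrier M \<Longrightarrow> f v = g v"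
  shows "f = g"
  using gEndD(2)[OF assms(1)] gEndD(2)[OF assms(2)] assms(3) by (rule extensionalityI)

lemma gEnd_zero_closed: "(\<lambda>v\<in>carrier M. \<zero>) \<in> carrier (gEnd' d)"
  by (rule homog_endo_carrier[OF homog_endo_zero[of 0]])

lemma gEnd_kmodule: "kmodule (gEnd' d)"
proof (rule kmoduleI)
  show "abelian_group (gEnd' d)"
  proof (rule abelian_groupI)
    fix f assume f: "f \<in> carrier (gEnd' d)"
    show "\<exists>g\<in>carrier (gEnd' d). g \<oplus>\<^bsub>gEnd' d\<^esub> f = \<zero>\<^bsub>gEnd' d\<^esub>"
      by (rule bexI[OF _ gEnd_smult_closed[OF f, of "- 1"]])
        (unfold gEnd_simps, rule restrict_ext, simp add: kcancel gEndD(3)[OF f])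
    show "\<zero>\<^bsub>gEnd' d\<^esub> \<oplus>\<^bsub>gEnd' d\<^esub> f = f"
      unfolding gEnd_simps
      by (rule gEnd_ext[OF gEnd_add_closed[OF gEnd_zero_closed f] f]) (use gEndD(3)[OF f] in simp)
  qed (auto simp: gEnd_simps gEnd_add_closed gEnd_zero_closed gEndD(3) a_ac intro!: restrict_ext)
  fix f assume f: "f \<in> carrier (gEnd' d)"
  show "1 \<odot>\<^bsub>gEnd' d\<^esub> f = f"
    unfolding gEnd_simps
    by (rule gEnd_ext[OF gEnd_smult_closed[OF f] f]) (use gEndD(3)[OF f] in simp)
qed (auto simp: gEnd_simps gEnd_smult_closed gEndD(3) ksmult_add ksmult_r_add ksmult_assoc intro!: restrict_ext)

lemma gEnd_eval: "v \<in> carrier M \<Longrightarrow> klin (gEnd' d) M (\<lambda>f. f v)"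
  by (rule klinI) (auto simp: gEnd_simps gEndD(3))

lemma gEnd_gr_module: "gr_module (gEnd' d)"
proof (rule gr_moduleI[OF gEnd_kmodule])
  interpret E: kmodule "gEnd' d" by (rule gEnd_kmodule)
  show "submodule (gr (gEnd' d) i) ground (gEnd' d)" for i
    by (rule E.ksubmoduleI)
      (auto simp: gEnd_simps homog_endo_carrier homog_endo_zero homog_endo_add homog_endo_smult)
  show "carrier (gEnd' d) \<subseteq> hsums (gEnd' d)"
  proof
    fix f assume f: "f \<in> carrier (gEnd' d)"
    then obtain J c where c: "finite J" "\<And>i. i \<in> J \<Longrightarrow> c i \<in> homog_endo M i"
      "\<And>v. v \<in> carrier M \<Longrightarrow> f v = (\<Oplus>i\<in>J. c i v)"
      unfolding gEnd_carrier by blast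
    have "(\<lambda>v\<in>carrier M. \<Oplus>i\<in>J'. c i v) \<in> hsums (gEnd' d)" if "finite J'" "J' \<subseteq> J" for J'
      using that
    proof (induction J')
      case empty
      have "(\<lambda>v\<in>carrier M. \<Oplus>i\<in>{}. c i v) = \<zero>\<^bsub>gEnd' d\<^esub>" by (simp add: gEnd_simps)
      then show ?case using hsums.zero[of "gEnd' d"] by metis
    next
      case (insert i J')
      have "c i \<oplus>\<^bsub>gEnd' d\<^esub> (\<lambda>v\<in>carrier M. \<Oplus>i\<in>J'. c i v) \<in> hsums (gEnd' d)"
      proof (rule hsums.add)
        show "c i \<in> gr (gEnd' d) i" using insert c(2) by (simp add: gEnd_simps)
        show "(\<lambda>v\<in>carrier M. \<Oplus>i\<in>J'. c i v) \<in> hsums (gEnd' d)" using insert by blast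
      qed
      moreover have "(\<Oplus>i\<in>insert i J'. c i v) = c i v \<oplus> (\<Oplus>i\<in>J'. c i v)" if "v \<in> carrier M" for v
        using insert homog_endoD(3)[OF c(2) that] by (subst M.finsum_insert) auto
      then have "(\<lambda>v\<in>carrier M. \<Oplus>i\<in>insert i J'. c i v) = c i \<oplus>\<^bsub>gEnd' d\<^esub> (\<lambda>v\<in>carrier M. \<Oplus>i\<in>J'. c i v)"
        unfolding gEnd_simps by (intro restrict_ext) simp
      ultimately show ?case by (simp only:)
    qed
    moreover have "(\<lambda>v\<in>carrier M. \<Oplus>i\<in>J. c i v) = f"
      by (rule extensionalityI[OF _ gEndD(2)[OF f]]) (auto simp: c(3))
    ultimately show "f \<in> hsums (gEnd' d)" using c(1) by auto
  qed
  fix J c assume J: "finite J" and c: "\<And>i. c i \<in> gr (gEnd' d) i" and z: "(\<Oplus>\<^bsub>gEnd' d\<^esub>i\<in>J. c i) = \<zero>\<^bsub>gEnd' d\<^esub>"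
  have h: "\<And>i. c i \<in> homog_endo M i" using c by (simp add: gEnd_simps)
  show "\<forall>i\<in>J. c i = \<zero>\<^bsub>gEnd' d\<^esub>"
  proof
    fix i assume i: "i \<in> J"
    have "c i v = \<zero>" if v: "v \<in> gr M j" for v j
    proof -
      have vc: "v \<in> carrier M" using v by (rule gr_closed)
      have "(\<Oplus>i\<in>J. c i v) = (\<Oplus>\<^bsub>gEnd' d\<^esub>i\<in>J. c i) v"
        using klin_finsum[OF gEnd_eval[OF vc] gEnd_kmodule kmodule, of J c] homog_endo_carrier[OF h] by simp
      then have "\<zero> = hcomp M (i + j) (\<Oplus>i\<in>J. c i v)"
        using z vc klin_zero[OF hcomp_klin kmodule kmodule] by (simp add: gEnd_simps)
      also have "\<dots> = (\<Oplus>k\<in>J. hcomp M (i + j) (c k v))"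
        by (rule klin_finsum[OF hcomp_klin kmodule kmodule]) (rule homog_endoD(3)[OF h vc])
      also have "\<dots> = hcomp M (i + j) (c i v)"
        using hcomp_homog[OF homog_endoD(2)[OF h v]] homog_endoD(3)[OF h vc]
        by (intro finsum_single[OF J i]) auto
      also have "\<dots> = c i v" using hcomp_homog[OF homog_endoD(2)[OF h v]] by simp
      finally show ?thesis ..
    qed
    then have "c i v = \<zero>" if "v \<in> carrier M" for v
      using klin_gr_eq[OF homog_endoD(1)[OF h] klin_const_zero kmodule _ that] by blast
    then show "c i = \<zero>\<^bsub>gEnd' d\<^esub>"
      using homog_endoD(4)[OF h[of i]] by (auto simp: gEnd_simps intro!: extensionalityI)
  qed
qed

text \<open>
  A product of two finite sums of homogeneous endomorphisms is again such a sum; induction on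
  the two decompositions replaces the regrouping of the double sum by degrees.
\<close>

lemma gEnd_compose_closed:
  assumes f: "f \<in> carrier (gEnd' d)" and g: "g \<in> carrier (gEnd' d)"
  shows "compose (carrier M) f g \<in> carrier (gEnd' d)"
proof -
  interpret E: gr_module "gEnd' d" by (rule gEnd_gr_module)
  have 1: "compose (carrier M) h g \<in> carrier (gEnd' d)" if h: "h \<in> homog_endo M i" for h i
    using g
  proof (induction g rule: E.gr_induct)
    case zero
    have "compose (carrier M) h (\<lambda>v\<in>carrier M. \<zero>) = (\<lambda>v\<in>carrier M. \<zero>)"
      using klin_zero[OF homog_endoD(1)[OF h] kmodule kmodule] by (auto simp: compose_def)
    then show ?case unfolding gEnd_simps by (metis gEnd_zero_closed)
  next
    case (add j x y)
    have x: "x \<in> homog_endo M j" using add(1) by (simp add: gEnd_simps)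
    have "compose (carrier M) h (\<lambda>v\<in>carrier M. x v \<oplus> y v) =
        (\<lambda>v\<in>carrier M. compose (carrier M) h x v \<oplus> compose (carrier M) h y v)"
      using homog_endoD(3)[OF x] gEndD(3)[OF add(2)]
      by (auto simp: compose_def klinD(2)[OF homog_endoD(1)[OF h]])
    then show ?case
      using gEnd_add_closed[OF homog_endo_carrier[OF homog_endo_compose[OF h x]] add(3)] unfolding gEnd_simps by metis
  qed
  show ?thesis
    using f
  proof (induction f rule: E.gr_induct)
    case zero
    have "compose (carrier M) (\<lambda>v\<in>carrier M. \<zero>) g = (\<lambda>v\<in>carrier M. \<zero>)"
      using gEndD(3)[OF g] by (auto simp: compose_def)
    then show ?case unfolding gEnd_simps by (metis gEnd_zero_closed)
  next
    case (add j x y)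
    have x: "x \<in> homog_endo M j" using add(1) by (simp add: gEnd_simps)
    have "compose (carrier M) (\<lambda>v\<in>carrier M. x v \<oplus> y v) g =
        (\<lambda>v\<in>carrier M. compose (carrier M) x g v \<oplus> compose (carrier M) y g v)"
      using gEndD(3)[OF g] by (auto simp: compose_def)
    then show ?case
      using gEnd_add_closed[OF 1[OF x] add(3)] unfolding gEnd_simps by metis
  qed
qed

lemma gEnd_gr_algebra: "gr_algebra (gEnd' d)"
proof (intro gr_algebra.intro gr_algebra_axioms.intro gEnd_gr_module)
  show "ring (gEnd' d)"
  proof (rule ringI)
    show "abelian_group (gEnd' d)" using gEnd_kmodule by (simp add: kmodule_def module_def)
    show "monoid (gEnd' d)"
    proof (rule monoidI)
      fix f assume f: "f \<in> carrier (gEnd' d)"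
      have o: "(\<lambda>v\<in>carrier M. v) \<in> carrier (gEnd' d)" by (rule homog_endo_carrier[OF homog_endo_id])
      show "\<one>\<^bsub>gEnd' d\<^esub> \<otimes>\<^bsub>gEnd' d\<^esub> f = f" "f \<otimes>\<^bsub>gEnd' d\<^esub> \<one>\<^bsub>gEnd' d\<^esub> = f"
        unfolding gEnd_simps
        by (rule gEnd_ext[OF gEnd_compose_closed[OF o f] f]; use gEndD(3)[OF f] in \<open>simp add: compose_def\<close>)
          (rule gEnd_ext[OF gEnd_compose_closed[OF f o] f]; use gEndD(3)[OF f] in \<open>simp add: compose_def\<close>)
    qed (auto simp: gEnd_simps gEnd_compose_closed[unfolded compose_def] homog_endo_carrier[OF homog_endo_id] compose_def gEndD(3) intro!: restrict_ext)
  qed (auto simp: gEnd_simps compose_def gEndD(3) klinD(2)[OF gEndD(1)] intro!: restrict_ext)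
qed (auto simp: gEnd_simps compose_def gEndD(3) klinD(3)[OF gEndD(1)] homog_endo_id homog_endo_compose[unfolded compose_def]
    intro!: restrict_ext)

lemma gEnd_eq: "gEnd M = gEnd' undefined"
  by (simp add: gEnd'_def gEnd_def)

definition endo_dif :: "int \<Rightarrow> ('a \<Rightarrow> 'a) \<Rightarrow> 'a \<Rightarrow> 'a"
  where "endo_dif i f = (\<lambda>v\<in>carrier M. dif M (f v) \<ominus> (ksign i \<odot> f (dif M v)))"

abbreviation "E \<equiv> End_dga M"

lemma E_eq: "E = gEnd' (hext (gEnd M) (gEnd M) endo_dif)"
  by (simp add: gEnd'_def End_dga_def endo_dif_def[abs_def])

lemma endo_dif_homog:
  assumes f: "f \<in> homog_endo M i"
  shows "endo_dif i f \<in> homog_endo M (i - 1)"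
  unfolding endo_dif_def
proof (rule homog_endoI)
  show "klin M M (\<lambda>v. dif M (f v) \<ominus> (ksign i \<odot> f (dif M v)))"
    by (rule klin_minus[OF klin_comp[OF homog_endoD(1)[OF f] dif_klin]
          klin_scale[OF klin_comp[OF dif_klin homog_endoD(1)[OF f]] kmodule] kmodule])
  fix j v assume v: "v \<in> gr M j"
  have "dif M (f v) \<in> gr M (i - 1 + j)" "f (dif M v) \<in> gr M (i - 1 + j)"
    using dif_degree[OF homog_endoD(2)[OF f v]] homog_endoD(2)[OF f dif_degree[OF v]] by (simp_all add: algebra_simps)
  then show "dif M (f v) \<ominus> (ksign i \<odot> f (dif M v)) \<in> gr M (i - 1 + j)"
    by (simp add: gr_diff gr_smult)
qed

lemma endo_dif_app:
  assumes "f \<in> homog_endo M i" "v \<in> carrier M"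
  shows "endo_dif i f v = dif M (f v) \<oplus> (- ksign i) \<odot> f (dif M v)"
  using assms homog_endoD(3)[OF assms(1)] by (simp add: endo_dif_def kdiff ksmult_assoc)

lemma endo_dif_hlin: "hlin (gEnd' d) (gEnd' d') endo_dif"
  unfolding hlin_def
proof (intro allI ballI conjI)
  fix i f g r assume "f \<in> gr (gEnd' d) i"
  then have f: "f \<in> homog_endo M i" by (simp add: gEnd_simps)
  note D = homog_endo_carrier[OF endo_dif_homog]
  show "endo_dif i f \<in> carrier (gEnd' d')" by (rule D[OF f])
  note S = homog_endo_smult[OF f, of r]
  show "endo_dif i (r \<odot>\<^bsub>gEnd' d\<^esub> f) = r \<odot>\<^bsub>gEnd' d'\<^esub> endo_dif i f"
    unfolding gEnd_simps
    by (rule gEnd_ext[OF D[OF S] gEnd_smult_closed[OF D[OF f]]])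
      (simp add: endo_dif_app[OF S] endo_dif_app[OF f] homog_endoD(3)[OF f] dif_smult ksmult_r_add ksmult_assoc mult.commute)
  assume "g \<in> gr (gEnd' d) i"
  then have g: "g \<in> homog_endo M i" by (simp add: gEnd_simps)
  note S = homog_endo_add[OF f g]
  show "endo_dif i (f \<oplus>\<^bsub>gEnd' d\<^esub> g) = endo_dif i f \<oplus>\<^bsub>gEnd' d'\<^esub> endo_dif i g"
    unfolding gEnd_simps
    by (rule gEnd_ext[OF D[OF S] gEnd_add_closed[OF D[OF f] D[OF g]]])
      (simp add: endo_dif_app[OF S] endo_dif_app[OF f] endo_dif_app[OF g] homog_endoD(3)[OF f] homog_endoD(3)[OF g]
        dif_add ksmult_r_add ksmult_assoc a_ac)
qed

lemma E_dif: "f \<in> homog_endo M i \<Longrightarrow> dif E f = endo_dif i f"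
proof -
  assume f: "f \<in> homog_endo M i"
  interpret E: gr_module "gEnd M" unfolding gEnd_eq by (rule gEnd_gr_module)
  have "hext (gEnd M) (gEnd M) endo_dif f = endo_dif i f"
    by (rule E.hext_homog[OF E.kmodule]) (use endo_dif_hlin f in \<open>simp_all add: gEnd_eq gEnd_simps\<close>)
  then show ?thesis by (simp add: E_eq gEnd_simps)
qed

text \<open>
  For homogeneous endomorphisms, \<open>df\<close> is the graded commutator of the differential of \<open>V\<close> with \<open>f\<close>;
  this is a derivation, and it squares to zero because the differential of \<open>V\<close> does.
\<close>

lemma E_dg_algebra: "dg_algebra E"
proof (rule dg_algebraI)
  interpret E0: gr_module "gEnd M" unfolding gEnd_eq by (rule gEnd_gr_module)
  have "klin (gEnd M) (gEnd M) (hext (gEnd M) (gEnd M) endo_dif)"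
    by (rule E0.hext_klin[OF E0.kmodule]) (use endo_dif_hlin in \<open>simp add: gEnd_eq\<close>)
  then have "klin E E (dif E)" by (simp add: klin_def E_eq gEnd'_def)
  moreover have "gr_algebra E" unfolding E_eq by (rule gEnd_gr_algebra)
  moreover have gr: "gr E = homog_endo M" by (simp add: E_eq gEnd_simps)
  ultimately show "predg_algebra E"
    by (intro predg_algebra.intro predg_algebra_axioms.intro) (auto simp: E_dif endo_dif_homog)
  fix f i assume "f \<in> gr E i"
  then have f: "f \<in> homog_endo M i" by (simp add: gr)
  note d = endo_dif_homog[OF f]
  have "endo_dif (i - 1) (endo_dif i f) v = \<zero>" if v: "v \<in> carrier M" for v
    using v homog_endoD(3)[OF f] klin_zero[OF homog_endoD(1)[OF f] kmodule kmodule]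
    by (simp add: endo_dif_app[OF d] endo_dif_app[OF f] dif_add dif_smult dif_dif ksmult_r_add flip: ksmult_add)
  then have "endo_dif (i - 1) (endo_dif i f) = (\<lambda>v\<in>carrier M. \<zero>)"
    using homog_endoD(4)[OF endo_dif_homog[OF d]] by (intro extensionalityI) auto
  then show "dif E (dif E f) = \<zero>\<^bsub>E\<^esub>"
    using E_dif[OF f] E_dif[OF d] by (simp add: E_eq gEnd_simps)
  fix g j assume "g \<in> gr E j"
  then have g: "g \<in> homog_endo M j" by (simp add: gr)
  note fg = homog_endo_compose[OF f g] and dg = endo_dif_homog[OF g]
  have eq: "endo_dif (i + j) (compose (carrier M) f g) v =
      endo_dif i f (g v) \<oplus> ksign i \<odot> f (endo_dif j g v)" if v: "v \<in> carrier M" for v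
  proof -
    note c [simp] = v homog_endoD(3)[OF f] homog_endoD(3)[OF g] klinD[OF homog_endoD(1)[OF f]]
    have "endo_dif (i + j) (compose (carrier M) f g) v = dif M (f (g v)) \<oplus> (- (ksign i * ksign j)) \<odot> f (g (dif M v))"
      by (simp add: endo_dif_app[OF fg] compose_eq ksign_add)
    also have "\<dots> = dif M (f (g v)) \<oplus> (((- ksign i) \<odot> f (dif M (g v)) \<oplus> ksign i \<odot> f (dif M (g v))) \<oplus>
        (- (ksign i * ksign j)) \<odot> f (g (dif M v)))"
      by (simp flip: ksmult_add)
    also have "\<dots> = endo_dif i f (g v) \<oplus> ksign i \<odot> f (endo_dif j g v)"
      by (simp add: endo_dif_app[OF f] endo_dif_app[OF g] ksmult_r_add ksmult_assoc a_assoc)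
    finally show ?thesis .
  qed
  have "endo_dif (i + j) (compose (carrier M) f g) =
      (\<lambda>v\<in>carrier M. compose (carrier M) (endo_dif i f) g v \<oplus> ksign i \<odot> compose (carrier M) f (endo_dif j g) v)"
    by (rule extensionalityI[OF homog_endoD(4)[OF endo_dif_homog[OF fg]]]) (simp_all add: eq compose_eq)
  then show "dif E (f \<otimes>\<^bsub>E\<^esub> g) = (dif E f \<otimes>\<^bsub>E\<^esub> g) \<oplus>\<^bsub>E\<^esub> (ksign i \<odot>\<^bsub>E\<^esub> (f \<otimes>\<^bsub>E\<^esub> dif E g))"
    using E_dif[OF f] E_dif[OF g] E_dif[OF fg] by (simp add: E_eq gEnd_simps cong: restrict_cong)
qed

end

section \<open>Homogeneous bases and matrix units\<close>

context kmodule
begin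

definition lincomb where "lincomb Xs r = (\<Oplus>b\<in>Xs. r b \<odot> b)"

lemma lincomb_closed: "Xs \<subseteq> carrier M \<Longrightarrow> lincomb Xs r \<in> carrier M"
  unfolding lincomb_def by (rule M.finsum_closed) auto

lemma lincomb_add:
  assumes "Xs \<subseteq> carrier M"
  shows "lincomb Xs r \<oplus> lincomb Xs s = lincomb Xs (\<lambda>b. r b + s b)"
proof -
  have "lincomb Xs (\<lambda>b. r b + s b) = (\<Oplus>b\<in>Xs. r b \<odot> b \<oplus> s b \<odot> b)"
    unfolding lincomb_def using assms by (intro M.finsum_cong') (auto simp: ksmult_add)
  then show ?thesis
    unfolding lincomb_def using assms by (subst (asm) M.finsum_addf) auto
qed

lemma lincomb_smult:
  assumes "finite Xs" "Xs \<subseteq> carrier M"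
  shows "s \<odot> lincomb Xs r = lincomb Xs (\<lambda>b. s * r b)"
proof -
  have "lincomb Xs (\<lambda>b. s * r b) = (\<Oplus>b\<in>Xs. s \<odot> (r b \<odot> b))"
    unfolding lincomb_def using assms by (intro M.finsum_cong') (auto simp: ksmult_assoc)
  then show ?thesis
    unfolding lincomb_def using assms by (subst finsum_smult_ldistr) auto
qed

lemma lincomb_delta:
  assumes "finite Xs" "Xs \<subseteq> carrier M" "a \<in> Xs"
  shows "lincomb Xs (\<lambda>b. if b = a then 1 else 0) = a"
proof -
  have "lincomb Xs (\<lambda>b. if b = a then 1 else 0) = (if a = a then 1 else 0) \<odot> a"
    unfolding lincomb_def by (rule finsum_single[OF assms(1,3)]) (use assms in auto)
  then show ?thesis using assms by auto
qed

lemma subspan_lincomb: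
  assumes Xs: "finite Xs" "Xs \<subseteq> carrier M" and v: "v \<in> subspan M Xs"
  shows "\<exists>r. v = lincomb Xs r"
proof -
  have "submodule (range (lincomb Xs)) ground M"
  proof (rule ksubmoduleI)
    show "\<zero> \<in> range (lincomb Xs)"
      using lincomb_smult[OF Xs, of 0 "\<lambda>_. 0"] lincomb_closed[OF Xs(2)] by (metis ksmult_zero(1) rangeI)
  qed (auto simp: lincomb_closed[OF Xs(2)] lincomb_add[OF Xs(2)] lincomb_smult[OF Xs])
  moreover have "Xs \<subseteq> range (lincomb Xs)"
    using lincomb_delta[OF Xs] by (metis rangeI subsetI)
  ultimately show ?thesis using subspan_least v by blast
qed

lemma lincomb_subspan: "Xs \<subseteq> carrier M \<Longrightarrow> lincomb Xs r \<in> subspan M Xs"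
  unfolding lincomb_def
  by (rule submodule_finsum[OF subspan_submodule]) (auto intro: ksubmoduleD(5)[OF subspan_submodule] subsetD[OF subspan_incl])

end

text \<open>
  A homogeneous basis \<open>B\<close> with coordinate functionals \<open>\<xi> b\<close>, and a base point \<open>q\<close> through which
  matrix units are factored later. A coordinate functional vanishes outside the degree of its basis vector.
\<close>

locale matrix_basis = dg_module V
  for V :: "('k::field_char_0, 'v, 'm) dg_scheme" (structure) +
  fixes B :: "'v set" and deg :: "'v \<Rightarrow> int" and \<xi> :: "'v \<Rightarrow> 'v \<Rightarrow> 'k" and q
  assumes B: "finite B" "b \<in> B \<Longrightarrow> b \<in> gr V (deg b)" "q \<in> B"
    and \<xi>_add: "\<lbrakk>b \<in> B; v \<in> carrier V; w \<in> carrier V\<rbrakk> \<Longrightarrow> \<xi> b (v \<oplus> w) = \<xi> b v + \<xi> b w"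
    and \<xi>_smult: "\<lbrakk>b \<in> B; v \<in> carrier V\<rbrakk> \<Longrightarrow> \<xi> b (r \<odot> v) = r * \<xi> b v"
    and \<xi>_delta: "\<lbrakk>a \<in> B; b \<in> B\<rbrakk> \<Longrightarrow> \<xi> a b = (if b = a then 1 else 0)"
    and \<xi>_sum: "v \<in> carrier V \<Longrightarrow> (\<Oplus>b\<in>B. \<xi> b v \<odot> b) = v"
    and \<xi>_deg: "\<lbrakk>b \<in> B; v \<in> gr V j; \<xi> b v \<noteq> 0\<rbrakk> \<Longrightarrow> j = deg b"

text \<open>
  The homogeneous components of a finite spanning set span as well. Among the finite homogeneous spanning
  sets, one of least cardinality is independent: a vector with nonzero coefficient in a linear relation could be
  dropped.
\<close>

lemma (in dg_module) homogeneous_basis: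
  assumes fin: "finite_total_dim M" and nz: "carrier M \<noteq> {\<zero>}"
  shows "\<exists>B deg \<xi> q. matrix_basis M B deg \<xi> q"
proof -
  define good where "good Xs \<longleftrightarrow> finite Xs \<and> Xs \<subseteq> (\<Union>i. gr M i) \<and> subspan M Xs = carrier M" for Xs
  have gc: "(\<Union>i. gr M i) \<subseteq> carrier M" using gr_closed by blast
  have full: "subspan M Xs = carrier M" if "Xs \<subseteq> carrier M" "Ys \<subseteq> subspan M Xs" "subspan M Ys = carrier M" for Xs Ys
    using ksubmoduleD(1)[OF subspan_submodule[OF that(1)]] subspan_least[OF subspan_submodule[OF that(1)] that(2)] that(3)
    by blast
  obtain B0 where B0: "finite B0" "B0 \<subseteq> carrier M" "subspan M B0 = carrier M"
    using fin unfolding finite_total_dim_def by blast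
  let ?Xs = "\<Union>b\<in>B0. (\<lambda>i. hcomp M i b) ` {i. hcomp M i b \<noteq> \<zero>}"
  have Xs: "finite ?Xs" "?Xs \<subseteq> (\<Union>i. gr M i)"
    using B0 hcomp_finite hcomp_gr by blast+
  have Xsc: "?Xs \<subseteq> carrier M" using Xs gc by blast
  have "B0 \<subseteq> subspan M ?Xs"
  proof
    fix b assume b: "b \<in> B0"
    have "(\<Oplus>i\<in>{i. hcomp M i b \<noteq> \<zero>}. hcomp M i b) \<in> subspan M ?Xs"
      by (rule submodule_finsum[OF subspan_submodule[OF Xsc]], rule subsetD[OF subspan_incl]) (use b in blast)
    then show "b \<in> subspan M ?Xs"
      using hcomp_sum[of b "{i. hcomp M i b \<noteq> \<zero>}"] hcomp_finite[of b] b B0(2) by auto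
  qed
  then have "good ?Xs" unfolding good_def using Xs full[OF Xsc] B0(3) by blast
  then obtain B where B: "good B" and min: "\<And>Ys. good Ys \<Longrightarrow> card B \<le> card Ys"
    using ex_has_least_nat[of good ?Xs card] by blast
  have Bf: "finite B" and Bg: "B \<subseteq> (\<Union>i. gr M i)" and Bs: "subspan M B = carrier M" and Bc: "B \<subseteq> carrier M"
    using B gc by (auto simp: good_def)
  have indep: "r b = 0" if r: "lincomb B r = \<zero>" and b: "b \<in> B" for r b
  proof (rule ccontr)
    assume n: "r b \<noteq> 0"
    let ?Ys = "B - {b}"
    have bc: "b \<in> carrier M" using b Bc by blast
    have Ysc: "?Ys \<subseteq> carrier M" using Bc by blast
    have e: "lincomb B r = r b \<odot> b \<oplus> lincomb ?Ys r"
      unfolding lincomb_def using b Bf Bc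
      by (subst insert_Diff[OF b, symmetric], subst M.finsum_insert) auto
    have "(- inverse (r b)) \<odot> (r b \<odot> b \<oplus> lincomb ?Ys r) = \<zero>" unfolding e[symmetric] r by simp
    then have "(- 1) \<odot> b \<oplus> (- inverse (r b)) \<odot> lincomb ?Ys r = \<zero>"
      using n bc lincomb_closed[OF Ysc] by (simp add: ksmult_r_add ksmult_assoc)
    then have "b \<oplus> ((- 1) \<odot> b \<oplus> (- inverse (r b)) \<odot> lincomb ?Ys r) = b"
      using bc by simp
    then have "b = (- inverse (r b)) \<odot> lincomb ?Ys r"
      using bc lincomb_closed[OF Ysc] by (simp add: kcancel flip: M.a_assoc)
    then have "b \<in> subspan M ?Ys"
      using ksubmoduleD(5)[OF subspan_submodule[OF Ysc] lincomb_subspan[OF Ysc]] by metis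
    then have "B \<subseteq> subspan M ?Ys" using subspan_incl[of ?Ys] by blast
    then have "good ?Ys" unfolding good_def using full[OF Ysc _ Bs] Bf Bg by blast
    then show False using min[of ?Ys] b Bf by (metis card_Diff1_less not_less)
  qed
  have uniq: "r b = s b" if "lincomb B r = lincomb B s" "b \<in> B" for r s b
  proof -
    have "lincomb B (\<lambda>b. r b + (- 1) * s b) = lincomb B r \<oplus> (- 1) \<odot> lincomb B s"
      by (simp only: lincomb_add[OF Bc] lincomb_smult[OF Bf Bc])
    also have "\<dots> = \<zero>"
      unfolding that(1) by (rule kcancel(1)[OF lincomb_closed[OF Bc]])
    finally have "lincomb B (\<lambda>b. r b + (- 1) * s b) = \<zero>" .
    from indep[OF this that(2)] show ?thesis by simp
  qed
  \<comment> \<open>The coefficients are unique, so the choice is linear in the vector.\<close>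
  define \<xi> where "\<xi> b v = (SOME r. v = lincomb B r) b" for b v
  have \<xi>: "lincomb B (\<lambda>b. \<xi> b v) = v" if "v \<in> carrier M" for v
  proof -
    have "\<exists>r. v = lincomb B r" using subspan_lincomb[OF Bf Bc] Bs that by blast
    from someI_ex[OF this] show ?thesis by (simp add: \<xi>_def)
  qed
  have \<xi>I: "\<xi> b v = r b" if "v = lincomb B r" "b \<in> B" for b v r
    by (rule uniq[OF _ that(2)]) (use \<xi>[of v] that(1) lincomb_closed[OF Bc] in simp)
  define deg where "deg b = (SOME i. b \<in> gr M i)" for b
  have deg: "b \<in> gr M (deg b)" if "b \<in> B" for b
    unfolding deg_def using Bg that by (intro someI_ex[of "\<lambda>i. b \<in> gr M i"]) blast
  have "B \<noteq> {}"
  proof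
    assume "B = {}"
    then have "v = \<zero>" if "v \<in> carrier M" for v using \<xi>[OF that] by (simp add: lincomb_def)
    then show False using nz by auto
  qed
  then obtain q where q: "q \<in> B" by blast
  have "matrix_basis M B deg \<xi> q"
  proof (intro matrix_basis.intro matrix_basis_axioms.intro)
    show "dg_module M" ..
    show "\<xi> a b = (if b = a then 1 else 0)" if "a \<in> B" "b \<in> B" for a b
      using \<xi>I[OF lincomb_delta[OF Bf Bc that(2), symmetric] that(1)] by simp
    show "\<xi> b (v \<oplus> w) = \<xi> b v + \<xi> b w" if "b \<in> B" "v \<in> carrier M" "w \<in> carrier M" for b v w
      by (rule \<xi>I[OF _ that(1)]) (simp add: lincomb_add[OF Bc, symmetric] \<xi> that)
    show "\<xi> b (r \<odot> v) = r * \<xi> b v" if "b \<in> B" "v \<in> carrier M" for b v r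
      by (rule \<xi>I[OF _ that(1)]) (simp add: lincomb_smult[OF Bf Bc, symmetric] \<xi> that)
    show "(\<Oplus>b\<in>B. \<xi> b v \<odot> b) = v" if "v \<in> carrier M" for v
      using \<xi>[OF that] by (simp add: lincomb_def)
    show "j = deg b" if b: "b \<in> B" and v: "v \<in> gr M j" and n: "\<xi> b v \<noteq> 0" for b v j
    proof -
      have vc: "v \<in> carrier M" using v by (rule gr_closed)
      have "v = hcomp M j v" using hcomp_homog[OF v, of j] by simp
      also have "\<dots> = hcomp M j (\<Oplus>b\<in>B. \<xi> b v \<odot> b)" using \<xi>[OF vc] by (simp add: lincomb_def)
      also have "\<dots> = (\<Oplus>b\<in>B. hcomp M j (\<xi> b v \<odot> b))"
        by (rule klin_finsum[OF hcomp_klin kmodule kmodule]) (use Bc in auto)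
      also have "\<dots> = lincomb B (\<lambda>b. if deg b = j then \<xi> b v else 0)"
        unfolding lincomb_def
      proof (rule M.finsum_cong')
        fix c assume c: "c \<in> B"
        then show "hcomp M j (\<xi> c v \<odot> c) = (if deg c = j then \<xi> c v else 0) \<odot> c"
          using hcomp_homog[OF gr_smult[OF deg[OF c]], of j "\<xi> c v"] Bc by auto
      qed (use Bc in auto)
      finally have "\<xi> b v = (if deg b = j then \<xi> b v else 0)" by (rule \<xi>I[OF _ b])
      then show ?thesis using n by (simp split: if_splits)
    qed
  qed (use Bf deg q in auto)
  then show ?thesis by blast
qed

context matrix_basis
begin

lemma Bc: "b \<in> B \<Longrightarrow> b \<in> carrier V"
  using B(2) gr_closed by blast

lemma E_simps: "t \<oplus>\<^bsub>E\<^esub> u = (\<lambda>v\<in>carrier V. t v \<oplus> u v)" "r \<odot>\<^bsub>E\<^esub> t = (\<lambda>v\<in>carrier V. r \<odot> t v)"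
  "t \<otimes>\<^bsub>E\<^esub> u = compose (carrier V) t u" "\<zero>\<^bsub>E\<^esub> = (\<lambda>v\<in>carrier V. \<zero>)"
  "\<one>\<^bsub>E\<^esub> = (\<lambda>v\<in>carrier V. v)" "gr E i = homog_endo V i"
  by (simp_all add: E_eq gEnd_simps)

lemma E_ext: "\<lbrakk>t \<in> carrier E; u \<in> carrier E; \<And>v. v \<in> carrier V \<Longrightarrow> t v = u v\<rbrakk> \<Longrightarrow> t = u"
  unfolding E_eq by (rule gEnd_ext)

lemma E_klin: "t \<in> carrier E \<Longrightarrow> klin V V t"
  unfolding E_eq by (rule gEndD(1))

lemma E_eval: "v \<in> carrier V \<Longrightarrow> klin E V (\<lambda>t. t v)"
  unfolding E_eq by (rule gEnd_eval)

sublocale E: dg_algebra E by (rule E_dg_algebra)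

text \<open>
  The matrix unit that maps \<open>b\<close> to \<open>a\<close> and the other basis vectors to zero.
\<close>

definition e :: "'v \<Rightarrow> 'v \<Rightarrow> 'v \<Rightarrow> 'v"
  where "e a b = (\<lambda>v\<in>carrier V. \<xi> b v \<odot> a)"

lemma e_app: "v \<in> carrier V \<Longrightarrow> e a b v = \<xi> b v \<odot> a"
  by (simp add: e_def)

lemma e_gr: "\<lbrakk>a \<in> B; b \<in> B\<rbrakk> \<Longrightarrow> e a b \<in> gr E (deg a - deg b)"
  unfolding E_simps e_def
proof (rule homog_endoI)
  assume a: "a \<in> B" and b: "b \<in> B"
  show "klin V V (\<lambda>v. \<xi> b v \<odot> a)"
    by (rule klinI) (simp_all add: a b Bc \<xi>_add \<xi>_smult ksmult_add ksmult_assoc)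
  fix j v assume v: "v \<in> gr V j"
  show "\<xi> b v \<odot> a \<in> gr V (deg a - deg b + j)"
    using \<xi>_deg[OF b v] gr_smult[OF B(2)[OF a]] Bc[OF a] by (cases "\<xi> b v = 0") auto
qed

lemma e_closed: "\<lbrakk>a \<in> B; b \<in> B\<rbrakk> \<Longrightarrow> e a b \<in> carrier E"
  using e_gr E.gr_closed by blast

lemma E_mult_app: "\<lbrakk>t \<in> carrier E; u \<in> carrier E; v \<in> carrier V\<rbrakk> \<Longrightarrow> (t \<otimes>\<^bsub>E\<^esub> u) v = t (u v)"
  by (simp add: E_simps compose_eq)

lemma e_mult:
  assumes "a \<in> B" "b \<in> B" "c \<in> B" "d \<in> B"
  shows "e a b \<otimes>\<^bsub>E\<^esub> e c d = (if b = c then e a d else \<zero>\<^bsub>E\<^esub>)"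
proof (rule E_ext)
  fix v assume v: "v \<in> carrier V"
  show "(e a b \<otimes>\<^bsub>E\<^esub> e c d) v = (if b = c then e a d else \<zero>\<^bsub>E\<^esub>) v"
    using v assms Bc by (auto simp: E_mult_app[OF e_closed e_closed] e_app \<xi>_smult \<xi>_delta E_simps(4))
qed (use assms e_closed in auto)

lemma E_finsum_app:
  assumes "\<And>c. c \<in> J \<Longrightarrow> f c \<in> carrier E" "v \<in> carrier V"
  shows "(\<Oplus>\<^bsub>E\<^esub>c\<in>J. f c) v = (\<Oplus>c\<in>J. f c v)"
  by (rule klin_finsum[OF E_eval[OF assms(2)] E.kmodule kmodule assms(1)])

lemma sum_e: "(\<Oplus>\<^bsub>E\<^esub>a\<in>B. e a a) = \<one>\<^bsub>E\<^esub>"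
proof (rule E_ext)
  fix v assume v: "v \<in> carrier V"
  have "(\<Oplus>\<^bsub>E\<^esub>a\<in>B. e a a) v = (\<Oplus>a\<in>B. e a a v)"
    by (rule E_finsum_app[OF _ v]) (simp add: e_closed)
  then show "(\<Oplus>\<^bsub>E\<^esub>a\<in>B. e a a) v = \<one>\<^bsub>E\<^esub> v"
    using \<xi>_sum[OF v] v by (simp add: e_app E_simps(5))
qed (auto intro: E.M.finsum_closed e_closed)

lemma mult_e:
  assumes t: "t \<in> carrier E" and b: "b \<in> B"
  shows "t \<otimes>\<^bsub>E\<^esub> e b b = (\<Oplus>\<^bsub>E\<^esub>a\<in>B. \<xi> a (t b) \<odot>\<^bsub>E\<^esub> e a b)"
proof (rule E_ext)
  fix v assume v: "v \<in> carrier V"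
  note tk = klinD[OF E_klin[OF t]]
  have "(\<Oplus>\<^bsub>E\<^esub>a\<in>B. \<xi> a (t b) \<odot>\<^bsub>E\<^esub> e a b) v = (\<Oplus>a\<in>B. (\<xi> a (t b) \<odot>\<^bsub>E\<^esub> e a b) v)"
    by (rule E_finsum_app[OF _ v]) (simp add: e_closed b)
  also have "\<dots> = (\<Oplus>a\<in>B. \<xi> b v \<odot> (\<xi> a (t b) \<odot> a))"
    using v b Bc by (intro M.finsum_cong') (auto simp: E_simps(2) e_app ksmult_assoc mult.commute)
  also have "\<dots> = \<xi> b v \<odot> (\<Oplus>a\<in>B. \<xi> a (t b) \<odot> a)"
    using B(1) Bc by (intro finsum_smult_ldistr[symmetric]) auto
  also have "\<dots> = \<xi> b v \<odot> t b" using \<xi>_sum[OF tk(1)[OF Bc[OF b]]] by simp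
  also have "\<dots> = (t \<otimes>\<^bsub>E\<^esub> e b b) v"
    using tk(3)[OF Bc[OF b]] by (simp add: E_mult_app[OF t e_closed[OF b b] v] e_app v)
  finally show "(t \<otimes>\<^bsub>E\<^esub> e b b) v = (\<Oplus>\<^bsub>E\<^esub>a\<in>B. \<xi> a (t b) \<odot>\<^bsub>E\<^esub> e a b) v" ..
qed (use t b in \<open>auto intro!: E.M.finsum_closed simp: e_closed\<close>)

lemma e_t_e:
  assumes t: "t \<in> carrier E" and c: "c \<in> B"
  shows "e c q \<otimes>\<^bsub>E\<^esub> t \<otimes>\<^bsub>E\<^esub> e q c = \<xi> q (t q) \<odot>\<^bsub>E\<^esub> e c c"
proof (rule E_ext)
  fix v assume v: "v \<in> carrier V"
  note tk = klinD[OF E_klin[OF t]]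
  have "(e c q \<otimes>\<^bsub>E\<^esub> t \<otimes>\<^bsub>E\<^esub> e q c) v = e c q (t (e q c v))"
    using c B(3) v t Bc by (simp add: E_mult_app e_closed e_app)
  also have "\<dots> = (\<xi> q (t q) \<odot>\<^bsub>E\<^esub> e c c) v"
    using v c B(3) Bc by (simp add: e_app tk E_simps(2) \<xi>_smult ksmult_assoc mult.commute)
  finally show "(e c q \<otimes>\<^bsub>E\<^esub> t \<otimes>\<^bsub>E\<^esub> e q c) v = (\<xi> q (t q) \<odot>\<^bsub>E\<^esub> e c c) v" .
qed (use t c B(3) in \<open>auto simp: e_closed\<close>)

lemma \<xi>_endo_deg:
  assumes "t \<in> gr E j" "a \<in> B" "b \<in> B" "\<xi> a (t b) \<noteq> 0"
  shows "j = deg a - deg b"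
proof -
  have "t b \<in> gr V (j + deg b)"
    using homog_endoD(2)[of t j b "deg b"] assms(1) B(2)[OF assms(3)] by (simp add: E_simps(6))
  from \<xi>_deg[OF assms(2) this assms(4)] show ?thesis by simp
qed

text \<open>
  Write \<open>t\<close> as the sum of its matrix entries. In an endomorphism of degree \<open>j\<close>, an entry at \<open>(a, b)\<close> with
  \<open>deg a - deg b \<noteq> j\<close> is zero.
\<close>

lemma gr_E_induct:
  assumes H: "submodule H ground E" and t: "t \<in> gr E j"
    and e: "\<And>a b. \<lbrakk>a \<in> B; b \<in> B; deg a - deg b = j\<rbrakk> \<Longrightarrow> e a b \<in> H"
  shows "t \<in> H"
proof -
  have tc: "t \<in> carrier E" using t by (rule E.gr_closed)
  have "t \<otimes>\<^bsub>E\<^esub> e b b \<in> H" if b: "b \<in> B" for b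
    unfolding mult_e[OF tc b]
  proof (rule E.submodule_finsum[OF H])
    fix a assume a: "a \<in> B"
    show "\<xi> a (t b) \<odot>\<^bsub>E\<^esub> e a b \<in> H"
    proof (cases "\<xi> a (t b) = 0")
      case True
      then show ?thesis using E.ksubmoduleD(3)[OF H] e_closed[OF a b] by simp
    next
      case False
      then show ?thesis using \<xi>_endo_deg[OF t a b] e[OF a b] E.ksubmoduleD(5)[OF H] by simp
    qed
  qed
  then have "(\<Oplus>\<^bsub>E\<^esub>b\<in>B. t \<otimes>\<^bsub>E\<^esub> e b b) \<in> H" by (rule E.submodule_finsum[OF H])
  moreover have "(\<Oplus>\<^bsub>E\<^esub>b\<in>B. t \<otimes>\<^bsub>E\<^esub> e b b) = t \<otimes>\<^bsub>E\<^esub> (\<Oplus>\<^bsub>E\<^esub>b\<in>B. e b b)"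
    by (rule klin_finsum[OF E.mult_klin_l[OF tc] E.kmodule E.kmodule, symmetric]) (simp add: e_closed)
  ultimately show ?thesis using tc by (simp add: sum_e)
qed

end

section \<open>The centralizer of a matrix algebra\<close>

text \<open>
  An algebra that receives a morphism from the matrix algebra; \<open>f a b\<close> below is the image of a matrix unit.
\<close>

locale matrix_hom = matrix_basis V B deg \<xi> q + P: dg_algebra P
  for V :: "('k::field_char_0, 'v, 'm) dg_scheme" and B deg \<xi> q and P :: "('k, 'p) dg" +
  fixes \<iota> assumes \<iota>: "\<iota> \<in> dga_hom (End_dga V) P"
begin

lemmas \<iota>D = dga_homD[OF \<iota>]

sublocale C: centralizer P "\<iota> ` carrier E"
proof (intro centralizer.intro centralizer_axioms.intro)
  show "dg_algebra P" by (rule P.dg_algebra_axioms)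
  show "\<iota> ` carrier E \<subseteq> carrier P" using \<iota>D(7) by auto
  fix s assume "s \<in> \<iota> ` carrier E"
  then obtain t where t: "t \<in> carrier E" "s = \<iota> t" by auto
  have "dif P s = \<iota> (dif E t)" using \<iota>D(6)[OF t(1)] t(2) by simp
  then show "dif P s \<in> \<iota> ` carrier E" using E.dif_closed[OF t(1)] by auto
qed

abbreviation "f a b \<equiv> \<iota> (e a b)"

lemma f_gr: "\<lbrakk>a \<in> B; b \<in> B\<rbrakk> \<Longrightarrow> f a b \<in> gr P (deg a - deg b)"
  by (rule \<iota>D(5)[OF e_gr])

lemma f_closed: "\<lbrakk>a \<in> B; b \<in> B\<rbrakk> \<Longrightarrow> f a b \<in> carrier P"
  using f_gr P.gr_closed by blast

lemma f_mult: "\<lbrakk>a \<in> B; b \<in> B; c \<in> B; d \<in> B\<rbrakk> \<Longrightarrow> f a b \<otimes>\<^bsub>P\<^esub> f c d = (if b = c then f a d else \<zero>\<^bsub>P\<^esub>)"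
proof -
  assume m: "a \<in> B" "b \<in> B" "c \<in> B" "d \<in> B"
  have "f a b \<otimes>\<^bsub>P\<^esub> f c d = \<iota> (e a b \<otimes>\<^bsub>E\<^esub> e c d)"
    using m by (simp add: \<iota>D(4) e_closed)
  then show ?thesis
    using klin_zero[OF \<iota>D(1) E.kmodule P.kmodule] m by (auto simp: e_mult)
qed

lemma f_mult': "\<lbrakk>a \<in> B; b \<in> B; c \<in> B; d \<in> B; x \<in> carrier P\<rbrakk> \<Longrightarrow>
    f a b \<otimes>\<^bsub>P\<^esub> (f c d \<otimes>\<^bsub>P\<^esub> x) = (if b = c then f a d \<otimes>\<^bsub>P\<^esub> x else \<zero>\<^bsub>P\<^esub>)"
  by (simp add: f_mult f_closed flip: P.m_assoc)

lemma sum_f: "(\<Oplus>\<^bsub>P\<^esub>a\<in>B. f a a) = \<one>\<^bsub>P\<^esub>"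
  using klin_finsum[OF \<iota>D(1) E.kmodule P.kmodule, of B "\<lambda>a. e a a"] by (simp add: e_closed sum_e \<iota>D(3))

text \<open>
  The classical averaging operator of a matrix algebra, with the signs that make its values commute with
  matrix units in the graded sense.
\<close>

definition average :: "int \<Rightarrow> 'p \<Rightarrow> 'p"
  where "average n z = (\<Oplus>\<^bsub>P\<^esub>c\<in>B. ksign (n * (deg c - deg q)) \<odot>\<^bsub>P\<^esub> (f c q \<otimes>\<^bsub>P\<^esub> z \<otimes>\<^bsub>P\<^esub> f q c))"

lemma average_klin: "klin P P (average n)"
  unfolding average_def
proof (rule klin_finsum_fun[OF klin_scale[OF _ P.kmodule] P.kmodule P.kmodule])
  fix c assume c: "c \<in> B"
  show "klin P P (\<lambda>z. f c q \<otimes>\<^bsub>P\<^esub> z \<otimes>\<^bsub>P\<^esub> f q c)"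
    by (rule klin_comp[OF P.mult_klin_l P.mult_klin_r]) (use c B(3) f_closed in auto)
qed

lemma term_closed: "\<lbrakk>c \<in> B; z \<in> carrier P\<rbrakk> \<Longrightarrow> f c q \<otimes>\<^bsub>P\<^esub> z \<otimes>\<^bsub>P\<^esub> f q c \<in> carrier P"
  using B(3) f_closed by simp

lemma average_gr:
  assumes z: "z \<in> gr P n"
  shows "average n z \<in> gr P n"
  unfolding average_def
proof (rule P.submodule_finsum[OF P.gr_submodule])
  fix c assume c: "c \<in> B"
  have "f c q \<otimes>\<^bsub>P\<^esub> z \<otimes>\<^bsub>P\<^esub> f q c \<in> gr P (deg c - deg q + n + (deg q - deg c))"
    by (rule P.mult_degree[OF P.mult_degree[OF f_gr[OF c B(3)] z] f_gr[OF B(3) c]])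
  then show "ksign (n * (deg c - deg q)) \<odot>\<^bsub>P\<^esub> (f c q \<otimes>\<^bsub>P\<^esub> z \<otimes>\<^bsub>P\<^esub> f q c) \<in> gr P n"
    by (simp add: P.gr_smult)
qed

lemma average_f:
  assumes z: "z \<in> carrier P" and a: "a \<in> B" and b: "b \<in> B"
  shows "average n z \<otimes>\<^bsub>P\<^esub> f a b = ksign (n * (deg a - deg q)) \<odot>\<^bsub>P\<^esub> (f a q \<otimes>\<^bsub>P\<^esub> z \<otimes>\<^bsub>P\<^esub> f q b)"
    "f a b \<otimes>\<^bsub>P\<^esub> average n z = ksign (n * (deg b - deg q)) \<odot>\<^bsub>P\<^esub> (f a q \<otimes>\<^bsub>P\<^esub> z \<otimes>\<^bsub>P\<^esub> f q b)"
proof -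
  note ab = f_closed[OF a b]
  have "average n z \<otimes>\<^bsub>P\<^esub> f a b =
      (\<Oplus>\<^bsub>P\<^esub>c\<in>B. ksign (n * (deg c - deg q)) \<odot>\<^bsub>P\<^esub> (f c q \<otimes>\<^bsub>P\<^esub> z \<otimes>\<^bsub>P\<^esub> f q c) \<otimes>\<^bsub>P\<^esub> f a b)"
    unfolding average_def by (rule klin_finsum[OF P.mult_klin_r[OF ab] P.kmodule P.kmodule]) (simp add: term_closed z)
  also have "\<dots> = ksign (n * (deg a - deg q)) \<odot>\<^bsub>P\<^esub> (f a q \<otimes>\<^bsub>P\<^esub> z \<otimes>\<^bsub>P\<^esub> f q a) \<otimes>\<^bsub>P\<^esub> f a b"
    by (rule P.finsum_single[OF B(1) a])
      (use z a b B(3) f_closed in \<open>auto simp: P.smult_mult_l P.m_assoc f_mult\<close>)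
  finally show "average n z \<otimes>\<^bsub>P\<^esub> f a b = ksign (n * (deg a - deg q)) \<odot>\<^bsub>P\<^esub> (f a q \<otimes>\<^bsub>P\<^esub> z \<otimes>\<^bsub>P\<^esub> f q b)"
    using z a b B(3) f_closed by (simp add: P.smult_mult_l P.m_assoc f_mult)
  have "f a b \<otimes>\<^bsub>P\<^esub> average n z =
      (\<Oplus>\<^bsub>P\<^esub>c\<in>B. f a b \<otimes>\<^bsub>P\<^esub> (ksign (n * (deg c - deg q)) \<odot>\<^bsub>P\<^esub> (f c q \<otimes>\<^bsub>P\<^esub> z \<otimes>\<^bsub>P\<^esub> f q c)))"
    unfolding average_def by (rule klin_finsum[OF P.mult_klin_l[OF ab] P.kmodule P.kmodule]) (simp add: term_closed z)
  also have "\<dots> = f a b \<otimes>\<^bsub>P\<^esub> (ksign (n * (deg b - deg q)) \<odot>\<^bsub>P\<^esub> (f b q \<otimes>\<^bsub>P\<^esub> z \<otimes>\<^bsub>P\<^esub> f q b))"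
    by (rule P.finsum_single[OF B(1) b])
      (use z a b B(3) f_closed in \<open>auto simp: P.smult_mult_r P.m_assoc f_mult'\<close>)
  finally show "f a b \<otimes>\<^bsub>P\<^esub> average n z = ksign (n * (deg b - deg q)) \<odot>\<^bsub>P\<^esub> (f a q \<otimes>\<^bsub>P\<^esub> z \<otimes>\<^bsub>P\<^esub> f q b)"
    using z a b B(3) f_closed by (simp add: P.smult_mult_r P.m_assoc f_mult')
qed

text \<open>
  By \<open>average_f\<close>, both products of the average with \<open>f a b\<close> are multiples of \<open>f a q \<cdot> z \<cdot> f q b\<close>. The coefficients
  differ by the sign for \<open>n (deg a - deg b)\<close>, which is the Koszul sign.
\<close>

lemma average_central:
  assumes z: "z \<in> gr P n"
  shows "average n z \<in> gr C.Z n"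
proof -
  have zc: "z \<in> carrier P" using z by (rule P.gr_closed)
  have ac: "average n z \<in> carrier P" using average_gr[OF z] by (rule P.gr_closed)
  have main: "average n z \<otimes>\<^bsub>P\<^esub> \<iota> t = ksign (n * j) \<odot>\<^bsub>P\<^esub> (\<iota> t \<otimes>\<^bsub>P\<^esub> average n z)" if t: "t \<in> gr E j" for t j
  proof -
    let ?g = "\<lambda>t. average n z \<otimes>\<^bsub>P\<^esub> \<iota> t \<ominus>\<^bsub>P\<^esub> (ksign (n * j) \<odot>\<^bsub>P\<^esub> (\<iota> t \<otimes>\<^bsub>P\<^esub> average n z))"
    have g: "klin E P ?g"
      by (rule klin_minus[OF klin_comp[OF \<iota>D(1) P.mult_klin_l[OF ac]]
            klin_scale[OF klin_comp[OF \<iota>D(1) P.mult_klin_r[OF ac]] P.kmodule] P.kmodule])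
    have z0: "submodule {\<zero>\<^bsub>P\<^esub>} ground P" by (rule P.ksubmoduleI) auto
    have "t \<in> {t \<in> carrier E. ?g t \<in> {\<zero>\<^bsub>P\<^esub>}}"
    proof (rule gr_E_induct[OF klin_preimage_submodule[OF g E.kmodule P.kmodule z0] t])
      fix a b assume ab: "a \<in> B" "b \<in> B" "deg a - deg b = j"
      have "ksign (n * (deg a - deg q)) = (ksign (n * j) * ksign (n * (deg b - deg q)) :: 'k)"
        unfolding ab(3)[symmetric] by (simp add: algebra_simps flip: ksign_add)
      then show "e a b \<in> {t \<in> carrier E. ?g t \<in> {\<zero>\<^bsub>P\<^esub>}}"
        using ab e_closed f_closed B(3) zc by (simp add: average_f P.ksmult_assoc P.kdiff_zero_iff)
    qed
    then show ?thesis using ac \<iota>D(7)[OF E.gr_closed[OF t]] by (simp add: P.kdiff_zero_iff)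
  qed
  have "average n z \<otimes>\<^bsub>P\<^esub> s = ksign (n * j) \<odot>\<^bsub>P\<^esub> (s \<otimes>\<^bsub>P\<^esub> average n z)" if s: "s \<in> \<iota> ` carrier E" "s \<in> gr P j" for s j
  proof -
    obtain t where t: "t \<in> carrier E" "s = \<iota> t" using s by blast
    \<comment> \<open>A homogeneous element of the image is the image of a homogeneous element, even if the map is not injective.\<close>
    have "s = \<iota> (hcomp E j t)"
      using dga_hom_hcomp[OF \<iota> E.gr_module P.gr_module t(1), of j] P.hcomp_homog[OF s(2), of j] t by simp
    then show ?thesis using main[OF E.hcomp_gr[OF t(1)]] by simp
  qed
  then show ?thesis using average_gr[OF z] by (auto simp: C.Z_gr)
qed

text \<open>
  If \<open>y\<close> can be moved past \<open>f q c\<close>, then the summands become \<open>f c c \<cdot> y\<close>, and the \<open>f c c\<close> add up to one.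
\<close>

lemma average_fixes_central:
  assumes y: "y \<in> gr C.Z n"
  shows "average n y = y"
proof -
  have yc: "y \<in> carrier P" using y by (rule C.Z_gr_P)
  have "average n y = (\<Oplus>\<^bsub>P\<^esub>c\<in>B. f c c \<otimes>\<^bsub>P\<^esub> y)"
    unfolding average_def
  proof (rule P.M.finsum_cong')
    fix c assume c: "c \<in> B"
    have "y \<otimes>\<^bsub>P\<^esub> f q c = ksign (n * (deg q - deg c)) \<odot>\<^bsub>P\<^esub> (f q c \<otimes>\<^bsub>P\<^esub> y)"
      using y f_gr[OF B(3) c] e_closed[OF B(3) c] by (auto simp: C.Z_gr)
    moreover have "ksign (n * (deg c - deg q)) = (ksign (n * (deg q - deg c)) :: 'k)"
      using ksign_simps(4)[of "n * (deg q - deg c)"] by (simp add: algebra_simps)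
    ultimately show "ksign (n * (deg c - deg q)) \<odot>\<^bsub>P\<^esub> (f c q \<otimes>\<^bsub>P\<^esub> y \<otimes>\<^bsub>P\<^esub> f q c) = f c c \<otimes>\<^bsub>P\<^esub> y"
      using yc c B(3) f_closed by (simp add: P.m_assoc P.smult_mult_r P.ksmult_assoc f_mult')
  qed (use yc f_closed in auto)
  also have "\<dots> = (\<Oplus>\<^bsub>P\<^esub>c\<in>B. f c c) \<otimes>\<^bsub>P\<^esub> y"
    by (rule klin_finsum[OF P.mult_klin_r[OF yc] P.kmodule P.kmodule, symmetric]) (simp add: f_closed)
  finally show ?thesis using yc by (simp add: sum_f)
qed

text \<open>
  Only the summand with \<open>c = b\<close> survives in \<open>f a b\<close> times the average, and there
  \<open>f a q \<cdot> f q a = f a a\<close> and \<open>f b q \<cdot> f q b = f b b\<close>.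
\<close>

lemma peirce_component:
  assumes z: "z \<in> gr P n" and a: "a \<in> B" and b: "b \<in> B"
  shows "f q a \<otimes>\<^bsub>P\<^esub> z \<otimes>\<^bsub>P\<^esub> f b q \<in> gr P (n + deg b - deg a)"
    "f a a \<otimes>\<^bsub>P\<^esub> z \<otimes>\<^bsub>P\<^esub> f b b = ksign ((n + deg b - deg a) * (deg b - deg q)) \<odot>\<^bsub>P\<^esub>
      (f a b \<otimes>\<^bsub>P\<^esub> average (n + deg b - deg a) (f q a \<otimes>\<^bsub>P\<^esub> z \<otimes>\<^bsub>P\<^esub> f b q))"
proof -
  have "f q a \<otimes>\<^bsub>P\<^esub> z \<otimes>\<^bsub>P\<^esub> f b q \<in> gr P (deg q - deg a + n + (deg b - deg q))"
    by (rule P.mult_degree[OF P.mult_degree[OF f_gr[OF B(3) a] z] f_gr[OF b B(3)]])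
  moreover have "deg q - deg a + n + (deg b - deg q) = n + deg b - deg a" by simp
  ultimately show w: "f q a \<otimes>\<^bsub>P\<^esub> z \<otimes>\<^bsub>P\<^esub> f b q \<in> gr P (n + deg b - deg a)" by simp
  show "f a a \<otimes>\<^bsub>P\<^esub> z \<otimes>\<^bsub>P\<^esub> f b b = ksign ((n + deg b - deg a) * (deg b - deg q)) \<odot>\<^bsub>P\<^esub>
      (f a b \<otimes>\<^bsub>P\<^esub> average (n + deg b - deg a) (f q a \<otimes>\<^bsub>P\<^esub> z \<otimes>\<^bsub>P\<^esub> f b q))"
    using P.gr_closed[OF w] P.gr_closed[OF z] a b B(3) f_closed
    by (simp add: average_f(2) P.ksmult_assoc P.m_assoc f_mult' f_mult)
qed

lemma peirce_sum:
  assumes x: "x \<in> carrier P"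
  shows "(\<Oplus>\<^bsub>P\<^esub>a\<in>B. \<Oplus>\<^bsub>P\<^esub>b\<in>B. f a a \<otimes>\<^bsub>P\<^esub> x \<otimes>\<^bsub>P\<^esub> f b b) = x"
proof -
  have 1: "(\<Oplus>\<^bsub>P\<^esub>b\<in>B. w \<otimes>\<^bsub>P\<^esub> f b b) = w" if w: "w \<in> carrier P" for w
    using klin_finsum[OF P.mult_klin_l[OF w] P.kmodule P.kmodule, of B "\<lambda>b. f b b"] w by (simp add: f_closed sum_f)
  have 2: "(\<Oplus>\<^bsub>P\<^esub>a\<in>B. f a a \<otimes>\<^bsub>P\<^esub> x) = x"
    using klin_finsum[OF P.mult_klin_r[OF x] P.kmodule P.kmodule, of B "\<lambda>b. f b b"] x by (simp add: f_closed sum_f)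
  have "(\<Oplus>\<^bsub>P\<^esub>a\<in>B. \<Oplus>\<^bsub>P\<^esub>b\<in>B. f a a \<otimes>\<^bsub>P\<^esub> x \<otimes>\<^bsub>P\<^esub> f b b) = (\<Oplus>\<^bsub>P\<^esub>a\<in>B. f a a \<otimes>\<^bsub>P\<^esub> x)"
    by (rule P.M.finsum_cong') (use x f_closed 1 in auto)
  then show ?thesis using 2 by simp
qed

end

section \<open>Centralizers in tensor products and the universal property\<close>

locale matrix_tensor = matrix_basis V B deg \<xi> q + C: dg_algebra C
  for V :: "('k::field_char_0, 'v, 'm) dg_scheme" and B deg \<xi> q and C :: "('k, 'c, 'p) dg_scheme"
begin

sublocale dga_tensor "End_dga V" C ..

sublocale mh: matrix_hom V B deg \<xi> q W il
  by (intro matrix_hom.intro matrix_hom_axioms.intro matrix_basis_axioms W.dg_algebra_axioms il_hom)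

text \<open>
  One summand of the average of a pure tensor. Conjugating \<open>a\<close> by matrix units through \<open>q\<close> leaves the single
  entry \<open>\<xi> q (a q)\<close>, which is zero unless \<open>a\<close> has degree zero; in that case the sign of the average and the
  Koszul sign coming from moving \<open>e q c\<close> past \<open>b\<close> cancel.
\<close>

lemma term_t:
  assumes c: "c \<in> B" and a: "a \<in> gr E i" and b: "b \<in> gr C j"
  shows "ksign ((i + j) * (deg c - deg q)) \<odot>\<^bsub>W\<^esub> (il (e c q) \<otimes>\<^bsub>W\<^esub> t i a j b \<otimes>\<^bsub>W\<^esub> il (e q c)) =
    \<xi> q (a q) \<odot>\<^bsub>W\<^esub> t 0 (e c c) j b"
proof -
  have ac: "a \<in> carrier E" using a by (rule E.gr_closed)
  have bc: "b \<in> carrier C" using b by (rule C.gr_closed)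
  note o = C.one_degree
  have m1: "e c q \<otimes>\<^bsub>E\<^esub> a \<in> gr E (deg c - deg q + i)"
    by (rule E.mult_degree[OF e_gr[OF c B(3)] a])
  have m2: "e c q \<otimes>\<^bsub>E\<^esub> a \<otimes>\<^bsub>E\<^esub> e q c \<in> gr E (deg c - deg q + i + (deg q - deg c))"
    by (rule E.mult_degree[OF m1 e_gr[OF B(3) c]])
  have "il (e c q) \<otimes>\<^bsub>W\<^esub> t i a j b \<otimes>\<^bsub>W\<^esub> il (e q c) =
      ksign (j * (deg q - deg c)) \<odot>\<^bsub>W\<^esub> t (deg c - deg q + i + (deg q - deg c)) (e c q \<otimes>\<^bsub>E\<^esub> a \<otimes>\<^bsub>E\<^esub> e q c) j b"
    using t_closed[OF m1 b] bc
    by (simp add: il_gr[OF e_gr[OF c B(3)]] il_gr[OF e_gr[OF B(3) c]] t_mult[OF e_gr[OF c B(3)] o a b]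
        t_mult[OF m1 b e_gr[OF B(3) c] o])
  also have "\<dots> = ksign (j * (deg q - deg c)) \<odot>\<^bsub>W\<^esub> t i (\<xi> q (a q) \<odot>\<^bsub>E\<^esub> e c c) j b"
    by (simp add: e_t_e[OF ac c])
  finally have 1: "il (e c q) \<otimes>\<^bsub>W\<^esub> t i a j b \<otimes>\<^bsub>W\<^esub> il (e q c) =
      ksign (j * (deg q - deg c)) \<odot>\<^bsub>W\<^esub> t i (\<xi> q (a q) \<odot>\<^bsub>E\<^esub> e c c) j b" .
  have e0: "e c c \<in> gr E 0" using e_gr[OF c c] by simp
  show ?thesis
  proof (cases "\<xi> q (a q) = 0")
    case True
    then show ?thesis
      using e_closed[OF c c] t_closed[OF e0 b] by (simp add: 1 t_zero[OF b])
  next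
    case False
    then have i: "i = 0" using \<xi>_endo_deg[OF a B(3) B(3)] by simp
    have s: "ksign (j * (deg c - deg q)) = (ksign (j * (deg q - deg c)) :: 'k)"
      using ksign_simps(4)[of "j * (deg q - deg c)"] by (simp add: algebra_simps)
    show ?thesis
      unfolding 1
      using gr_bilinearD(4)[OF t_bilinear e0 b, of "\<xi> q (a q)"] t_closed[OF e0 b]
      by (simp add: i s W.ksmult_assoc)
  qed
qed

text \<open>
  The centralizer of the first factor is the second factor. The functional \<open>a \<mapsto> \<xi> q (a q)\<close> takes the
  identity to \<open>1\<close>, so contracting with it gives a retraction \<open>p\<close> of the inclusion of the second factor. On all
  pure tensors, \<open>1 \<otimes> p y\<close> equals the average of \<open>y\<close>, and the average fixes the centralizer.
\<close>

lemma second_factor_centralizer: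
  obtains p where "klin W C p" "\<And>n x. x \<in> gr W n \<Longrightarrow> p x \<in> gr C n" "\<And>c. c \<in> carrier C \<Longrightarrow> p (ir c) = c"
    "\<And>n y. y \<in> gr mh.C.Z n \<Longrightarrow> ir (p y) = y"
proof -
  have bil: "gr_bilinear E C C (\<lambda>i a j b. \<xi> q (a q) \<odot>\<^bsub>C\<^esub> b)"
    unfolding gr_bilinear_def
  proof (intro allI ballI)
    fix i j a b assume a: "a \<in> gr E i" and b: "b \<in> gr C j"
    have bc: "b \<in> carrier C" "\<And>b'. b' \<in> gr C j \<Longrightarrow> b' \<in> carrier C" using b C.gr_closed by blast+
    have qa: "a' q \<in> carrier V" if "a' \<in> gr E i" for a'
      using klinD(1)[OF E_klin[OF E.gr_closed[OF that]] Bc[OF B(3)]] .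
    show "\<xi> q (a q) \<odot>\<^bsub>C\<^esub> b \<in> carrier C \<and>
      (\<forall>a'\<in>gr E i. \<xi> q ((a \<oplus>\<^bsub>E\<^esub> a') q) \<odot>\<^bsub>C\<^esub> b = \<xi> q (a q) \<odot>\<^bsub>C\<^esub> b \<oplus>\<^bsub>C\<^esub> \<xi> q (a' q) \<odot>\<^bsub>C\<^esub> b) \<and>
      (\<forall>b'\<in>gr C j. \<xi> q (a q) \<odot>\<^bsub>C\<^esub> (b \<oplus>\<^bsub>C\<^esub> b') = \<xi> q (a q) \<odot>\<^bsub>C\<^esub> b \<oplus>\<^bsub>C\<^esub> \<xi> q (a q) \<odot>\<^bsub>C\<^esub> b') \<and>
      (\<forall>r. \<xi> q ((r \<odot>\<^bsub>E\<^esub> a) q) \<odot>\<^bsub>C\<^esub> b = r \<odot>\<^bsub>C\<^esub> (\<xi> q (a q) \<odot>\<^bsub>C\<^esub> b)) \<and>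
      (\<forall>r. \<xi> q (a q) \<odot>\<^bsub>C\<^esub> (r \<odot>\<^bsub>C\<^esub> b) = r \<odot>\<^bsub>C\<^esub> (\<xi> q (a q) \<odot>\<^bsub>C\<^esub> b))"
      using bc qa[OF a] qa Bc[OF B(3)] B(3)
      by (simp add: E_simps(1,2) \<xi>_add \<xi>_smult C.ksmult_add C.ksmult_r_add C.ksmult_assoc mult.commute)
  qed
  obtain p where p: "klin W C p"
    and pt: "\<And>i a j b. \<lbrakk>a \<in> gr E i; b \<in> gr C j\<rbrakk> \<Longrightarrow> p (t i a j b) = \<xi> q (a q) \<odot>\<^bsub>C\<^esub> b"
    using lift_lin[OF C.kmodule bil] by blast
  have deg_p: "p x \<in> gr C n" if x: "x \<in> gr W n" for n x
  proof (rule W_gr_mem[OF p C.kmodule C.gr_submodule x])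
    fix i a j b assume m: "a \<in> gr E i" "b \<in> gr C j" "i + j = n"
    show "p (t i a j b) \<in> gr C n"
    proof (cases "\<xi> q (a q) = 0")
      case True
      then show ?thesis using C.gr_closed[OF m(2)] by (simp add: pt m)
    next
      case False
      then have "i = 0" using \<xi>_endo_deg[OF m(1) B(3) B(3)] by simp
      then show ?thesis unfolding pt[OF m(1,2)] using C.gr_smult[OF m(2)] m(3) by simp
    qed
  qed
  have one: "\<xi> q (\<one>\<^bsub>E\<^esub> q) = 1" using Bc[OF B(3)] B(3) by (simp add: E_simps(5) \<xi>_delta)
  have pir: "p (ir c) = c" if c: "c \<in> carrier C" for c
  proof (rule C.klin_gr_eq[OF klin_comp[OF ir_klin p] _ C.kmodule _ c])
    show "klin C C (\<lambda>x. x)" by (rule klinI) auto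
    show "p (ir x) = x" if "x \<in> gr C k" for k x
      using C.gr_closed[OF that] by (simp add: ir_gr[OF that] pt[OF E.one_degree that] one)
  qed
  have irp: "ir (p y) = y" if y: "y \<in> gr mh.C.Z n" for n y
  proof -
    have "mh.average n y = ir (p y)"
    proof (rule W_gr_klin_eq[OF mh.average_klin klin_comp[OF p ir_klin] W.kmodule mh.C.Z_gr_P(1)[OF y]])
      fix i a j b assume m: "a \<in> gr E i" "b \<in> gr C j" "i + j = n"
      let ?l = "\<lambda>z. \<xi> q (a q) \<odot>\<^bsub>W\<^esub> hext E W (\<lambda>i x. t i x j b) z"
      have hl: "klin E W (hext E W (\<lambda>i x. t i x j b))"
        by (rule E.hext_klin[OF W.kmodule hlin_t_left[OF m(2)]])
      have he: "hext E W (\<lambda>i x. t i x j b) x = t k x j b" if "x \<in> gr E k" for k x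
        by (rule E.hext_homog[OF W.kmodule hlin_t_left[OF m(2)] that])
      have l: "klin E W ?l" by (rule klin_scale[OF hl W.kmodule])
      have e0: "e c c \<in> gr E 0" if "c \<in> B" for c using e_gr[OF that that] by simp
      have "mh.average n (t i a j b) = (\<Oplus>\<^bsub>W\<^esub>c\<in>B. ?l (e c c))"
        unfolding mh.average_def m(3)[symmetric]
        by (rule W.M.finsum_cong') (use klinD(1)[OF l e_closed] in \<open>auto simp: term_t[OF _ m(1,2)] he[OF e0]\<close>)
      also have "\<dots> = ?l \<one>\<^bsub>E\<^esub>"
        using klin_finsum[OF l E.kmodule W.kmodule, of B "\<lambda>c. e c c"] by (simp add: e_closed sum_e)
      also have "\<dots> = \<xi> q (a q) \<odot>\<^bsub>W\<^esub> ir b"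
        by (simp add: he[OF E.one_degree] ir_gr[OF m(2)])
      also have "\<dots> = ir (p (t i a j b))"
        using klinD(3)[OF ir_klin C.gr_closed[OF m(2)]] by (simp add: pt[OF m(1,2)])
      finally show "mh.average n (t i a j b) = ir (p (t i a j b))" .
    qed
    then show ?thesis using mh.average_fixes_central[OF y] by simp
  qed
  show thesis by (rule that[OF p deg_p pir irp])
qed

end

text \<open>
  The inverse respects degrees because morphisms commute with taking homogeneous components.
\<close>

lemma dga_hom_inverse:
  assumes "predg_algebra M" "predg_algebra N" and f: "f \<in> dga_hom M N"
    and inj: "inj_on f (carrier M)" and surj: "carrier N \<subseteq> f ` carrier M"
  obtains g where "g \<in> dga_hom N M" "\<And>x. x \<in> carrier M \<Longrightarrow> g (f x) = x" "\<And>y. y \<in> carrier N \<Longrightarrow> f (g y) = y"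
proof -
  interpret M: predg_algebra M by fact
  interpret N: predg_algebra N by fact
  note F = dga_homD[OF f]
  note k = klinD[OF F(1)]
  let ?g = "\<lambda>y\<in>carrier N. inv_into (carrier M) f y"
  have gc: "?g y \<in> carrier M" and fg: "f (?g y) = y" if "y \<in> carrier N" for y
    using that surj by (auto intro: inv_into_into f_inv_into_f)
  have gf: "?g (f x) = x" if "x \<in> carrier M" for x
    using that inj F(7) by (simp add: inv_into_f_f)
  have gI: "?g y = x" if "x \<in> carrier M" "y = f x" for x y
    using gf[OF that(1)] that(2) by simp
  have "?g \<in> dga_hom N M"
  proof (rule dga_homI)
    show "klin N M ?g"
    proof (rule klinI)
      show "?g (x \<oplus>\<^bsub>N\<^esub> y) = ?g x \<oplus>\<^bsub>M\<^esub> ?g y" if "x \<in> carrier N" "y \<in> carrier N" for x y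
        by (rule gI) (use that gc fg k in \<open>simp_all del: restrict_apply\<close>)
      show "?g (r \<odot>\<^bsub>N\<^esub> x) = r \<odot>\<^bsub>M\<^esub> ?g x" if "x \<in> carrier N" for x r
        by (rule gI) (use that gc fg k in \<open>simp_all del: restrict_apply\<close>)
    qed (rule gc)
    show "?g \<one>\<^bsub>N\<^esub> = \<one>\<^bsub>M\<^esub>" by (rule gI) (simp_all add: F(3))
    fix i j x y assume x: "x \<in> gr N i"
    note xc = N.gr_closed[OF x]
    show "?g (dif N x) = dif M (?g x)"
      by (rule gI) (use gc[OF xc] fg[OF xc] klinD(1)[OF M.dif_klin] F(6) in \<open>simp_all del: restrict_apply\<close>)
    have "?g x = hcomp M i (?g x)"
      by (rule gI) (use gc[OF xc] fg[OF xc] dga_hom_hcomp[OF f M.gr_module N.gr_module gc[OF xc], of i]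
        N.hcomp_homog[OF x, of i] in \<open>simp_all del: restrict_apply\<close>)
    then show "?g x \<in> gr M i" using M.hcomp_gr[OF gc[OF xc]] by metis
    assume y: "y \<in> gr N j"
    note yc = N.gr_closed[OF y]
    show "?g (x \<otimes>\<^bsub>N\<^esub> y) = ?g x \<otimes>\<^bsub>M\<^esub> ?g y"
      by (rule gI) (use gc[OF xc] gc[OF yc] fg[OF xc] fg[OF yc] F(4) in \<open>simp_all del: restrict_apply\<close>)
  qed (use assms in auto)
  then show thesis using gf fg that by blast
qed

locale rep_setup = matrix_basis V B deg \<xi> q + co: dga_coprod S "End_dga V" A \<rho> \<alpha>
  for V :: "('k::field_char_0, 'v, 'm) dg_scheme" and B deg \<xi> q
    and S :: "('k, 's, 'l) dg_scheme" and A :: "('k, 'a, 'n) dg_scheme" and \<rho> \<alpha>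
begin

abbreviation "P \<equiv> co.P"

sublocale mh: matrix_hom V B deg \<xi> q P co.inl
  by (intro matrix_hom.intro matrix_hom_axioms.intro matrix_basis_axioms co.P.dg_algebra_axioms co.inl_hom)

abbreviation "Z \<equiv> mh.C.Z"

lemma Z_eq: "dga_root S V \<rho> A \<alpha> = Z"
  by (simp add: dga_root_def)

sublocale Z: dg_algebra Z by (rule mh.C.Z_dg_algebra)

sublocale mz: matrix_tensor V B deg \<xi> q Z
  by (intro matrix_tensor.intro matrix_basis_axioms Z.dg_algebra_axioms)

lemma Z_incl_hom: "(\<lambda>x\<in>carrier Z. x) \<in> dga_hom Z P"
proof (rule dga_homI[OF Z.predg_algebra co.P.predg_algebra])
  show "klin Z P (\<lambda>x\<in>carrier Z. x)" by (rule klin_restrict[OF Z.kmodule mh.C.Z_incl])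
qed (use Z.gr_closed mh.C.Z_gr_P Z.m_closed Z.one_closed Z.dif_closed in \<open>auto simp: mh.C.Z_simps\<close>)

lemma mu_exists:
  obtains \<mu> where "\<mu> \<in> dga_hom mz.W P" "\<And>i a j x. \<lbrakk>a \<in> gr E i; x \<in> gr Z j\<rbrakk> \<Longrightarrow> \<mu> (mz.t i a j x) = co.inl a \<otimes>\<^bsub>P\<^esub> x"
proof -
  have comm: "(\<lambda>x\<in>carrier Z. x) b \<otimes>\<^bsub>P\<^esub> co.inl a = ksign (i * j) \<odot>\<^bsub>P\<^esub> (co.inl a \<otimes>\<^bsub>P\<^esub> (\<lambda>x\<in>carrier Z. x) b)"
    if "a \<in> gr E i" "b \<in> gr Z j" for i a j b
    using that Z.gr_closed[OF that(2)] E.gr_closed[OF that(1)] dga_homD(5)[OF co.inl_hom that(1)]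
    by (auto simp: mh.C.Z_gr mult.commute)
  obtain h where h: "h \<in> dga_hom mz.W P"
    and ht: "\<And>i a j x. \<lbrakk>a \<in> gr E i; x \<in> gr Z j\<rbrakk> \<Longrightarrow> h (mz.t i a j x) = co.inl a \<otimes>\<^bsub>P\<^esub> (\<lambda>x\<in>carrier Z. x) x"
    using mz.lift_dga[OF co.P.predg_algebra co.inl_hom Z_incl_hom comm co.P.leibniz] by blast
  show thesis by (rule that[OF h]) (use ht Z.gr_closed in auto)
qed

text \<open>
  Multiplication from the tensor product of \<open>E\<close> and \<open>Z\<close> to \<open>P\<close> is bijective. It is onto since each \<open>f a a \<cdot> x \<cdot> f b b\<close> is, up to sign,
  \<open>f a b\<close> times an average, and averages lie in \<open>Z\<close>. For injectivity, decompose a homogeneous \<open>w\<close> in the kernel in the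
  same way inside the tensor product: the averages are in the kernel too and have the form \<open>1 \<otimes> y\<close>; such an element is
  mapped to \<open>y\<close>, so it is zero.
\<close>

lemma matrix_decomposition:
  obtains \<mu> \<nu> where "\<mu> \<in> dga_hom mz.W P" "\<nu> \<in> dga_hom P mz.W"
    "\<And>i a j x. \<lbrakk>a \<in> gr E i; x \<in> gr Z j\<rbrakk> \<Longrightarrow> \<mu> (mz.t i a j x) = co.inl a \<otimes>\<^bsub>P\<^esub> x"
    "\<And>w. w \<in> carrier mz.W \<Longrightarrow> \<nu> (\<mu> w) = w" "\<And>x. x \<in> carrier P \<Longrightarrow> \<mu> (\<nu> x) = x"
proof -
  obtain \<mu> where \<mu>: "\<mu> \<in> dga_hom mz.W P"
    and \<mu>t: "\<And>i a j x. \<lbrakk>a \<in> gr E i; x \<in> gr Z j\<rbrakk> \<Longrightarrow> \<mu> (mz.t i a j x) = co.inl a \<otimes>\<^bsub>P\<^esub> x"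
    by (rule mu_exists) blast
  note M = dga_homD[OF \<mu>]
  note k = klinD[OF M(1)]
  let ?H = "\<mu> ` carrier mz.W"
  have H: "submodule ?H ground P"
  proof (rule co.P.ksubmoduleI)
    show "?H \<subseteq> carrier P" using M(7) by auto
    show "\<zero>\<^bsub>P\<^esub> \<in> ?H" using klin_zero[OF M(1) mz.W.kmodule co.P.kmodule] mz.W.M.zero_closed by (metis imageI)
    show "x \<oplus>\<^bsub>P\<^esub> y \<in> ?H" if "x \<in> ?H" "y \<in> ?H" for x y
      using that k(2) by (auto simp flip: k(2))
    show "r \<odot>\<^bsub>P\<^esub> x \<in> ?H" if "x \<in> ?H" for x r
      using that by (auto simp flip: k(3))
  qed
  have surj: "carrier P \<subseteq> ?H"
  proof (rule co.P.submodule_contains_gr[OF H])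
    fix n
    show "gr P n \<subseteq> ?H"
    proof
      fix x assume x: "x \<in> gr P n"
      have "mh.f a a \<otimes>\<^bsub>P\<^esub> x \<otimes>\<^bsub>P\<^esub> mh.f b b \<in> ?H" if a: "a \<in> B" and b: "b \<in> B" for a b
      proof -
        let ?w = "mh.average (n + deg b - deg a) (mh.f q a \<otimes>\<^bsub>P\<^esub> x \<otimes>\<^bsub>P\<^esub> mh.f b q)"
        have z: "?w \<in> gr Z (n + deg b - deg a)"
          by (rule mh.average_central[OF mh.peirce_component(1)[OF x a b]])
        have "mh.f a b \<otimes>\<^bsub>P\<^esub> ?w \<in> ?H"
          using \<mu>t[OF e_gr[OF a b] z] mz.t_closed[OF e_gr[OF a b] z] by (metis imageI)
        then show ?thesis
          unfolding mh.peirce_component(2)[OF x a b] by (rule co.P.ksubmoduleD(5)[OF H])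
      qed
      then have "(\<Oplus>\<^bsub>P\<^esub>a\<in>B. \<Oplus>\<^bsub>P\<^esub>b\<in>B. mh.f a a \<otimes>\<^bsub>P\<^esub> x \<otimes>\<^bsub>P\<^esub> mh.f b b) \<in> ?H"
        by (intro co.P.submodule_finsum[OF H])
      then show "x \<in> ?H" using mh.peirce_sum[OF co.P.gr_closed[OF x]] by simp
    qed
  qed
  obtain p where p: "klin mz.W Z p" "\<And>n x. x \<in> gr mz.W n \<Longrightarrow> p x \<in> gr Z n"
    and irp: "\<And>n y. y \<in> gr mz.mh.C.Z n \<Longrightarrow> mz.ir (p y) = y"
    by (rule mz.second_factor_centralizer) blast
  have \<mu>ir: "\<mu> (mz.ir x) = x" if "x \<in> gr Z j" for x j
    using mh.C.Z_gr_P(2)[OF that] dga_homD(3)[OF co.inl_hom]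
    by (simp add: mz.ir_gr[OF that] \<mu>t[OF E.one_degree that])
  have ker_gr: "w = \<zero>\<^bsub>mz.W\<^esub>" if w: "w \<in> gr mz.W n" and z: "\<mu> w = \<zero>\<^bsub>P\<^esub>" for w n
  proof -
    have wc: "w \<in> carrier mz.W" using w by (rule mz.W.gr_closed)
    have "mz.mh.f a a \<otimes>\<^bsub>mz.W\<^esub> w \<otimes>\<^bsub>mz.W\<^esub> mz.mh.f b b = \<zero>\<^bsub>mz.W\<^esub>" if a: "a \<in> B" and b: "b \<in> B" for a b
    proof -
      let ?n = "n + deg b - deg a"
      let ?x = "mz.mh.f q a \<otimes>\<^bsub>mz.W\<^esub> w \<otimes>\<^bsub>mz.W\<^esub> mz.mh.f b q"
      let ?w = "mz.mh.average ?n ?x"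
      have xc: "?x \<in> carrier mz.W" using mz.mh.f_closed a b B(3) wc by simp
      have zc: "?w \<in> gr mz.mh.C.Z ?n"
        by (rule mz.mh.average_central[OF mz.mh.peirce_component(1)[OF w a b]])
      have \<mu>x: "\<mu> ?x = \<zero>\<^bsub>P\<^esub>"
        using mz.mh.f_closed a b B(3) wc M(7) by (simp add: M(4) z)
      have "\<mu> ?w = (\<Oplus>\<^bsub>P\<^esub>c\<in>B. \<mu> (ksign (?n * (deg c - deg q)) \<odot>\<^bsub>mz.W\<^esub>
          (mz.mh.f c q \<otimes>\<^bsub>mz.W\<^esub> ?x \<otimes>\<^bsub>mz.W\<^esub> mz.mh.f q c)))"
        unfolding mz.mh.average_def
        by (rule klin_finsum[OF M(1) mz.W.kmodule co.P.kmodule]) (use mz.mh.term_closed xc in auto)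
      also have "\<dots> = (\<Oplus>\<^bsub>P\<^esub>c\<in>B. \<zero>\<^bsub>P\<^esub>)"
      proof (rule co.P.M.finsum_cong')
        fix c assume c: "c \<in> B"
        note cc = mz.mh.f_closed[OF c B(3)] mz.mh.f_closed[OF B(3) c]
        have "\<mu> (mz.mh.f c q \<otimes>\<^bsub>mz.W\<^esub> ?x \<otimes>\<^bsub>mz.W\<^esub> mz.mh.f q c) = \<mu> (mz.mh.f c q) \<otimes>\<^bsub>P\<^esub> \<mu> ?x \<otimes>\<^bsub>P\<^esub> \<mu> (mz.mh.f q c)"
          using M(4)[OF mz.W.m_closed[OF cc(1) xc] cc(2)] M(4)[OF cc(1) xc] by simp
        also have "\<dots> = \<zero>\<^bsub>P\<^esub>" unfolding \<mu>x using M(7)[OF cc(1)] M(7)[OF cc(2)] by simp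
        finally show "\<mu> (ksign (?n * (deg c - deg q)) \<odot>\<^bsub>mz.W\<^esub> (mz.mh.f c q \<otimes>\<^bsub>mz.W\<^esub> ?x \<otimes>\<^bsub>mz.W\<^esub> mz.mh.f q c)) = \<zero>\<^bsub>P\<^esub>"
          by (simp add: k(3)[OF mz.mh.term_closed[OF c xc]])
      qed auto
      finally have "\<mu> ?w = \<zero>\<^bsub>P\<^esub>" by simp
      moreover have "\<mu> ?w = p ?w"
        using irp[OF zc] \<mu>ir[OF p(2)[OF mz.mh.C.Z_gr_P(1)[OF zc]]] by simp
      ultimately have "p ?w = \<zero>\<^bsub>Z\<^esub>" by (simp add: mh.C.Z_simps)
      then have "?w = \<zero>\<^bsub>mz.W\<^esub>"
        using irp[OF zc] klin_zero[OF mz.ir_klin Z.kmodule mz.W.kmodule] by simp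
      then show ?thesis
        unfolding mz.mh.peirce_component(2)[OF w a b] using mz.mh.f_closed[OF a b] by simp
    qed
    then have "(\<Oplus>\<^bsub>mz.W\<^esub>a\<in>B. \<Oplus>\<^bsub>mz.W\<^esub>b\<in>B. mz.mh.f a a \<otimes>\<^bsub>mz.W\<^esub> w \<otimes>\<^bsub>mz.W\<^esub> mz.mh.f b b) = \<zero>\<^bsub>mz.W\<^esub>"
      by (intro mz.W.M.add.finprod_one_eqI) simp
    then show ?thesis using mz.mh.peirce_sum[OF wc] by simp
  qed
  have inj: "inj_on \<mu> (carrier mz.W)"
  proof (rule inj_onI)
    fix x y assume xy: "x \<in> carrier mz.W" "y \<in> carrier mz.W" "\<mu> x = \<mu> y"
    let ?d = "x \<ominus>\<^bsub>mz.W\<^esub> y"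
    have d: "?d \<in> carrier mz.W" using xy by simp
    have "\<mu> ?d = \<zero>\<^bsub>P\<^esub>"
      using klin_diff[OF M(1) mz.W.kmodule co.P.kmodule xy(1,2)] xy M(7) by (simp add: co.P.kdiff_zero_iff)
    then have "\<mu> (hcomp mz.W n ?d) = \<zero>\<^bsub>P\<^esub>" for n
      using dga_hom_hcomp[OF \<mu> mz.W.gr_module co.P.gr_module d, of n]
        klin_zero[OF co.P.hcomp_klin co.P.kmodule co.P.kmodule] by simp
    then have "hcomp mz.W n ?d = \<zero>\<^bsub>mz.W\<^esub>" for n
      using ker_gr[OF mz.W.hcomp_gr[OF d]] by blast
    then have "?d = \<zero>\<^bsub>mz.W\<^esub>"
      using mz.W.hcomp_sum[OF d, of "{}"] by simp
    then show "x = y" using xy by (simp add: mz.W.kdiff_zero_iff)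
  qed
  obtain \<nu> where \<nu>: "\<nu> \<in> dga_hom P mz.W" "\<And>w. w \<in> carrier mz.W \<Longrightarrow> \<nu> (\<mu> w) = w" "\<And>x. x \<in> carrier P \<Longrightarrow> \<mu> (\<nu> x) = x"
    using dga_hom_inverse[OF mz.W.predg_algebra co.P.predg_algebra \<mu> inj surj] by blast
  show thesis by (rule that[OF \<mu> \<nu>(1) \<mu>t \<nu>(2,3)])
qed

abbreviation "K \<equiv> genideal Z (graded_commutators Z)"
abbreviation "R \<equiv> abelianization Z"

definition "\<pi> = (\<lambda>x\<in>carrier Z. K +>\<^bsub>Z\<^esub> x)"

lemma \<pi>_hom: "\<pi> \<in> dga_hom Z R"
  unfolding \<pi>_def abelianization_def by (rule dg_ideal.quot_hom[OF Z.dg_ideal_commutators])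

lemma R_carrier: "carrier R = \<pi> ` carrier Z"
  unfolding \<pi>_def abelianization_def using Z.quot_carrier[OF dg_ideal.sub[OF Z.dg_ideal_commutators]] by simp

sublocale ab: cdg_algebra R by (rule Z.abelianization_cdg_algebra)

text \<open>
  A morphism \<open>f\<close> from \<open>R\<close> corresponds to \<open>A \<rightarrow> P \<rightarrow> E \<otimes> Z \<rightarrow> E \<otimes> C\<close>. It can be recovered: by generation of
  \<open>P\<close> the map determines \<open>P \<rightarrow> E \<otimes> C\<close>, whose restriction to \<open>Z\<close> takes values in \<open>1 \<otimes> C\<close>. In the same way, a
  given \<open>A \<rightarrow> E \<otimes> C\<close> extends to \<open>P\<close> and, restricted to \<open>Z\<close>, gives a morphism to \<open>C\<close> that factors through \<open>R\<close>.
\<close>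

lemma represents_Rep: "represents (rep_dga S V \<rho> A \<alpha>) (Rep_obj S V \<rho> A \<alpha> :: ('k, 'c) dg \<Rightarrow> _) (Rep_mor V A)"
proof -
  obtain \<mu> \<nu> where \<mu>: "\<mu> \<in> dga_hom mz.W P" and \<nu>: "\<nu> \<in> dga_hom P mz.W"
    and \<mu>t: "\<And>i a j x. \<lbrakk>a \<in> gr E i; x \<in> gr Z j\<rbrakk> \<Longrightarrow> \<mu> (mz.t i a j x) = co.inl a \<otimes>\<^bsub>P\<^esub> x"
    and \<nu>\<mu>: "\<And>w. w \<in> carrier mz.W \<Longrightarrow> \<nu> (\<mu> w) = w" and \<mu>\<nu>: "\<And>x. x \<in> carrier P \<Longrightarrow> \<mu> (\<nu> x) = x"
    by (rule matrix_decomposition) blast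
  note pre = mz.W.predg_algebra co.P.predg_algebra Z.predg_algebra ab.predg_algebra co.A.predg_algebra
  note M = dga_homD[OF \<mu>] and N = dga_homD[OF \<nu>] and inr = dga_homD[OF co.inr_hom] and inl = dga_homD[OF co.inl_hom]
  have \<nu>inl: "\<nu> (co.inl a) = mz.il a" if a: "a \<in> gr E i" for a i
  proof -
    have "\<mu> (mz.il a) = co.inl a"
      unfolding mz.il_gr[OF a] \<mu>t[OF a Z.one_degree]
      using inl(7)[OF E.gr_closed[OF a]] by (simp add: mh.C.Z_simps)
    then show ?thesis using \<nu>\<mu>[OF dga_homD(7)[OF mz.il_hom E.gr_closed[OF a]]] by simp
  qed
  define tm where "tm C f = tensor_map_right E Z C (compose (carrier Z) f \<pi>)" for C :: "('k, 'c) dg" and f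
  define \<Phi> where "\<Phi> C f = compose (carrier A) (tm C f) (compose (carrier A) \<nu> co.inr)" for C :: "('k, 'c) dg" and f
  have \<Phi>_app: "\<Phi> C f a = tm C f (\<nu> (co.inr a))" if "a \<in> carrier A" for C f a
    using that by (simp add: \<Phi>_def compose_eq)
  have ni: "compose (carrier A) \<nu> co.inr \<in> dga_hom A mz.W"
    by (rule dga_hom_comp[OF pre(5,2,1) co.inr_hom \<nu>])
  have main: "bij_betw (\<Phi> C) (dga_hom R C) (Rep_obj S V \<rho> A \<alpha> C)" if C: "cdg_algebra C" for C
  proof -
    interpret C: cdg_algebra C by fact
    interpret mc: matrix_tensor V B deg \<xi> q C
      by (intro matrix_tensor.intro matrix_basis_axioms C.dg_algebra_axioms)
    note preC = C.predg_algebra mc.W.predg_algebra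
    obtain p where p: "klin mc.W C p" "\<And>n x. x \<in> gr mc.W n \<Longrightarrow> p x \<in> gr C n" "\<And>c. c \<in> carrier C \<Longrightarrow> p (mc.ir c) = c"
      and irp: "\<And>n y. y \<in> gr mc.mh.C.Z n \<Longrightarrow> mc.ir (p y) = y"
      by (rule mc.second_factor_centralizer) blast
    have fpi: "compose (carrier Z) f \<pi> \<in> dga_hom Z C" if "f \<in> dga_hom R C" for f
      by (rule dga_hom_comp[OF pre(3,4) preC(1) \<pi>_hom that])
    note tmr = tensor_map_right[OF E.dg_algebra_axioms Z.dg_algebra_axioms C.dg_algebra_axioms]
    have tm_hom: "tm C f \<in> dga_hom mz.W mc.W"
      and tm_t: "\<And>i a j x. \<lbrakk>a \<in> gr E i; x \<in> gr Z j\<rbrakk> \<Longrightarrow> tm C f (mz.t i a j x) = mc.t i a j (f (\<pi> x))"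
      if f: "f \<in> dga_hom R C" for f
      using tmr[OF fpi[OF f]] Z.gr_closed by (simp_all add: tm_def compose_eq)
    have tm_il: "tm C f (mz.il a) = mc.il a" if f: "f \<in> dga_hom R C" and a: "a \<in> gr E i" for f a i
      using dga_homD(3)[OF fpi[OF f]] by (simp add: mz.il_gr[OF a] mc.il_gr[OF a] tm_t[OF f a Z.one_degree] compose_eq)
    have te: "tensor_elem E C (\<rho> s) \<one>\<^bsub>C\<^esub> = mc.il (\<rho> s)" if "s \<in> carrier S" for s
      using dga_homD(7)[OF co.\<beta> that] by (simp add: mc.il_def)
    have into: "\<Phi> C f \<in> Rep_obj S V \<rho> A \<alpha> C" if f: "f \<in> dga_hom R C" for f
    proof -
      have 1: "\<Phi> C f \<in> dga_hom A mc.W"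
        unfolding \<Phi>_def by (rule dga_hom_comp[OF pre(5,1) preC(2) ni tm_hom[OF f]])
      have "\<Phi> C f (\<alpha> s) = mc.il (\<rho> s)" if s: "s \<in> carrier S" for s
      proof -
        have "\<Phi> C f (\<alpha> s) = tm C f (\<nu> (co.inl (\<rho> s)))"
          using dga_homD(7)[OF co.\<alpha> s] co.inl_\<beta>[OF s] by (simp add: \<Phi>_app)
        also have "\<dots> = mc.il (\<rho> s)"
          by (rule E.klin_gr_eq[OF klin_comp[OF klin_comp[OF inl(1) N(1)] dga_homD(1)[OF tm_hom[OF f]]] mc.il_klin
                mc.W.kmodule _ dga_homD(7)[OF co.\<beta> s]]) (simp add: \<nu>inl tm_il[OF f])
        finally show ?thesis .
      qed
      then show ?thesis using 1 by (simp add: Rep_obj_def dga_under_hom_def te)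
    qed
    \<comment> \<open>Morphisms from the coproduct that agree on both factors are equal.\<close>
    have inj: "inj_on (\<Phi> C) (dga_hom R C)"
    proof (rule inj_onI)
      fix f f' assume f: "f \<in> dga_hom R C" and f': "f' \<in> dga_hom R C" and eq: "\<Phi> C f = \<Phi> C f'"
      have h: "compose (carrier P) (tm C f) \<nu> \<in> dga_hom P mc.W" "compose (carrier P) (tm C f') \<nu> \<in> dga_hom P mc.W"
        by (rule dga_hom_comp[OF pre(2,1) preC(2) \<nu> tm_hom]; fact)+
      have hP: "tm C f (\<nu> x) = tm C f' (\<nu> x)" if x: "x \<in> carrier P" for x
      proof -
        have "compose (carrier P) (tm C f) \<nu> x = compose (carrier P) (tm C f') \<nu> x"
        proof (rule co.P_hom_eq[OF h preC(2) _ _ x])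
          show "compose (carrier P) (tm C f) \<nu> (co.inl b) = compose (carrier P) (tm C f') \<nu> (co.inl b)"
            if "b \<in> gr E i" for i b
            using inl(7)[OF E.gr_closed[OF that]] by (simp add: compose_eq \<nu>inl[OF that] tm_il[OF f that] tm_il[OF f' that])
          show "compose (carrier P) (tm C f) \<nu> (co.inr a) = compose (carrier P) (tm C f') \<nu> (co.inr a)"
            if "a \<in> gr A i" for i a
            using inr(7)[OF co.A.gr_closed[OF that]] fun_cong[OF eq, of a] co.A.gr_closed[OF that] by (simp add: compose_eq \<Phi>_app)
        qed
        then show ?thesis using x by (simp add: compose_eq)
      qed
      have "f (\<pi> x) = f' (\<pi> x)" if x: "x \<in> gr Z i" for i x
      proof -
        note tx = mz.t_closed[OF E.one_degree x]
        have g: "f (\<pi> x) \<in> gr C i" "f' (\<pi> x) \<in> gr C i"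
          by (rule dga_homD(5)[OF f dga_homD(5)[OF \<pi>_hom x]] dga_homD(5)[OF f' dga_homD(5)[OF \<pi>_hom x]])+
        note c = C.gr_closed[OF g(1)] C.gr_closed[OF g(2)] g
        have "mc.t 0 \<one>\<^bsub>E\<^esub> i (f (\<pi> x)) = mc.t 0 \<one>\<^bsub>E\<^esub> i (f' (\<pi> x))"
          using hP[OF M(7)[OF tx]] \<nu>\<mu>[OF tx] tm_t[OF f E.one_degree x] tm_t[OF f' E.one_degree x] by simp
        then have "p (mc.ir (f (\<pi> x))) = p (mc.ir (f' (\<pi> x)))"
          by (simp only: mc.ir_gr[OF c(3)] mc.ir_gr[OF c(4)])
        then show ?thesis by (simp only: p(3)[OF c(1)] p(3)[OF c(2)])
      qed
      then have "f (\<pi> x) = f' (\<pi> x)" if "x \<in> carrier Z" for x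
        by (rule Z.klin_gr_eq[OF klin_comp[OF dga_homD(1)[OF \<pi>_hom] dga_homD(1)[OF f]]
              klin_comp[OF dga_homD(1)[OF \<pi>_hom] dga_homD(1)[OF f']] C.kmodule _ that])
      then show "f = f'"
        by (intro extensionalityI[OF dga_homD(2)[OF f] dga_homD(2)[OF f']]) (auto simp: R_carrier)
    qed
    have surj: "\<exists>f\<in>dga_hom R C. \<Phi> C f = \<phi>" if \<phi>': "\<phi> \<in> Rep_obj S V \<rho> A \<alpha> C" for \<phi>
    proof -
      have \<phi>: "\<phi> \<in> dga_hom A mc.W" and \<phi>s: "\<And>s. s \<in> carrier S \<Longrightarrow> mc.il (\<rho> s) = \<phi> (\<alpha> s)"
        using \<phi>' te by (auto simp: Rep_obj_def dga_under_hom_def)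
      obtain h where h: "h \<in> dga_hom P mc.W" and hl: "\<And>b. b \<in> carrier E \<Longrightarrow> h (co.inl b) = mc.il b"
        and hr: "\<And>a. a \<in> carrier A \<Longrightarrow> h (co.inr a) = \<phi> a"
        using co.P_lift[OF mc.W.dg_algebra_axioms mc.il_hom \<phi> \<phi>s] by blast
      note H = dga_homD[OF h]
      have hZ: "h x \<in> gr mc.mh.C.Z i" if x: "x \<in> gr Z i" for x i
      proof -
        have "h x \<otimes>\<^bsub>mc.W\<^esub> s = ksign (i * j) \<odot>\<^bsub>mc.W\<^esub> (s \<otimes>\<^bsub>mc.W\<^esub> h x)" if s: "s \<in> mc.il ` carrier E" "s \<in> gr mc.W j" for s j
        proof -
          obtain u where u: "u \<in> carrier E" "s = mc.il u" using s by blast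
          let ?u = "hcomp E j u"
          have ug: "?u \<in> gr E j" by (rule E.hcomp_gr[OF u(1)])
          have uc: "?u \<in> carrier E" using ug by (rule E.gr_closed)
          have s': "s = mc.il ?u"
            using dga_hom_hcomp[OF mc.il_hom E.gr_module mc.W.gr_module u(1), of j] mc.W.hcomp_homog[OF s(2), of j] u by simp
          have xc: "x \<in> carrier P" using x by (rule mh.C.Z_gr_P)
          note ic = inl(7)[OF uc]
          have "x \<otimes>\<^bsub>P\<^esub> co.inl ?u = ksign (i * j) \<odot>\<^bsub>P\<^esub> (co.inl ?u \<otimes>\<^bsub>P\<^esub> x)"
            using x inl(5)[OF ug] uc by (auto simp: mh.C.Z_gr)
          then have "h (x \<otimes>\<^bsub>P\<^esub> co.inl ?u) = h (ksign (i * j) \<odot>\<^bsub>P\<^esub> (co.inl ?u \<otimes>\<^bsub>P\<^esub> x))" by simp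
          then show ?thesis using xc ic by (simp add: H(4) klinD(3)[OF H(1)] hl[OF uc] s')
        qed
        then show ?thesis using H(5)[OF mh.C.Z_gr_P(1)[OF x]] by (auto simp: mc.mh.C.Z_gr)
      qed
      \<comment> \<open>The restriction to the centralizer, followed by the retraction of the second factor.\<close>
      define v where "v = (\<lambda>x\<in>carrier Z. p (h x))"
      have irv: "mc.ir (v x) = h x" if "x \<in> gr Z i" for x i
        using irp[OF hZ[OF that]] Z.gr_closed[OF that] by (simp add: v_def)
      have vlin: "klin Z C v"
        unfolding v_def by (rule klin_restrict[OF Z.kmodule klin_comp[OF klin_comp[OF mh.C.Z_incl H(1)] p(1)]])
      note ir = dga_homD[OF mc.ir_hom]
      have vI: "v x = c" if "x \<in> gr Z i" "c \<in> carrier C" "h x = mc.ir c" for x i c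
        using p(3)[OF that(2)] that(3) Z.gr_closed[OF that(1)] by (simp add: v_def)
      have v: "v \<in> dga_hom Z C"
      proof (rule dga_homI[OF pre(3) preC(1) vlin])
        show "v \<in> extensional (carrier Z)" unfolding v_def by (rule restrict_extensional)
        show "v \<one>\<^bsub>Z\<^esub> = \<one>\<^bsub>C\<^esub>" by (rule vI[OF Z.one_degree]) (simp_all add: mh.C.Z_simps H(3) ir(3))
        fix i j x y assume x: "x \<in> gr Z i"
        have xc: "x \<in> carrier P" "v x \<in> carrier C"
          using mh.C.Z_gr_P(2)[OF x] klinD(1)[OF vlin Z.gr_closed[OF x]] by blast+
        show "v x \<in> gr C i" using p(2)[OF H(5)[OF mh.C.Z_gr_P(1)[OF x]]] Z.gr_closed[OF x] by (simp add: v_def)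
        show "v (dif Z x) = dif C (v x)"
          by (rule vI[OF Z.dif_degree[OF x]]) (use xc in \<open>simp_all add: mh.C.Z_simps H(6) ir(6) irv[OF x]\<close>)
        assume y: "y \<in> gr Z j"
        have yc: "y \<in> carrier P" "v y \<in> carrier C"
          using mh.C.Z_gr_P(2)[OF y] klinD(1)[OF vlin Z.gr_closed[OF y]] by blast+
        show "v (x \<otimes>\<^bsub>Z\<^esub> y) = v x \<otimes>\<^bsub>C\<^esub> v y"
          by (rule vI[OF Z.mult_degree[OF x y]]) (use xc yc in \<open>simp_all add: mh.C.Z_simps H(4) ir(4) irv[OF x] irv[OF y]\<close>)
      qed
      obtain f where f: "f \<in> dga_hom R C" and fv: "\<And>x. x \<in> carrier Z \<Longrightarrow> f (K +>\<^bsub>Z\<^esub> x) = v x"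
        using Z.dga_hom_abelianization[OF v C] by blast
      have f\<pi>: "f (\<pi> x) = v x" if "x \<in> carrier Z" for x
        using fv[OF that] that by (simp add: \<pi>_def)
      have tmh: "tm C f w = h (\<mu> w)" if w: "w \<in> carrier mz.W" for w
      proof (rule mz.W_klin_eq[OF dga_homD(1)[OF tm_hom[OF f]] klin_comp[OF M(1) H(1)] mc.W.kmodule w])
        fix i a j x assume ax: "a \<in> gr E i" "x \<in> gr Z j"
        have vx: "v x \<in> gr C j" by (rule dga_homD(5)[OF v ax(2)])
        have "h (\<mu> (mz.t i a j x)) = mc.il a \<otimes>\<^bsub>mc.W\<^esub> mc.ir (v x)"
          using inl(7)[OF E.gr_closed[OF ax(1)]] mh.C.Z_gr_P(2)[OF ax(2)] E.gr_closed[OF ax(1)]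
          by (simp add: \<mu>t[OF ax] H(4) hl irv[OF ax(2)])
        then show "tm C f (mz.t i a j x) = h (\<mu> (mz.t i a j x))"
          using Z.gr_closed[OF ax(2)] by (simp add: tm_t[OF f ax] f\<pi> mc.il_ir_mult(1)[OF ax(1) vx])
      qed
      have "\<Phi> C f = \<phi>"
      proof (rule extensionalityI[OF _ dga_homD(2)[OF \<phi>]])
        show "\<Phi> C f \<in> extensional (carrier A)" by (simp add: \<Phi>_def)
        fix a assume a: "a \<in> carrier A"
        show "\<Phi> C f a = \<phi> a"
          using tmh[OF N(7)[OF inr(7)[OF a]]] \<mu>\<nu>[OF inr(7)[OF a]] hr[OF a] by (simp add: \<Phi>_app[OF a])
      qed
      then show ?thesis using f by blast
    qed
    show ?thesis
      unfolding bij_betw_def using inj into surj by blast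
  qed
  have nat: "\<Phi> D (compose (carrier R) g f) = Rep_mor V A C D g (\<Phi> C f)"
    if g: "g \<in> dga_hom C D" and f: "f \<in> dga_hom R C" and C: "cdg_algebra C" and D: "cdg_algebra D" for C D g f
  proof -
    interpret C: cdg_algebra C by fact
    interpret D: cdg_algebra D by fact
    interpret mc: matrix_tensor V B deg \<xi> q C
      by (intro matrix_tensor.intro matrix_basis_axioms C.dg_algebra_axioms)
    interpret md: matrix_tensor V B deg \<xi> q D
      by (intro matrix_tensor.intro matrix_basis_axioms D.dg_algebra_axioms)
    have gf: "compose (carrier R) g f \<in> dga_hom R D"
      by (rule dga_hom_comp[OF pre(4) C.predg_algebra D.predg_algebra f g])
    note c1 = dga_hom_comp[OF pre(3,4) D.predg_algebra \<pi>_hom gf] and c2 = dga_hom_comp[OF pre(3,4) C.predg_algebra \<pi>_hom f]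
    note t1 = tensor_map_right[OF E.dg_algebra_axioms Z.dg_algebra_axioms D.dg_algebra_axioms c1, folded tm_def]
      and t2 = tensor_map_right[OF E.dg_algebra_axioms Z.dg_algebra_axioms C.dg_algebra_axioms c2, folded tm_def]
      and t3 = tensor_map_right[OF E.dg_algebra_axioms C.dg_algebra_axioms D.dg_algebra_axioms g]
    have eq: "tm D (compose (carrier R) g f) w = tensor_map_right E C D g (tm C f w)" if w: "w \<in> carrier mz.W" for w
    proof (rule mz.W_klin_eq[OF dga_homD(1)[OF t1(1)] klin_comp[OF dga_homD(1)[OF t2(1)] dga_homD(1)[OF t3(1)]] md.W.kmodule w])
      fix i a j x assume ax: "a \<in> gr E i" "x \<in> gr Z j"
      have "compose (carrier Z) f \<pi> x \<in> gr C j" by (rule dga_homD(5)[OF c2 ax(2)])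
      then show "tm D (compose (carrier R) g f) (mz.t i a j x) = tensor_map_right E C D g (tm C f (mz.t i a j x))"
        using dga_homD(7)[OF \<pi>_hom Z.gr_closed[OF ax(2)]] Z.gr_closed[OF ax(2)]
        by (simp add: t1(2)[OF ax] t2(2)[OF ax] t3(2)[OF ax(1)] compose_eq)
    qed
    show ?thesis
    proof (rule extensionalityI)
      show "\<Phi> D (compose (carrier R) g f) \<in> extensional (carrier A)" by (simp add: \<Phi>_def)
      show "Rep_mor V A C D g (\<Phi> C f) \<in> extensional (carrier A)" by (simp add: Rep_mor_def)
      fix a assume a: "a \<in> carrier A"
      show "\<Phi> D (compose (carrier R) g f) a = Rep_mor V A C D g (\<Phi> C f) a"
        using eq[OF N(7)[OF inr(7)[OF a]]] a by (simp add: \<Phi>_app Rep_mor_def compose_eq)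
    qed
  qed
  show ?thesis
    unfolding represents_def rep_dga_def Z_eq
    using ab.cdg_algebra_axioms main nat by blast
qed

end

theorem theorem2p1:
  fixes S :: "('k::field_char_0, 's) dg"
    and V :: "('k, 'v) dg"
    and A :: "('k, 'a) dg"
    and \<rho> :: "'s \<Rightarrow> 'v \<Rightarrow> 'v"
    and \<alpha> :: "'s \<Rightarrow> 'a"
  assumes "dg_algebra S"
    and "dg_module V" and "finite_total_dim V" and "carrier V \<noteq> {\<zero>\<^bsub>V\<^esub>}"
    and "\<rho> \<in> dga_hom S (End_dga V)"
    and "dg_algebra A" and "\<alpha> \<in> dga_hom S A"
  shows "represents (rep_dga S V \<rho> A \<alpha>)
    (Rep_obj S V \<rho> A \<alpha> :: ('k, 'c) dg \<Rightarrow> _) (Rep_mor V A)"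
proof -
  obtain B deg \<xi> q where basis: "matrix_basis V B deg \<xi> q"
    using dg_module.homogeneous_basis[OF assms(2-4)] by blast
  have "rep_setup V B deg \<xi> q S A \<rho> \<alpha>"
    by (intro rep_setup.intro dga_coprod.intro dga_coprod_axioms.intro basis assms
        dg_module.E_dg_algebra[OF assms(2)])
  then show ?thesis by (rule rep_setup.represents_Rep)
qed

end
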